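(* Let $k$ be an algebraically closed field of characteristic zero and $R=k[x_1,\ldots,x_n]$ with $n\ge3$. Let $J\subseteq R$ be a $3$-equigenerated ideal of codimension $2$ with minimal graded free resolution $$0\to\bigoplus_{i=1}^3R(-3-\delta_{i+2}-\epsilon_i)\to\bigoplus_{i=1}^5R(-3-\delta_i)\to R(-3)^3\to J\to0.$$ Then the list of all possible vectors $\underline\delta=(\delta_1,\ldots,\delta_5)$ and $\underline\epsilon=(\epsilon_1,\epsilon_2,\epsilon_3)$ and their respective values $\deg(R/J)$ and $\mathrm{Bour}(J)$ consists of the single entry: - $\underline\delta=(3,3,3,3,3)$, $\underline\epsilon=(1,1,1)$, $\deg(R/J)=3$, $\mathrm{Bour}(J)=6$.
   Context: $J=(f_1,f_2,f_3)$ is minimally generated by three forms of degree $d=3$. Conventions for the resolution: $1\le\delta_1\le\cdots\le\delta_5$, the $\epsilon_i$ are positive integers, and $\delta_3+\epsilon_1\le\delta_4+\epsilon_2\le\delta_5+\epsilon_3$. $\deg(R/J)$ is the multiplicity of $R/J$. Bourbaki degree: $\mathrm{Syz}(J)\subseteq R^3$ carries the standard grading, $e=\mathrm{indeg}(\mathrm{Syz}(J))$ is the least degree of a nonzero homogeneous syzygy (so $e=\delta_1$), and $\nu$ is a minimal generator of degree $e$. If $J$ is perfect of height two put $\mathrm{Bour}(J)=0$; otherwise $\mathrm{Syz}(J)/R\nu$ is isomorphic, up to shift, to an unmixed homogeneous ideal $I_\nu$ of height $2$ and $\mathrm{Bour}(J)=\deg(R/I_\nu)$. In all cases $\mathrm{Bour}(J)=d^2-ed+e^2-\deg(R/J)$.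 *)

theory Defs
  imports
    "HOL-Library.Poly_Mapping"
    "HOL-Library.Extended_Nat"
    "HOL-Library.Cardinality"
    "HOL-Computational_Algebra.Polynomial"
    "Jordan_Normal_Form.Matrix_Kernel"
begin

text \<open>
  The polynomial ring over \<open>'k\<close> in the variables indexed by \<open>'v\<close>; for \<open>'v\<close> finite this is
  \<open>k[x\<^sub>1,\<dots>,x\<^sub>n]\<close> with \<open>n = CARD('v)\<close>.
\<close>

type_synonym ('v, 'k) mpoly = "('v \<Rightarrow>\<^sub>0 nat) \<Rightarrow>\<^sub>0 'k"


section \<open>Ideals and height\<close>

abbreviation is_ideal :: "'a::comm_ring_1 set \<Rightarrow> bool" where
  "is_ideal \<equiv> Modules.module.subspace (*)"

abbreviation ideal_gen :: "'a::comm_ring_1 set \<Rightarrow> 'a set" where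
  "ideal_gen \<equiv> Modules.module.span (*)"

definition is_prime_ideal :: "'a::comm_ring_1 set \<Rightarrow> bool" where
  "is_prime_ideal P \<longleftrightarrow>
     is_ideal P \<and> 1 \<notin> P \<and> (\<forall>x y. x * y \<in> P \<longrightarrow> x \<in> P \<or> y \<in> P)"

definition prime_height :: "'a::comm_ring_1 set \<Rightarrow> enat" where
  "prime_height P =
     (SUP h \<in> {h. \<exists>C :: nat \<Rightarrow> 'a set. (\<forall>i\<le>h. is_prime_ideal (C i)) \<and>
                  (\<forall>i<h. C i \<subset> C (Suc i)) \<and> C h = P}. enat h)"

text \<open>The codimension of an ideal is its height; the unit ideal has height \<open>\<infinity>\<close>.\<close>

definition height :: "'a::comm_ring_1 set \<Rightarrow> enat" where
  "height I = (INF P \<in> {P. is_prime_ideal P \<and> I \<subseteq> P}. prime_height P)"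

text \<open>\<open>P\<close> is a prime of the form \<open>I : r\<close>, that is, an associated prime of \<open>R/I\<close>.\<close>

definition associated_prime :: "'a::comm_ring_1 set \<Rightarrow> 'a set \<Rightarrow> bool" where
  "associated_prime I P \<longleftrightarrow> is_prime_ideal P \<and> (\<exists>r. P = {p. p * r \<in> I})"

definition unmixed :: "'a::comm_ring_1 set \<Rightarrow> bool" where
  "unmixed I \<longleftrightarrow> (\<forall>P. associated_prime I P \<longrightarrow> prime_height P = height I)"


section \<open>Grading\<close>

definition mon_degree :: "('v::finite \<Rightarrow>\<^sub>0 nat) \<Rightarrow> nat" where
  "mon_degree m = (\<Sum>v\<in>UNIV. Poly_Mapping.lookup m v)"

text \<open>Degrees are integers, and only \<open>0\<close> is homogeneous of negative degree.\<close>

definition homogeneous :: "int \<Rightarrow> ('v::finite, 'k::field) mpoly \<Rightarrow> bool" where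
  "homogeneous t p \<longleftrightarrow> (\<forall>m\<in>Poly_Mapping.keys p. int (mon_degree m) = t)"

definition homogeneous_ideal :: "('v::finite, 'k::field) mpoly set \<Rightarrow> bool" where
  "homogeneous_ideal I \<longleftrightarrow> I = ideal_gen {p \<in> I. \<exists>t. homogeneous t p}"

text \<open>Homogeneous elements of a free module \<open>R\<^sup>r\<close> with its standard grading.\<close>

definition homogeneous_vec :: "int \<Rightarrow> ('v::finite, 'k::field) mpoly vec \<Rightarrow> bool" where
  "homogeneous_vec t v \<longleftrightarrow> (\<forall>i<dim_vec v. homogeneous t (v $ i))"

definition minimally_generated_by_forms ::
    "nat \<Rightarrow> ('v::finite, 'k::field) mpoly list \<Rightarrow> ('v, 'k) mpoly set \<Rightarrow> bool" where
  "minimally_generated_by_forms d fs I \<longleftrightarrow>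
     (\<forall>f\<in>set fs. homogeneous (int d) f) \<and> I = ideal_gen (set fs) \<and>
     distinct fs \<and> (\<forall>f\<in>set fs. f \<notin> ideal_gen (set fs - {f}))"


section \<open>Hilbert function and multiplicity\<close>

definition scale :: "'k \<Rightarrow> ('v, 'k::field) mpoly \<Rightarrow> ('v, 'k) mpoly" where
  "scale c p = Poly_Mapping.single 0 c * p"

text \<open>
  The Hilbert function of \<open>R/I\<close> for a homogeneous ideal \<open>I\<close>: the degree \<open>t\<close> part of \<open>R/I\<close> is the
  quotient of the finite-dimensional space \<open>R\<^sub>t\<close> by \<open>I \<inter> R\<^sub>t\<close>.
\<close>

definition hilbert_function :: "('v::finite, 'k::field) mpoly set \<Rightarrow> nat \<Rightarrow> nat" where
  "hilbert_function I t =
     Vector_Spaces.vector_space.dim scale {p :: ('v, 'k) mpoly. homogeneous (int t) p} -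
     Vector_Spaces.vector_space.dim scale {p \<in> I. homogeneous (int t) p}"

definition hilbert_polynomial :: "('v::finite, 'k::field) mpoly set \<Rightarrow> rat poly" where
  "hilbert_polynomial I =
     (THE h. \<forall>\<^sub>F t in sequentially. of_nat (hilbert_function I t) = poly h (of_nat t))"

text \<open>
  The multiplicity of \<open>R/I\<close>. The Hilbert polynomial has degree \<open>dim (R/I) - 1\<close>; it vanishes
  precisely if \<open>R/I\<close> has finite length, and the multiplicity is then that length.
\<close>

definition multiplicity_quotient :: "('v::finite, 'k::field) mpoly set \<Rightarrow> rat" where
  "multiplicity_quotient I =
     (let h = hilbert_polynomial I in
      if h \<noteq> 0 then fact (degree h) * lead_coeff h
      else of_nat (\<Sum>t | hilbert_function I t \<noteq> 0. hilbert_function I t))"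


section \<open>Graded free resolutions\<close>

definition mat_image :: "'a::comm_ring_1 mat \<Rightarrow> 'a vec set" where
  "mat_image A = (\<lambda>v. A *\<^sub>v v) ` carrier_vec (dim_col A)"

text \<open>
  A list \<open>[a\<^sub>0, a\<^sub>1, \<dots>]\<close> of integers stands for the graded free module \<open>\<Oplus>\<^sub>i R(-a\<^sub>i)\<close>. The matrix
  \<open>A\<close> is a degree \<open>0\<close> homomorphism from the module of \<open>b\<close> to the module of \<open>a\<close>.
\<close>

definition graded_matrix ::
    "int list \<Rightarrow> int list \<Rightarrow> ('v::finite, 'k::field) mpoly mat \<Rightarrow> bool" where
  "graded_matrix b a A \<longleftrightarrow>
     A \<in> carrier_mat (length a) (length b) \<and>
     (\<forall>i<length a. \<forall>j<length b. homogeneous (b ! j - a ! i) (A $$ (i, j)))"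

text \<open>
  With \<open>F = [F\<^sub>0, \<dots>, F\<^sub>s]\<close> and \<open>A = [A\<^sub>0, \<dots>, A\<^sub>s]\<close>, the complex
  \<open>0 \<rightarrow> F\<^sub>s \<rightarrow> \<dots> \<rightarrow> F\<^sub>0 \<rightarrow> I \<rightarrow> 0\<close> with maps \<open>A\<^sub>i\<close> (where \<open>A\<^sub>0 : F\<^sub>0 \<rightarrow> R\<close> has image \<open>I\<close>)
  is exact. Equivalently \<open>F\<close> is a resolution of \<open>R/I\<close> of length \<open>s + 1 = length F\<close>, with \<open>R\<close>
  itself left implicit; the empty list resolves \<open>R/0\<close>.
\<close>

definition graded_free_resolution ::
    "('v::finite, 'k::field) mpoly set \<Rightarrow> int list list \<Rightarrow> ('v, 'k) mpoly mat list \<Rightarrow> bool" where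
  "graded_free_resolution I F A \<longleftrightarrow>
     length A = length F \<and>
     (\<forall>i<length F. graded_matrix (F ! i) (([0] # F) ! i) (A ! i)) \<and>
     I = (if F = [] then {0} else (\<lambda>v. v $ 0) ` mat_image (A ! 0)) \<and>
     (\<forall>i. Suc i < length F \<longrightarrow> mat_kernel (A ! i) = mat_image (A ! Suc i)) \<and>
     (F \<noteq> [] \<longrightarrow> mat_kernel (last A) = {0\<^sub>v (length (last F))})"

text \<open>Minimality: all entries have zero constant term, i.e. lie in \<open>(x\<^sub>1,\<dots>,x\<^sub>n)\<close>.\<close>

definition minimal_graded_free_resolution ::
    "('v::finite, 'k::field) mpoly set \<Rightarrow> int list list \<Rightarrow> ('v, 'k) mpoly mat list \<Rightarrow> bool" where
  "minimal_graded_free_resolution I F A \<longleftrightarrow>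
     graded_free_resolution I F A \<and>
     (\<forall>B\<in>set A. \<forall>i<dim_row B. \<forall>j<dim_col B. Poly_Mapping.lookup (B $$ (i, j)) 0 = 0)"

text \<open>
  The projective dimension of \<open>R/I\<close> for a homogeneous ideal \<open>I\<close>; finitely generated graded
  projective \<open>R\<close>-modules are graded free.
\<close>

definition proj_dim_quotient :: "('v::finite, 'k::field) mpoly set \<Rightarrow> nat" where
  "proj_dim_quotient I = (LEAST s. \<exists>F A. graded_free_resolution I F A \<and> length F = s)"

text \<open>The grade of an ideal of the Cohen-Macaulay ring \<open>R\<close> is its height.\<close>

definition perfect_ideal :: "('v::finite, 'k::field) mpoly set \<Rightarrow> bool" where
  "perfect_ideal I \<longleftrightarrow> enat (proj_dim_quotient I) = height I"


section \<open>The Bourbaki degree\<close>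

definition syzygies :: "('v::finite, 'k::field) mpoly list \<Rightarrow> ('v, 'k) mpoly vec set" where
  "syzygies fs = {v \<in> carrier_vec (length fs). (\<Sum>i<length fs. v $ i * fs ! i) = 0}"

definition syz_indeg :: "('v::finite, 'k::field) mpoly list \<Rightarrow> nat" where
  "syz_indeg fs =
     (LEAST t. \<exists>v\<in>syzygies fs. v \<noteq> 0\<^sub>v (length fs) \<and> homogeneous_vec (int t) v)"

text \<open>
  \<open>B\<close> is a Bourbaki ideal for \<open>\<nu>\<close>. The graded isomorphism from \<open>Syz/R\<nu>\<close> to a shift of \<open>B\<close> is given
  as an \<open>R\<close>-linear map \<open>\<phi>\<close> on \<open>Syz\<close> of some degree \<open>s\<close>, with image \<open>B\<close> and kernel \<open>R\<nu>\<close>.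
\<close>

definition bourbaki_ideal ::
    "('v::finite, 'k::field) mpoly list \<Rightarrow> ('v, 'k) mpoly vec \<Rightarrow> ('v, 'k) mpoly set \<Rightarrow> bool" where
  "bourbaki_ideal fs \<nu> B \<longleftrightarrow>
     is_ideal B \<and> homogeneous_ideal B \<and> height B = 2 \<and> unmixed B \<and>
     (\<exists>\<phi> s. (\<forall>v\<in>syzygies fs. \<forall>w\<in>syzygies fs. \<phi> (v + w) = \<phi> v + \<phi> w) \<and>
            (\<forall>r. \<forall>v\<in>syzygies fs. \<phi> (r \<cdot>\<^sub>v v) = r * \<phi> v) \<and>
            (\<forall>t. \<forall>v\<in>syzygies fs. homogeneous_vec t v \<longrightarrow> homogeneous (t + s) (\<phi> v)) \<and>
            \<phi> ` syzygies fs = B \<and>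
            {v \<in> syzygies fs. \<phi> v = 0} = range (\<lambda>r. r \<cdot>\<^sub>v \<nu>))"

text \<open>
  The Bourbaki degree of an ideal \<open>J\<close> minimally generated by three forms of the same degree. A
  nonzero homogeneous syzygy of least degree is automatically a minimal generator of \<open>Syz(J)\<close>.
  The value depends neither on the three generators nor on \<open>\<nu>\<close> nor on the ideal \<open>B\<close>.
\<close>

definition bourbaki_degree :: "('v::finite, 'k::field) mpoly set \<Rightarrow> rat" where
  "bourbaki_degree J =
     (if height J = 2 \<and> perfect_ideal J then 0
      else THE b. \<exists>d fs \<nu> B. length fs = 3 \<and> minimally_generated_by_forms d fs J \<and>
             \<nu> \<in> syzygies fs \<and> \<nu> \<noteq> 0\<^sub>v 3 \<and> homogeneous_vec (int (syz_indeg fs)) \<nu> \<and>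
             bourbaki_ideal fs \<nu> B \<and> b = multiplicity_quotient B)"


section \<open>Shifts of the resolution\<close>

text \<open>
  The conventions on the degrees; \<open>\<delta>\<^sub>i\<close> is \<open>\<delta> ! (i - 1)\<close>, and likewise for \<open>\<epsilon>\<close>.
\<close>

definition shift_conventions :: "nat list \<Rightarrow> nat list \<Rightarrow> bool" where
  "shift_conventions \<delta> \<epsilon> \<longleftrightarrow>
     length \<delta> = 5 \<and> length \<epsilon> = 3 \<and>
     1 \<le> \<delta> ! 0 \<and> sorted \<delta> \<and> (\<forall>i<3. 1 \<le> \<epsilon> ! i) \<and>
     \<delta> ! 2 + \<epsilon> ! 0 \<le> \<delta> ! 3 + \<epsilon> ! 1 \<and> \<delta> ! 3 + \<epsilon> ! 1 \<le> \<delta> ! 4 + \<epsilon> ! 2"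

definition resolution_shifts :: "nat list \<Rightarrow> nat list \<Rightarrow> int list list" where
  "resolution_shifts \<delta> \<epsilon> =
     [[3, 3, 3],
      map (\<lambda>i. 3 + int (\<delta> ! i)) [0..<5],
      map (\<lambda>i. 3 + int (\<delta> ! (i + 2)) + int (\<epsilon> ! i)) [0..<3]]"

end

theory Submission
  imports Defs "HOL-Library.Function_Algebras"
begin

text \<open>
  Comparing Hilbert functions, codimension two forces \<open>\<Sum>\<epsilon> = \<delta>\<^sub>1 + \<delta>\<^sub>2 - 3\<close>. The three Koszul
  relations have degree 3 and are independent, so \<open>\<delta>\<^sub>1, \<delta>\<^sub>2 \<le> 3\<close>; as the \<open>\<epsilon>\<^sub>i\<close> are positive,
  \<open>\<delta>\<^sub>1 = \<delta>\<^sub>2 = 3\<close> and \<open>\<epsilon> = (1, 1, 1)\<close>, and then \<open>\<delta>\<^sub>3 = 3\<close>. If \<open>\<delta>\<^sub>4 > 3\<close> or \<open>\<delta>\<^sub>5 > 3\<close>,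
  the second syzygies of degree 4 are linear relations between at most four generators, three of
  which may be taken to be the Koszul relations; this contradicts the coprimality of the cubics or
  the injectivity of the last map. The multiplicity is read off the Hilbert function.

  A minimal syzygy \<open>\<nu>\<close> has degree 3 and coprime entries, so the values on the Koszul relations of a
  map with kernel \<open>R\<nu>\<close> are a constant multiple of \<open>\<nu>\<close>. This fixes the degree of the map, and
  with it the Hilbert function and the multiplicity 6 of any Bourbaki ideal. One exists: with the
  first two cubics \<open>f, g\<close> coprime and \<open>h\<close> the third, \<open>(f, g) : h\<close> is a Bourbaki ideal of
  \<open>(g, -f, 0)\<close>. It is unmixed of height two because, after a change of variables making \<open>f\<close> monic,
  nonzero polynomials in \<open>n - 2\<close> of the variables avoid all the primes concerned, while heights are
  bounded by the growth of \<open>R/P\<close>.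

  The vector is realized by \<open>(x\<^sup>3, y\<^sup>3 - 2xyz, y\<^sup>2z - xz\<^sup>2)\<close>.
\<close>

section \<open>Substitution homomorphisms\<close>

text \<open>For the shifts, the height of \<open>J\<close> matters only through coprimality. As
  \<open>J\<close> lies in no principal prime and the field is infinite, it contains two coprime
  cubics, and the single relation between these bounds the Hilbert function of R/J by nine times a
  binomial of degree n - 3. This replaces dimension theory in the numerical part. The obstacle is
  the Bourbaki degree: it is a definite description over all generating triples, all syzygies of
  least degree and all Bourbaki ideals. Uniqueness therefore has to use only data common to all
  choices, namely the dimensions of the graded pieces of \<open>J\<close>. Existence needs an ideal
  whose height and associated primes can be controlled; for a colon ideal of a coprime pair this
  works because its associated primes are again colon ideals of the same pair. That the first branch
  of the definition is not taken is a separate point: a resolution of length two would split the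
  last map of the minimal one, whose entries have no constant terms.\<close>

abbreviation (input) "coef \<equiv> Poly_Mapping.lookup"
abbreviation (input) "mkeys \<equiv> Poly_Mapping.keys"

definition cst :: "'k \<Rightarrow> ('v, 'k::field) mpoly" where
  "cst c = Poly_Mapping.single 0 c"

definition X :: "'v \<Rightarrow> ('v, 'k::field) mpoly" where
  "X v = Poly_Mapping.single (Poly_Mapping.single v 1) 1"

definition mon_eval :: "('v::finite \<Rightarrow> 'a::comm_ring_1) \<Rightarrow> ('v \<Rightarrow>\<^sub>0 nat) \<Rightarrow> 'a" where
  "mon_eval s m = (\<Prod>v\<in>UNIV. s v ^ coef m v)"

text \<open>The universal property of the polynomial ring in one formula. The maps
  \<open>kronecker\<close>, \<open>uni\<close>, \<open>gr\<close>, \<open>nagata\<close>,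
  \<open>vanish\<close> and the evaluation at points are instances, so all are ring homomorphisms
  for one reason, and \<open>hom_eqI\<close> compares composites on constants and variables.\<close>

definition msubst :: "('k::field \<Rightarrow> 'a::comm_ring_1) \<Rightarrow> ('v::finite \<Rightarrow> 'a) \<Rightarrow> ('v, 'k) mpoly \<Rightarrow> 'a" where
  "msubst h s p = (\<Sum>m\<in>mkeys p. h (coef p m) * mon_eval s m)"

lemma mon_eval_0 [simp]: "mon_eval s 0 = 1"
  by (simp add: mon_eval_def)

lemma mon_eval_add: "mon_eval s (m + m') = mon_eval s m * mon_eval s m'"
  by (simp add: mon_eval_def lookup_add power_add prod.distrib)

lemma mon_eval_single: "mon_eval s (Poly_Mapping.single v n) = s v ^ n"
proof -
  have "mon_eval s (Poly_Mapping.single v n) = (\<Prod>w\<in>UNIV. if w = v then s v ^ n else 1)"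
    unfolding mon_eval_def by (rule prod.cong) (auto simp: lookup_single when_def)
  then show ?thesis by simp
qed

lemma mpoly_sum_single:
  fixes p :: "'a \<Rightarrow>\<^sub>0 'b::comm_monoid_add"
  assumes "finite A" "mkeys p \<subseteq> A"
  shows "p = (\<Sum>m\<in>A. Poly_Mapping.single m (coef p m))"
proof (rule poly_mapping_eqI)
  fix k
  have "coef (\<Sum>m\<in>A. Poly_Mapping.single m (coef p m)) k = (\<Sum>m\<in>A. if m = k then coef p k else 0)"
    by (auto simp: lookup_sum lookup_single when_def intro!: sum.cong)
  also have "\<dots> = coef p k"
    using assms by (auto simp: in_keys_iff)
  finally show "coef p k = coef (\<Sum>m\<in>A. Poly_Mapping.single m (coef p m)) k" by simp
qed

lemma comm_ring_hom_cst: "comm_ring_hom cst"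
  by unfold_locales (simp_all add: cst_def single_add mult_single)

interpretation cst: comm_ring_hom cst
  by (rule comm_ring_hom_cst)

lemma scale_cst: "scale c p = cst c * p"
  by (simp add: scale_def cst_def)

lemma X_power: "X v ^ n = Poly_Mapping.single (Poly_Mapping.single v n) 1"
  by (induct n) (simp_all add: X_def mult_single single_add[symmetric])

lemma mon_eval_X:
  fixes m :: "'v::finite \<Rightarrow>\<^sub>0 nat"
  shows "mon_eval X m = (Poly_Mapping.single m 1 :: ('v, 'k::field) mpoly)"
proof -
  have *: "(\<Prod>v\<in>A. (X v :: ('v, 'k) mpoly) ^ coef m v)
      = Poly_Mapping.single (\<Sum>v\<in>A. Poly_Mapping.single v (coef m v)) 1" if "finite A" for A
    using that by induct (simp_all add: X_power mult_single)
  have "m = (\<Sum>v\<in>UNIV. Poly_Mapping.single v (coef m v))"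
    by (rule mpoly_sum_single) simp_all
  then show ?thesis
    unfolding mon_eval_def using *[of UNIV] by simp
qed

context
  fixes h :: "'k::field \<Rightarrow> 'a::comm_ring_1" and s :: "'v::finite \<Rightarrow> 'a"
  assumes h: "comm_ring_hom h"
begin

interpretation h: comm_ring_hom h by (rule h)

lemma msubst_superset:
  assumes "finite A" "mkeys p \<subseteq> A"
  shows "msubst h s p = (\<Sum>m\<in>A. h (coef p m) * mon_eval s m)"
  unfolding msubst_def
  by (rule sum.mono_neutral_left) (use assms in \<open>auto simp: in_keys_iff\<close>)

lemma msubst_single: "msubst h s (Poly_Mapping.single m c) = h c * mon_eval s m"
  by (subst msubst_superset[where A = "{m}"]) auto

lemma msubst_cst: "msubst h s (cst c) = h c"
  by (simp add: cst_def msubst_single)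

lemma msubst_X: "msubst h s (X v) = s v"
  by (simp add: X_def msubst_single mon_eval_single)

lemma msubst_add: "msubst h s (p + q) = msubst h s p + msubst h s q"
proof -
  let ?A = "mkeys p \<union> mkeys q"
  have "msubst h s (p + q) = (\<Sum>m\<in>?A. h (coef (p + q) m) * mon_eval s m)"
    by (rule msubst_superset) (use keys_add[of p q] in auto)
  also have "\<dots> = (\<Sum>m\<in>?A. h (coef p m) * mon_eval s m) + (\<Sum>m\<in>?A. h (coef q m) * mon_eval s m)"
    by (simp add: lookup_add h.hom_add algebra_simps sum.distrib)
  also have "\<dots> = msubst h s p + msubst h s q"
    by (simp add: msubst_superset[where A = ?A, symmetric])
  finally show ?thesis .
qed

lemma msubst_sum: "msubst h s (\<Sum>i\<in>I. f i) = (\<Sum>i\<in>I. msubst h s (f i))"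
proof -
  have z: "msubst h s 0 = 0" by (simp add: msubst_def)
  show ?thesis
    by (induct I rule: infinite_finite_induct) (simp_all add: z msubst_add)
qed

lemma msubst_mult: "msubst h s (p * q) = msubst h s p * msubst h s q"
proof -
  have p: "p = (\<Sum>m\<in>mkeys p. Poly_Mapping.single m (coef p m))"
    and q: "q = (\<Sum>m\<in>mkeys q. Poly_Mapping.single m (coef q m))"
    by (rule mpoly_sum_single; simp)+
  have "msubst h s (p * q) = msubst h s ((\<Sum>m\<in>mkeys p. Poly_Mapping.single m (coef p m)) *
      (\<Sum>m\<in>mkeys q. Poly_Mapping.single m (coef q m)))"
    using p q by simp
  also have "\<dots> = (\<Sum>m\<in>mkeys p. \<Sum>m'\<in>mkeys q. (h (coef p m) * mon_eval s m) * (h (coef q m') * mon_eval s m'))"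
    by (simp add: sum_product msubst_sum mult_single msubst_single h.hom_mult mon_eval_add ac_simps)
  also have "\<dots> = msubst h s p * msubst h s q"
    by (simp add: msubst_def sum_product)
  finally show ?thesis .
qed

lemma comm_ring_hom_msubst: "comm_ring_hom (msubst h s)"
proof
  show "msubst h s 1 = 1"
    using msubst_cst[of 1] by simp
qed (simp_all add: msubst_add msubst_mult, simp add: msubst_def)

end

lemma hom_eq_msubst:
  assumes "comm_ring_hom \<phi>"
  shows "\<phi> p = msubst (\<lambda>c. \<phi> (cst c)) (\<lambda>v. \<phi> (X v)) (p :: ('v::finite, 'k::field) mpoly)"
proof -
  interpret comm_ring_hom \<phi> by fact
  have me: "\<phi> (mon_eval X m) = mon_eval (\<lambda>v. \<phi> (X v)) m" for m :: "'v \<Rightarrow>\<^sub>0 nat"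
    by (simp add: mon_eval_def hom_prod hom_power)
  have "\<phi> p = \<phi> (\<Sum>m\<in>mkeys p. Poly_Mapping.single m (coef p m))"
    using mpoly_sum_single[of "mkeys p" p] by simp
  also have "\<dots> = (\<Sum>m\<in>mkeys p. \<phi> (cst (coef p m) * mon_eval X m))"
    by (simp add: hom_sum mon_eval_X cst_def mult_single)
  also have "\<dots> = msubst (\<lambda>c. \<phi> (cst c)) (\<lambda>v. \<phi> (X v)) p"
    by (simp add: msubst_def hom_mult me)
  finally show ?thesis .
qed

lemma hom_eqI:
  assumes "comm_ring_hom \<phi>" "comm_ring_hom \<psi>"
    and "\<And>c. \<phi> (cst c) = \<psi> (cst c)" "\<And>v. \<phi> (X v) = \<psi> (X v)"
  shows "\<phi> p = \<psi> (p :: ('v::finite, 'k::field) mpoly)"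
  by (subst hom_eq_msubst[OF assms(1)], subst hom_eq_msubst[OF assms(2)]) (simp add: assms)

lemma comm_ring_hom_comp: "comm_ring_hom f \<Longrightarrow> comm_ring_hom g \<Longrightarrow> comm_ring_hom (\<lambda>x. f (g x))"
proof -
  assume "comm_ring_hom f" "comm_ring_hom g"
  interpret f: comm_ring_hom f by fact
  interpret g: comm_ring_hom g by fact
  show ?thesis
    by unfold_locales (simp_all add: f.hom_add g.hom_add f.hom_mult g.hom_mult)
qed

section \<open>Weights, and the absence of zero divisors\<close>

definition weight :: "('v::finite \<Rightarrow> nat) \<Rightarrow> ('v \<Rightarrow>\<^sub>0 nat) \<Rightarrow> nat" where
  "weight N m = (\<Sum>v\<in>UNIV. coef m v * N v)"

lemma digits_less:
  fixes a :: "nat \<Rightarrow> nat"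
  assumes "\<And>i. i < n \<Longrightarrow> a i < B"
  shows "(\<Sum>i<n. a i * B ^ i) < B ^ n"
  using assms
proof (induct n)
  case (Suc n)
  have "a n < B" using Suc.prems[of n] by simp
  then have "a n \<le> B - 1" "B \<ge> 1" by simp_all
  moreover have "(\<Sum>i<n. a i * B ^ i) < B ^ n" using Suc by simp
  moreover have "a n * B ^ n \<le> (B - 1) * B ^ n" using \<open>a n \<le> B - 1\<close> by (rule mult_right_mono) simp
  moreover have "(B - 1) * B ^ n + B ^ n = B ^ Suc n" using \<open>B \<ge> 1\<close> by (simp add: algebra_simps)
  ultimately have "(\<Sum>i<n. a i * B ^ i) + a n * B ^ n < B ^ Suc n" by linarith
  then show ?case by simp
qed simp

lemma digits_unique:
  fixes a b :: "nat \<Rightarrow> nat"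
  assumes "\<And>i. i < n \<Longrightarrow> a i < B" "\<And>i. i < n \<Longrightarrow> b i < B"
    and "(\<Sum>i<n. a i * B ^ i) = (\<Sum>i<n. b i * B ^ i)"
  shows "\<forall>i<n. a i = b i"
  using assms
proof (induct n)
  case (Suc n)
  let ?s = "\<lambda>a. \<Sum>i<n. a i * B ^ i"
  have 1: "?s a < B ^ n" "?s b < B ^ n"
    using Suc.prems by (auto intro: digits_less)
  have 2: "?s a + a n * B ^ n = ?s b + b n * B ^ n" using Suc.prems(3) by simp
  have B: "B ^ n \<noteq> 0" using 1 by linarith
  have "(?s a + a n * B ^ n) div B ^ n = a n" "(?s b + b n * B ^ n) div B ^ n = b n"
    using 1 B by simp_all
  with 2 have "a n = b n" by metis
  moreover have "?s a = ?s b" using 2 \<open>a n = b n\<close> by simp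
  then have "\<forall>i<n. a i = b i" using Suc.prems(1,2) by (intro Suc.hyps) auto
  ultimately show ?case by (metis less_Suc_eq)
qed simp

text \<open>The weights are powers of a base \<open>B\<close> exceeding all exponents in
  \<open>K\<close>, so a weight is a numeral with the exponents as digits. The variable
  \<open>b\<close> is moved to place 0 and gets weight 1, as \<open>ex_nagata_monic\<close> requires
  because its substitution fixes \<open>X b\<close>.\<close>

lemma ex_weight:
  fixes K :: "('v::finite \<Rightarrow>\<^sub>0 nat) set" and b :: 'v
  assumes "finite K"
  obtains N where "N b = 1" "\<And>v. N v \<ge> 1" "inj_on (weight N) K"
proof -
  define n where "n = CARD('v)"
  obtain e0 where e0: "bij_betw e0 (UNIV :: 'v set) {0..<n}"
    using ex_bij_betw_finite_nat[of "UNIV :: 'v set"] by (auto simp: n_def)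
  define e where "e = Transposition.transpose (e0 b) 0 \<circ> e0"
  have n0: "0 < n" by (simp add: n_def)
  have "e0 b \<in> {0..<n}" using e0 by (auto simp: bij_betw_def)
  then have "bij_betw (Transposition.transpose (e0 b) 0) {0..<n} {0..<n}"
    using n0 by simp
  then have e: "bij_betw e (UNIV :: 'v set) {..<n}"
    using bij_betw_trans[OF e0] by (simp add: e_def lessThan_atLeast0)
  have eb: "e b = 0" by (simp add: e_def)
  define B where "B = Suc (Suc (Max (insert 0 (\<Union>m\<in>K. range (coef m)))))"
  have fr: "finite (range (coef m))" for m :: "'v \<Rightarrow>\<^sub>0 nat" by simp
  have fin: "finite (\<Union>m\<in>K. range (coef m))" using assms fr by blast
  have B: "coef m v < B" if "m \<in> K" for m v
  proof -
    have "coef m v \<le> Max (insert 0 (\<Union>m\<in>K. range (coef m)))"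
      by (rule Max_ge) (use fin that in auto)
    then show ?thesis unfolding B_def by linarith
  qed
  define N where "N v = B ^ e v" for v
  have wt: "weight N m = (\<Sum>i<n. coef m (inv_into UNIV e i) * B ^ i)" for m
    unfolding weight_def N_def
    using sum.reindex_bij_betw[OF e, of "\<lambda>i. coef m (inv_into UNIV e i) * B ^ i"]
    by (simp add: bij_betw_inv_into_left[OF e])
  have "inj_on (weight N) K"
  proof (rule inj_onI)
    fix m m' assume m: "m \<in> K" "m' \<in> K" "weight N m = weight N m'"
    have "\<forall>i<n. coef m (inv_into UNIV e i) = coef m' (inv_into UNIV e i)"
      by (rule digits_unique[where B = B]) (use m B wt in auto)
    moreover have "inv_into UNIV e (e v) = v" "e v < n" for v
      using bij_betw_inv_into_left[OF e] e by (auto simp: bij_betw_def)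
    ultimately have "coef m v = coef m' v" for v by metis
    then show "m = m'" by (rule poly_mapping_eqI)
  qed
  moreover have "N v \<ge> 1" for v by (simp add: N_def B_def)
  moreover have "N b = 1" by (simp add: N_def eb)
  ultimately show ?thesis using that by blast
qed

definition kronecker :: "('v::finite \<Rightarrow> nat) \<Rightarrow> ('v, 'k::field) mpoly \<Rightarrow> 'k poly" where
  "kronecker N = msubst (\<lambda>c. [:c:]) (\<lambda>v. monom 1 (N v))"

lemma comm_ring_hom_const_poly: "comm_ring_hom (\<lambda>c :: 'a::comm_ring_1. [:c:])"
  by unfold_locales (simp_all add: one_pCons)

lemma comm_ring_hom_kronecker: "comm_ring_hom (kronecker N)"
  unfolding kronecker_def by (rule comm_ring_hom_msubst[OF comm_ring_hom_const_poly])

lemma kronecker_eq: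
  fixes p :: "('v::finite, 'k::field) mpoly"
  shows "kronecker N p = (\<Sum>m\<in>mkeys p. monom (coef p m) (weight N m))"
proof -
  have "mon_eval (\<lambda>v. monom (1::'k) (N v)) m = monom 1 (weight N m)" for m
  proof -
    have "(\<Prod>v\<in>A. monom (1::'k) (N v) ^ coef m v) = monom 1 (\<Sum>v\<in>A. coef m v * N v)" if "finite A" for A
      using that by induct (simp_all add: monom_power mult_monom mult.commute)
    then show ?thesis by (simp add: mon_eval_def weight_def)
  qed
  then show ?thesis by (simp add: kronecker_def msubst_def smult_monom)
qed

lemma kronecker_nonzero:
  assumes "inj_on (weight N) (mkeys p)" "p \<noteq> 0"
  shows "kronecker N p \<noteq> 0"
proof -
  obtain m where m: "m \<in> mkeys p" using assms(2) by (metis poly_mapping_eqI in_keys_iff lookup_zero)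
  have "coeff (kronecker N p) (weight N m) = (\<Sum>m'\<in>mkeys p. if m' = m then coef p m' else 0)"
    unfolding kronecker_eq coeff_sum
    by (rule sum.cong) (use assms m in \<open>auto simp: inj_on_def\<close>)
  also have "\<dots> = coef p m" using m by simp
  finally show ?thesis using m by (auto simp: in_keys_iff)
qed

text \<open>With a weight that separates the exponents of both factors, Kronecker substitution keeps
  both nonzero, and \<open>'k poly\<close> is an integral domain.\<close>

lemma mpoly_mult_eq_0_iff:
  fixes p q :: "('v::finite, 'k::field) mpoly"
  shows "p * q = 0 \<longleftrightarrow> p = 0 \<or> q = 0"
proof (rule iffI)
  assume pq: "p * q = 0"
  obtain N where "inj_on (weight N) (mkeys p \<union> mkeys q)"
    using ex_weight[of "mkeys p \<union> mkeys q"] by (metis finite_UnI finite_keys)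
  then have N: "inj_on (weight N) (mkeys p)" "inj_on (weight N) (mkeys q)"
    by (auto intro: inj_on_subset)
  interpret comm_ring_hom "kronecker N :: ('v, 'k) mpoly \<Rightarrow> _" by (rule comm_ring_hom_kronecker)
  have "kronecker N p * kronecker N q = 0" using pq by (metis hom_mult hom_zero)
  then show "p = 0 \<or> q = 0" using kronecker_nonzero[OF N(1)] kronecker_nonzero[OF N(2)] by auto
qed auto

lemma mpoly_mult_left_cancel:
  fixes p q :: "('v::finite, 'k::field) mpoly"
  assumes "c \<noteq> 0" shows "c * p = c * q \<longleftrightarrow> p = q"
  using mpoly_mult_eq_0_iff[of c "p - q"] assms by (simp add: right_diff_distrib)

lemma mpoly_dvd_cancel:
  fixes p q :: "('v::finite, 'k::field) mpoly"
  assumes "c \<noteq> 0" shows "c * p dvd c * q \<longleftrightarrow> p dvd q"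
proof
  assume "c * p dvd c * q"
  then obtain r where "c * q = c * (p * r)" by (auto simp: dvd_def mult.assoc)
  then show "p dvd q" using mpoly_mult_left_cancel[OF assms, of q "p * r"] by simp
qed (rule mult_dvd_mono, simp_all)

lemma mpoly_power_eq_0:
  fixes p :: "('v::finite, 'k::field) mpoly"
  shows "p ^ n = 0 \<longleftrightarrow> p = 0 \<and> n > 0"
proof (induct n)
  case (Suc n)
  then show ?case unfolding power_Suc mpoly_mult_eq_0_iff by blast
qed simp

section \<open>Polynomials in some of the variables\<close>

text \<open>Subrings of one fixed ring instead of a new ring for each set of variables, so that the
  induction on the number of variables behind unique factorization never changes the type.\<close>

definition svars :: "'v set \<Rightarrow> ('v::finite, 'k::field) mpoly set" where
  "svars V = {p. \<forall>m\<in>mkeys p. \<forall>v. v \<notin> V \<longrightarrow> coef m v = 0}"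

lemma svars_mono: "V \<subseteq> W \<Longrightarrow> p \<in> svars V \<Longrightarrow> p \<in> svars W"
  by (auto simp: svars_def)

lemma svars_UNIV [simp]: "p \<in> svars UNIV"
  by (simp add: svars_def)

lemma svars_iff: "p \<in> svars V \<longleftrightarrow> (\<forall>v. v \<notin> V \<longrightarrow> p \<in> svars (- {v}))"
  by (auto simp: svars_def)

lemma svars_0 [simp]: "0 \<in> svars V"
  by (simp add: svars_def)

lemma svars_cst [simp]: "cst c \<in> svars V"
  by (auto simp: svars_def cst_def)

lemma svars_1 [simp]: "1 \<in> svars V"
  by (auto simp: svars_def)

lemma svars_X: "v \<in> V \<Longrightarrow> X v \<in> svars V"
  by (auto simp: svars_def X_def lookup_single when_def)

lemma svars_add: "p \<in> svars V \<Longrightarrow> q \<in> svars V \<Longrightarrow> p + q \<in> svars V"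
  unfolding svars_def using keys_add[of p q] by blast

lemma svars_uminus: "p \<in> svars V \<Longrightarrow> - p \<in> svars V"
  by (auto simp: svars_def in_keys_iff)

lemma svars_diff: "p \<in> svars V \<Longrightarrow> q \<in> svars V \<Longrightarrow> p - q \<in> svars V"
  using svars_add[of p V "- q"] svars_uminus[of q V] by simp

lemma svars_mult:
  assumes "p \<in> svars V" "q \<in> svars V"
  shows "p * q \<in> svars V"
proof -
  have "\<forall>v. v \<notin> V \<longrightarrow> coef m v = 0" if "m \<in> mkeys (p * q)" for m
  proof -
    obtain a b where "m = a + b" "a \<in> mkeys p" "b \<in> mkeys q"
      using keys_mult[of p q] \<open>m \<in> mkeys (p * q)\<close> by blast
    with assms show ?thesis by (auto simp: svars_def lookup_add)
  qed
  then show ?thesis by (simp add: svars_def)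
qed

lemma svars_power: "p \<in> svars V \<Longrightarrow> p ^ n \<in> svars V"
  by (induct n) (auto intro: svars_mult)

lemma svars_sum: "(\<And>i. i \<in> I \<Longrightarrow> f i \<in> svars V) \<Longrightarrow> sum f I \<in> svars V"
  by (induct I rule: infinite_finite_induct) (auto intro: svars_add)

lemma svars_induct [consumes 1, case_names cst X add mult]:
  fixes p :: "('v::finite, 'k::field) mpoly"
  assumes p: "p \<in> svars V"
    and cst: "\<And>c. P (cst c)" and X: "\<And>v. v \<in> V \<Longrightarrow> P (X v)"
    and add: "\<And>p q. P p \<Longrightarrow> P q \<Longrightarrow> P (p + q)"
    and mult: "\<And>p q. P p \<Longrightarrow> P q \<Longrightarrow> P (p * q)"
  shows "P p"
proof -
  have P1: "P 1" using cst[of 1] by simp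
  have pow: "P (x ^ n)" if "P x" for x n
    using that by (induct n) (auto intro: P1 mult)
  have prod: "P (prod f A)" if "\<And>i. i \<in> A \<Longrightarrow> P (f i)" for f :: "'v \<Rightarrow> _" and A
    using that by (induct A rule: infinite_finite_induct) (auto intro: P1 mult)
  have sum: "P (sum f A)" if "\<And>i. i \<in> A \<Longrightarrow> P (f i)" for f :: "('v \<Rightarrow>\<^sub>0 nat) \<Rightarrow> _" and A
    using that cst[of 0] by (induct A rule: infinite_finite_induct) (auto intro: add)
  have "P (cst (coef p m) * mon_eval X m)" if m: "m \<in> mkeys p" for m
    unfolding mon_eval_def
  proof (intro mult cst prod)
    fix v
    show "P (X v ^ coef m v)"
    proof (cases "v \<in> V")
      case False
      then have "coef m v = 0" using p m by (auto simp: svars_def)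
      then show ?thesis using P1 by simp
    qed (auto intro: pow X)
  qed
  then have "P (\<Sum>m\<in>mkeys p. cst (coef p m) * mon_eval X m)" by (rule sum)
  then show ?thesis
    using mpoly_sum_single[of "mkeys p" p] by (simp add: mon_eval_X cst_def mult_single)
qed

lemma svars_empty:
  assumes "p \<in> svars {}" shows "p = cst (coef p 0)"
proof (rule poly_mapping_eqI)
  fix m
  show "coef p m = coef (cst (coef p 0)) m"
  proof (cases "m = 0")
    case False
    then have "\<exists>v. coef m v \<noteq> 0" by (metis lookup_zero poly_mapping_eqI)
    then have "m \<notin> mkeys p" using assms by (auto simp: svars_def)
    then show ?thesis using False by (simp add: in_keys_iff cst_def lookup_single when_def)
  qed (simp add: cst_def)
qed

text \<open>The coefficients stay in the full ring. By \<open>coeff_uni_svars\<close> they no longer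
  involve \<open>b\<close>, and \<open>poly_uni\<close> recovers \<open>p\<close> by evaluation at
  \<open>X b\<close>.\<close>

definition uni :: "'v \<Rightarrow> ('v::finite, 'k::field) mpoly \<Rightarrow> ('v, 'k) mpoly poly" where
  "uni b = msubst (\<lambda>c. [:cst c:]) (\<lambda>v. if v = b then [:0, 1:] else [:X v:])"

abbreviation deg_in :: "'v \<Rightarrow> ('v::finite, 'k::field) mpoly \<Rightarrow> nat" where
  "deg_in b p \<equiv> degree (uni b p)"

lemma comm_ring_hom_const_cst: "comm_ring_hom (\<lambda>c. [:cst c:])"
  by (rule comm_ring_hom_comp[OF comm_ring_hom_const_poly comm_ring_hom_cst])

lemma comm_ring_hom_uni: "comm_ring_hom (uni b)"
  unfolding uni_def by (rule comm_ring_hom_msubst[OF comm_ring_hom_const_cst])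

interpretation uni: comm_ring_hom "uni b" for b
  by (rule comm_ring_hom_uni)

lemma uni_cst: "uni b (cst c) = [:cst c:]"
  by (simp add: uni_def msubst_cst[OF comm_ring_hom_const_cst])

lemma uni_X: "uni b (X v) = (if v = b then [:0, 1:] else [:X v:])"
  by (simp add: uni_def msubst_X[OF comm_ring_hom_const_cst])

lemma comm_ring_hom_poly: "comm_ring_hom (\<lambda>P. poly P x)"
  by unfold_locales simp_all

lemma poly_uni: "poly (uni b p) (X b) = p"
proof -
  have "comm_ring_hom (\<lambda>p. poly (uni b p) (X b))"
    by (rule comm_ring_hom_comp[OF comm_ring_hom_poly comm_ring_hom_uni])
  moreover have "comm_ring_hom (\<lambda>p :: ('a, 'b) mpoly. p)" by unfold_locales simp_all
  ultimately show ?thesis by (rule hom_eqI) (auto simp: uni_cst uni_X)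
qed

lemma uni_inject [simp]: "uni b p = uni b q \<longleftrightarrow> p = q"
  by (metis poly_uni)

lemma uni_eq_0_iff [simp]: "uni b p = 0 \<longleftrightarrow> p = 0"
  using uni_inject[of b p 0] by (simp del: uni_inject)

lemma coeff_uni_svars:
  assumes "p \<in> svars V" shows "coeff (uni b p) i \<in> svars (V - {b})"
  using assms
proof (induct arbitrary: i rule: svars_induct)
  case (mult p q)
  then show ?case
    by (auto simp: uni.hom_mult coeff_mult intro!: svars_sum svars_mult)
qed (auto simp: uni_cst uni_X uni.hom_add coeff_pCons split: nat.split intro: svars_add svars_X)

lemma uni_const:
  assumes "p \<in> svars (- {b})" shows "uni b p = [:p:]"
  using assms
  by (induct rule: svars_induct) (auto simp: uni_cst uni_X uni.hom_mult uni.hom_add)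

lemma degree_mult_mpoly:
  fixes P Q :: "('v::finite, 'k::field) mpoly poly"
  assumes "P \<noteq> 0" "Q \<noteq> 0" shows "degree (P * Q) = degree P + degree Q"
proof (rule antisym[OF degree_mult_le])
  have "coeff (P * Q) (degree P + degree Q) \<noteq> 0"
    using assms by (simp add: coeff_mult_degree_sum mpoly_mult_eq_0_iff)
  then show "degree P + degree Q \<le> degree (P * Q)" by (rule le_degree)
qed

lemma deg_in_mult:
  "p \<noteq> 0 \<Longrightarrow> q \<noteq> 0 \<Longrightarrow> deg_in b (p * q) = deg_in b p + deg_in b q"
  by (simp add: uni.hom_mult degree_mult_mpoly)

lemma svars_iff_deg_in: "p \<in> svars (- {b}) \<longleftrightarrow> deg_in b p = 0"
proof
  assume "deg_in b p = 0"
  then obtain c where c: "uni b p = [:c:]" using degree_eq_zeroE by blast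
  then have "p = c" using poly_uni[of b p] by simp
  moreover have "c \<in> svars (- {b})"
    using coeff_uni_svars[of p UNIV b 0] c by (simp add: Compl_eq_Diff_UNIV)
  ultimately show "p \<in> svars (- {b})" by simp
qed (simp add: uni_const)

text \<open>Degrees in each single variable are additive, so a variable of a factor survives in a
  nonzero product.\<close>

lemma svars_factor:
  assumes "p * q \<in> svars V" "p * q \<noteq> 0" shows "p \<in> svars V"
proof (subst svars_iff, intro allI impI)
  fix v assume "v \<notin> V"
  then have "deg_in v (p * q) = 0" using assms(1) svars_iff[of "p * q" V] svars_iff_deg_in[of "p * q" v] by blast
  moreover have "p \<noteq> 0" "q \<noteq> 0" using assms(2) by auto
  ultimately have "deg_in v p = 0" by (simp add: deg_in_mult)
  then show "p \<in> svars (- {v})" by (simp add: svars_iff_deg_in)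
qed

lemma svars_dvd: "p dvd q \<Longrightarrow> q \<in> svars V \<Longrightarrow> q \<noteq> 0 \<Longrightarrow> p \<in> svars V"
  by (auto elim!: dvdE intro: svars_factor)

lemma svars_codvd:
  assumes "p * q \<in> svars V" "p \<noteq> 0" shows "q \<in> svars V"
  using svars_factor[of q p V] assms by (cases "q = 0") (auto simp: mult.commute mpoly_mult_eq_0_iff)

lemma deg_in_le_of_dvd: "p dvd q \<Longrightarrow> q \<noteq> 0 \<Longrightarrow> deg_in b p \<le> deg_in b q"
  by (auto elim!: dvdE simp: deg_in_mult mpoly_mult_eq_0_iff)

lemma degree_less_of_coeffs:
  assumes "\<And>i. i \<ge> n \<Longrightarrow> coeff P i = 0" shows "P = 0 \<or> degree P < n"
  using assms[of "degree P"] by (cases "n \<le> degree P") auto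

lemma deg_in_add_less:
  assumes "p = 0 \<or> deg_in b p < n" "q = 0 \<or> deg_in b q < n"
  shows "p + q = 0 \<or> deg_in b (p + q) < n"
proof -
  have "coeff (uni b (p + q)) i = 0" if "i \<ge> n" for i
    using assms that by (auto simp: uni.hom_add coeff_eq_0)
  then show ?thesis using degree_less_of_coeffs[of n "uni b (p + q)"] by simp
qed

text \<open>The leading coefficient of \<open>h\<close> need not be invertible, hence its power on
  the left. Keeping \<open>q\<close> and \<open>r\<close> in \<open>svars V\<close> makes the
  division usable in the induction on \<open>V\<close>.\<close>

lemma pseudo_division:
  fixes p h :: "('v::finite, 'k::field) mpoly"
  assumes "p \<in> svars V" "h \<in> svars V" "h \<noteq> 0" "b \<in> V"
  shows "\<exists>k q r. q \<in> svars V \<and> r \<in> svars V \<and> lead_coeff (uni b h) ^ k * p = q * h + r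
           \<and> (r = 0 \<or> deg_in b r < deg_in b h)"
  using assms(1)
proof (induct "deg_in b p" arbitrary: p rule: less_induct)
  case less
  let ?l = "lead_coeff (uni b h)"
  have l: "?l \<in> svars (V - {b})" by (rule coeff_uni_svars[OF assms(2)])
  have lV: "?l \<in> svars V" "lead_coeff (uni b p) \<in> svars V"
    by (rule svars_mono[of "V - {b}"], blast, rule coeff_uni_svars, fact)+
  show ?case
  proof (cases "p = 0 \<or> deg_in b p < deg_in b h")
    case True
    then show ?thesis
      by (intro exI[of _ 0] exI[of _ "0"] exI[of _ p]) (use less.prems in auto)
  next
    case False
    let ?e = "deg_in b p - deg_in b h"
    define t where "t = lead_coeff (uni b p) * X b ^ ?e"
    define p' where "p' = ?l * p - t * h"
    have tV: "t \<in> svars V" unfolding t_def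
      by (intro svars_mult svars_power svars_X lV assms)
    have p'V: "p' \<in> svars V" unfolding p'_def
      by (intro svars_diff svars_mult lV tV less.prems assms)
    have cu: "uni b (coeff (uni b q) i) = [:coeff (uni b q) i:]" for q :: "('v, 'k) mpoly" and i
      by (rule uni_const) (use coeff_uni_svars[of q UNIV b i] in \<open>simp add: Compl_eq_Diff_UNIV\<close>)
    have Xe: "[:0, 1:] ^ n = monom (1 :: ('v, 'k) mpoly) n" for n
      by (induct n) (simp_all add: monom_Suc one_pCons monom_0)
    have u: "uni b p' = Polynomial.smult ?l (uni b p) - Polynomial.smult (lead_coeff (uni b p)) (monom 1 ?e * uni b h)"
      unfolding p'_def t_def
      by (simp add: uni.hom_minus uni.hom_mult uni.hom_power cu uni_X Xe)
    \<comment> \<open>Both summands of \<open>p'\<close> have the product of the two leading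
      coefficients as top coefficient, so the degree drops.\<close>
    have "coeff (uni b p') i = 0" if "i \<ge> deg_in b p" for i
    proof (cases "i = deg_in b p")
      case True
      then show ?thesis using False
        by (simp add: u coeff_monom_mult mult.commute[of "lead_coeff (uni b h)"])
    next
      case False
      then have "i > deg_in b p" using that by simp
      then have "i - ?e > deg_in b h" "coeff (uni b p) i = 0"
        using \<open>\<not> (p = 0 \<or> deg_in b p < deg_in b h)\<close> by (auto simp: coeff_eq_0)
      then show ?thesis by (simp add: u coeff_monom_mult coeff_eq_0)
    qed
    then have "p' = 0 \<or> deg_in b p' < deg_in b p"
      using degree_less_of_coeffs[of "deg_in b p" "uni b p'"] by simp
    then have "\<exists>k q r. q \<in> svars V \<and> r \<in> svars V \<and> ?l ^ k * p' = q * h + r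
           \<and> (r = 0 \<or> deg_in b r < deg_in b h)"
    proof
      assume "p' = 0"
      then show ?thesis by (intro exI[of _ 0] exI[of _ "0"] exI[of _ "0"]) auto
    next
      assume "deg_in b p' < deg_in b p"
      then show ?thesis by (rule less.hyps) (rule p'V)
    qed
    then obtain k q r where kqr: "q \<in> svars V" "r \<in> svars V" "?l ^ k * p' = q * h + r"
        "r = 0 \<or> deg_in b r < deg_in b h" by blast
    have "?l ^ Suc k * p = (q + ?l ^ k * t) * h + r"
      using kqr(3) by (simp add: p'_def algebra_simps)
    moreover have "q + ?l ^ k * t \<in> svars V"
      by (intro svars_add svars_mult svars_power kqr lV tV)
    ultimately show ?thesis using kqr by blast
  qed
qed

section \<open>The total degree\<close>

text \<open>The coefficients of \<open>gr p\<close> are the homogeneous components of \<open>p\<close>.\<close>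

definition gr :: "('v::finite, 'k::field) mpoly \<Rightarrow> ('v, 'k) mpoly poly" where
  "gr = msubst (\<lambda>c. [:cst c:]) (\<lambda>v. monom (X v) 1)"

lemma comm_ring_hom_gr: "comm_ring_hom gr"
  unfolding gr_def by (rule comm_ring_hom_msubst[OF comm_ring_hom_const_cst])

interpretation gr: comm_ring_hom gr
  by (rule comm_ring_hom_gr)

abbreviation tdeg :: "('v::finite, 'k::field) mpoly \<Rightarrow> nat" where
  "tdeg p \<equiv> degree (gr p)"

lemma gr_cst: "gr (cst c) = [:cst c:]"
  by (simp add: gr_def msubst_cst[OF comm_ring_hom_const_cst])

lemma gr_X: "gr (X v) = monom (X v) 1"
  by (simp add: gr_def msubst_X[OF comm_ring_hom_const_cst])

lemma poly_gr: "poly (gr p) 1 = p"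
proof -
  have "comm_ring_hom (\<lambda>p. poly (gr p) 1)"
    by (rule comm_ring_hom_comp[OF comm_ring_hom_poly comm_ring_hom_gr])
  moreover have "comm_ring_hom (\<lambda>p :: ('a, 'b) mpoly. p)" by unfold_locales simp_all
  ultimately show ?thesis by (rule hom_eqI) (auto simp: gr_cst gr_X poly_monom)
qed

lemma gr_eq_0_iff [simp]: "gr p = 0 \<longleftrightarrow> p = 0"
  by (metis poly_gr gr.hom_zero)

lemma gr_eq: "gr p = (\<Sum>m\<in>mkeys p. monom (Poly_Mapping.single m (coef p m)) (mon_degree m))"
proof -
  have me: "mon_eval (\<lambda>v. monom (X v) 1) m = monom (mon_eval X m :: ('a, 'b) mpoly) (mon_degree m)" for m :: "'a \<Rightarrow>\<^sub>0 nat"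
  proof -
    have "(\<Prod>v\<in>A. monom (X v :: ('a, 'b) mpoly) 1 ^ coef m v) = monom (\<Prod>v\<in>A. X v ^ coef m v) (\<Sum>v\<in>A. coef m v)"
      if "finite A" for A
      using that by induct (simp_all add: monom_power mult_monom)
    then show ?thesis by (simp add: mon_eval_def mon_degree_def)
  qed
  show ?thesis
    unfolding gr_def msubst_def by (simp add: me[unfolded One_nat_def] smult_monom mon_eval_X cst_def mult_single)
qed

lemma lookup_coeff_gr: "coef (coeff (gr p) d) m = (if mon_degree m = d then coef p m else 0)"
proof -
  have "coef (coeff (gr p) d) m = (\<Sum>m'\<in>mkeys p. if m' = m then (if mon_degree m = d then coef p m else 0) else 0)"
    unfolding gr_eq coeff_sum lookup_sum
    by (rule sum.cong) (auto simp: lookup_single when_def)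
  also have "\<dots> = (if mon_degree m = d then coef p m else 0)"
    by (auto simp: in_keys_iff)
  finally show ?thesis .
qed

lemma tdeg_mult: "p \<noteq> 0 \<Longrightarrow> q \<noteq> 0 \<Longrightarrow> tdeg (p * q) = tdeg p + tdeg q"
  by (simp add: gr.hom_mult degree_mult_mpoly)

lemma mon_degree_eq_0: "mon_degree m = 0 \<longleftrightarrow> m = 0"
  by (simp add: mon_degree_def poly_mapping_eq_iff fun_eq_iff)

lemma tdeg_eq_0: "tdeg p = 0 \<longleftrightarrow> (\<exists>c. p = cst c)"
proof
  assume d: "tdeg p = 0"
  have "coef p m = coef (cst (coef p 0)) m" for m
  proof (cases "m = 0")
    case False
    then have "mon_degree m \<noteq> 0"
      by (auto simp: mon_degree_def intro: poly_mapping_eqI)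
    then have "coeff (gr p) (mon_degree m) = 0" using d by (simp add: coeff_eq_0)
    then have "coef p m = 0" using lookup_coeff_gr[of p "mon_degree m" m] by simp
    then show ?thesis using False by (simp add: cst_def lookup_single when_def)
  qed (simp add: cst_def)
  then have "p = cst (coef p 0)" by (rule poly_mapping_eqI)
  then show "\<exists>c. p = cst c" by blast
qed (auto simp: gr_cst)

lemma cst_eq_0_iff [simp]: "cst c = (0 :: ('v, 'k::field) mpoly) \<longleftrightarrow> c = 0"
  by (metis cst_def single_zero lookup_single_eq lookup_zero)

lemma cst_dvd_1: "c \<noteq> 0 \<Longrightarrow> cst c dvd (1 :: ('v::finite, 'k::field) mpoly)"
  by (rule dvdI[of _ _ "cst (inverse c)"]) (simp flip: cst.hom_mult)

lemma unit_iff_tdeg: "p dvd 1 \<longleftrightarrow> p \<noteq> 0 \<and> tdeg (p :: ('v::finite, 'k::field) mpoly) = 0"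
proof
  assume "p dvd 1"
  then obtain q where q: "p * q = 1" by (auto elim!: dvdE)
  then have "p \<noteq> 0" "q \<noteq> 0" by auto
  then show "p \<noteq> 0 \<and> tdeg p = 0" using tdeg_mult[of p q] q by simp
qed (auto simp: tdeg_eq_0 intro: cst_dvd_1)

section \<open>Unique factorization\<close>

text \<open>A nonunit divisor of least total degree cannot split, since total degree is additive and
  nonzero elements of degree 0 are units. The degree bound on \<open>g\<close> drives
  \<open>irreducible_induct\<close>.\<close>

lemma irreducible_factor:
  fixes f :: "('v::finite, 'k::field) mpoly"
  assumes "f \<noteq> 0" "\<not> f dvd 1"
  obtains p g where "irreducible p" "f = p * g" "tdeg g < tdeg f" "g \<noteq> 0"
proof -
  define d where "d = (LEAST d. \<exists>p. p dvd f \<and> \<not> p dvd 1 \<and> tdeg p = d)"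
  have "\<exists>p. p dvd f \<and> \<not> p dvd 1 \<and> tdeg p = d"
    unfolding d_def by (rule LeastI_ex) (use assms in \<open>auto intro!: exI[of _ "tdeg f"] exI[of _ f]\<close>)
  then obtain p where p: "p dvd f" "\<not> p dvd 1" "tdeg p = d" by blast
  have min: "d \<le> tdeg q" if "q dvd f" "\<not> q dvd 1" for q
    unfolding d_def by (rule Least_le, rule exI[of _ q]) (use that in simp)
  have p0: "p \<noteq> 0" using p(1) assms by auto
  have "irreducible p"
  proof (rule irreducibleI)
    fix a b assume ab: "p = a * b"
    show "a dvd 1 \<or> b dvd 1"
    proof (rule ccontr)
      assume n: "\<not> (a dvd 1 \<or> b dvd 1)"
      have "a \<noteq> 0" "b \<noteq> 0" using ab p0 by auto
      then have "tdeg p = tdeg a + tdeg b" "tdeg b \<noteq> 0"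
        using ab n by (auto simp: tdeg_mult unit_iff_tdeg)
      moreover have "d \<le> tdeg a" using min[of a] n ab p(1) dvd_trans[of a p f] by auto
      ultimately show False using p(3) by simp
    qed
  qed (use p0 p in auto)
  moreover obtain g where g: "f = p * g" using p(1) by (elim dvdE)
  moreover have "g \<noteq> 0" using g assms by auto
  moreover have "tdeg g < tdeg f"
    using g \<open>g \<noteq> 0\<close> p0 p(2) by (simp add: tdeg_mult unit_iff_tdeg)
  ultimately show ?thesis using that by blast
qed

lemma irreducible_induct [consumes 1, case_names unit mult]:
  fixes f :: "('v::finite, 'k::field) mpoly"
  assumes "f \<noteq> 0" "\<And>u. u dvd 1 \<Longrightarrow> P u"
    and "\<And>p g. irreducible p \<Longrightarrow> g \<noteq> 0 \<Longrightarrow> P g \<Longrightarrow> P (p * g)"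
  shows "P f"
  using assms(1)
proof (induct "tdeg f" arbitrary: f rule: less_induct)
  case less
  show ?case
  proof (cases "f dvd 1")
    case False
    then obtain p g where "irreducible p" "f = p * g" "tdeg g < tdeg f" "g \<noteq> 0"
      using irreducible_factor[of f] less.prems by blast
    then show ?thesis using assms(3) less.hyps by blast
  qed (rule assms(2))
qed

text \<open>An intermediate notion for induction on \<open>V\<close>: at \<open>V = UNIV\<close> it
  is the product condition of primality, and \<open>svars {}\<close> contains no irreducible
  element, which starts the induction.\<close>

definition prime_in :: "'v set \<Rightarrow> ('v::finite, 'k::field) mpoly \<Rightarrow> bool" where
  "prime_in V p \<longleftrightarrow> (\<forall>f\<in>svars V. \<forall>g\<in>svars V. p dvd f * g \<longrightarrow> p dvd f \<or> p dvd g)"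

lemma dvd_iff_coeffs:
  assumes "p \<in> svars (- {b})"
  shows "p dvd f \<longleftrightarrow> (\<forall>i. p dvd coeff (uni b f) i)"
proof
  assume "p dvd f"
  then obtain g where "f = p * g" by (elim dvdE)
  then show "\<forall>i. p dvd coeff (uni b f) i" by (simp add: uni.hom_mult uni_const[OF assms])
next
  assume "\<forall>i. p dvd coeff (uni b f) i"
  then have "p dvd poly (uni b f) (X b)" unfolding poly_altdef by (intro dvd_sum) auto
  then show "p dvd f" by (simp add: poly_uni)
qed

text \<open>Gauss's argument: if \<open>p\<close> divides neither factor, let \<open>i\<close> and
  \<open>j\<close> be the first coefficients in \<open>b\<close> that it does not divide. In the
  coefficient of index \<open>i + j\<close> of the product all other summands are divisible by
  \<open>p\<close>.\<close>

lemma prime_in_extend: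
  assumes "prime_in V p" "p \<in> svars V" "b \<notin> V"
  shows "prime_in (insert b V) p"
  unfolding prime_in_def
proof (intro ballI impI, rule ccontr)
  fix f g assume f: "f \<in> svars (insert b V)" and g: "g \<in> svars (insert b V)"
    and d: "p dvd f * g" and n: "\<not> (p dvd f \<or> p dvd g)"
  have pb: "p \<in> svars (- {b})" using assms(2,3) by (auto intro: svars_mono[of V])
  have cV: "coeff (uni b q) i \<in> svars V" if "q \<in> svars (insert b V)" for q i
    using coeff_uni_svars[OF that, of b i] by (auto intro: svars_mono)
  define i where "i = (LEAST i. \<not> p dvd coeff (uni b f) i)"
  define j where "j = (LEAST j. \<not> p dvd coeff (uni b g) j)"
  have i: "\<not> p dvd coeff (uni b f) i" unfolding i_def
    by (rule LeastI_ex) (use n dvd_iff_coeffs[OF pb, of f] in simp)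
  have j: "\<not> p dvd coeff (uni b g) j" unfolding j_def
    by (rule LeastI_ex) (use n dvd_iff_coeffs[OF pb, of g] in simp)
  have il: "p dvd coeff (uni b f) i'" if "i' < i" for i'
    using not_less_Least[of i' "\<lambda>i. \<not> p dvd coeff (uni b f) i"] that by (simp add: i_def)
  have jl: "p dvd coeff (uni b g) j'" if "j' < j" for j'
    using not_less_Least[of j' "\<lambda>i. \<not> p dvd coeff (uni b g) i"] that by (simp add: j_def)
  have "p dvd coeff (uni b (f * g)) (i + j)" using d dvd_iff_coeffs[OF pb] by blast
  also have "coeff (uni b (f * g)) (i + j) =
      (\<Sum>k\<le>i + j. coeff (uni b f) k * coeff (uni b g) (i + j - k))"
    by (simp add: uni.hom_mult coeff_mult)
  also have "\<dots> = coeff (uni b f) i * coeff (uni b g) j +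
      (\<Sum>k\<in>{..i + j} - {i}. coeff (uni b f) k * coeff (uni b g) (i + j - k))"
    by (subst sum.remove[of _ i]) auto
  finally have "p dvd coeff (uni b f) i * coeff (uni b g) j +
      (\<Sum>k\<in>{..i + j} - {i}. coeff (uni b f) k * coeff (uni b g) (i + j - k))" .
  moreover have "p dvd (\<Sum>k\<in>{..i + j} - {i}. coeff (uni b f) k * coeff (uni b g) (i + j - k))"
  proof (rule dvd_sum)
    fix k assume "k \<in> {..i + j} - {i}"
    then have "k < i \<or> i + j - k < j" by auto
    then show "p dvd coeff (uni b f) k * coeff (uni b g) (i + j - k)"
      using il jl by (auto intro: dvd_mult dvd_mult2)
  qed
  ultimately have "p dvd coeff (uni b f) i * coeff (uni b g) j"
    by (simp add: dvd_add_left_iff)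
  then show False using assms(1) cV[OF f] cV[OF g] i j by (auto simp: prime_in_def)
qed

text \<open>Each prime factor of \<open>c\<close> divides \<open>q\<close> or \<open>h\<close> and
  is cancelled there; \<open>c1\<close> and \<open>c2\<close> collect what is cancelled. So a
  factorization that holds up to a multiplier from the lower variables yields one without
  it.\<close>

lemma split_through_product:
  fixes c :: "('v::finite, 'k::field) mpoly"
  assumes "c \<noteq> 0" "c \<in> svars V"
    and "\<And>p :: ('v, 'k) mpoly. irreducible p \<Longrightarrow> p \<in> svars V \<Longrightarrow> prime_in W p" "V \<subseteq> W"
    and "c * f = q * h" "q \<in> svars W" "h \<in> svars W" "h \<noteq> 0" "q \<noteq> 0"
  shows "\<exists>c1 c2 q1 h1. c2 \<in> svars V \<and> q = c1 * q1 \<and> h = c2 * h1 \<and> f = q1 * h1"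
  using assms(1,2,5-)
proof (induct arbitrary: q h rule: irreducible_induct)
  case (unit u)
  then obtain u' where u': "1 = u * u'" by (elim dvdE)
  have "f = (u' * q) * h" using unit u' by (metis mult.assoc mult.commute mult_1)
  moreover have "q = u * (u' * q)" using u' by (metis mult.assoc mult_1)
  ultimately show ?case
    by (intro exI[of _ u] exI[of _ 1] exI[of _ "u' * q"] exI[of _ h]) auto
next
  case (mult p g)
  have p0: "p \<noteq> 0" using mult(1) by auto
  have pg: "p \<in> svars V" "g \<in> svars V"
    using mult(4) svars_factor[of p g] svars_codvd[of p g] mult(2) p0 by (auto simp: mpoly_mult_eq_0_iff)
  have "p dvd q * h" using mult(5) by (metis dvd_triv_left mult.assoc)
  then have "p dvd q \<or> p dvd h"
    using assms(3)[OF mult(1) pg(1)] mult(6,7) by (auto simp: prime_in_def)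
  then show ?case
  proof
    assume "p dvd q"
    then obtain q' where q': "q = p * q'" by (elim dvdE)
    have "g * f = q' * h"
      using mult(5) q' mpoly_mult_left_cancel[OF p0] by (metis mult.assoc)
    moreover have "q' \<in> svars W" using q' mult(6) p0 svars_codvd by blast
    moreover have "q' \<noteq> 0" using q' mult by auto
    ultimately obtain c1 c2 q1 h1 where "c2 \<in> svars V" "q' = c1 * q1" "h = c2 * h1" "f = q1 * h1"
      using mult.hyps(3)[OF pg(2)] mult.prems by blast
    then show ?thesis using q' by (metis mult.assoc)
  next
    assume "p dvd h"
    then obtain h' where h': "h = p * h'" by (elim dvdE)
    have "g * f = q * h'"
      using mult(5) h' mpoly_mult_left_cancel[OF p0] by (metis mult.assoc mult.left_commute)
    moreover have "h' \<in> svars W" using h' mult p0 svars_codvd by blast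
    moreover have "h' \<noteq> 0" using h' mult by auto
    ultimately obtain c1 c2 q1 h1 where *: "c2 \<in> svars V" "q = c1 * q1" "h' = c2 * h1" "f = q1 * h1"
      using mult.hyps(3)[OF pg(2)] mult.prems by blast
    have "p * c2 \<in> svars V" using * pg by (auto intro: svars_mult)
    then show ?thesis using * h' by (metis mult.assoc)
  qed
qed

text \<open>Being irreducible and involving \<open>b\<close>, the element \<open>p\<close> has no
  nonunit factor from \<open>svars V\<close>. Hence in \<open>c * f = p * w\<close> the factors of
  \<open>c\<close> can only be absorbed by \<open>w\<close>.\<close>

lemma dvd_cancel_lower:
  fixes c :: "('v::finite, 'k::field) mpoly"
  assumes "c \<noteq> 0" "c \<in> svars V" "b \<notin> V"
    and pr: "\<And>p :: ('v, 'k) mpoly. irreducible p \<Longrightarrow> p \<in> svars V \<Longrightarrow> prime_in (insert b V) p"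
    and p: "irreducible p" "p \<in> svars (insert b V)" "p \<notin> svars V"
    and f: "f \<in> svars (insert b V)" "p dvd c * f"
  shows "p dvd f"
proof (cases "f = 0")
  case False
  have p0: "p \<noteq> 0" using p by auto
  obtain w where w: "c * f = p * w" using f by (elim dvdE)
  have w0: "w \<noteq> 0" using w assms(1) False by (auto simp: mpoly_mult_eq_0_iff)
  have wV: "w \<in> svars (insert b V)"
    using w svars_mult[of c "insert b V" f] svars_mono[of V "insert b V" c] assms f p0
    by (metis svars_codvd subset_insertI)
  obtain c1 c2 w1 p1 where *: "c2 \<in> svars V" "w = c1 * w1" "p = c2 * p1" "f = w1 * p1"
    using split_through_product[OF assms(1,2) pr _ w[unfolded mult.commute[of p w]] wV p(2) p0 w0]
    by blast
  have "c2 dvd 1 \<or> p1 dvd 1" using irreducibleD[OF p(1) *(3)] .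
  then show ?thesis
  proof
    assume "c2 dvd 1"
    then have "p dvd p1" using *(3) by (metis dvd_refl mult.commute mult_dvd_mono mult_1)
    then show ?thesis using * by simp
  next
    assume "p1 dvd 1"
    then have "p1 \<in> svars V" by (auto simp: unit_iff_tdeg tdeg_eq_0)
    then have "p \<in> svars V" using * by (auto intro: svars_mult)
    then show ?thesis using p by simp
  qed
qed simp

text \<open>Euclid's algorithm over the fraction field of \<open>svars V\<close>, without fractions:
  an element \<open>h\<close> of least degree in \<open>b\<close> of the ideal of \<open>p\<close>
  and \<open>f\<close> divides both up to powers of its leading coefficient. Irreducibility leaves
  two cases: \<open>h\<close> is a multiple of \<open>p\<close>, and then \<open>p\<close> divides
  \<open>f\<close>; or \<open>h\<close> is free of \<open>b\<close>, and it can be cancelled from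
  \<open>h * g\<close>, which \<open>p\<close> divides.\<close>

lemma irreducible_prime_in_step:
  fixes p :: "('v::finite, 'k::field) mpoly"
  assumes IH: "\<And>p :: ('v, 'k) mpoly. irreducible p \<Longrightarrow> p \<in> svars V \<Longrightarrow> prime_in V p"
    and b: "b \<notin> V" and p: "irreducible p" "p \<in> svars (insert b V)"
  shows "prime_in (insert b V) p"
proof (cases "p \<in> svars V")
  case True
  then show ?thesis using prime_in_extend IH p b by blast
next
  case pnV: False
  let ?W = "insert b V"
  have pr: "prime_in ?W q" if "irreducible q" "q \<in> svars V" for q :: "('v, 'k) mpoly"
    using prime_in_extend IH that b by blast
  have p0: "p \<noteq> 0" using p by auto
  show ?thesis unfolding prime_in_def
  proof (intro ballI impI)
    fix f g assume f: "f \<in> svars ?W" and g: "g \<in> svars ?W" and d: "p dvd f * g"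
    define I where "I = {u * p + v * f | u v. u \<in> svars ?W \<and> v \<in> svars ?W}"
    have IW: "I \<subseteq> svars ?W" using p f by (auto simp: I_def intro!: svars_add svars_mult)
    have "p = 1 * p + 0 * f" "f = 0 * p + 1 * f" by simp_all
    then have pI: "p \<in> I" "f \<in> I" unfolding I_def by (blast intro: svars_0 svars_1)+
    define h where "h = arg_min (deg_in b) (\<lambda>h. h \<in> I \<and> h \<noteq> 0)"
    have h: "h \<in> I \<and> h \<noteq> 0" unfolding h_def by (rule arg_min_natI) (use pI p0 in blast)
    have hmin: "deg_in b h \<le> deg_in b r" if "r \<in> I" "r \<noteq> 0" for r
      unfolding h_def by (rule arg_min_nat_le) (use that in blast)
    obtain u v where uv: "h = u * p + v * f" "u \<in> svars ?W" "v \<in> svars ?W" using h by (auto simp: I_def)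
    have hW: "h \<in> svars ?W" using h IW by blast
    have l0: "lead_coeff (uni b h) ^ k \<noteq> 0" for k
      using h by (auto simp: mpoly_power_eq_0)
    have lV: "lead_coeff (uni b h) ^ k \<in> svars V" for k
      using coeff_uni_svars[OF hW, of b] b by (auto intro!: svars_power intro: svars_mono)
    have lW: "lead_coeff (uni b h) ^ k \<in> svars ?W" for k
      using lV by (auto intro: svars_mono)
    have divI: "\<exists>k q. q \<in> svars ?W \<and> lead_coeff (uni b h) ^ k * r = q * h" if r: "r \<in> I" for r
    proof -
      obtain k q r' where kq: "q \<in> svars ?W" "r' \<in> svars ?W"
          "lead_coeff (uni b h) ^ k * r = q * h + r'" "r' = 0 \<or> deg_in b r' < deg_in b h"
        using pseudo_division[of r ?W h b] r IW hW h by blast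
      obtain u1 v1 where uv1: "r = u1 * p + v1 * f" "u1 \<in> svars ?W" "v1 \<in> svars ?W"
        using r by (auto simp: I_def)
      let ?l = "lead_coeff (uni b h) ^ k"
      have "r' = (?l * u1 - q * u) * p + (?l * v1 - q * v) * f"
        using kq(3) uv(1) uv1(1) by (simp add: algebra_simps)
      moreover have "?l * u1 - q * u \<in> svars ?W" "?l * v1 - q * v \<in> svars ?W"
        by (intro svars_diff svars_mult lW kq uv uv1)+
      ultimately have "r' \<in> I" unfolding I_def by blast
      then have "r' = 0" using hmin[of r'] kq(4) by (metis not_less)
      then show ?thesis using kq by auto
    qed
    obtain k q where kq: "q \<in> svars ?W" "lead_coeff (uni b h) ^ k * p = q * h" using divI[OF pI(1)] by blast
    obtain k' q' where kq': "q' \<in> svars ?W" "lead_coeff (uni b h) ^ k' * f = q' * h" using divI[OF pI(2)] by blast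
    have q0: "q \<noteq> 0" using kq l0[of k] p0 by (metis mult_zero_left mpoly_mult_eq_0_iff)
    have "V \<subseteq> ?W" by blast
    obtain c1 c2 q1 h1 where s: "c2 \<in> svars V" "q = c1 * q1" "h = c2 * h1" "p = q1 * h1"
      using split_through_product[OF l0 lV pr \<open>V \<subseteq> ?W\<close> kq(2) kq(1) hW] h q0 by blast
    have "q1 dvd 1 \<or> h1 dvd 1" using irreducibleD[OF p(1) s(4)] .
    then show "p dvd f \<or> p dvd g"
    proof
      assume "q1 dvd 1"
      then have "p dvd h1" using s(4) by (metis dvd_refl mult_dvd_mono mult_1)
      then have "p dvd lead_coeff (uni b h) ^ k' * f" using kq'(2) s(3) by simp
      then show ?thesis using dvd_cancel_lower[OF l0 lV b pr p pnV f] by blast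
    next
      assume "h1 dvd 1"
      then have "h1 \<in> svars V" by (auto simp: unit_iff_tdeg tdeg_eq_0)
      then have hV: "h \<in> svars V" using s by (auto intro: svars_mult)
      have "h * g = u * g * p + v * (f * g)" using uv by (simp add: algebra_simps)
      then have "p dvd h * g" using d by simp
      then show ?thesis using dvd_cancel_lower[OF _ hV b pr p pnV g] h by blast
    qed
  qed
qed

lemma irreducible_prime_elem:
  fixes p :: "('v::finite, 'k::field) mpoly"
  assumes "irreducible p" shows "prime_elem p"
proof -
  have "\<forall>p :: ('v, 'k) mpoly. irreducible p \<longrightarrow> p \<in> svars V \<longrightarrow> prime_in V p" if "finite V" for V
    using that
  proof induct
    case empty
    have "p dvd 1" if "irreducible p" "p \<in> svars {}" for p :: "('v, 'k) mpoly"
    proof -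
      have "p = cst (coef p 0)" using that(2) by (rule svars_empty)
      then show ?thesis using that(1) cst_dvd_1[of "coef p 0"] by (metis cst_eq_0_iff not_irreducible_zero)
    qed
    then show ?case using irreducible_not_unit by blast
  next
    case (insert b V)
    then show ?case using irreducible_prime_in_step by blast
  qed
  then have "prime_in UNIV p" using assms by simp
  then show ?thesis using assms
    by (auto simp: prime_in_def prime_elem_def irreducible_def)
qed

lemma prime_induct [consumes 1, case_names unit mult]:
  fixes f :: "('v::finite, 'k::field) mpoly"
  assumes "f \<noteq> 0" "\<And>u. u dvd 1 \<Longrightarrow> P u"
    and "\<And>p g. prime_elem p \<Longrightarrow> g \<noteq> 0 \<Longrightarrow> P g \<Longrightarrow> P (p * g)"
  shows "P f"
  using assms by (induct rule: irreducible_induct) (auto intro: irreducible_prime_elem)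

section \<open>Coprime sets\<close>

text \<open>Coprimality in the sense of factorization; the ideal generated may still be proper.
  Height at least two is exploited in this form.\<close>

definition coprime_set :: "('v::finite, 'k::field) mpoly set \<Rightarrow> bool" where
  "coprime_set F \<longleftrightarrow> (\<forall>p. prime_elem p \<longrightarrow> (\<exists>f\<in>F. \<not> p dvd f))"

lemma coprime_set_mono: "coprime_set F \<Longrightarrow> F \<subseteq> G \<Longrightarrow> coprime_set G"
  by (auto simp: coprime_set_def)

text \<open>Induction on the prime factors of \<open>d\<close>: each of them fails to divide some
  element of \<open>F\<close>, so it divides \<open>a\<close> and is cancelled.\<close>

lemma coprime_set_dvd:
  fixes d :: "('v::finite, 'k::field) mpoly"
  assumes "coprime_set F" "d \<noteq> 0" "\<And>f. f \<in> F \<Longrightarrow> d dvd a * f"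
  shows "d dvd a"
  using assms(2,3)
proof (induct arbitrary: a rule: prime_induct)
  case (unit u)
  then show ?case by (meson dvd_trans one_dvd)
next
  case (mult p g)
  obtain f where "f \<in> F" "\<not> p dvd f" using assms(1) mult(1) by (auto simp: coprime_set_def)
  moreover have "p dvd a * f" using mult(4)[OF \<open>f \<in> F\<close>] by (rule dvd_mult_left)
  ultimately have "p dvd a" using mult(1) by (simp add: prime_elem_dvd_mult_iff)
  then obtain a' where a': "a = p * a'" by (elim dvdE)
  have p0: "p \<noteq> 0" using mult(1) by auto
  have "g dvd a' * f" if "f \<in> F" for f
    using mult(4)[OF that] by (simp add: a' mult.assoc mpoly_dvd_cancel[OF p0])
  then have "g dvd a'" by (rule mult(3))
  then show ?case by (simp add: a' mult_dvd_mono)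
qed

lemma coprime_pair_dvd:
  assumes "coprime_set {f, g}" "f \<noteq> 0" "f dvd g * u" shows "f dvd u"
  by (rule coprime_set_dvd[OF assms(1,2)]) (use assms(3) in \<open>auto simp: mult.commute\<close>)

text \<open>The equations say that the 2 by 2 minors of the two vectors vanish. If, say,
  \<open>f1\<close> is nonzero, it divides \<open>a1 * f2\<close> and \<open>a1 * f3\<close>, hence
  \<open>a1\<close> by coprimality, and the quotient is \<open>c\<close>.\<close>

lemma coprime_triple_parallel:
  fixes f1 f2 f3 :: "('v::finite, 'k::field) mpoly"
  assumes F: "coprime_set {f1, f2, f3}" "\<not> (f1 = 0 \<and> f2 = 0 \<and> f3 = 0)"
    and a: "a1 * f2 = a2 * f1" "a1 * f3 = a3 * f1" "a2 * f3 = a3 * f2"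
  shows "\<exists>c. a1 = c * f1 \<and> a2 = c * f2 \<and> a3 = c * f3"
proof -
  have *: "\<exists>c. x = c * f \<and> y = c * g \<and> z = c * h"
    if c: "coprime_set {f, g, h}" "f \<noteq> 0" and e: "x * g = y * f" "x * h = z * f"
    for f g h x y z :: "('v, 'k) mpoly"
  proof -
    have "f dvd x"
      by (rule coprime_set_dvd[OF c]) (use e in \<open>auto simp: \<close>)
    then obtain c where x: "x = f * c" by (elim dvdE)
    have "f * y = f * (c * g)" "f * z = f * (c * h)" using e x by (simp_all add: ac_simps)
    then have "y = c * g" "z = c * h" using mpoly_mult_left_cancel[OF \<open>f \<noteq> 0\<close>] by blast+
    then show ?thesis using x by (auto simp: mult.commute)
  qed
  consider "f1 \<noteq> 0" | "f2 \<noteq> 0" | "f3 \<noteq> 0" using F(2) by blast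
  then show ?thesis
  proof cases
    case 1
    then show ?thesis using *[of f1 f2 f3 a1 a2 a3] F a by simp
  next
    case 2
    then show ?thesis using *[of f2 f1 f3 a2 a1 a3] F a by (force simp: insert_commute)
  next
    case 3
    then show ?thesis using *[of f3 f1 f2 a3 a1 a2] F a by (force simp: insert_commute)
  qed
qed

section \<open>Ideals and heights\<close>

lemma module_mult: "Modules.module ((*) :: 'a::comm_ring_1 \<Rightarrow> 'a \<Rightarrow> 'a)"
  by unfold_locales (simp_all add: algebra_simps)

lemma is_ideal_iff:
  "is_ideal (I :: 'a::comm_ring_1 set) \<longleftrightarrow>
    0 \<in> I \<and> (\<forall>x\<in>I. \<forall>y\<in>I. x + y \<in> I) \<and> (\<forall>c. \<forall>x\<in>I. c * x \<in> I)"
  by (simp add: Modules.module.subspace_def[OF module_mult])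

lemma prime_ideal_power: "is_prime_ideal P \<Longrightarrow> p ^ k * u \<in> P \<Longrightarrow> p \<in> P \<or> u \<in> P"
proof (induct k)
  case (Suc k)
  have "p * (p ^ k * u) \<in> P" using Suc.prems(2) unfolding power_Suc mult.assoc .
  then have "p \<in> P \<or> p ^ k * u \<in> P" using Suc.prems(1) unfolding is_prime_ideal_def by blast
  then show ?case using Suc by blast
qed simp

lemma prime_ideal_zero: "is_prime_ideal {0 :: ('v::finite, 'k::field) mpoly}"
  by (auto simp: is_prime_ideal_def is_ideal_iff mpoly_mult_eq_0_iff)

lemma prime_ideal_principal:
  "prime_elem p \<Longrightarrow> is_prime_ideal {x. p dvd x}"
  by (auto simp: is_prime_ideal_def is_ideal_iff prime_elem_dvd_mult_iff dest: prime_elem_not_unit)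

lemma prime_height_leI:
  assumes "\<And>h C. (\<forall>i\<le>h. is_prime_ideal (C i)) \<Longrightarrow> (\<forall>i<h. C i \<subset> C (Suc i)) \<Longrightarrow> C h = P \<Longrightarrow> h \<le> m"
  shows "prime_height P \<le> enat m"
  unfolding prime_height_def by (rule SUP_least) (use assms in auto)

lemma exact_power_factor:
  fixes y :: "('v::finite, 'k::field) mpoly"
  assumes "prime_elem p" "y \<noteq> 0"
  obtains k u where "y = p ^ k * u" "\<not> p dvd u"
proof -
  have p: "p \<noteq> 0" "tdeg p \<noteq> 0" using assms(1) by (auto simp: prime_elem_def unit_iff_tdeg)
  have "\<exists>k u. y = p ^ k * u \<and> \<not> p dvd u" using assms(2)
  proof (induct "tdeg y" arbitrary: y rule: less_induct)
    case less
    show ?case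
    proof (cases "p dvd y")
      case True
      then obtain z where z: "y = p * z" by (elim dvdE)
      then have "z \<noteq> 0" using less by auto
      then have "tdeg z < tdeg y" using z p by (simp add: tdeg_mult)
      then have "\<exists>k u. z = p ^ k * u \<and> \<not> p dvd u" using \<open>z \<noteq> 0\<close> by (rule less.hyps)
      then obtain k u where "z = p ^ k * u" "\<not> p dvd u" by (elim exE conjE)
      then have "y = p ^ Suc k * u" unfolding z by (simp only: power_Suc mult.assoc)
      then show ?thesis using \<open>\<not> p dvd u\<close> by blast
    next
      case False
      then have "y = p ^ 0 * y \<and> \<not> p dvd y" by simp
      then show ?thesis by blast
    qed
  qed
  then show ?thesis using that by blast
qed

text \<open>A nonzero \<open>y\<close> in a prime strictly inside the principal one is
  \<open>p ^ k * u\<close> with \<open>u\<close> outside, so the smaller prime would contain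
  \<open>p\<close> and be equal. Factorization takes the place of Krull's theorem.\<close>

lemma prime_height_principal:
  fixes p :: "('v::finite, 'k::field) mpoly"
  assumes "prime_elem p" shows "prime_height {x. p dvd x} \<le> 1"
proof -
  have "prime_height {x. p dvd x} \<le> enat 1"
  proof (rule prime_height_leI, rule ccontr)
    fix h C assume C: "\<forall>i\<le>h. is_prime_ideal (C i)" "\<forall>i<h. C i \<subset> C (Suc i)" "C h = {x. p dvd x}"
      and "\<not> h \<le> 1"
    then obtain g where h: "h = Suc (Suc g)" using less_imp_Suc_add[of 1 h] by auto
    have s: "C g \<subset> C (Suc g)" "C (Suc g) \<subset> {x. p dvd x}" using C h by auto
    have P: "is_prime_ideal (C g)" "is_prime_ideal (C (Suc g))" using C(1) h by auto
    obtain y where y: "y \<in> C (Suc g)" "y \<notin> C g" using s by auto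
    have "y \<noteq> 0" using y P by (auto simp: is_prime_ideal_def is_ideal_iff)
    then obtain k u where ku: "y = p ^ k * u" "\<not> p dvd u" using exact_power_factor[OF assms] by blast
    have "p \<in> C (Suc g) \<or> u \<in> C (Suc g)" using prime_ideal_power[OF P(2)] y ku by blast
    then show False
    proof
      assume "p \<in> C (Suc g)"
      then have "{x. p dvd x} \<subseteq> C (Suc g)"
        using P(2) by (auto simp: is_prime_ideal_def is_ideal_iff mult.commute elim!: dvdE)
      then show False using s by blast
    qed (use s ku in blast)
  qed
  then show ?thesis by (simp add: one_enat_def)
qed

lemma coprime_set_of_height:
  fixes I :: "('v::finite, 'k::field) mpoly set"
  assumes "2 \<le> height I" shows "coprime_set I"
proof (rule ccontr)
  assume "\<not> coprime_set I"
  then obtain p where p: "prime_elem p" "I \<subseteq> {x. p dvd x}" by (auto simp: coprime_set_def)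
  have "height I \<le> prime_height {x. p dvd x}"
    unfolding height_def by (rule INF_lower) (use p prime_ideal_principal in auto)
  also have "\<dots> \<le> 1" by (rule prime_height_principal[OF p(1)])
  finally have "(2::enat) \<le> 1" using assms by (rule order_trans[rotated])
  then show False by (simp add: numeral_eq_enat one_enat_def)
qed

lemma prime_ideal_prime_factor:
  fixes P :: "('v::finite, 'k::field) mpoly set"
  assumes "is_prime_ideal P" "f \<in> P" "f \<noteq> 0"
  obtains p where "prime_elem p" "p \<in> P"
proof -
  have "f \<in> P \<longrightarrow> (\<exists>p. prime_elem p \<and> p \<in> P)" using assms(3)
  proof (induct rule: prime_induct)
    case (unit u)
    then obtain w where "1 = u * w" by (elim dvdE)
    moreover have "w * u \<in> P" if "u \<in> P" using assms(1) that by (simp add: is_prime_ideal_def is_ideal_iff)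
    ultimately have "u \<in> P \<Longrightarrow> 1 \<in> P" by (simp add: mult.commute)
    then show ?case using assms(1) by (auto simp: is_prime_ideal_def)
  next
    case (mult p g)
    then show ?case using assms(1) by (auto simp: is_prime_ideal_def)
  qed
  then show ?thesis using assms that by blast
qed

text \<open>The chain consists of zero, the ideal of a prime element of \<open>P\<close>, and
  \<open>P\<close>; coprimality makes the last step strict.\<close>

lemma prime_height_ge_2:
  fixes P :: "('v::finite, 'k::field) mpoly set"
  assumes "is_prime_ideal P" "f \<in> P" "f \<noteq> 0" "coprime_set P"
  shows "2 \<le> prime_height P"
proof -
  obtain p where p: "prime_elem p" "p \<in> P" using prime_ideal_prime_factor assms by blast
  define C where "C i = (if i = 0 then {0} else if i = 1 then {x. p dvd x} else P)" for i :: nat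
  have sub: "{x. p dvd x} \<subseteq> P"
    using assms(1) p(2) by (auto simp: is_prime_ideal_def is_ideal_iff mult.commute elim!: dvdE)
  obtain x where "x \<in> P" "\<not> p dvd x" using assms(4) p by (auto simp: coprime_set_def)
  then have "{x. p dvd x} \<subset> P" using sub by auto
  moreover have "{0} \<subset> {x. p dvd x}" using p(1) by (auto simp: prime_elem_def)
  ultimately have "\<forall>i<2. C i \<subset> C (Suc i)" by (auto simp: C_def less_2_cases_iff)
  moreover have "\<forall>i\<le>2. is_prime_ideal (C i)"
    using assms(1) p(1) prime_ideal_zero prime_ideal_principal by (auto simp: C_def)
  moreover have "C 2 = P" by (simp add: C_def)
  ultimately have "enat 2 \<le> prime_height P"
    unfolding prime_height_def by (intro SUP_upper) blast
  then show ?thesis by (simp add: numeral_eq_enat)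
qed

section \<open>An upper bound for the height of a prime\<close>

text \<open>
  \<open>R/P\<close> grows at least like a polynomial of degree \<open>m\<close>. Going down one step in a chain of
  primes increases the order of growth by one, and it cannot exceed the number of variables.
\<close>

definition indep_mod :: "('v::finite, 'k::field) mpoly set \<Rightarrow> 'i set \<Rightarrow> ('i \<Rightarrow> ('v, 'k) mpoly) \<Rightarrow> bool" where
  "indep_mod P I e \<longleftrightarrow> (\<forall>c. (\<Sum>i\<in>I. cst (c i) * e i) \<in> P \<longrightarrow> (\<forall>i\<in>I. c i = 0))"

text \<open>The index type is fixed because a definition cannot quantify over types. The monomial
  part indexes the family of \<open>growth_of_subring\<close>; the list records the powers adjoined
  by repeated use of \<open>growth_step\<close>.\<close>

definition growth :: "('v::finite, 'k::field) mpoly set \<Rightarrow> nat \<Rightarrow> bool" where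
  "growth P m \<longleftrightarrow> (\<exists>D. \<forall>N. \<exists>(I :: (('v \<Rightarrow>\<^sub>0 nat) \<times> nat list) set) e.
     finite I \<and> (N + 1) ^ m \<le> card I \<and> (\<forall>i\<in>I. tdeg (e i) \<le> D * N) \<and> indep_mod P I e)"

lemma tdeg_mult_le: "tdeg (p * q) \<le> tdeg p + tdeg q"
  by (simp add: gr.hom_mult degree_mult_le)

lemma tdeg_power_le: "tdeg (p ^ n) \<le> n * tdeg p"
proof (induct n)
  case (Suc n)
  have "tdeg (p ^ Suc n) \<le> tdeg p + tdeg (p ^ n)" using tdeg_mult_le[of p "p ^ n"] by simp
  then show ?case using Suc by simp
qed simp

lemma tdeg_prod_le: "finite A \<Longrightarrow> tdeg (\<Prod>i\<in>A. f i) \<le> (\<Sum>i\<in>A. tdeg (f i))"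
proof (induct rule: finite_induct)
  case (insert i A)
  have "tdeg (f i * prod f A) \<le> tdeg (f i) + tdeg (prod f A)" by (rule tdeg_mult_le)
  then show ?case using insert by simp
qed simp

text \<open>Modulo \<open>P1\<close> only \<open>w 0\<close> survives, so it vanishes; then
  \<open>y\<close>, lying outside the prime \<open>P0\<close>, is cancelled and the sum becomes
  shorter.\<close>

lemma power_combination_in_prime:
  fixes w :: "nat \<Rightarrow> 'a::comm_ring_1"
  assumes P0: "is_prime_ideal P0" and P1: "is_ideal P1" "P0 \<subseteq> P1" and y: "y \<in> P1" "y \<notin> P0"
    and "(\<Sum>i\<le>N. y ^ i * w i) \<in> P0" "\<And>i. i \<le> N \<Longrightarrow> w i \<in> P1 \<Longrightarrow> w i = 0"
  shows "\<forall>i\<le>N. w i = 0"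
  using assms(6,7)
proof (induct N arbitrary: w)
  case 0
  then show ?case using P1 by auto
next
  case (Suc N)
  let ?S = "\<Sum>i\<le>N. y ^ i * w (Suc i)"
  have e: "(\<Sum>i\<le>Suc N. y ^ i * w i) = w 0 + y * ?S"
    unfolding sum.atMost_Suc_shift sum_distrib_left power_Suc mult.assoc by simp
  have "w 0 + y * ?S \<in> P1" using Suc.prems(1) P1 unfolding e by blast
  moreover have "- (?S) * y \<in> P1" using P1(1) y(1) unfolding is_ideal_iff by blast
  ultimately have "(w 0 + y * ?S) + (- (?S) * y) \<in> P1" using P1(1) unfolding is_ideal_iff by blast
  then have "w 0 \<in> P1" by (simp add: algebra_simps)
  then have w0: "w 0 = 0" using Suc.prems(2) by simp
  then have "y * ?S \<in> P0" using Suc.prems(1) unfolding e by simp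
  then have "?S \<in> P0" using P0 y(2) by (auto simp: is_prime_ideal_def)
  then have "\<forall>i\<le>N. w (Suc i) = 0" by (rule Suc.hyps) (use Suc.prems(2) in auto)
  then show ?case using w0 by (metis Suc_le_mono not0_implies_Suc)
qed

text \<open>For \<open>y\<close> in \<open>P1\<close> outside \<open>P0\<close>, the products of
  \<open>y ^ i\<close>, \<open>i \<le> N\<close>, with a family independent modulo \<open>P1\<close>
  are independent modulo \<open>P0\<close>. The family grows by the factor \<open>N + 1\<close>, its
  degrees only by a multiple of \<open>N\<close>.\<close>

lemma growth_step:
  fixes P0 P1 :: "('v::finite, 'k::field) mpoly set"
  assumes P0: "is_prime_ideal P0" and P1: "is_ideal P1" "P0 \<subset> P1" and g: "growth P1 m"
  shows "growth P0 (Suc m)"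
proof -
  obtain y where y: "y \<in> P1" "y \<notin> P0" using P1 by blast
  obtain D where D: "\<And>N. \<exists>(I :: (('v \<Rightarrow>\<^sub>0 nat) \<times> nat list) set) e.
     finite I \<and> (N + 1) ^ m \<le> card I \<and> (\<forall>i\<in>I. tdeg (e i) \<le> D * N) \<and> indep_mod P1 I e"
    using g unfolding growth_def by blast
  have "\<exists>(I :: (('v \<Rightarrow>\<^sub>0 nat) \<times> nat list) set) e.
     finite I \<and> (N + 1) ^ Suc m \<le> card I \<and> (\<forall>i\<in>I. tdeg (e i) \<le> (tdeg y + D) * N) \<and> indep_mod P0 I e" for N
  proof -
    obtain I :: "(('v \<Rightarrow>\<^sub>0 nat) \<times> nat list) set" and e where I: "finite I" "(N + 1) ^ m \<le> card I"
        "\<forall>i\<in>I. tdeg (e i) \<le> D * N" "indep_mod P1 I e" using D[of N] by blast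
    define f :: "nat \<times> ('v \<Rightarrow>\<^sub>0 nat) \<times> nat list \<Rightarrow> ('v \<Rightarrow>\<^sub>0 nat) \<times> nat list"
      where "f = (\<lambda>(i, k, l). (k, i # l))"
    define e' where "e' = (\<lambda>(k, l). y ^ hd l * e (k, tl l))"
    have inj: "inj_on f A" for A by (auto simp: f_def inj_on_def)
    have e'f: "e' (f (i, j)) = y ^ i * e j" for i j by (cases j) (simp add: e'_def f_def)
    let ?I = "f ` ({..N} \<times> I)"
    have "card ?I = Suc N * card I" by (simp add: card_image[OF inj] card_cartesian_product)
    then have a1: "(N + 1) ^ Suc m \<le> card ?I" using I(2) mult_le_mono2[of "(N + 1) ^ m" "card I" "Suc N"] by simp
    have a2: "\<forall>i\<in>?I. tdeg (e' i) \<le> (tdeg y + D) * N"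
    proof
      fix k assume "k \<in> ?I"
      then obtain i j where ij: "k = f (i, j)" "i \<le> N" "j \<in> I" by auto
      have "tdeg (e' k) \<le> tdeg (y ^ i) + tdeg (e j)" by (simp add: ij(1) e'f tdeg_mult_le)
      also have "\<dots> \<le> i * tdeg y + D * N" using tdeg_power_le[of y i] I(3) ij(3) by (simp add: add_mono)
      also have "\<dots> \<le> (tdeg y + D) * N" using ij(2) by (simp add: algebra_simps)
      finally show "tdeg (e' k) \<le> (tdeg y + D) * N" .
    qed
    have a3: "indep_mod P0 ?I e'" unfolding indep_mod_def
    proof (intro allI impI)
      fix c assume c: "(\<Sum>i\<in>?I. cst (c i) * e' i) \<in> P0"
      define w where "w i = (\<Sum>j\<in>I. cst (c (f (i, j))) * e j)" for i
      have "(\<Sum>i\<in>?I. cst (c i) * e' i) = (\<Sum>(i, j)\<in>{..N} \<times> I. cst (c (f (i, j))) * (y ^ i * e j))"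
        unfolding sum.reindex[OF inj] by (rule sum.cong) (auto simp: e'f)
      also have "\<dots> = (\<Sum>i\<le>N. y ^ i * w i)"
        unfolding sum.cartesian_product[symmetric] w_def sum_distrib_left
        by (intro sum.cong refl) (rule mult.left_commute)
      finally have wP: "(\<Sum>i\<le>N. y ^ i * w i) \<in> P0" using c by simp
      have cz: "\<forall>j\<in>I. c (f (i, j)) = 0" if "w i \<in> P1" for i
        using I(4)[unfolded indep_mod_def, rule_format, of "\<lambda>j. c (f (i, j))"] that[unfolded w_def] by simp
      have "w i = 0" if "w i \<in> P1" for i
        unfolding w_def by (rule sum.neutral) (use cz[OF that] in auto)
      then have "\<forall>i\<le>N. w i = 0"
        by (intro power_combination_in_prime[OF P0 P1(1) psubset_imp_subset[OF P1(2)] y wP])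
      moreover have "0 \<in> P1" using P1(1) unfolding is_ideal_iff by blast
      ultimately have "\<forall>i\<le>N. \<forall>j\<in>I. c (f (i, j)) = 0" using cz by fastforce
      then show "\<forall>i\<in>?I. c i = 0" by auto
    qed
    have a4: "finite ?I" using I(1) by simp
    show ?thesis by (intro exI[of _ ?I] exI[of _ e'] conjI a1 a2 a3 a4)
  qed
  then show ?thesis unfolding growth_def by (intro exI[of _ "tdeg y + D"] allI)
qed

interpretation mp: vector_space "scale :: 'k::field \<Rightarrow> ('v, 'k) mpoly \<Rightarrow> ('v, 'k) mpoly"
proof
  fix a b :: 'k and x y :: "('v, 'k) mpoly"
  show "scale a (x + y) = scale a x + scale a y" unfolding scale_def distrib_left ..
  show "scale (a + b) x = scale a x + scale b x" unfolding scale_def single_add distrib_right ..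
  show "scale a (scale b x) = scale (a * b) x"
    unfolding scale_def by (simp add: mult_single flip: mult.assoc)
  show "scale 1 x = x" unfolding scale_def by simp
qed

lemma card_monomials_le: "finite {m :: 'v::finite \<Rightarrow>\<^sub>0 nat. mon_degree m \<le> E}"
  "card {m :: 'v::finite \<Rightarrow>\<^sub>0 nat. mon_degree m \<le> E} \<le> (E + 1) ^ CARD('v)"
proof -
  let ?M = "{m :: 'v::finite \<Rightarrow>\<^sub>0 nat. mon_degree m \<le> E}"
  have inj: "inj_on coef ?M" by (auto simp: inj_on_def)
  have "coef m v \<le> mon_degree m" for m :: "'v \<Rightarrow>\<^sub>0 nat" and v
    unfolding mon_degree_def by (rule member_le_sum) auto
  then have sub: "coef ` ?M \<subseteq> PiE UNIV (\<lambda>_. {..E})"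
    by (auto simp: PiE_UNIV_domain) (meson le_trans)
  have fin: "finite (PiE (UNIV :: 'v set) (\<lambda>_. {..E}))" by (rule finite_PiE) auto
  show "finite ?M" using finite_imageD[OF finite_subset[OF sub fin] inj] .
  have "card ?M \<le> card (PiE (UNIV :: 'v set) (\<lambda>_. {..E}))"
    using card_inj_on_le[OF inj sub fin] .
  then show "card ?M \<le> (E + 1) ^ CARD('v)" by (simp add: card_PiE)
qed

lemma mon_degree_le_tdeg: "m \<in> mkeys p \<Longrightarrow> mon_degree m \<le> tdeg p"
proof (rule le_degree)
  assume "m \<in> mkeys p"
  then have "coef (coeff (gr p) (mon_degree m)) m \<noteq> 0" by (simp add: lookup_coeff_gr in_keys_iff)
  then show "coeff (gr p) (mon_degree m) \<noteq> 0" by auto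
qed

lemma growth_le:
  fixes P :: "('v::finite, 'k::field) mpoly set"
  assumes "growth P m" "0 \<in> P" shows "m \<le> CARD('v)"
proof (rule ccontr)
  assume "\<not> m \<le> CARD('v)"
  then have m: "Suc CARD('v) \<le> m" by simp
  let ?n = "CARD('v)"
  obtain D where D: "\<And>N. \<exists>(I :: (('v \<Rightarrow>\<^sub>0 nat) \<times> nat list) set) e.
     finite I \<and> (N + 1) ^ m \<le> card I \<and> (\<forall>i\<in>I. tdeg (e i) \<le> D * N) \<and> indep_mod P I e"
    using assms(1) unfolding growth_def by blast
  \<comment> \<open>There are at most \<open>((D + 1) * (N + 1)) ^ ?n\<close> monomials of degree at
    most \<open>D * N\<close>. For this \<open>N\<close> the bound is
    \<open>N * (N + 1) ^ ?n\<close>, just below \<open>(N + 1) ^ Suc ?n\<close>.\<close>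
  define N where "N = (D + 1) ^ ?n"
  obtain I :: "(('v \<Rightarrow>\<^sub>0 nat) \<times> nat list) set" and e where I: "finite I" "(N + 1) ^ m \<le> card I"
    "\<forall>i\<in>I. tdeg (e i) \<le> D * N" "indep_mod P I e" using D[of N] by blast
  let ?M = "{m :: 'v \<Rightarrow>\<^sub>0 nat. mon_degree m \<le> D * N}"
  define B :: "('v, 'k) mpoly set" where "B = (\<lambda>m. Poly_Mapping.single m 1) ` ?M"
  have span: "p \<in> mp.span B" if "tdeg p \<le> D * N" for p
  proof -
    have "p = (\<Sum>m\<in>mkeys p. scale (coef p m) (Poly_Mapping.single m 1))"
      using mpoly_sum_single[of "mkeys p" p] by (simp add: scale_def mult_single)
    moreover have "(\<Sum>m\<in>mkeys p. scale (coef p m) (Poly_Mapping.single m 1)) \<in> mp.span B"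
      by (intro mp.span_sum mp.span_scale mp.span_base)
        (use that mon_degree_le_tdeg[of _ p] in \<open>auto simp: B_def intro: order_trans\<close>)
    ultimately show ?thesis by simp
  qed
  have z: "\<forall>i\<in>I. c i = 0" if "(\<Sum>i\<in>I. scale (c i) (e i)) = 0" for c
    using I(4) that assms(2) by (simp add: indep_mod_def scale_cst)
  have inj: "inj_on e I"
  proof (rule inj_onI, rule ccontr)
    fix i j assume ij: "i \<in> I" "j \<in> I" "e i = e j" "i \<noteq> j"
    let ?c = "\<lambda>k. if k = i then 1 else if k = j then - 1 else (0 :: 'k)"
    have "(\<Sum>k\<in>I. scale (?c k) (e k)) = (\<Sum>k\<in>{i, j}. scale (?c k) (e k))"
      by (rule sum.mono_neutral_right) (use I(1) ij in auto)
    also have "\<dots> = 0" using ij by simp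
    finally show False using bspec[OF z[of ?c] ij(1)] by simp
  qed
  have ind: "mp.independent (e ` I)"
  proof (rule mp.independent_if_scalars_zero)
    fix f x assume fx: "(\<Sum>x\<in>e ` I. scale (f x) x) = 0" "x \<in> e ` I"
    have "(\<Sum>i\<in>I. scale (f (e i)) (e i)) = 0" using fx(1) by (simp add: sum.reindex[OF inj])
    from z[OF this] fx(2) show "f x = 0" by blast
  qed (use I(1) in simp)
  have "finite B" by (simp add: B_def card_monomials_le)
  then have "card (e ` I) \<le> card B"
    using mp.independent_span_bound[OF _ ind] span I(3) by auto
  also have "\<dots> \<le> card ?M" unfolding B_def by (rule card_image_le) (rule card_monomials_le)
  also have "\<dots> \<le> (D * N + 1) ^ ?n" by (rule card_monomials_le)
  also have "\<dots> \<le> ((D + 1) * (N + 1)) ^ ?n" by (rule power_mono) (simp_all add: algebra_simps)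
  also have "\<dots> = N * (N + 1) ^ ?n" by (simp only: N_def power_mult_distrib)
  also have "\<dots> < (N + 1) ^ Suc ?n" by simp
  also have "\<dots> \<le> (N + 1) ^ m" by (rule power_increasing[OF m]) simp
  finally show False using I(2) by (simp add: card_image[OF inj])
qed

lemma prime_height_le_of_growth:
  fixes P :: "('v::finite, 'k::field) mpoly set"
  assumes "growth P m" shows "prime_height P \<le> enat (CARD('v) - m)"
proof (rule prime_height_leI)
  fix h and C :: "nat \<Rightarrow> ('v, 'k) mpoly set"
  assume C: "\<forall>i\<le>h. is_prime_ideal (C i)" "\<forall>i<h. C i \<subset> C (Suc i)" "C h = P"
  have "growth (C (h - k)) (m + k)" if "k \<le> h" for k
    using that
  proof (induct k)
    case (Suc k)
    then have e: "Suc (h - Suc k) = h - k" by simp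
    have "growth (C (h - Suc k)) (Suc (m + k))"
    proof (rule growth_step)
      show "C (h - Suc k) \<subset> C (h - k)" using C(2)[rule_format, of "h - Suc k"] Suc.prems e by simp
      show "is_ideal (C (h - k))" using C(1) by (simp add: is_prime_ideal_def)
    qed (use C Suc in auto)
    then show ?case by simp
  qed (use assms C in simp)
  from this[of h] have "growth (C 0) (m + h)" by simp
  moreover have "0 \<in> C 0" using C(1) by (simp add: is_prime_ideal_def is_ideal_iff)
  ultimately have "m + h \<le> CARD('v)" by (rule growth_le)
  then show "h \<le> CARD('v) - m" by simp
qed

text \<open>The family consists of the images of the monomials in the variables of \<open>A\<close>
  with exponents at most \<open>N\<close>. It is independent modulo \<open>P\<close> because
  \<open>\<kappa>\<close> sends no nonzero element of the subring into \<open>P\<close>. For colon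
  ideals \<open>\<kappa>\<close> is the inverse of Nagata's substitution.\<close>

lemma growth_of_subring:
  fixes P :: "('v::finite, 'k::field) mpoly set"
  assumes \<kappa>: "comm_ring_hom \<kappa>" "\<And>c. \<kappa> (cst c) = cst c"
    and A: "\<And>s :: ('v, 'k) mpoly. s \<in> svars A \<Longrightarrow> s \<noteq> 0 \<Longrightarrow> \<kappa> s \<notin> P"
  shows "growth P (card A)"
proof -
  interpret comm_ring_hom \<kappa> by fact
  define D where "D = (\<Sum>v\<in>UNIV. tdeg (\<kappa> (X v)))"
  have "\<exists>(I :: (('v \<Rightarrow>\<^sub>0 nat) \<times> nat list) set) e.
     finite I \<and> (N + 1) ^ card A \<le> card I \<and> (\<forall>i\<in>I. tdeg (e i) \<le> D * N) \<and> indep_mod P I e" for N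
  proof -
    define mo :: "('v \<Rightarrow> nat) \<Rightarrow> 'v \<Rightarrow>\<^sub>0 nat" where "mo f = (\<Sum>v\<in>A. Poly_Mapping.single v (f v))" for f
    have co: "coef (mo f) v = (if v \<in> A then f v else 0)" for f v
    proof -
      have "coef (mo f) v = (\<Sum>w\<in>A. if w = v then f v else 0)"
        unfolding mo_def lookup_sum by (rule sum.cong) (auto simp: lookup_single when_def)
      then show ?thesis by simp
    qed
    define J where "J = mo ` PiE A (\<lambda>_. {..N})"
    have inj: "inj_on mo (PiE A (\<lambda>_. {..N}))"
    proof (rule inj_onI)
      fix f g assume fg: "f \<in> PiE A (\<lambda>_. {..N})" "g \<in> PiE A (\<lambda>_. {..N})" "mo f = mo g"
      have "f v = g v" if "v \<in> A" for v using co[of f v] co[of g v] fg(3) that by simp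
      then show "f = g" using fg by (intro PiE_ext)
    qed
    have "finite (PiE A (\<lambda>_. {..N}))" by (rule finite_PiE) auto
    then have J: "finite J" "card J = (N + 1) ^ card A"
      by (simp_all add: J_def card_image[OF inj] card_PiE)
    have Jc: "coef m v \<le> N" "v \<notin> A \<Longrightarrow> coef m v = 0" if "m \<in> J" for m v
      using that by (auto simp: J_def co PiE_def Pi_def)
    let ?I = "(\<lambda>m. (m, [] :: nat list)) ` J"
    have injI: "inj_on (\<lambda>m. (m, [] :: nat list)) J" by (auto simp: inj_on_def)
    define e where "e = (\<lambda>(m, l :: nat list). \<kappa> (mon_eval X m))"
    have "tdeg (e i) \<le> D * N" if "i \<in> ?I" for i
    proof -
      obtain m where m: "m \<in> J" "i = (m, [])" using \<open>i \<in> ?I\<close> by auto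
      have "tdeg (e i) = tdeg (\<Prod>v\<in>UNIV. \<kappa> (X v) ^ coef m v)"
        by (simp add: m e_def mon_eval_def hom_prod hom_power)
      also have "\<dots> \<le> (\<Sum>v\<in>UNIV. tdeg (\<kappa> (X v) ^ coef m v))" by (rule tdeg_prod_le) simp
      also have "\<dots> \<le> (\<Sum>v\<in>UNIV. N * tdeg (\<kappa> (X v)))"
      proof (rule sum_mono)
        fix v
        have "tdeg (\<kappa> (X v) ^ coef m v) \<le> coef m v * tdeg (\<kappa> (X v))" by (rule tdeg_power_le)
        also have "\<dots> \<le> N * tdeg (\<kappa> (X v))" using Jc(1)[OF m(1)] by (rule mult_le_mono1)
        finally show "tdeg (\<kappa> (X v) ^ coef m v) \<le> N * tdeg (\<kappa> (X v))" .
      qed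
      also have "\<dots> = D * N" by (simp add: D_def sum_distrib_left mult.commute)
      finally show ?thesis .
    qed
    then have a1: "\<forall>i\<in>?I. tdeg (e i) \<le> D * N" by blast
    have a2: "indep_mod P ?I e" unfolding indep_mod_def
    proof (intro allI impI)
      fix c :: "('v \<Rightarrow>\<^sub>0 nat) \<times> nat list \<Rightarrow> 'k"
      assume c: "(\<Sum>i\<in>?I. cst (c i) * e i) \<in> P"
      define s :: "('v, 'k) mpoly" where "s = (\<Sum>m\<in>J. Poly_Mapping.single m (c (m, [])))"
      have "s = (\<Sum>m\<in>J. cst (c (m, [])) * mon_eval X m)"
        by (simp add: s_def mon_eval_X cst_def mult_single)
      then have "\<kappa> s = (\<Sum>i\<in>?I. cst (c i) * e i)"
        by (simp add: sum.reindex[OF injI] hom_sum hom_mult \<kappa>(2) e_def)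
      then have "\<kappa> s \<in> P" using c by simp
      moreover have "s \<in> svars A" unfolding s_def
        by (rule svars_sum) (use Jc(2) in \<open>auto simp: svars_def\<close>)
      ultimately have "s = 0" using A by blast
      have "c (m, []) = 0" if "m \<in> J" for m
      proof -
        have "coef s m = (\<Sum>m'\<in>J. if m' = m then c (m, []) else 0)"
          unfolding s_def lookup_sum by (rule sum.cong) (auto simp: lookup_single when_def)
        then show ?thesis using that J \<open>s = 0\<close> by simp
      qed
      then show "\<forall>i\<in>?I. c i = 0" by auto
    qed
    have a3: "finite ?I" "(N + 1) ^ card A \<le> card ?I" using J by (simp_all add: card_image[OF injI])
    show ?thesis by (intro exI[of _ ?I] exI[of _ e] conjI a1 a2 a3)
  qed
  then show ?thesis unfolding growth_def by (intro exI[of _ D] allI)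
qed

text \<open>Serves to find a prime above a colon ideal that still avoids the subring responsible for
  growth. As usual, an ideal maximal among those missing a multiplicative set is prime.\<close>

lemma prime_avoiding:
  fixes Q :: "'a::comm_ring_1 set"
  assumes Q: "is_ideal Q" and M: "1 \<in> M" "\<And>a b. a \<in> M \<Longrightarrow> b \<in> M \<Longrightarrow> a * b \<in> M" "Q \<inter> M = {}"
  obtains P where "is_prime_ideal P" "Q \<subseteq> P" "P \<inter> M = {}"
proof -
  define \<A> where "\<A> = {I. is_ideal I \<and> Q \<subseteq> I \<and> I \<inter> M = {}}"
  have "\<exists>P\<in>\<A>. \<forall>I\<in>\<A>. P \<subseteq> I \<longrightarrow> I = P"
  proof (rule subset_Zorn_nonempty)
    show "\<A> \<noteq> {}" using Q M(3) by (auto simp: \<A>_def)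
    fix \<C> assume \<C>: "\<C> \<noteq> {}" "subset.chain \<A> \<C>"
    have c: "is_ideal I \<and> Q \<subseteq> I \<and> I \<inter> M = {}" if "I \<in> \<C>" for I
      using \<C>(2) that unfolding \<A>_def subset.chain_def by blast
    have t: "I \<subseteq> J \<or> J \<subseteq> I" if "I \<in> \<C>" "J \<in> \<C>" for I J
    proof -
      have "I \<subset> J \<or> I = J \<or> J \<subset> I \<or> J = I" using \<C>(2) that by (simp add: subset.chain_def)
      then show ?thesis by blast
    qed
    have "is_ideal (\<Union>\<C>)" unfolding is_ideal_iff
    proof (intro conjI ballI allI)
      show "0 \<in> \<Union>\<C>" using \<C>(1) c by (auto simp: is_ideal_iff)
      fix x assume x: "x \<in> \<Union>\<C>"
      then obtain I where I: "I \<in> \<C>" "x \<in> I" by blast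
      then have "r * x \<in> I" for r using c[of I] unfolding is_ideal_iff by blast
      then show "r * x \<in> \<Union>\<C>" for r using I(1) by (rule UnionI[rotated])
      fix y assume "y \<in> \<Union>\<C>"
      then obtain J where J: "J \<in> \<C>" "y \<in> J" by blast
      obtain K where K: "K \<in> \<C>" "x \<in> K" "y \<in> K" using t[OF I(1) J(1)] I J by blast
      then have "x + y \<in> K" using c[of K] unfolding is_ideal_iff by blast
      then show "x + y \<in> \<Union>\<C>" using K(1) by (rule UnionI[rotated])
    qed
    moreover have "Q \<subseteq> \<Union>\<C>" "\<Union>\<C> \<inter> M = {}" using \<C>(1) c by blast+
    ultimately show "\<Union>\<C> \<in> \<A>" by (simp only: \<A>_def mem_Collect_eq simp_thms)
  qed
  then obtain P where PA: "P \<in> \<A>" and PM: "\<forall>I\<in>\<A>. P \<subseteq> I \<longrightarrow> I = P" by (elim bexE)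
  have P: "is_ideal P" "Q \<subseteq> P" "P \<inter> M = {}" using PA by (simp_all add: \<A>_def)
  have max: "I = P" if "is_ideal I" "P \<subseteq> I" "I \<inter> M = {}" for I
  proof -
    have "I \<in> \<A>" using that P(2) by (simp add: \<A>_def)
    then show ?thesis using PM that(2) by blast
  qed
  have *: "\<exists>p a. p \<in> P \<and> p + a * x \<in> M" if "x \<notin> P" for x
  proof -
    define I where "I = {p + a * x | p a. p \<in> P}"
    have pP: "\<And>p q. p \<in> P \<Longrightarrow> q \<in> P \<Longrightarrow> p + q \<in> P" "\<And>p r. p \<in> P \<Longrightarrow> r * p \<in> P" "0 \<in> P"
      using P(1) by (auto simp: is_ideal_iff)
    have mI: "p + a * x \<in> I" if "p \<in> P" for p a using that unfolding I_def by blast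
    have "is_ideal I" unfolding is_ideal_iff
    proof (intro conjI ballI allI)
      show "0 \<in> I" using mI[OF pP(3), of 0] by simp
      fix u assume "u \<in> I"
      then obtain p a where u: "u = p + a * x" "p \<in> P" by (auto simp: I_def)
      have "r * u = r * p + (r * a) * x" for r unfolding u distrib_left mult.assoc ..
      then show "r * u \<in> I" for r using mI[OF pP(2)[OF u(2)]] by simp
      fix w assume "w \<in> I"
      then obtain q b where w: "w = q + b * x" "q \<in> P" by (auto simp: I_def)
      have "u + w = (p + q) + (a + b) * x" unfolding u w distrib_right by (simp only: ac_simps)
      then show "u + w \<in> I" using mI[OF pP(1)[OF u(2) w(2)]] by simp
    qed
    moreover have "P \<subseteq> I" using mI[of _ 0] by auto
    moreover have "x \<in> I" using mI[OF pP(3), of 1] by simp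
    ultimately have "I \<inter> M \<noteq> {}" using max[of I] that by blast
    then show ?thesis by (auto simp: I_def)
  qed
  have "is_prime_ideal P" unfolding is_prime_ideal_def
  proof (intro conjI allI impI P(1))
    show "1 \<notin> P" using M(1) P(3) by blast
    fix x y assume xy: "x * y \<in> P"
    show "x \<in> P \<or> y \<in> P"
    proof (rule ccontr)
      assume "\<not> (x \<in> P \<or> y \<in> P)"
      then obtain p a q b where pq: "p \<in> P" "p + a * x \<in> M" "q \<in> P" "q + b * y \<in> M"
        using *[of x] *[of y] by blast
      then have "(p + a * x) * (q + b * y) \<in> M" by (intro M(2))
      moreover have "(p + a * x) * (q + b * y) = (q + b * y) * p + (a * x) * q + (a * b) * (x * y)"
        by (simp add: algebra_simps)
      moreover have "\<dots> \<in> P" using P(1) pq xy unfolding is_ideal_iff by simp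
      ultimately show False using P(3) by auto
    qed
  qed
  then show ?thesis using that P by blast
qed

section \<open>Colon ideals of a coprime pair\<close>

text \<open>Nagata's substitution from Noether normalization. The parameter \<open>t\<close> is
  there so that opposite values give inverse substitutions.\<close>

definition nagata :: "'v \<Rightarrow> ('v::finite \<Rightarrow> nat) \<Rightarrow> 'k \<Rightarrow> ('v, 'k::field) mpoly \<Rightarrow> ('v, 'k) mpoly" where
  "nagata b N t = msubst cst (\<lambda>v. if v = b then X b else X v + cst t * X b ^ N v)"

lemma comm_ring_hom_nagata: "comm_ring_hom (nagata b N t)"
  unfolding nagata_def by (rule comm_ring_hom_msubst[OF comm_ring_hom_cst])

lemma nagata_cst: "nagata b N t (cst c) = cst c"
  by (simp add: nagata_def msubst_cst[OF comm_ring_hom_cst])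

lemma nagata_X: "nagata b N t (X v) = (if v = b then X b else X v + cst t * X b ^ N v)"
  by (simp add: nagata_def msubst_X[OF comm_ring_hom_cst])

lemma nagata_nagata:
  fixes p :: "('v::finite, 'k::field) mpoly"
  assumes "t + t' = 0" shows "nagata b N t (nagata b N t' p) = p"
proof -
  interpret comm_ring_hom "nagata b N t" by (rule comm_ring_hom_nagata)
  have "comm_ring_hom (\<lambda>p. nagata b N t (nagata b N t' p))"
    by (rule comm_ring_hom_comp[OF comm_ring_hom_nagata comm_ring_hom_nagata])
  moreover have "comm_ring_hom (\<lambda>p :: ('v, 'k) mpoly. p)" by unfold_locales simp_all
  ultimately show ?thesis
  proof (rule hom_eqI)
    fix v
    have "cst t * X b ^ N v + cst t' * X b ^ N v = (0 :: ('v, 'k) mpoly)"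
      by (simp add: assms flip: distrib_right cst.hom_add)
    then show "nagata b N t (nagata b N t' (X v)) = X v"
      by (simp add: nagata_X nagata_cst hom_add hom_mult hom_power add.assoc)
  qed (simp add: nagata_cst)
qed

definition monic_of :: "nat \<Rightarrow> 'a::comm_ring_1 poly \<Rightarrow> bool" where
  "monic_of d P \<longleftrightarrow> coeff P d = 1 \<and> degree P = d"

lemma monic_of_mult:
  fixes P Q :: "('v::finite, 'k::field) mpoly poly"
  assumes "monic_of d P" "monic_of e Q" shows "monic_of (d + e) (P * Q)"
proof -
  have "P \<noteq> 0" "Q \<noteq> 0" using assms by (auto simp: monic_of_def)
  then have "degree (P * Q) = degree P + degree Q" by (rule degree_mult_mpoly)
  then show ?thesis using assms coeff_mult_degree_sum[of P Q] by (simp add: monic_of_def)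
qed

lemma monic_of_1: "monic_of 0 1"
  by (simp add: monic_of_def)

lemma monic_of_power:
  fixes P :: "('v::finite, 'k::field) mpoly poly"
  assumes "monic_of d P" shows "monic_of (n * d) (P ^ n)"
  by (induct n) (auto intro: monic_of_mult assms monic_of_1)

lemma monic_of_prod:
  fixes P :: "'i \<Rightarrow> ('v::finite, 'k::field) mpoly poly"
  assumes "finite A" "\<And>i. i \<in> A \<Longrightarrow> monic_of (d i) (P i)"
  shows "monic_of (sum d A) (\<Prod>i\<in>A. P i)"
  using assms by induct (auto intro: monic_of_mult monic_of_1)

text \<open>A monomial becomes monic in \<open>b\<close>, of degree equal to its weight. The weights
  of the monomials of \<open>f\<close> are distinct, so only the heaviest one reaches the top
  degree.\<close>

lemma ex_nagata_monic:
  fixes f :: "('v::finite, 'k::field) mpoly" and b :: 'v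
  assumes "f \<noteq> 0"
  obtains N c where "c \<noteq> 0" "lead_coeff (uni b (nagata b N 1 f)) = cst c"
proof -
  obtain N where N: "N b = 1" "\<And>v. N v \<ge> 1" "inj_on (weight N) (mkeys f)"
    using ex_weight[OF finite_keys] by blast
  define \<tau> :: "'v \<Rightarrow> ('v, 'k) mpoly poly" where "\<tau> v = uni b (nagata b N 1 (X v))" for v
  have Xe: "[:0, 1:] ^ n = monom (1 :: ('v, 'k) mpoly) n" for n
    by (induct n) (simp_all add: monom_Suc one_pCons monom_0)
  have \<tau>: "monic_of (N v) (\<tau> v)" for v
  proof (cases "v = b")
    case True
    then show ?thesis using N(1) by (simp add: \<tau>_def nagata_X uni_X monic_of_def)
  next
    case False
    then have e: "\<tau> v = [:X v:] + monom 1 (N v)"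
      by (simp add: \<tau>_def nagata_X uni_X uni.hom_add uni.hom_power Xe)
    have "degree [:X v :: ('v, 'k) mpoly:] < degree (monom (1 :: ('v, 'k) mpoly) (N v))"
      using N(2)[of v] by (simp add: degree_monom_eq)
    then have "degree (\<tau> v) = N v" unfolding e by (simp add: degree_add_eq_right degree_monom_eq)
    then show ?thesis using N(2)[of v] by (simp add: monic_of_def e coeff_pCons split: nat.split)
  qed
  have me: "monic_of (weight N m) (mon_eval \<tau> m)" for m
    unfolding mon_eval_def weight_def by (intro monic_of_prod monic_of_power \<tau>) simp
  have u: "uni b (nagata b N 1 f) = (\<Sum>m\<in>mkeys f. Polynomial.smult (cst (coef f m)) (mon_eval \<tau> m))"
    using hom_eq_msubst[OF comm_ring_hom_comp[OF comm_ring_hom_uni comm_ring_hom_nagata], of b b N 1 f]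
    by (simp add: msubst_def nagata_cst uni_cst \<tau>_def[abs_def])
  have "mkeys f \<noteq> {}" using assms by simp
  then have "Max (weight N ` mkeys f) \<in> weight N ` mkeys f" by (intro Max_in) auto
  then obtain m where m: "m \<in> mkeys f" "Max (weight N ` mkeys f) = weight N m" by blast
  have m_max: "weight N m' \<le> weight N m" if "m' \<in> mkeys f" for m'
    unfolding m(2)[symmetric] using that by (intro Max_ge) auto
  let ?W = "weight N m" and ?F = "uni b (nagata b N 1 f)"
  have "coeff ?F ?W = (\<Sum>m'\<in>mkeys f. if m' = m then cst (coef f m) else 0)"
    unfolding u coeff_sum
  proof (rule sum.cong)
    fix m' assume m': "m' \<in> mkeys f"
    show "coeff (Polynomial.smult (cst (coef f m')) (mon_eval \<tau> m')) ?W = (if m' = m then cst (coef f m) else 0)"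
    proof (cases "m' = m")
      case True
      then show ?thesis using me[of m] by (simp add: monic_of_def)
    next
      case False
      then have "weight N m' < ?W" using m(1) m_max[OF m'] m' N(3) by (metis inj_onD le_neq_implies_less)
      then show ?thesis using False me[of m'] by (simp add: coeff_eq_0 monic_of_def)
    qed
  qed simp
  then have c: "coeff ?F ?W = cst (coef f m)" using m by simp
  have c0: "coef f m \<noteq> 0" using m(1) by (simp add: in_keys_iff)
  have "degree ?F \<le> ?W" unfolding u
  proof (rule degree_sum_le)
    fix m' assume "m' \<in> mkeys f"
    then show "degree (Polynomial.smult (cst (coef f m')) (mon_eval \<tau> m')) \<le> ?W"
      using degree_smult_le[of "cst (coef f m')" "mon_eval \<tau> m'"] me[of m'] m_max[of m'] by (simp add: monic_of_def)
  qed simp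
  moreover have "?W \<le> degree ?F" by (rule le_degree) (simp add: c c0)
  ultimately have "degree ?F = ?W" by simp
  then show ?thesis using that[of "coef f m" N] c c0 by simp
qed

section \<open>Ideals generated by two elements, one of them monic in a variable\<close>

definition ideal_pair :: "'a::comm_ring_1 \<Rightarrow> 'a \<Rightarrow> 'a set" where
  "ideal_pair f g = {u * f + v * g | u v. True}"

lemma ideal_pairI: "x = u * f + v * g \<Longrightarrow> x \<in> ideal_pair f g"
  unfolding ideal_pair_def by blast

lemma ideal_pair_ideal: "is_ideal (ideal_pair f g)"
  unfolding is_ideal_iff
proof (intro conjI ballI allI)
  show "0 \<in> ideal_pair f g" by (rule ideal_pairI[of _ 0 _ 0]) simp
  fix x assume "x \<in> ideal_pair f g"
  then obtain u v where x: "x = u * f + v * g" by (auto simp: ideal_pair_def)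
  show "c * x \<in> ideal_pair f g" for c
    by (rule ideal_pairI[of _ "c * u" _ "c * v"]) (simp add: x algebra_simps)
  fix y assume "y \<in> ideal_pair f g"
  then obtain u' v' where y: "y = u' * f + v' * g" by (auto simp: ideal_pair_def)
  show "x + y \<in> ideal_pair f g"
    by (rule ideal_pairI[of _ "u + u'" _ "v + v'"]) (simp add: x y algebra_simps)
qed

lemma ideal_pair_mem: "f \<in> ideal_pair f g" "g \<in> ideal_pair f g"
  by (rule ideal_pairI[of _ 1 _ 0] ideal_pairI[of _ 0 _ 1], simp)+

lemma ideal_pair_closed:
  "x \<in> ideal_pair f g \<Longrightarrow> y \<in> ideal_pair f g \<Longrightarrow> x + y \<in> ideal_pair f g"
  "x \<in> ideal_pair f g \<Longrightarrow> c * x \<in> ideal_pair f g"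
  using ideal_pair_ideal[of f g] unfolding is_ideal_iff by blast+

context
  fixes f :: "('v::finite, 'k::field) mpoly" and b :: 'v and c :: 'k
  assumes c: "c \<noteq> 0" "lead_coeff (uni b f) = cst c"
begin

lemma monic_nonzero: "f \<noteq> 0"
  using c by auto

text \<open>The leading coefficient of \<open>f\<close> is a nonzero constant, so its powers can be
  removed from the pseudo-division.\<close>

lemma monic_division: "\<exists>q r. p = q * f + r \<and> (r = 0 \<or> deg_in b r < deg_in b f)"
proof -
  obtain k q r where kqr: "cst c ^ k * p = q * f + r" "r = 0 \<or> deg_in b r < deg_in b f"
    using pseudo_division[of p UNIV f b] monic_nonzero c(2) by auto
  let ?d = "cst (inverse (c ^ k)) :: ('v, 'k) mpoly"
  have d: "?d * cst c ^ k = 1" using c(1) by (simp flip: cst.hom_power cst.hom_mult)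
  then have "p = ?d * (cst c ^ k * p)" by (metis mult.assoc mult_1)
  then have "p = (?d * q) * f + ?d * r" unfolding kqr(1) by (simp only: distrib_left mult.assoc)
  moreover have "?d * r = 0 \<or> deg_in b (?d * r) < deg_in b f"
    using kqr(2) c(1) by (cases "r = 0") (auto simp: deg_in_mult uni_cst)
  ultimately show ?thesis by blast
qed

lemma monic_multiple_zero:
  assumes "r = f * a" "r = 0 \<or> deg_in b r < deg_in b f" shows "r = 0"
  using assms monic_nonzero by (cases "a = 0") (auto simp: deg_in_mult)

lemma deg_in_small_mult:
  assumes "s \<in> svars (- {b})" "r = 0 \<or> deg_in b r < n" shows "s * r = 0 \<or> deg_in b (s * r) < n"
  using assms by (cases "s = 0 \<or> r = 0") (auto simp: deg_in_mult svars_iff_deg_in)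

text \<open>
  \<open>R/(f)\<close> is free over the polynomials without the variable \<open>b\<close>, so an element of this subring
  that is coprime to an element \<open>\<rho>\<close> of \<open>(f, g)\<close> is not a zero divisor modulo \<open>(f, g)\<close>.
\<close>

lemma cancel_coprime_to_eliminant:
  assumes \<rho>: "\<rho> \<in> ideal_pair f g" "\<rho> \<in> svars (- {b})"
    and s: "s \<in> svars (- {b})" "s \<noteq> 0" "\<And>u. s dvd \<rho> * u \<Longrightarrow> s dvd u"
    and r: "s * r \<in> ideal_pair f g"
  shows "r \<in> ideal_pair f g"
proof -
  obtain \<alpha> \<beta> where \<rho>e: "\<rho> = \<alpha> * f + \<beta> * g" using \<rho>(1) by (auto simp: ideal_pair_def)
  obtain u v where sr: "s * r = u * f + v * g" using r by (auto simp: ideal_pair_def)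
  obtain q v0 where v: "v = q * f + v0" "v0 = 0 \<or> deg_in b v0 < deg_in b f" using monic_division by blast
  obtain z1 z0 where z: "\<beta> * r = z1 * f + z0" "z0 = 0 \<or> deg_in b z0 < deg_in b f" using monic_division by blast
  \<comment> \<open>Multiplication by \<open>\<beta>\<close> trades \<open>g\<close> for the
    eliminant \<open>\<rho>\<close> modulo \<open>f\<close>, and \<open>\<rho>\<close> does not
    raise degrees in \<open>b\<close>.\<close>
  have "\<beta> * (s * r) = \<beta> * u * f + v * (\<rho> - \<alpha> * f)" unfolding sr \<rho>e by (simp add: algebra_simps)
  then have "s * (z1 * f + z0) = \<beta> * u * f + (q * f + v0) * (\<rho> - \<alpha> * f)"
    using z(1) v(1) by (metis mult.left_commute)
  then have "s * z0 - \<rho> * v0 = f * (\<beta> * u + q * \<rho> - q * f * \<alpha> - v0 * \<alpha> - s * z1)"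
    by (simp add: algebra_simps)
  moreover have "s * z0 - \<rho> * v0 = 0 \<or> deg_in b (s * z0 - \<rho> * v0) < deg_in b f"
    using deg_in_add_less[OF deg_in_small_mult[OF s(1) z(2)] deg_in_small_mult[OF svars_uminus[OF \<rho>(2)] v(2)]] by simp
  \<comment> \<open>A multiple of \<open>f\<close> of smaller degree in \<open>b\<close> than
    \<open>f\<close> vanishes; here freeness modulo \<open>f\<close> is used.\<close>
  ultimately have "s * z0 - \<rho> * v0 = 0" by (rule monic_multiple_zero)
  then have "\<rho> * v0 = s * z0" by simp
  then have "s dvd v0" using s(3)[of v0] by simp
  then obtain v1 where v1: "v0 = s * v1" by (elim dvdE)
  \<comment> \<open>Since \<open>s\<close> divides \<open>v0\<close>, subtracting
    \<open>v1 * g\<close> leaves something whose product with \<open>s\<close> is a multiple of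
    \<open>f\<close>; the same degree argument then applies to its remainder.\<close>
  obtain y1 y0 where y: "r - v1 * g = y1 * f + y0" "y0 = 0 \<or> deg_in b y0 < deg_in b f" using monic_division by blast
  have "s * (r - v1 * g) = f * (u + q * g)" unfolding right_diff_distrib sr v(1) v1 by (simp add: algebra_simps)
  then have "s * y0 = f * (u + q * g - s * y1)" unfolding y(1) by (simp add: algebra_simps)
  then have "s * y0 = 0" using deg_in_small_mult[OF s(1) y(2)] by (rule monic_multiple_zero)
  then have "r = y1 * f + v1 * g" using y(1) s(2) by (simp add: mpoly_mult_eq_0_iff algebra_simps)
  then show ?thesis by (rule ideal_pairI)
qed

text \<open>An element \<open>h\<close> of least degree in \<open>b\<close> divides \<open>f\<close>
  and \<open>g\<close> up to powers of its leading coefficient. As \<open>f\<close> and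
  \<open>g\<close> are coprime, \<open>h\<close> divides a product of such powers, which is free of
  \<open>b\<close>. This takes the place of the resultant.\<close>

lemma ex_eliminant:
  assumes fg: "coprime_set {f, g}"
  obtains \<rho> where "\<rho> \<in> ideal_pair f g" "\<rho> \<in> svars (- {b})" "\<rho> \<noteq> 0"
proof -
  let ?I = "ideal_pair f g"
  define h where "h = arg_min (deg_in b) (\<lambda>h. h \<in> ?I \<and> h \<noteq> 0)"
  have h: "h \<in> ?I \<and> h \<noteq> 0" unfolding h_def
    by (rule arg_min_natI[of _ f]) (simp add: ideal_pair_mem monic_nonzero)
  have hmin: "deg_in b h \<le> deg_in b r" if "r \<in> ?I" "r \<noteq> 0" for r
    unfolding h_def by (rule arg_min_nat_le) (simp add: that)
  let ?l = "lead_coeff (uni b h)"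
  have l: "?l ^ k \<noteq> 0" "?l ^ k \<in> svars (- {b})" for k
    using h coeff_uni_svars[of h UNIV b] by (auto simp: mpoly_power_eq_0 Compl_eq_Diff_UNIV intro!: svars_power)
  have divI: "\<exists>k q. ?l ^ k * r = q * h" if r: "r \<in> ?I" for r
  proof -
    obtain k q r' where kq: "?l ^ k * r = q * h + r'" "r' = 0 \<or> deg_in b r' < deg_in b h"
      using pseudo_division[of r UNIV h b] h by auto
    have "r' = ?l ^ k * r + (- q) * h" using kq(1) by (simp add: algebra_simps)
    moreover have "?l ^ k * r + (- q) * h \<in> ?I" using r h by (intro ideal_pair_closed) auto
    ultimately have "r' \<in> ?I" by simp
    then have "r' = 0" using hmin[of r'] kq(2) by (metis not_less)
    then show ?thesis using kq by auto
  qed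
  obtain k q where kq: "?l ^ k * f = q * h" using divI[OF ideal_pair_mem(1)] by blast
  obtain k' q' where kq': "?l ^ k' * g = q' * h" using divI[OF ideal_pair_mem(2)] by blast
  have "f * (?l ^ k * q') = (?l ^ k * f) * q'" by (simp add: ac_simps)
  also have "\<dots> = q * (q' * h)" unfolding kq by (simp add: ac_simps)
  also have "\<dots> = g * (q * ?l ^ k')" unfolding kq'[symmetric] by (simp add: ac_simps)
  finally have "f dvd g * (q * ?l ^ k')" by (metis dvd_triv_left)
  then have "f dvd q * ?l ^ k'" by (rule coprime_pair_dvd[OF fg monic_nonzero])
  then obtain z where z: "q * ?l ^ k' = f * z" by (elim dvdE)
  have "f * (?l ^ k * ?l ^ k') = (q * h) * ?l ^ k'" unfolding kq[symmetric] by (simp add: ac_simps)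
  also have "\<dots> = (q * ?l ^ k') * h" by (simp add: ac_simps)
  also have "\<dots> = f * (z * h)" unfolding z by (simp add: ac_simps)
  finally have "?l ^ k * ?l ^ k' = z * h" using mpoly_mult_left_cancel[OF monic_nonzero] by blast
  then have "h dvd ?l ^ k * ?l ^ k'" by simp
  moreover have "?l ^ k * ?l ^ k' \<in> svars (- {b})" "?l ^ k * ?l ^ k' \<noteq> 0"
    using l by (auto intro: svars_mult simp: mpoly_mult_eq_0_iff)
  ultimately have "h \<in> svars (- {b})" by (rule svars_dvd)
  then show ?thesis using that h by blast
qed

text \<open>\<open>Q\<close> collects the elements free of \<open>b\<close> that carry
  \<open>r\<close> into the ideal. If no prime factor of the eliminant divided all of
  \<open>Q\<close>, some element of \<open>Q\<close> would be coprime to the eliminant and could be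
  cancelled, putting \<open>r\<close> into the ideal. So one prime \<open>p\<close> free of
  \<open>b\<close> divides all of \<open>Q\<close>; it involves a second variable \<open>v\<close>,
  and a nonzero polynomial without \<open>b\<close> and \<open>v\<close> is not a multiple of
  it.\<close>

lemma colon_avoids_monic:
  assumes fg: "coprime_set {f, g}" and r: "r \<notin> ideal_pair f g" and n: "CARD('v) \<ge> 2"
  shows "\<exists>A :: 'v set. card A = CARD('v) - 2 \<and> (\<forall>s\<in>svars A. s \<noteq> 0 \<longrightarrow> s * r \<notin> ideal_pair f g)"
proof -
  let ?I = "ideal_pair f g"
  obtain \<rho> where \<rho>: "\<rho> \<in> ?I" "\<rho> \<in> svars (- {b})" "\<rho> \<noteq> 0" using ex_eliminant[OF fg] by blast
  define Q where "Q = {s \<in> svars (- {b}). s * r \<in> ?I}"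
  have QI: "s + t \<in> Q" "u \<in> svars (- {b}) \<Longrightarrow> u * s \<in> Q" if "s \<in> Q" "t \<in> Q" for s t u
    using that ideal_pair_closed by (auto simp: Q_def distrib_right mult.assoc intro: svars_add svars_mult)
  have Q0: "0 \<in> Q" using ideal_pair_closed(2)[OF ideal_pair_mem(1), of 0 f g] by (simp add: Q_def)
  have "\<exists>p. prime_elem p \<and> p dvd \<rho> \<and> (\<forall>s\<in>Q. p dvd s)"
  proof (rule ccontr)
    assume n: "\<not> ?thesis"
    \<comment> \<open>Prime avoidance for principal primes: the prime factors of \<open>d\<close>
      are treated one after another.\<close>
    have "\<exists>s\<in>Q. \<forall>p. prime_elem p \<longrightarrow> p dvd d \<longrightarrow> \<not> p dvd s" if "d dvd \<rho>" for d
    proof -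
      have "d \<noteq> 0" using that \<rho>(3) by auto
      then show ?thesis using that
      proof (induct rule: prime_induct)
        case (unit u)
        then show ?case using Q0 by (meson dvd_trans prime_elem_not_unit)
      next
        case (mult p g')
        have g'\<rho>: "g' dvd \<rho>" "p dvd \<rho>" using mult(4) by (auto dest: dvd_mult_left dvd_mult_right)
        have g'b: "g' \<in> svars (- {b})" by (rule svars_dvd[OF g'\<rho>(1) \<rho>(2,3)])
        obtain s where s: "s \<in> Q" "\<And>q. prime_elem q \<Longrightarrow> q dvd g' \<Longrightarrow> \<not> q dvd s" using mult(3)[OF g'\<rho>(1)] by blast
        have div: "q dvd p * g' \<Longrightarrow> q dvd p \<or> q dvd g'" if "prime_elem q" for q
          using that by (simp add: prime_elem_dvd_mult_iff)
        have qp: "p dvd q" if "prime_elem q" "q dvd p" for q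
        proof -
          obtain w where w: "p = q * w" using \<open>q dvd p\<close> by (elim dvdE)
          have "p dvd q \<or> p dvd w" using mult(1) w by (metis dvd_refl prime_elem_dvd_mult_iff)
          moreover have "\<not> p dvd w"
          proof
            assume "p dvd w"
            then obtain x where "w = p * x" by (elim dvdE)
            then have "p * 1 = p * (q * x)" using w by (simp add: ac_simps)
            then have "1 = q * x" using mult(1) mpoly_mult_left_cancel[of p 1 "q * x"] by (simp add: prime_elem_def)
            then show False using \<open>prime_elem q\<close> by (metis dvd_triv_left prime_elem_not_unit)
          qed
          ultimately show ?thesis by blast
        qed
        show ?case
        proof (cases "p dvd s")
          case False
          have "\<not> q dvd s" if "prime_elem q" "q dvd p * g'" for q
            using div[OF that] s(2)[OF that(1)] qp[OF that(1)] False by (meson dvd_trans)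
          then show ?thesis using s(1) by blast
        next
          case True
          obtain t where t: "t \<in> Q" "\<not> p dvd t" using n mult(1) g'\<rho>(2) by blast
          have pg: "\<not> p dvd g'" using s(2)[OF mult(1)] True by blast
          \<comment> \<open>Primes in \<open>g'\<close> divide \<open>g' * t\<close> but not
            \<open>s\<close>, while \<open>p\<close> divides \<open>s\<close> but not
            \<open>g' * t\<close>; so no prime factor of \<open>p * g'\<close> divides the
            sum.\<close>
          have "\<not> q dvd s + g' * t" if "prime_elem q" "q dvd p * g'" for q
          proof (cases "q dvd g'")
            case q: True
            then show ?thesis using s(2)[OF that(1) q] by (simp add: dvd_add_left_iff)
          next
            case False
            then have "p dvd q" using div[OF that] qp[OF that(1)] by blast
            moreover have "\<not> p dvd s + g' * t"
              using True pg t(2) mult(1) by (simp add: dvd_add_right_iff prime_elem_dvd_mult_iff)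
            ultimately show ?thesis by (meson dvd_trans)
          qed
          moreover have "s + g' * t \<in> Q" using QI s(1) t(1) g'b by blast
          ultimately show ?thesis by blast
        qed
      qed
    qed
    from this[OF dvd_refl] obtain s where s: "s \<in> Q" "\<And>p. prime_elem p \<Longrightarrow> p dvd \<rho> \<Longrightarrow> \<not> p dvd s" by blast
    show False
    proof (cases "\<rho> dvd 1")
      case True
      then obtain w where "1 = \<rho> * w" by (elim dvdE)
      then have "r = (w * r) * \<rho>" by (metis mult.assoc mult.commute mult_1)
      then show False using r ideal_pair_closed(2)[OF \<rho>(1)] by metis
    next
      case False
      then obtain p where p: "irreducible p" "p dvd \<rho>" using irreducible_factor[OF \<rho>(3)] by (metis dvd_triv_left)
      have s0: "s \<noteq> 0" using s(2)[OF irreducible_prime_elem[OF p(1)] p(2)] by auto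
      have cs: "coprime_set {s, \<rho>}" using s(2) by (auto simp: coprime_set_def)
      have sb: "s \<in> svars (- {b})" "s * r \<in> ?I" using s(1) by (simp_all add: Q_def)
      have "r \<in> ?I"
        by (rule cancel_coprime_to_eliminant[OF \<rho>(1,2) sb(1) s0 _ sb(2)]) (rule coprime_pair_dvd[OF cs s0])
      then show False using r by blast
    qed
  qed
  then obtain p where p: "prime_elem p" "p dvd \<rho>" "\<And>s. s \<in> Q \<Longrightarrow> p dvd s" by blast
  have pb: "p \<in> svars (- {b})" by (rule svars_dvd[OF p(2) \<rho>(2,3)])
  have "\<exists>v. deg_in v p \<noteq> 0"
  proof (rule ccontr)
    assume "\<not> ?thesis"
    then have "p \<in> svars {}" by (subst svars_iff) (simp add: svars_iff_deg_in)
    then have "p = cst (coef p 0)" by (rule svars_empty)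
    then have "p dvd 1" using p(1) cst_dvd_1[of "coef p 0"] by (metis cst_eq_0_iff prime_elem_not_zeroI)
    then show False using p(1) by (simp add: prime_elem_not_unit)
  qed
  then obtain v where v: "deg_in v p \<noteq> 0" by blast
  then have "v \<noteq> b" using pb by (auto simp: svars_iff_deg_in)
  define A where "A = - {b, v}"
  have "card A = CARD('v) - 2" using \<open>v \<noteq> b\<close> by (simp add: A_def Compl_eq_Diff_UNIV card_Diff_subset)
  moreover have "s * r \<notin> ?I" if "s \<in> svars A" "s \<noteq> 0" for s
  proof
    assume "s * r \<in> ?I"
    then have "s \<in> Q" using that by (auto simp: Q_def A_def intro: svars_mono[of "- {b, v}"])
    then have "p dvd s" by (rule p(3))
    then have "deg_in v p \<le> deg_in v s" using that by (intro deg_in_le_of_dvd)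
    moreover have "s \<in> svars (- {v})" using that by (auto simp: A_def intro: svars_mono[of "- {b, v}"])
    ultimately show False using v by (simp add: svars_iff_deg_in)
  qed
  ultimately show ?thesis by blast
qed

end

lemma prime_elem_automorphism:
  assumes "comm_ring_hom \<phi>" "comm_ring_hom \<psi>" "\<And>x. \<phi> (\<psi> x) = x" "\<And>x. \<psi> (\<phi> x) = (x :: 'a::comm_ring_1)"
    and "prime_elem p" shows "prime_elem (\<phi> p)"
proof -
  interpret f: comm_ring_hom \<phi> by fact
  interpret g: comm_ring_hom \<psi> by fact
  have d: "\<phi> p dvd x \<longleftrightarrow> p dvd \<psi> x" for x
    by (metis assms(3,4) dvd_def f.hom_mult g.hom_mult)
  have "\<phi> p \<noteq> 0" using assms(4,5) by (metis g.hom_zero prime_elem_not_zeroI)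
  then show ?thesis using assms(5) by (simp add: prime_elem_def d g.hom_mult)
qed

text \<open>The substitution with parameter 1 makes \<open>f\<close> monic up to a constant, and
  \<open>\<kappa>\<close>, its inverse, carries the subring found there back.\<close>

lemma colon_avoids:
  fixes f g r :: "('v::finite, 'k::field) mpoly"
  assumes fg: "coprime_set {f, g}" "f \<noteq> 0" and r: "r \<notin> ideal_pair f g" and n: "CARD('v) \<ge> 2"
  obtains \<kappa> and A :: "'v set" where "comm_ring_hom \<kappa>" "\<And>c. \<kappa> (cst c) = cst c" "card A = CARD('v) - 2"
    "\<And>s :: ('v, 'k) mpoly. s \<in> svars A \<Longrightarrow> s \<noteq> 0 \<Longrightarrow> \<kappa> s * r \<notin> ideal_pair f g"
proof -
  fix b :: 'v
  obtain N c where c: "c \<noteq> 0" "lead_coeff (uni b (nagata b N 1 f)) = cst c"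
    using ex_nagata_monic[OF fg(2)] by blast
  let ?\<kappa> = "nagata b N (- 1) :: ('v, 'k) mpoly \<Rightarrow> _" and ?\<kappa>' = "nagata b N 1 :: ('v, 'k) mpoly \<Rightarrow> _"
  interpret \<kappa>: comm_ring_hom ?\<kappa> by (rule comm_ring_hom_nagata)
  interpret \<kappa>': comm_ring_hom ?\<kappa>' by (rule comm_ring_hom_nagata)
  have inv: "?\<kappa> (?\<kappa>' x) = x" "?\<kappa>' (?\<kappa> x) = x" for x by (simp_all add: nagata_nagata)
  have m: "?\<kappa>' x \<in> ideal_pair (?\<kappa>' f) (?\<kappa>' g)" if x: "x \<in> ideal_pair f g" for x
  proof -
    obtain u v where "x = u * f + v * g" using x by (auto simp: ideal_pair_def)
    then have "?\<kappa>' x = ?\<kappa>' u * ?\<kappa>' f + ?\<kappa>' v * ?\<kappa>' g" by (simp add: \<kappa>'.hom_add \<kappa>'.hom_mult)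
    then show ?thesis by (rule ideal_pairI)
  qed
  have m': "x \<in> ideal_pair f g" if x: "?\<kappa>' x \<in> ideal_pair (?\<kappa>' f) (?\<kappa>' g)" for x
  proof -
    obtain u v where "?\<kappa>' x = u * ?\<kappa>' f + v * ?\<kappa>' g" using x by (auto simp: ideal_pair_def)
    then have "?\<kappa> (?\<kappa>' x) = ?\<kappa> u * ?\<kappa> (?\<kappa>' f) + ?\<kappa> v * ?\<kappa> (?\<kappa>' g)" by (simp add: \<kappa>.hom_add \<kappa>.hom_mult)
    then show ?thesis unfolding inv by (rule ideal_pairI)
  qed
  have "coprime_set {?\<kappa>' f, ?\<kappa>' g}" unfolding coprime_set_def
  proof (intro allI impI)
    fix p :: "('v, 'k) mpoly" assume "prime_elem p"
    then have "prime_elem (?\<kappa> p)"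
      by (intro prime_elem_automorphism[OF comm_ring_hom_nagata comm_ring_hom_nagata inv])
    then have "\<not> ?\<kappa> p dvd f \<or> \<not> ?\<kappa> p dvd g" using fg(1) by (auto simp: coprime_set_def)
    moreover have "?\<kappa> p dvd x" if "p dvd ?\<kappa>' x" for x
      using that inv by (metis \<kappa>.hom_mult dvd_def)
    ultimately show "\<exists>f\<in>{?\<kappa>' f, ?\<kappa>' g}. \<not> p dvd f" by blast
  qed
  moreover have "?\<kappa>' r \<notin> ideal_pair (?\<kappa>' f) (?\<kappa>' g)" using m' r by blast
  ultimately obtain A :: "'v set" where A: "card A = CARD('v) - 2"
    "\<forall>s\<in>svars A. s \<noteq> 0 \<longrightarrow> s * ?\<kappa>' r \<notin> ideal_pair (?\<kappa>' f) (?\<kappa>' g)"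
    using colon_avoids_monic[OF c] n by blast
  have "?\<kappa> s * r \<notin> ideal_pair f g" if "s \<in> svars A" "s \<noteq> 0" for s
  proof
    assume "?\<kappa> s * r \<in> ideal_pair f g"
    then have "?\<kappa>' (?\<kappa> s * r) \<in> ideal_pair (?\<kappa>' f) (?\<kappa>' g)" by (rule m)
    then show False using A(2) that by (simp add: \<kappa>'.hom_mult inv)
  qed
  then show ?thesis using that[OF comm_ring_hom_nagata nagata_cst A(1)] by blast
qed

section \<open>Height and unmixedness of colon ideals\<close>

definition colon_pair :: "'a::comm_ring_1 \<Rightarrow> 'a \<Rightarrow> 'a \<Rightarrow> 'a set" where
  "colon_pair f g r = {q. q * r \<in> ideal_pair f g}"

lemma colon_pair_ideal: "is_ideal (colon_pair f g r)"
  using ideal_pair_ideal[of f g] unfolding is_ideal_iff colon_pair_def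
  by (simp add: distrib_right mult.assoc)

lemma colon_pair_mem: "f \<in> colon_pair f g r" "g \<in> colon_pair f g r"
proof -
  have "r * f \<in> ideal_pair f g" "r * g \<in> ideal_pair f g"
    by (intro ideal_pair_closed ideal_pair_mem)+
  then show "f \<in> colon_pair f g r" "g \<in> colon_pair f g r" by (simp_all add: colon_pair_def mult.commute)
qed

context
  fixes f g :: "('v::finite, 'k::field) mpoly"
  assumes fg: "coprime_set {f, g}" "f \<noteq> 0" and n: "CARD('v) \<ge> 2"
begin

lemma prime_over_colon_pair_ge:
  assumes "is_prime_ideal P" "colon_pair f g r \<subseteq> P" shows "2 \<le> prime_height P"
proof (rule prime_height_ge_2[OF assms(1) _ fg(2)])
  show "f \<in> P" using colon_pair_mem(1) assms(2) by blast
  show "coprime_set P" by (rule coprime_set_mono[OF fg(1)]) (use colon_pair_mem assms(2) in blast)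
qed

text \<open>The nonzero polynomials in \<open>CARD('v) - 2\<close> variables are sent by
  \<open>\<kappa>\<close> to a multiplicative set disjoint from the colon ideal. A prime above the
  ideal that avoids this set has growth \<open>CARD('v) - 2\<close>, hence height at most 2.
  Conversely every prime above contains the coprime pair.\<close>

lemma height_colon_pair:
  assumes r: "r \<notin> ideal_pair f g" shows "height (colon_pair f g r) = 2"
proof (rule antisym)
  obtain \<kappa> and A :: "'v set" where \<kappa>: "comm_ring_hom \<kappa>" "\<And>c. \<kappa> (cst c) = cst c" "card A = CARD('v) - 2"
    "\<And>s :: ('v, 'k) mpoly. s \<in> svars A \<Longrightarrow> s \<noteq> 0 \<Longrightarrow> \<kappa> s * r \<notin> ideal_pair f g"
    using colon_avoids[OF fg r n] by blast
  interpret comm_ring_hom \<kappa> by fact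
  let ?M = "\<kappa> ` (svars A - {0})"
  obtain P where P: "is_prime_ideal P" "colon_pair f g r \<subseteq> P" "P \<inter> ?M = {}"
  proof (rule prime_avoiding[OF colon_pair_ideal[of f g r], of ?M])
    have "\<kappa> 1 \<in> ?M" by (rule imageI) simp
    then show "1 \<in> ?M" by simp
    show "a * b \<in> ?M" if a: "a \<in> ?M" "b \<in> ?M" for a b
    proof -
      obtain x y where xy: "a = \<kappa> x" "b = \<kappa> y" "x \<in> svars A - {0}" "y \<in> svars A - {0}" using a by blast
      then have "x * y \<in> svars A - {0}" by (auto simp: mpoly_mult_eq_0_iff intro: svars_mult)
      then have "\<kappa> (x * y) \<in> ?M" by (rule imageI)
      then show ?thesis by (simp add: xy hom_mult)
    qed
    show "colon_pair f g r \<inter> ?M = {}" using \<kappa>(4) by (auto simp: colon_pair_def)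
  qed blast
  have "growth P (card A)" by (rule growth_of_subring[OF \<kappa>(1,2)]) (use P(3) in blast)
  then have "prime_height P \<le> enat (CARD('v) - card A)" by (rule prime_height_le_of_growth)
  then have "prime_height P \<le> 2" using \<kappa>(3) n by (simp add: numeral_eq_enat)
  moreover have "height (colon_pair f g r) \<le> prime_height P"
    unfolding height_def by (rule INF_lower) (use P in blast)
  ultimately show "height (colon_pair f g r) \<le> 2" by (rule order_trans[rotated])
  show "2 \<le> height (colon_pair f g r)"
    unfolding height_def by (rule INF_greatest) (use prime_over_colon_pair_ge in blast)
qed

text \<open>An associated prime is itself the colon ideal of the pair by \<open>r' * r\<close>, so
  \<open>colon_avoids\<close> bounds its height directly and no primary decomposition is
  involved.\<close>

lemma unmixed_colon_pair:
  assumes r: "r \<notin> ideal_pair f g" shows "unmixed (colon_pair f g r)"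
  unfolding unmixed_def
proof (intro allI impI)
  fix P assume "associated_prime (colon_pair f g r) P"
  then obtain r' where P: "is_prime_ideal P" "P = {p. p * r' \<in> colon_pair f g r}"
    by (auto simp: associated_prime_def)
  have Pe: "P = colon_pair f g (r' * r)" unfolding P(2) by (simp add: colon_pair_def mult.assoc)
  have "1 \<notin> P" using P(1) by (simp add: is_prime_ideal_def)
  then have r'r: "r' * r \<notin> ideal_pair f g" by (simp add: Pe colon_pair_def)
  obtain \<kappa> and A :: "'v set" where \<kappa>: "comm_ring_hom \<kappa>" "\<And>c. \<kappa> (cst c) = cst c" "card A = CARD('v) - 2"
    "\<And>s :: ('v, 'k) mpoly. s \<in> svars A \<Longrightarrow> s \<noteq> 0 \<Longrightarrow> \<kappa> s * (r' * r) \<notin> ideal_pair f g"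
    using colon_avoids[OF fg r'r n] by blast
  have "growth P (card A)" by (rule growth_of_subring[OF \<kappa>(1,2)]) (use \<kappa>(4) in \<open>simp add: Pe colon_pair_def\<close>)
  then have "prime_height P \<le> enat (CARD('v) - card A)" by (rule prime_height_le_of_growth)
  then have "prime_height P \<le> 2" using \<kappa>(3) n by (simp add: numeral_eq_enat)
  moreover have "2 \<le> prime_height P" by (rule prime_over_colon_pair_ge[OF P(1), of "r' * r"]) (simp add: Pe)
  ultimately show "prime_height P = height (colon_pair f g r)" using height_colon_pair[OF r] by simp
qed

end

section \<open>Homogeneous components\<close>

text \<open>Degrees of matrix entries and coefficients are differences of shifts and may be
  negative; the component is zero there.\<close>

definition hc :: "int \<Rightarrow> ('v::finite, 'k::field) mpoly \<Rightarrow> ('v, 'k) mpoly" where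
  "hc t p = (if t < 0 then 0 else coeff (gr p) (nat t))"

lemma lookup_hc: "coef (hc t p) m = (if int (mon_degree m) = t then coef p m else 0)"
  by (auto simp: hc_def lookup_coeff_gr)

lemma homogeneous_iff: "homogeneous t p \<longleftrightarrow> (\<forall>m. int (mon_degree m) \<noteq> t \<longrightarrow> coef p m = 0)"
  by (auto simp: homogeneous_def in_keys_iff)

lemma homogeneous_iff_hc: "homogeneous t p \<longleftrightarrow> hc t p = p"
  by (auto simp: homogeneous_iff poly_mapping_eq_iff fun_eq_iff lookup_hc)

lemma homogeneous_hc [simp]: "homogeneous t (hc t p)"
  by (simp add: homogeneous_iff lookup_hc)

lemma hc_add: "hc t (p + q) = hc t p + hc t q"
  by (simp add: hc_def gr.hom_add)

lemma hc_0 [simp]: "hc t 0 = 0"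
  by (simp add: hc_def)

lemma hc_sum: "hc t (sum f A) = (\<Sum>i\<in>A. hc t (f i))"
  by (induct A rule: infinite_finite_induct) (simp_all add: hc_add)

lemma hc_other: "homogeneous s p \<Longrightarrow> s \<noteq> t \<Longrightarrow> hc t p = 0"
  by (auto simp: homogeneous_iff poly_mapping_eq_iff fun_eq_iff lookup_hc)

lemma homogeneous_0 [simp]: "homogeneous t 0"
  by (simp add: homogeneous_def)

lemma homogeneous_neg: "homogeneous t p \<Longrightarrow> t < 0 \<Longrightarrow> p = 0"
  by (simp add: homogeneous_iff_hc hc_def)

lemma homogeneous_unique: "homogeneous s p \<Longrightarrow> homogeneous t p \<Longrightarrow> p \<noteq> 0 \<Longrightarrow> s = t"
  by (metis hc_other homogeneous_iff_hc)

lemma homogeneous_gr: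
  assumes "homogeneous (int d) p" shows "gr p = monom p d"
proof (rule poly_eqI)
  fix i
  have "coeff (gr p) i = hc (int i) p" by (simp add: hc_def)
  also have "\<dots> = (if i = d then p else 0)" using assms hc_other[OF assms] by (auto simp: homogeneous_iff_hc)
  finally show "coeff (gr p) i = coeff (monom p d) i" by (simp add: eq_commute)
qed

lemma gr_homogeneous: "gr p = monom p d \<Longrightarrow> homogeneous (int d) p"
  by (simp add: homogeneous_iff_hc hc_def)

lemma hc_mult:
  assumes "homogeneous d f" shows "hc t (f * p) = f * hc (t - d) p"
proof (cases "d < 0")
  case False
  then have f: "gr f = monom f (nat d)" using homogeneous_gr[of "nat d" f] assms by simp
  show ?thesis using False
    by (auto simp: hc_def gr.hom_mult f coeff_monom_mult nat_diff_distrib nat_less_iff)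
qed (use homogeneous_neg[OF assms] in simp)

lemma homogeneous_add: "homogeneous t p \<Longrightarrow> homogeneous t q \<Longrightarrow> homogeneous t (p + q)"
  by (simp add: homogeneous_iff lookup_add)

lemma homogeneous_uminus: "homogeneous t p \<Longrightarrow> homogeneous t (- p)"
  by (simp add: homogeneous_iff)

lemma homogeneous_diff: "homogeneous t p \<Longrightarrow> homogeneous t q \<Longrightarrow> homogeneous t (p - q)"
  by (simp add: homogeneous_iff lookup_minus)

lemma homogeneous_sum: "(\<And>i. i \<in> A \<Longrightarrow> homogeneous t (f i)) \<Longrightarrow> homogeneous t (sum f A)"
  by (induct A rule: infinite_finite_induct) (auto intro: homogeneous_add)

lemma homogeneous_mult: "homogeneous s p \<Longrightarrow> homogeneous t q \<Longrightarrow> homogeneous (s + t) (p * q)"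
  by (simp add: homogeneous_iff_hc[of "s + t"] hc_mult) (simp add: homogeneous_iff_hc)

lemma homogeneous_cst [simp]: "homogeneous 0 (cst c)"
  by (simp add: homogeneous_iff cst_def lookup_single when_def mon_degree_eq_0)

lemma homogeneous_X [simp]: "homogeneous 1 (X v)"
  using gr_homogeneous[of "X v" 1] by (simp add: gr_X)

lemma homogeneous_cst_mult: "homogeneous t p \<Longrightarrow> homogeneous t (cst c * p)"
  using homogeneous_mult[OF homogeneous_cst, of t p c] by simp

lemma homogeneous_degree_0:
  assumes "homogeneous 0 p" shows "p = cst (coef p 0)"
proof (rule poly_mapping_eqI)
  fix m
  show "coef p m = coef (cst (coef p 0)) m"
    using assms by (cases "m = 0") (auto simp: homogeneous_iff cst_def lookup_single when_def mon_degree_eq_0)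
qed

lemma homogeneous_const_coef: "homogeneous t p \<Longrightarrow> t \<noteq> 0 \<Longrightarrow> coef p 0 = 0"
  by (simp add: homogeneous_iff mon_degree_def)

lemma sum_hc: "p = (\<Sum>d\<le>tdeg p. hc (int d) p)"
  using poly_gr[of p] by (simp add: poly_altdef hc_def)

text \<open>The lowest components of the factors multiply to a nonzero component of the product, and
  so do the highest. The product has only one degree, so lowest and highest agree in each
  factor.\<close>

lemma homogeneous_factor:
  assumes "homogeneous t (p * q)" "p * q \<noteq> 0" shows "\<exists>s\<ge>0. homogeneous s p"
proof -
  have t: "t \<ge> 0" using homogeneous_neg[OF assms(1)] assms(2) by linarith
  define d where "d = nat t"
  let ?A = "gr p" and ?B = "gr q"
  have AB: "?A * ?B = monom (p * q) d" using homogeneous_gr[of d "p * q"] assms t by (simp add: d_def gr.hom_mult)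
  have nz: "?A \<noteq> 0" "?B \<noteq> 0" "p \<noteq> 0" "q \<noteq> 0" using assms by auto
  define i where "i = (LEAST i. coeff ?A i \<noteq> 0)"
  define j where "j = (LEAST j. coeff ?B j \<noteq> 0)"
  have i: "coeff ?A i \<noteq> 0" unfolding i_def by (rule LeastI[of _ "degree ?A"]) (use nz in simp)
  have j: "coeff ?B j \<noteq> 0" unfolding j_def by (rule LeastI[of _ "degree ?B"]) (use nz in simp)
  have il: "coeff ?A k = 0" if "k < i" for k using not_less_Least[OF that[unfolded i_def]] by simp
  have jl: "coeff ?B k = 0" if "k < j" for k using not_less_Least[OF that[unfolded j_def]] by simp
  have "coeff (?A * ?B) (i + j) = (\<Sum>k\<le>i + j. coeff ?A k * coeff ?B (i + j - k))" by (simp add: coeff_mult)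
  also have "\<dots> = (\<Sum>k\<in>{i}. coeff ?A k * coeff ?B (i + j - k))"
  proof (rule sum.mono_neutral_right)
    show "\<forall>k\<in>{..i + j} - {i}. coeff ?A k * coeff ?B (i + j - k) = 0"
    proof
      fix k assume "k \<in> {..i + j} - {i}"
      then have "k < i \<or> i + j - k < j" by auto
      then show "coeff ?A k * coeff ?B (i + j - k) = 0" using il jl by auto
    qed
  qed auto
  finally have "coeff (?A * ?B) (i + j) \<noteq> 0" using i j by (simp add: mpoly_mult_eq_0_iff)
  then have ij: "i + j = d" unfolding AB by (auto split: if_splits)
  have "degree ?A + degree ?B = d"
    using degree_mult_mpoly[OF nz(1,2)] AB assms(2) by (simp add: degree_monom_eq)
  then have "i = degree ?A" using ij le_degree[OF i] le_degree[OF j] by simp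
  then have "?A = monom (coeff ?A i) i"
    using il by (intro poly_eqI) (metis coeff_eq_0 coeff_monom linorder_neqE_nat)
  then have "p = coeff ?A i" "?A = monom p i" using poly_gr[of p] by (metis mult.right_neutral poly_monom power_one)+
  then have "homogeneous (int i) p" by (intro gr_homogeneous)
  then show ?thesis by (intro exI[of _ "int i"]) simp
qed

section \<open>Dimensions\<close>

context vector_space
begin

lemma dim_family:
  assumes I: "finite I" and ind: "\<And>c. (\<Sum>i\<in>I. c i *s e i) = 0 \<Longrightarrow> \<forall>i\<in>I. c i = 0"
  shows "independent (e ` I)" "inj_on e I"
proof -
  show inj: "inj_on e I"
  proof (rule inj_onI, rule ccontr)
    fix i j assume ij: "i \<in> I" "j \<in> I" "e i = e j" "i \<noteq> j"
    let ?c = "\<lambda>k. if k = i then 1 else if k = j then - 1 else (0 :: 'a)"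
    have "(\<Sum>k\<in>I. ?c k *s e k) = (\<Sum>k\<in>{i, j}. ?c k *s e k)"
      by (rule sum.mono_neutral_right) (use I ij in auto)
    also have "\<dots> = 0" using ij by simp
    finally show False using bspec[OF ind[of ?c] ij(1)] by simp
  qed
  show "independent (e ` I)"
  proof (rule independent_if_scalars_zero)
    fix f x assume fx: "(\<Sum>x\<in>e ` I. f x *s x) = 0" "x \<in> e ` I"
    have "(\<Sum>i\<in>I. f (e i) *s e i) = 0" using fx(1) by (simp add: sum.reindex[OF inj])
    from ind[OF this] fx(2) show "f x = 0" by blast
  qed (use I in simp)
qed

lemma dim_eq_card_family:
  assumes I: "finite I" and ind: "\<And>c. (\<Sum>i\<in>I. c i *s e i) = 0 \<Longrightarrow> \<forall>i\<in>I. c i = 0"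
    and V: "\<And>i. i \<in> I \<Longrightarrow> e i \<in> V" "\<And>v. v \<in> V \<Longrightarrow> v \<in> span (e ` I)"
  shows "dim V = card I"
proof -
  have "dim V = card (e ` I)"
    by (rule dim_unique[OF _ _ dim_family(1)[OF I ind]]) (use V in auto)
  then show ?thesis by (simp add: card_image[OF dim_family(2)[OF I ind]])
qed

lemma dim_subset_finite:
  assumes "V \<subseteq> W" "W \<subseteq> span B" "finite B" shows "dim V \<le> dim W"
proof -
  obtain C where C: "C \<subseteq> W" "independent C" "W \<subseteq> span C" "card C = dim W" by (rule basis_exists)
  have "C \<subseteq> span B" using C(1) assms(2) by blast
  then have "finite C" using independent_span_bound[OF assms(3) C(2)] by blast
  then show ?thesis using dim_le_card[of V C] C assms(1) by auto
qed

lemma subspace_eq_of_dim: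
  assumes "subspace V" "V \<subseteq> W" "W \<subseteq> span B" "finite B" "dim W \<le> dim V"
  shows "W \<subseteq> V"
proof -
  obtain C where C: "C \<subseteq> V" "independent C" "V \<subseteq> span C" "card C = dim V" by (rule basis_exists)
  obtain D where D: "C \<subseteq> D" "D \<subseteq> W" "independent D" "W \<subseteq> span D"
    using maximal_independent_subset_extend[of C W] C assms(2) by blast
  have "D \<subseteq> span B" using D(2) assms(3) by blast
  then have fD: "finite D" using independent_span_bound[OF assms(4) D(3)] by blast
  have "card D = dim W" by (rule basis_card_eq_dim[OF D(2,4,3)])
  then have "card D \<le> card C" using assms(5) C(4) by simp
  then have "C = D" using D(1) fD by (metis card_seteq)
  then have "W \<subseteq> span C" using D by simp
  also have "span C \<subseteq> V" using C(1) assms(1) by (rule span_minimal)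
  finally show ?thesis .
qed

end

context vector_space_pair
begin

text \<open>Linearity is asked for on \<open>V\<close> alone, because the map of a Bourbaki ideal is
  specified only on the syzygies.\<close>

lemma rank_nullity_on:
  assumes V: "vs1.subspace V" "V \<subseteq> vs1.span S" "finite S"
    and add: "\<And>x y. x \<in> V \<Longrightarrow> y \<in> V \<Longrightarrow> f (x + y) = f x + f y"
    and scale: "\<And>c x. x \<in> V \<Longrightarrow> f (s1 c x) = s2 c (f x)"
  shows "vs1.dim V = vs2.dim (f ` V) + vs1.dim {v \<in> V. f v = 0}"
proof -
  let ?K = "{v \<in> V. f v = 0}"
  have f0: "f 0 = 0" using scale[of 0 0] V(1) by (simp add: vs1.subspace_0)
  have fsum: "f (\<Sum>b\<in>B. s1 (u b) b) = (\<Sum>b\<in>B. s2 (u b) (f b)) \<and> (\<Sum>b\<in>B. s1 (u b) b) \<in> V"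
    if "finite B" "B \<subseteq> V" for B u
    using that
    by induct (auto simp: f0 add scale vs1.subspace_0[OF V(1)] vs1.subspace_scale[OF V(1)] intro: vs1.subspace_add[OF V(1)])
  obtain BK where BK: "BK \<subseteq> ?K" "vs1.independent BK" "?K \<subseteq> vs1.span BK" "card BK = vs1.dim ?K"
    by (rule vs1.basis_exists)
  obtain B where B: "BK \<subseteq> B" "B \<subseteq> V" "vs1.independent B" "V \<subseteq> vs1.span B"
    using vs1.maximal_independent_subset_extend[of BK V] BK by blast
  have "B \<subseteq> vs1.span S" using B(2) V(2) by blast
  then have fB: "finite B" using vs1.independent_span_bound[OF V(3) B(3)] by blast
  have fBK: "finite BK" using B(1) fB by (rule finite_subset)
  define C where "C = B - BK"
  have fC: "finite C" "C \<subseteq> V" using fB B(2) by (auto simp: C_def)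
  have "vs2.dim (f ` V) = card C"
  proof (rule vs2.dim_eq_card_family[where e = f, OF fC(1)])
    show "f c \<in> f ` V" if "c \<in> C" for c using that fC(2) by blast
    fix c assume "(\<Sum>i\<in>C. s2 (c i) (f i)) = 0"
    then have "(\<Sum>i\<in>C. s1 (c i) i) \<in> ?K" using fsum[OF fC, of c] by auto
    then have "(\<Sum>i\<in>C. s1 (c i) i) \<in> vs1.span BK" using BK(3) by blast
    then obtain u where u: "(\<Sum>i\<in>C. s1 (c i) i) = (\<Sum>i\<in>BK. s1 (u i) i)"
      unfolding vs1.span_finite[OF fBK] by blast
    let ?w = "\<lambda>i. if i \<in> C then c i else - u i"
    have "(\<Sum>i\<in>B. s1 (?w i) i) = (\<Sum>i\<in>C. s1 (?w i) i) + (\<Sum>i\<in>BK. s1 (?w i) i)"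
      using sum.subset_diff[OF B(1) fB, of "\<lambda>i. s1 (?w i) i"] by (simp add: C_def)
    also have "(\<Sum>i\<in>C. s1 (?w i) i) = (\<Sum>i\<in>C. s1 (c i) i)" by simp
    also have "(\<Sum>i\<in>BK. s1 (?w i) i) = - (\<Sum>i\<in>BK. s1 (u i) i)"
      unfolding sum_negf[symmetric] by (rule sum.cong) (auto simp: C_def)
    finally have "(\<Sum>i\<in>B. s1 (?w i) i) = 0" using u by simp
    then have w: "?w i = 0" if "i \<in> B" for i
      using vs1.independentD[OF B(3) fB subset_refl, of ?w i] that by simp
    show "\<forall>i\<in>C. c i = 0"
    proof
      fix i assume "i \<in> C"
      then show "c i = 0" using w[of i] by (simp add: C_def)
    qed
  next
    fix w assume "w \<in> f ` V"
    then obtain v where v: "v \<in> V" "w = f v" by blast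
    then have "v \<in> vs1.span B" using B(4) by blast
    then obtain u where u: "v = (\<Sum>i\<in>B. s1 (u i) i)" unfolding vs1.span_finite[OF fB] by blast
    have "w = (\<Sum>i\<in>B. s2 (u i) (f i))" using v(2) u fsum[OF fB B(2), of u] by simp
    also have "\<dots> = (\<Sum>i\<in>C. s2 (u i) (f i))"
      by (rule sum.mono_neutral_right) (use fB BK(1) in \<open>auto simp: C_def\<close>)
    also have "\<dots> \<in> vs2.span (f ` C)"
      by (intro vs2.span_sum vs2.span_scale vs2.span_base) blast
    finally show "w \<in> vs2.span (f ` C)" .
  qed
  moreover have "vs1.dim V = card B" using vs1.basis_card_eq_dim[OF B(2,4,3)] by simp
  moreover have "card B = card C + card BK"
    unfolding C_def using B(1) fB fBK by (simp add: card_Diff_subset card_mono)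
  ultimately show ?thesis using BK(4) by simp
qed

end

text \<open>The number of monomials of degree \<open>t\<close> in \<open>m + 1\<close> variables,
  zero for negative \<open>t\<close>, so that shifted modules need no case distinction.\<close>

definition cb :: "nat \<Rightarrow> int \<Rightarrow> nat" where
  "cb m t = (if t < 0 then 0 else (nat t + m) choose m)"

lemma card_monomials_of_degree:
  "finite {m :: 'v::finite \<Rightarrow>\<^sub>0 nat. int (mon_degree m) = t}"
  "card {m :: 'v::finite \<Rightarrow>\<^sub>0 nat. int (mon_degree m) = t} = cb (CARD('v) - 1) t"
proof -
  let ?M = "{m :: 'v::finite \<Rightarrow>\<^sub>0 nat. int (mon_degree m) = t}"
  show "finite ?M" by (rule finite_subset[OF _ card_monomials_le(1)[of "nat t"]]) auto
  show "card ?M = cb (CARD('v) - 1) t"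
  proof (cases "t < 0")
    case False
    define d where "d = nat t"
    obtain vs :: "'v list" where vs: "set vs = UNIV" "distinct vs" using finite_distinct_list[OF finite[of "UNIV :: 'v set"]] by blast
    have len: "length vs = CARD('v)" using vs by (metis distinct_card)
    let ?L = "{l :: nat list. length l = CARD('v) \<and> sum_list l = d}"
    have "bij_betw (\<lambda>m. map (coef m) vs) ?M ?L"
    proof (rule bij_betwI')
      fix m m' :: "'v \<Rightarrow>\<^sub>0 nat"
      show "map (coef m) vs = map (coef m') vs \<longleftrightarrow> m = m'"
        using vs(1) by (auto simp: map_eq_conv poly_mapping_eq_iff fun_eq_iff)
    next
      fix m :: "'v \<Rightarrow>\<^sub>0 nat" assume "m \<in> ?M"
      then have "mon_degree m = d" by (auto simp: d_def)
      then show "map (coef m) vs \<in> ?L"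
        using vs len by (simp add: sum_list_distinct_conv_sum_set mon_degree_def)
    next
      fix l assume l: "l \<in> ?L"
      define m where "m = Abs_poly_mapping (\<lambda>v. the (map_of (zip vs l) v))"
      have co: "coef m v = the (map_of (zip vs l) v)" for v by (simp add: m_def)
      have "map (coef m) vs = l"
      proof (rule nth_equalityI)
        fix i assume i: "i < length (map (coef m) vs)"
        then have "map_of (zip vs l) (vs ! i) = Some (l ! i)" using vs(2) l len by (simp add: map_of_zip_nth)
        then show "map (coef m) vs ! i = l ! i" using i by (simp add: co)
      qed (use l len in simp)
      moreover from this have "mon_degree m = d"
        using l sum_list_distinct_conv_sum_set[OF vs(2), of "coef m"] vs(1) by (simp add: mon_degree_def)
      then have "int (mon_degree m) = t" using False by (simp add: d_def)
      ultimately show "\<exists>m\<in>?M. l = map (coef m) vs" by auto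
    qed
    then have "card ?M = card ?L" by (rule bij_betw_same_card)
    also have "\<dots> = (d + CARD('v) - 1) choose d" by (rule card_length_sum_list)
    also have "\<dots> = (d + (CARD('v) - 1)) choose (CARD('v) - 1)"
    proof -
      have "d + CARD('v) - 1 = d + (CARD('v) - 1)" by (rule diff_add_assoc) (simp add: Suc_leI)
      then show ?thesis using binomial_symmetric[of d "d + (CARD('v) - 1)", OF le_add1] by simp
    qed
    finally show ?thesis using False by (simp add: cb_def d_def)
  qed (simp add: cb_def)
qed

section \<open>Graded pieces of free modules\<close>

definition scalef :: "'k \<Rightarrow> (nat \<Rightarrow> ('v, 'k::field) mpoly) \<Rightarrow> nat \<Rightarrow> ('v, 'k) mpoly" where
  "scalef c F = (\<lambda>i. scale c (F i))"

interpretation mf: vector_space "scalef :: 'k::field \<Rightarrow> (nat \<Rightarrow> ('v, 'k) mpoly) \<Rightarrow> _"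
  by unfold_locales (auto simp: scalef_def fun_eq_iff plus_fun_def mp.scale_right_distrib mp.scale_left_distrib)

interpretation mff: vector_space_pair "scalef :: 'k::field \<Rightarrow> (nat \<Rightarrow> ('v, 'k) mpoly) \<Rightarrow> _"
    "scalef :: 'k::field \<Rightarrow> (nat \<Rightarrow> ('v, 'k) mpoly) \<Rightarrow> _"
  by unfold_locales

interpretation mfp: vector_space_pair "scalef :: 'k::field \<Rightarrow> (nat \<Rightarrow> ('v, 'k) mpoly) \<Rightarrow> _"
    "scale :: 'k::field \<Rightarrow> ('v, 'k) mpoly \<Rightarrow> _"
  by unfold_locales

text \<open>
  Elements of free modules are functions on the naturals that vanish beyond the rank, so that free
  modules of all ranks live in one vector space.
\<close>

definition grade :: "int list \<Rightarrow> int \<Rightarrow> (nat \<Rightarrow> ('v::finite, 'k::field) mpoly) set" where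
  "grade bs t = {F. (\<forall>i<length bs. homogeneous (t - bs ! i) (F i)) \<and> (\<forall>i\<ge>length bs. F i = 0)}"

lemma sum_fun_apply: "(\<Sum>i\<in>A. f i) x = (\<Sum>i\<in>A. f i x)" for f :: "'i \<Rightarrow> 'a \<Rightarrow> 'b::comm_monoid_add"
  by (induct A rule: infinite_finite_induct) (simp_all add: plus_fun_def zero_fun_def)

definition unit_monomial :: "nat \<times> ('v \<Rightarrow>\<^sub>0 nat) \<Rightarrow> nat \<Rightarrow> ('v, 'k::field) mpoly" where
  "unit_monomial = (\<lambda>(i, m) j. if j = i then Poly_Mapping.single m 1 else 0)"

definition grade_index :: "int list \<Rightarrow> int \<Rightarrow> (nat \<times> ('v::finite \<Rightarrow>\<^sub>0 nat)) set" where
  "grade_index bs t = (SIGMA i:{..<length bs}. {m. int (mon_degree m) = t - bs ! i})"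

lemma finite_grade_index: "finite (grade_index bs t)"
  unfolding grade_index_def by (intro finite_SigmaI card_monomials_of_degree) simp

lemma card_grade_index:
  "card (grade_index bs t :: (nat \<times> ('v::finite \<Rightarrow>\<^sub>0 nat)) set) = (\<Sum>i<length bs. cb (CARD('v) - 1) (t - bs ! i))"
  unfolding grade_index_def by (subst card_SigmaI) (simp_all add: card_monomials_of_degree)

lemma grade_span:
  assumes "F \<in> grade bs t" shows "F \<in> mf.span (unit_monomial ` grade_index bs t)"
proof -
  have "F = (\<Sum>i<length bs. \<Sum>m\<in>mkeys (F i). scalef (coef (F i) m) (unit_monomial (i, m)))"
  proof
    fix j
    have "(\<Sum>i<length bs. \<Sum>m\<in>mkeys (F i). scalef (coef (F i) m) (unit_monomial (i, m))) j =
        (\<Sum>i<length bs. if i = j then (\<Sum>m\<in>mkeys (F j). Poly_Mapping.single m (coef (F j) m)) else 0)"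
      unfolding sum_fun_apply
      by (rule sum.cong) (auto simp: scalef_def unit_monomial_def scale_def mult_single)
    also have "\<dots> = (if j < length bs then F j else 0)"
      using mpoly_sum_single[of "mkeys (F j)" "F j"] by simp
    also have "\<dots> = F j" using assms by (auto simp: grade_def)
    finally show "F j = (\<Sum>i<length bs. \<Sum>m\<in>mkeys (F i). scalef (coef (F i) m) (unit_monomial (i, m))) j" by simp
  qed
  moreover have "\<dots> \<in> mf.span (unit_monomial ` grade_index bs t)"
    by (intro mf.span_sum mf.span_scale mf.span_base imageI)
      (use assms in \<open>auto simp: grade_def grade_index_def homogeneous_def\<close>)
  ultimately show ?thesis by simp
qed

lemma dim_grade:
  "mf.dim (grade bs t :: (nat \<Rightarrow> ('v::finite, 'k::field) mpoly) set) = (\<Sum>i<length bs. cb (CARD('v) - 1) (t - bs ! i))"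
proof -
  let ?I = "grade_index bs t :: (nat \<times> ('v \<Rightarrow>\<^sub>0 nat)) set"
  have "mf.dim (grade bs t :: (nat \<Rightarrow> ('v, 'k) mpoly) set) = card ?I"
  proof (rule mf.dim_eq_card_family[where e = unit_monomial, OF finite_grade_index])
    fix c :: "nat \<times> ('v \<Rightarrow>\<^sub>0 nat) \<Rightarrow> 'k"
    assume c: "(\<Sum>i\<in>?I. scalef (c i) (unit_monomial i)) = 0"
    show "\<forall>i\<in>?I. c i = 0"
    proof
      fix jm assume jm: "jm \<in> ?I"
      obtain j m where e: "jm = (j, m)" by (cases jm)
      have "0 = coef ((\<Sum>i\<in>?I. scalef (c i) (unit_monomial i)) j) m" using c by (simp add: zero_fun_def)
      also have "\<dots> = (\<Sum>i\<in>?I. if i = jm then c jm else 0)"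
        unfolding sum_fun_apply lookup_sum
        by (rule sum.cong) (auto simp: e scalef_def unit_monomial_def scale_def mult_single lookup_single when_def split: if_splits)
      also have "\<dots> = c jm" using jm by (simp add: finite_grade_index)
      finally show "c jm = 0" by simp
    qed
  next
    show "(unit_monomial i :: nat \<Rightarrow> ('v, 'k) mpoly) \<in> grade bs t" if "i \<in> ?I" for i
      using that by (auto simp: grade_index_def grade_def unit_monomial_def homogeneous_iff lookup_single when_def)
  qed (rule grade_span)
  then show ?thesis by (simp add: card_grade_index)
qed

lemma subspace_grade: "mf.subspace (grade bs t)"
  unfolding mf.subspace_def
  by (auto simp: grade_def zero_fun_def plus_fun_def scalef_def scale_cst intro: homogeneous_add homogeneous_cst_mult)

lemma homogeneous_span: "{p. homogeneous t p} \<subseteq> mp.span ((\<lambda>m. Poly_Mapping.single m 1) ` {m. int (mon_degree m) = t})"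
proof
  fix p assume "p \<in> {p. homogeneous t p}"
  then have "mkeys p \<subseteq> {m. int (mon_degree m) = t}" by (auto simp: homogeneous_def)
  then have "(\<Sum>m\<in>mkeys p. scale (coef p m) (Poly_Mapping.single m 1)) \<in>
      mp.span ((\<lambda>m. Poly_Mapping.single m 1) ` {m. int (mon_degree m) = t})"
    by (intro mp.span_sum mp.span_scale mp.span_base imageI) auto
  moreover have "p = (\<Sum>m\<in>mkeys p. scale (coef p m) (Poly_Mapping.single m 1))"
    using mpoly_sum_single[of "mkeys p" p] by (simp add: scale_def mult_single)
  ultimately show "p \<in> mp.span ((\<lambda>m. Poly_Mapping.single m 1) ` {m. int (mon_degree m) = t})" by simp
qed

lemma finite_homogeneous_basis: "finite ((\<lambda>m. Poly_Mapping.single m 1) ` {m :: 'v::finite \<Rightarrow>\<^sub>0 nat. int (mon_degree m) = t})"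
  by (intro finite_imageI card_monomials_of_degree)

lemma dim_homogeneous_le:
  assumes "V \<subseteq> W" "W \<subseteq> {p. homogeneous t p}" shows "mp.dim V \<le> mp.dim W"
  by (rule mp.dim_subset_finite[OF assms(1) order_trans[OF assms(2) homogeneous_span] finite_homogeneous_basis])

section \<open>Graded matrices as maps of graded vector spaces\<close>

definition lin :: "('v::finite, 'k::field) mpoly mat \<Rightarrow> (nat \<Rightarrow> ('v, 'k) mpoly) \<Rightarrow> nat \<Rightarrow> ('v, 'k) mpoly" where
  "lin A F = (\<lambda>i. if i < dim_row A then (\<Sum>j<dim_col A. A $$ (i, j) * F j) else 0)"

lemma lin_add: "lin A (F + G) = lin A F + lin A G"
  by (auto simp: lin_def plus_fun_def fun_eq_iff distrib_left sum.distrib)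

lemma lin_scalef: "lin A (scalef c F) = scalef c (lin A F)"
  by (auto simp: lin_def scalef_def fun_eq_iff scale_cst sum_distrib_left ac_simps)

lemma lin_grade:
  assumes "graded_matrix b a A" "F \<in> grade b t" shows "lin A F \<in> grade a t"
proof -
  have "homogeneous (t - a ! i) (\<Sum>j<length b. A $$ (i, j) * F j)" if "i < length a" for i
  proof (rule homogeneous_sum)
    fix j assume "j \<in> {..<length b}"
    then have "homogeneous (b ! j - a ! i) (A $$ (i, j))" "homogeneous (t - b ! j) (F j)"
      using assms that by (auto simp: graded_matrix_def grade_def)
    from homogeneous_mult[OF this] show "homogeneous (t - a ! i) (A $$ (i, j) * F j)" by simp
  qed
  then show ?thesis using assms by (auto simp: lin_def grade_def graded_matrix_def)
qed

definition component :: "int list \<Rightarrow> int \<Rightarrow> (nat \<Rightarrow> ('v::finite, 'k::field) mpoly) \<Rightarrow> nat \<Rightarrow> ('v, 'k) mpoly" where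
  "component bs t F = (\<lambda>i. if i < length bs then hc (t - bs ! i) (F i) else 0)"

lemma component_grade: "component bs t F \<in> grade bs t"
  by (simp add: component_def grade_def)

lemma component_id: "F \<in> grade bs t \<Longrightarrow> component bs t F = F"
  by (auto simp: component_def grade_def fun_eq_iff homogeneous_iff_hc not_less)

text \<open>An arbitrary preimage under a graded matrix may thus be replaced by its component of the
  right degree, which turns exactness of modules into exactness in every degree.\<close>

lemma lin_component:
  assumes "graded_matrix b a A" shows "lin A (component b t F) = component a t (lin A F)"
proof
  fix i
  have d: "dim_row A = length a" "dim_col A = length b" using assms by (auto simp: graded_matrix_def)
  show "lin A (component b t F) i = component a t (lin A F) i"
  proof (cases "i < length a")
    case True
    have "hc (t - a ! i) (A $$ (i, j) * F j) = A $$ (i, j) * hc (t - b ! j) (F j)" if "j < length b" for j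
      using hc_mult[of "b ! j - a ! i" "A $$ (i, j)" "t - a ! i" "F j"] assms that True by (simp add: graded_matrix_def)
    then show ?thesis using True by (simp add: lin_def component_def d hc_sum)
  qed (simp add: lin_def component_def d)
qed

definition vfun :: "'a::zero vec \<Rightarrow> nat \<Rightarrow> 'a" where
  "vfun v = (\<lambda>i. if i < dim_vec v then v $ i else 0)"

lemma vfun_vec: "(\<And>i. i \<ge> n \<Longrightarrow> F i = 0) \<Longrightarrow> vfun (vec n F) = F"
  by (auto simp: vfun_def fun_eq_iff)

lemma vfun_mult:
  assumes "dim_vec v = dim_col A" shows "vfun (A *\<^sub>v v) = lin A (vfun v)"
  using assms by (auto simp: vfun_def lin_def fun_eq_iff scalar_prod_def atLeast0LessThan intro!: sum.cong)

lemma vfun_inject: "dim_vec v = dim_vec w \<Longrightarrow> vfun v = vfun w \<longleftrightarrow> v = w"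
  by (auto simp: vfun_def fun_eq_iff intro!: eq_vecI)

lemma kernel_image_grade:
  assumes A: "graded_matrix b a A" and B: "graded_matrix c b B" and ex: "mat_kernel A = mat_image B"
  shows "{F \<in> grade b t. lin A F = 0} = lin B ` grade c t"
proof -
  have dA: "dim_row A = length a" "dim_col A = length b" and dB: "dim_row B = length b" "dim_col B = length c"
    using A B by (auto simp: graded_matrix_def)
  show ?thesis
  proof (intro equalityI subsetI)
    fix F assume F: "F \<in> {F \<in> grade b t. lin A F = 0}"
    let ?v = "vec (length b) F"
    have vF: "vfun ?v = F" by (rule vfun_vec) (use F in \<open>auto simp: grade_def\<close>)
    have "vfun (A *\<^sub>v ?v) = lin A F" using vfun_mult[of ?v A] dA by (simp add: vF)
    also have "\<dots> = vfun (0\<^sub>v (dim_row A))" using F by (auto simp: vfun_def zero_fun_def)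
    finally have "A *\<^sub>v ?v = 0\<^sub>v (dim_row A)" by (subst (asm) vfun_inject) simp_all
    then have "?v \<in> mat_image B" unfolding ex[symmetric] using dA by (simp add: mat_kernel_def)
    then obtain w where w: "w \<in> carrier_vec (dim_col B)" "?v = B *\<^sub>v w" by (auto simp: mat_image_def)
    have "F = lin B (vfun w)" using vfun_mult[of w B] w vF by simp
    then have "F = component b t (lin B (vfun w))" using F component_id[of F b t] by simp
    also have "\<dots> = lin B (component c t (vfun w))" by (rule lin_component[OF B, symmetric])
    finally show "F \<in> lin B ` grade c t" using component_grade by blast
  next
    fix F assume "F \<in> lin B ` grade c t"
    then obtain G where G: "F = lin B G" "G \<in> grade c t" by blast
    let ?w = "vec (length c) G"
    have wG: "vfun ?w = G" by (rule vfun_vec) (use G in \<open>auto simp: grade_def\<close>)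
    have "B *\<^sub>v ?w \<in> mat_kernel A" unfolding ex mat_image_def using dB by auto
    then have "A *\<^sub>v (B *\<^sub>v ?w) = 0\<^sub>v (dim_row A)" by (simp add: mat_kernel_def)
    moreover have "vfun (A *\<^sub>v (B *\<^sub>v ?w)) = lin A F"
      using vfun_mult[of "B *\<^sub>v ?w" A] vfun_mult[of ?w B] dA dB by (simp add: wG G)
    ultimately have "lin A F = 0" by (metis (no_types, lifting) ext index_zero_vec(1,2) vfun_def zero_fun_def)
    then show "F \<in> {F \<in> grade b t. lin A F = 0}" using lin_grade[OF B G(2)] G(1) by simp
  qed
qed

lemma dim_lin_image:
  assumes "V \<subseteq> grade b t" "mf.subspace V"
  shows "mf.dim V = mf.dim (lin A ` V) + mf.dim {F \<in> V. lin A F = 0}"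
proof (rule mff.rank_nullity_on[OF assms(2)])
  show "V \<subseteq> mf.span (unit_monomial ` grade_index b t)" using assms(1) grade_span by blast
  show "finite (unit_monomial ` grade_index b t)" by (intro finite_imageI finite_grade_index)
qed (simp_all add: lin_add lin_scalef)

section \<open>Hilbert functions and multiplicities\<close>

lemma cb_Suc: "cb (Suc m) t = cb (Suc m) (t - 1) + cb m t"
proof -
  consider "t < 0" | "t = 0" | "t > 0" by linarith
  then show ?thesis
  proof cases
    case 3
    define k where "k = nat (t - 1)"
    have "nat t = Suc k" "nat (t - 1) = k" using 3 by (auto simp: k_def)
    then show ?thesis using 3 by (simp add: cb_def)
  qed (simp_all add: cb_def)
qed

lemma cb_mono: "s \<le> t \<Longrightarrow> cb m s \<le> cb m t"
  by (auto simp: cb_def intro!: binomial_right_mono nat_mono)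

lemma cb_diff_bounds: "int (cb (Suc m) t) - int (cb (Suc m) (t - int a)) \<in> {0..int a * int (cb m t)}"
proof (induct a)
  case (Suc a)
  have "int (cb (Suc m) (t - int a)) = int (cb (Suc m) (t - int (Suc a))) + int (cb m (t - int a))"
    using cb_Suc[of m "t - int a"] by (simp add: algebra_simps)
  moreover have "int (cb m (t - int a)) \<le> int (cb m t)" by (simp add: cb_mono)
  ultimately show ?case using Suc by (simp add: algebra_simps)
qed simp

text \<open>A discrete Taylor formula with remainder: \<open>cb (Suc m)\<close> and
  \<open>cb m\<close> are the first and second backward differences of
  \<open>cb (Suc (Suc m))\<close>.\<close>

lemma cb_second_order:
  "int (cb (Suc (Suc m)) (t - int a)) - int (cb (Suc (Suc m)) t) + int a * int (cb (Suc m) t)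
    \<in> {0..(int a)\<^sup>2 * int (cb m t)}"
proof (induct a)
  case (Suc a)
  have "int (cb (Suc (Suc m)) (t - int a)) = int (cb (Suc (Suc m)) (t - int (Suc a))) + int (cb (Suc m) (t - int a))"
    using cb_Suc[of "Suc m" "t - int a"] by (simp add: algebra_simps)
  moreover have "int a * int (cb m t) \<le> (2 * int a + 1) * int (cb m t)" by (intro mult_right_mono) auto
  moreover have "(int (Suc a))\<^sup>2 * int (cb m t) = (int a)\<^sup>2 * int (cb m t) + (2 * int a + 1) * int (cb m t)"
    by (simp add: power2_eq_square algebra_simps)
  ultimately show ?case using Suc cb_diff_bounds[of m t a] by (simp add: algebra_simps)
qed simp

text \<open>The quotient of the two binomials is \<open>(t + m + 1) / (m + 1)\<close>, which exceeds
  every bound.\<close>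

lemma cb_quotient_unbounded:
  assumes "\<And>t :: nat. E * int (cb (Suc m) (int t)) \<le> M * int (cb m (int t))" shows "E \<le> 0"
proof (rule ccontr)
  assume "\<not> E \<le> 0"
  then have E: "E \<ge> 1" by simp
  define t where "t = nat (M * int (Suc m))"
  have "Suc m * cb (Suc m) (int t) = (t + Suc m) * cb m (int t)"
    using Suc_times_binomial_eq[of "t + m" m] by (simp add: cb_def algebra_simps)
  then have eq: "int (Suc m) * int (cb (Suc m) (int t)) = int (t + Suc m) * int (cb m (int t))"
    by (metis of_nat_mult)
  have pos: "int (cb m (int t)) > 0" by (simp add: cb_def)
  have "int (cb (Suc m) (int t)) \<le> E * int (cb (Suc m) (int t))" using E by (simp add: mult_le_cancel_right1)
  also have "\<dots> \<le> M * int (cb m (int t))" by (rule assms)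
  finally have "int (Suc m) * int (cb (Suc m) (int t)) \<le> int (Suc m) * (M * int (cb m (int t)))"
    by (intro mult_left_mono) auto
  then have "int (t + Suc m) * int (cb m (int t)) \<le> (M * int (Suc m)) * int (cb m (int t))"
    unfolding eq by (simp add: ac_simps)
  then have "int (t + Suc m) \<le> M * int (Suc m)" using pos by simp
  then show False unfolding t_def by linarith
qed

text \<open>
  The numerator \<open>\<Sum>\<^sub>a z\<^sup>a - \<Sum>\<^sub>b z\<^sup>b\<close> of the Hilbert series vanishes to second order at \<open>z = 1\<close>,
  hence so does its derivative.
\<close>

lemma cb_combination_first_order:
  fixes as bs :: "nat list"
  assumes len: "length as = length bs"
    and bound: "\<And>t :: nat. \<bar>(\<Sum>a\<leftarrow>as. int (cb (Suc (Suc m)) (int t - int a)))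
      - (\<Sum>b\<leftarrow>bs. int (cb (Suc (Suc m)) (int t - int b)))\<bar> \<le> K * int (cb m (int t))"
  shows "sum_list as = sum_list bs"
proof -
  have *: "(\<Sum>a\<leftarrow>as. int (cb (Suc (Suc m)) (t - int a))) - int (length as) * int (cb (Suc (Suc m)) t)
      + int (sum_list as) * int (cb (Suc m) t) \<in> {0..int (\<Sum>a\<leftarrow>as. a\<^sup>2) * int (cb m t)}" for t and as :: "nat list"
  proof (induct as)
    case (Cons a as)
    then show ?case using cb_second_order[of m t a] by (simp add: algebra_simps)
  qed simp
  \<comment> \<open>The given bound and the two Taylor remainders are all of the order of
    \<open>cb m\<close>. What is left is the difference of the sums times \<open>cb (Suc m)\<close>,
    which grows faster unless the difference is zero.\<close>
  define M where "M = K + int (\<Sum>a\<leftarrow>as. a\<^sup>2) + int (\<Sum>b\<leftarrow>bs. b\<^sup>2)"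
  have le: "(int (sum_list as) - int (sum_list bs)) * int (cb (Suc m) (int t)) \<le> M * int (cb m (int t))"
    "(int (sum_list bs) - int (sum_list as)) * int (cb (Suc m) (int t)) \<le> M * int (cb m (int t))" for t :: nat
    using *[of "int t" as] *[of "int t" bs] bound[of t] len by (auto simp: M_def algebra_simps abs_le_iff)
  have "int (sum_list as) - int (sum_list bs) \<le> 0" "int (sum_list bs) - int (sum_list as) \<le> 0"
    by (rule cb_quotient_unbounded[OF le(1)], rule cb_quotient_unbounded[OF le(2)])
  then show ?thesis by simp
qed

definition binomial_poly :: "nat \<Rightarrow> rat poly" where
  "binomial_poly m = Polynomial.smult (1 / fact m) (\<Prod>i<m. [:of_nat i + 1, 1:])"

lemma poly_binomial_poly: "poly (binomial_poly m) (of_nat t) = of_nat ((t + m) choose m)"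
proof -
  have "(of_nat ((t + m) choose m) :: rat) = of_nat (t + m) gchoose m" by (simp add: binomial_gbinomial)
  also have "\<dots> = pochhammer (of_nat t + 1) m / fact m" by (simp add: gbinomial_pochhammer')
  also have "pochhammer (of_nat t + 1 :: rat) m = (\<Prod>i<m. of_nat i + 1 + of_nat t)"
    by (simp add: pochhammer_prod atLeast0LessThan ac_simps)
  finally show ?thesis by (simp add: binomial_poly_def poly_prod ac_simps)
qed

lemma binomial_poly_props: "degree (binomial_poly m) = m" "coeff (binomial_poly m) m = 1 / fact m"
proof -
  have "degree (\<Prod>i<m. [:of_nat i + 1, 1 :: rat:]) = m \<and> lead_coeff (\<Prod>i<m. [:of_nat i + 1, 1 :: rat:]) = 1"
    by (subst degree_prod_eq_sum_degree) (auto simp: lead_coeff_prod)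
  then show "degree (binomial_poly m) = m" "coeff (binomial_poly m) m = 1 / fact m"
    by (auto simp: binomial_poly_def)
qed

lemma poly_eq_of_eventually:
  fixes g h :: "rat poly"
  assumes "\<forall>\<^sub>F t in sequentially. poly g (of_nat t) = poly h (of_nat t)" shows "g = h"
proof (rule ccontr)
  assume "g \<noteq> h"
  then have fin: "finite {x. poly (g - h) x = 0}" by (intro poly_roots_finite) simp
  obtain N where N: "\<And>t. t \<ge> N \<Longrightarrow> poly g (of_nat t) = poly h (of_nat t)"
    using assms by (auto simp: eventually_sequentially)
  have "(of_nat :: nat \<Rightarrow> rat) ` {N..} \<subseteq> {x. poly (g - h) x = 0}" using N by auto
  then have "finite ((of_nat :: nat \<Rightarrow> rat) ` {N..})" using fin by (rule finite_subset)
  then have "finite {N..}" by (rule finite_imageD) (simp add: inj_on_def)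
  then show False by (simp add: infinite_Ici)
qed

text \<open>The \<open>q j\<close> are the coefficients of the numerator of the Hilbert series over
  \<open>(1 - z) ^ (m + 1)\<close>, and their sum is its value at 1. As this is nonzero, the Hilbert
  polynomial has degree exactly \<open>m\<close> and the finite length branch of the definition does
  not occur.\<close>

lemma multiplicity_from_hilbert_function:
  fixes I :: "('v::finite, 'k::field) mpoly set" and q :: "nat \<Rightarrow> int"
  assumes hf: "\<And>t. int (hilbert_function I t) = (\<Sum>j<l. q j * int (cb m (int t - int j)))"
    and q: "(\<Sum>j<l. q j) \<noteq> 0"
  shows "multiplicity_quotient I = of_int (\<Sum>j<l. q j)"
proof -
  define s where "s j = pcompose (binomial_poly m) [:- of_nat j, 1:]" for j :: nat
  define h where "h = (\<Sum>j<l. Polynomial.smult (of_int (q j)) (s j))"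
  have s: "degree (s j) = m" "coeff (s j) m = 1 / fact m" for j
  proof -
    show d: "degree (s j) = m" by (simp add: s_def degree_pcompose binomial_poly_props)
    have "lead_coeff (s j) = lead_coeff (binomial_poly m) * 1 ^ degree (binomial_poly m)"
      unfolding s_def by (subst lead_coeff_comp) auto
    then show "coeff (s j) m = 1 / fact m" by (simp add: d binomial_poly_props)
  qed
  have ch: "coeff h m = of_int (\<Sum>j<l. q j) / fact m"
    by (simp add: h_def coeff_sum s sum_divide_distrib)
  have "degree h \<le> m" unfolding h_def
    by (rule degree_sum_le) (auto intro: order_trans[OF degree_smult_le] simp: s)
  moreover have nz: "coeff h m \<noteq> 0" using q unfolding ch by (metis divide_eq_0_iff fact_nonzero of_int_eq_0_iff)
  ultimately have dh: "degree h = m" by (simp add: antisym le_degree)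
  \<comment> \<open>From \<open>t = l\<close> on all arguments of \<open>cb\<close> are nonnegative,
    where it agrees with a polynomial.\<close>
  have ev: "of_nat (hilbert_function I t) = poly h (of_nat t)" if "t \<ge> l" for t
  proof -
    have ps: "poly (s j) (of_nat t) = of_nat (cb m (int t - int j))" if "j < l" for j
    proof -
      have e: "(of_nat t - of_nat j :: rat) = of_nat (t - j)" "int t - int j = int (t - j)"
        using that \<open>t \<ge> l\<close> by (simp_all add: of_nat_diff)
      have "poly (s j) (of_nat t) = poly (binomial_poly m) (of_nat (t - j))"
        unfolding s_def poly_pcompose e(1)[symmetric] by simp
      then show ?thesis unfolding e(2) by (simp add: poly_binomial_poly cb_def)
    qed
    have "(of_nat (hilbert_function I t) :: rat) = of_int (int (hilbert_function I t))" by simp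
    also have "\<dots> = (\<Sum>j<l. of_int (q j) * of_nat (cb m (int t - int j)))" unfolding hf by simp
    also have "\<dots> = poly h (of_nat t)" by (simp add: h_def poly_sum ps)
    finally show ?thesis .
  qed
  have "hilbert_polynomial I = h" unfolding hilbert_polynomial_def
  proof (rule the_equality)
    show "\<forall>\<^sub>F t in sequentially. of_nat (hilbert_function I t) = poly h (of_nat t)"
      unfolding eventually_sequentially using ev by blast
    fix g :: "rat poly" assume "\<forall>\<^sub>F t in sequentially. of_nat (hilbert_function I t) = poly g (of_nat t)"
    then have "\<forall>\<^sub>F t in sequentially. poly g (of_nat t) = poly h (of_nat t)"
    proof (rule eventually_mp[rotated])
      show "\<forall>\<^sub>F t in sequentially. of_nat (hilbert_function I t) = poly g (of_nat t) \<longrightarrow> poly g (of_nat t) = poly h (of_nat t)"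
        unfolding eventually_sequentially using ev by metis
    qed
    then show "g = h" by (rule poly_eq_of_eventually)
  qed
  moreover have "h \<noteq> 0" using nz by auto
  ultimately show ?thesis
    using dh by (simp add: multiplicity_quotient_def Let_def ch)
qed

section \<open>Ideals generated by forms\<close>

definition row_matrix :: "'a list \<Rightarrow> 'a mat" where
  "row_matrix fs = mat 1 (length fs) (\<lambda>(i, j). fs ! j)"

lemma lin_row_matrix: "lin (row_matrix fs) F 0 = (\<Sum>j<length fs. fs ! j * F j)"
  by (simp add: lin_def row_matrix_def)

lemma lin_eq_0_iff_single_row:
  "dim_row A = 1 \<Longrightarrow> lin A F = 0 \<longleftrightarrow> lin A F 0 = 0"
  by (auto simp: lin_def zero_fun_def fun_eq_iff)

lemma graded_row_matrix:
  assumes "\<And>f. f \<in> set fs \<Longrightarrow> homogeneous d f"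
  shows "graded_matrix (replicate (length fs) d) [0] (row_matrix fs)"
  using assms by (auto simp: graded_matrix_def row_matrix_def)

lemma ideal_gen_set:
  "ideal_gen (set fs) = {\<Sum>j<length fs. fs ! j * F j | F. True}" (is "?L = ?R")
proof
  have mem: "(\<Sum>j<length fs. fs ! j * F j) \<in> ?R" for F by blast
  have idl: "is_ideal ?R" unfolding is_ideal_iff
  proof (intro conjI ballI allI)
    show "0 \<in> ?R" using mem[of "\<lambda>_. 0"] by simp
    fix x assume "x \<in> ?R"
    then obtain F where F: "x = (\<Sum>j<length fs. fs ! j * F j)" by blast
    have "c * x = (\<Sum>j<length fs. fs ! j * (c * F j))" for c unfolding F sum_distrib_left by (simp add: ac_simps)
    then show "c * x \<in> ?R" for c using mem[of "\<lambda>j. c * F j"] by simp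
    fix y assume "y \<in> ?R"
    then obtain G where G: "y = (\<Sum>j<length fs. fs ! j * G j)" by blast
    have "x + y = (\<Sum>j<length fs. fs ! j * (F j + G j))" unfolding F G by (simp add: distrib_left sum.distrib)
    then show "x + y \<in> ?R" using mem[of "\<lambda>j. F j + G j"] by simp
  qed
  have fsR: "fs ! i \<in> ?R" if "i < length fs" for i
  proof -
    have "fs ! i = (\<Sum>j<length fs. fs ! j * (if j = i then 1 else 0))" 
    proof -
      have "(\<Sum>j<length fs. fs ! j * (if j = i then 1 else 0)) = (\<Sum>j<length fs. if j = i then fs ! j else 0)"
        by (rule sum.cong) auto
      then show ?thesis using that by simp
    qed
    then show ?thesis using mem[of "\<lambda>j. if j = i then 1 else 0"] by simp
  qed
  have "set fs \<subseteq> ?R"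
  proof
    fix x assume "x \<in> set fs"
    then obtain i where "i < length fs" "x = fs ! i" by (auto simp: in_set_conv_nth)
    then show "x \<in> ?R" using fsR[of i] by (simp only:)
  qed
  then show "?L \<subseteq> ?R" using idl by (rule Modules.module.span_minimal[OF module_mult])
  show "?R \<subseteq> ?L"
  proof clarify
    fix F
    show "(\<Sum>j<length fs. fs ! j * F j) \<in> ?L"
    proof (rule Modules.module.span_sum[OF module_mult])
      fix j assume "j \<in> {..<length fs}"
      then have "fs ! j \<in> ?L" by (intro Modules.module.span_base[OF module_mult]) simp
      then have "F j * fs ! j \<in> ?L" by (rule Modules.module.span_scale[OF module_mult])
      then show "fs ! j * F j \<in> ?L" by (simp add: mult.commute)
    qed
  qed
qed

lemma dim_row_image:
  fixes A :: "('v::finite, 'k::field) mpoly mat"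
  assumes A: "graded_matrix b [0] A" and J: "J = {lin A F 0 | F. True}"
  shows "{p \<in> J. homogeneous t p} = (\<lambda>F. lin A F 0) ` grade b t"
    and "mp.dim {p \<in> J. homogeneous t p} + mf.dim {F \<in> grade b t. lin A F = 0} = mf.dim (grade b t :: (nat \<Rightarrow> ('v, 'k) mpoly) set)"
proof -
  show im: "{p \<in> J. homogeneous t p} = (\<lambda>F. lin A F 0) ` grade b t"
  proof (intro equalityI subsetI)
    fix p assume p: "p \<in> {p \<in> J. homogeneous t p}"
    then obtain F where F: "p = lin A F 0" using J by blast
    have "p = component [0] t (lin A F) 0"
      using p by (simp add: F[symmetric] component_def homogeneous_iff_hc)
    also have "\<dots> = lin A (component b t F) 0" by (simp add: lin_component[OF A])
    finally show "p \<in> (\<lambda>F. lin A F 0) ` grade b t" using component_grade by blast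
  next
    fix p assume "p \<in> (\<lambda>F. lin A F 0) ` grade b t"
    then obtain F where F: "p = lin A F 0" "F \<in> grade b t" by blast
    then have "lin A F \<in> grade [0] t" using lin_grade[OF A] by blast
    then show "p \<in> {p \<in> J. homogeneous t p}" using F(1) by (auto simp: J grade_def)
  qed
  have d: "dim_row A = 1" using A by (auto simp: graded_matrix_def)
  have "mf.dim (grade b t :: (nat \<Rightarrow> ('v, 'k) mpoly) set) = mp.dim ((\<lambda>F. lin A F 0) ` grade b t) + mf.dim {F \<in> grade b t. lin A F 0 = 0}"
  proof (rule mfp.rank_nullity_on[where f = "\<lambda>F. lin A F 0", OF subspace_grade])
    show "grade b t \<subseteq> mf.span (unit_monomial ` grade_index b t)" using grade_span by blast
    show "finite (unit_monomial ` grade_index b t)" by (intro finite_imageI finite_grade_index)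
    show "lin A (x + y) 0 = lin A x 0 + lin A y 0" for x y :: "nat \<Rightarrow> ('v, 'k) mpoly" unfolding lin_add by (simp add: plus_fun_def)
    show "lin A (scalef c x) 0 = scale c (lin A x 0)" for c and x :: "nat \<Rightarrow> ('v, 'k) mpoly" unfolding lin_scalef by (simp add: scalef_def)
  qed
  then show "mp.dim {p \<in> J. homogeneous t p} + mf.dim {F \<in> grade b t. lin A F = 0} = mf.dim (grade b t :: (nat \<Rightarrow> ('v, 'k) mpoly) set)"
    unfolding im lin_eq_0_iff_single_row[OF d] by simp
qed

lemma mat_image_first: "dim_row A = 1 \<Longrightarrow> (\<lambda>v. v $ 0) ` mat_image A = {lin A F 0 | F. True}"
proof (intro equalityI subsetI)
  fix p assume d: "dim_row A = 1" and "p \<in> (\<lambda>v. v $ 0) ` mat_image A"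
  then obtain v where v: "p = (A *\<^sub>v v) $ 0" "dim_vec v = dim_col A" by (auto simp: mat_image_def)
  have "p = vfun (A *\<^sub>v v) 0" using d by (simp add: v vfun_def)
  then have "p = lin A (vfun v) 0" by (simp add: vfun_mult[OF v(2)])
  then show "p \<in> {lin A F 0 | F. True}" by blast
next
  fix p assume d: "dim_row A = 1" and "p \<in> {lin A F 0 | F. True}"
  then obtain F where F: "p = lin A F 0" by blast
  let ?v = "vec (dim_col A) F"
  have "lin A F 0 = (A *\<^sub>v ?v) $ 0" using d by (simp add: lin_def scalar_prod_def atLeast0LessThan)
  then show "p \<in> (\<lambda>v. v $ 0) ` mat_image A" using F by (auto simp: mat_image_def)
qed

text \<open>Rank and nullity for the three maps. The kernel of \<open>A0\<close> is kept as an
  intermediate term because it is the module of syzygies.\<close>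

lemma dim_resolved_ideal:
  fixes J :: "('v::finite, 'k::field) mpoly set"
  assumes res: "graded_free_resolution J [a0, a1, a2] [A0, A1, A2]"
  shows "mf.dim {F \<in> grade a0 t. lin A0 F = 0} + mf.dim (grade a2 t :: (nat \<Rightarrow> ('v, 'k) mpoly) set)
      = mf.dim (grade a1 t :: (nat \<Rightarrow> ('v, 'k) mpoly) set)"
    and "mp.dim {p \<in> J. homogeneous t p} + mf.dim {F \<in> grade a0 t. lin A0 F = 0}
      = mf.dim (grade a0 t :: (nat \<Rightarrow> ('v, 'k) mpoly) set)"
proof -
  have all: "\<forall>i<3. graded_matrix ([a0, a1, a2] ! i) (([0] # [a0, a1, a2]) ! i) ([A0, A1, A2] ! i)"
    "\<forall>i. Suc i < 3 \<longrightarrow> mat_kernel ([A0, A1, A2] ! i) = mat_image ([A0, A1, A2] ! Suc i)"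
    using res by (auto simp: graded_free_resolution_def)
  have g: "graded_matrix a0 [0] A0" "graded_matrix a1 a0 A1" "graded_matrix a2 a1 A2"
    using all(1)[rule_format, of 0] all(1)[rule_format, of 1] all(1)[rule_format, of 2] by simp_all
  have ex: "mat_kernel A0 = mat_image A1" "mat_kernel A1 = mat_image A2"
    using all(2)[rule_format, of 0] all(2)[rule_format, of 1] by simp_all
  have k: "mat_kernel A2 = {0\<^sub>v (length a2)}" and J: "J = (\<lambda>v. v $ 0) ` mat_image A0"
    using res by (auto simp: graded_free_resolution_def)
  have d0: "dim_row A0 = 1" using g(1) by (auto simp: graded_matrix_def)
  show "mp.dim {p \<in> J. homogeneous t p} + mf.dim {F \<in> grade a0 t. lin A0 F = 0} = mf.dim (grade a0 t :: (nat \<Rightarrow> ('v, 'k) mpoly) set)"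
    by (rule dim_row_image(2)[OF g(1)]) (simp add: J mat_image_first[OF d0])
  have "mf.dim (grade a1 t :: (nat \<Rightarrow> ('v, 'k) mpoly) set) = mf.dim (lin A1 ` grade a1 t) + mf.dim {F \<in> grade a1 t. lin A1 F = 0}"
    by (rule dim_lin_image[OF subset_refl subspace_grade])
  moreover have "mf.dim (grade a2 t :: (nat \<Rightarrow> ('v, 'k) mpoly) set) = mf.dim (lin A2 ` grade a2 t) + mf.dim {F \<in> grade a2 t. lin A2 F = 0}"
    by (rule dim_lin_image[OF subset_refl subspace_grade])
  moreover have "{F \<in> grade a2 t. lin A2 F = 0} \<subseteq> {0}"
  proof
    fix F assume F: "F \<in> {F \<in> grade a2 t. lin A2 F = 0}"
    let ?v = "vec (length a2) F"
    have dA: "dim_row A2 = length a1" "dim_col A2 = length a2" using g(3) by (auto simp: graded_matrix_def)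
    have vF: "vfun ?v = F" by (rule vfun_vec) (use F in \<open>auto simp: grade_def\<close>)
    have "vfun (A2 *\<^sub>v ?v) = lin A2 F" using vfun_mult[of ?v A2] dA by (simp add: vF)
    also have "\<dots> = vfun (0\<^sub>v (dim_row A2))" using F by (auto simp: vfun_def zero_fun_def)
    finally have "A2 *\<^sub>v ?v = 0\<^sub>v (dim_row A2)" by (subst (asm) vfun_inject) simp_all
    then have "?v \<in> mat_kernel A2" using dA by (simp add: mat_kernel_def)
    then have "?v = 0\<^sub>v (length a2)" using k by blast
    then show "F \<in> {0}" using vF by (auto simp: vfun_def zero_fun_def)
  qed
  then have "mf.dim {F \<in> grade a2 t. lin A2 F = 0} = 0"
    using mf.dim_le_card[of "{F \<in> grade a2 t. lin A2 F = 0}" "{}"] by simp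
  ultimately show "mf.dim {F \<in> grade a0 t. lin A0 F = 0} + mf.dim (grade a2 t :: (nat \<Rightarrow> ('v, 'k) mpoly) set)
      = mf.dim (grade a1 t :: (nat \<Rightarrow> ('v, 'k) mpoly) set)"
    unfolding kernel_image_grade[OF g(1,2) ex(1)] kernel_image_grade[OF g(2,3) ex(2)] by simp
qed

text \<open>The additive form removes the truncated subtraction of the definition, which
  monotonicity of the dimension justifies.\<close>

lemma hilbert_function_add:
  fixes I :: "('v::finite, 'k::field) mpoly set"
  shows "hilbert_function I t + mp.dim {p \<in> I. homogeneous (int t) p} = cb (CARD('v) - 1) (int t)"
proof -
  have "mp.dim {p :: ('v, 'k) mpoly. homogeneous (int t) p} = card {m :: 'v \<Rightarrow>\<^sub>0 nat. int (mon_degree m) = int t}"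
  proof (rule mp.dim_eq_card_family[where e = "\<lambda>m. Poly_Mapping.single m 1"])
    show "finite {m :: 'v \<Rightarrow>\<^sub>0 nat. int (mon_degree m) = int t}" by (rule card_monomials_of_degree)
    fix c :: "('v \<Rightarrow>\<^sub>0 nat) \<Rightarrow> 'k"
    assume c: "(\<Sum>i\<in>{m. int (mon_degree m) = int t}. scale (c i) (Poly_Mapping.single i 1)) = 0"
    show "\<forall>i\<in>{m. int (mon_degree m) = int t}. c i = 0"
    proof
      fix m :: "'v \<Rightarrow>\<^sub>0 nat" assume m: "m \<in> {m. int (mon_degree m) = int t}"
      have "0 = coef (\<Sum>i\<in>{m. int (mon_degree m) = int t}. scale (c i) (Poly_Mapping.single i 1)) m" unfolding c by simp
      also have "\<dots> = (\<Sum>i\<in>{m. int (mon_degree m) = int t}. if i = m then c m else 0)"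
        unfolding lookup_sum by (rule sum.cong) (auto simp: scale_def mult_single lookup_single when_def)
      also have "\<dots> = c m" using m card_monomials_of_degree(1)[where ?'v = 'v, of "int t"] by (subst sum.delta) auto
      finally show "c m = 0" by simp
    qed
  next
    fix v :: "('v, 'k) mpoly" assume "v \<in> {p. homogeneous (int t) p}"
    then show "v \<in> mp.span ((\<lambda>m. Poly_Mapping.single m 1) ` {m. int (mon_degree m) = int t})"
      using homogeneous_span by blast
  qed (auto simp: homogeneous_def)
  then have d: "mp.dim {p :: ('v, 'k) mpoly. homogeneous (int t) p} = cb (CARD('v) - 1) (int t)"
    by (simp only: card_monomials_of_degree)
  have "mp.dim {p \<in> I. homogeneous (int t) p} \<le> mp.dim {p :: ('v, 'k) mpoly. homogeneous (int t) p}"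
    by (rule dim_homogeneous_le) auto
  then show ?thesis by (simp add: hilbert_function_def d)
qed

text \<open>The pair alone generates that much: coprimality leaves only the multiples of the Koszul
  relation \<open>(- g, f)\<close>, which sits in degree 6.\<close>

lemma coprime_pair_dim:
  fixes J :: "('v::finite, 'k::field) mpoly set"
  assumes fg: "coprime_set {f, g}" "f \<noteq> 0" "homogeneous 3 f" "homogeneous 3 g"
    and J: "is_ideal J" "f \<in> J" "g \<in> J"
  shows "2 * cb (CARD('v) - 1) (t - 3) \<le> mp.dim {p \<in> J. homogeneous t p} + cb (CARD('v) - 1) (t - 6)"
proof -
  let ?A = "row_matrix [f, g]"
  let ?I = "{lin ?A F 0 | F. True}"
  let ?B = "mat 2 1 (\<lambda>(i, j). if i = 0 then - g else f)"
  have "homogeneous 3 h" if "h \<in> set [f, g]" for h using that fg by auto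
  then have "graded_matrix (replicate (length [f, g]) 3) [0] ?A" by (rule graded_row_matrix)
  then have A: "graded_matrix [3, 3] [0] ?A" by simp
  have B: "graded_matrix [6] [3, 3] ?B"
    using fg by (auto simp: graded_matrix_def less_Suc_eq homogeneous_uminus)
  have IJ: "?I \<subseteq> J"
    using J unfolding is_ideal_iff lin_row_matrix by (auto simp: lessThan_Suc mult.commute[of f] mult.commute[of g])
  have "{F \<in> grade [3, 3] t. lin ?A F = 0} \<subseteq> lin ?B ` grade [6] t"
  proof
    fix F assume F: "F \<in> {F \<in> grade [3, 3] t. lin ?A F = 0}"
    then have e: "f * F 0 + g * F 1 = 0"
      using lin_row_matrix[of "[f, g]" F] by (simp add: zero_fun_def lessThan_Suc add.commute)
    then have e': "g * F 1 = f * (- F 0)" by (simp add: add_eq_0_iff)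
    then have "f dvd g * F 1" by simp
    then have "f dvd F 1" by (rule coprime_pair_dvd[OF fg(1,2)])
    then obtain w where w: "F 1 = f * w" by (elim dvdE)
    have h1: "homogeneous (t - 3) (F 1)" using F by (auto simp: grade_def)
    define w' where "w' = hc (t - 6) w"
    have "hc (t - 3) (f * w) = f * w'" using hc_mult[OF fg(3), of "t - 3" w] by (simp add: w'_def)
    then have F1: "F 1 = f * w'" using h1 w by (simp add: homogeneous_iff_hc)
    have "f * F 0 = f * (- g * w')" using e unfolding F1 by (simp add: add_eq_0_iff ac_simps)
    then have F0: "F 0 = - g * w'" using mpoly_mult_left_cancel[OF fg(2)] by blast
    define G where "G = (\<lambda>i :: nat. if i = 0 then w' else 0)"
    have "G \<in> grade [6] t" by (simp add: grade_def G_def w'_def)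
    moreover have "F = lin ?B G"
    proof
      fix i :: nat
      consider "i = 0" | "i = 1" | "i \<ge> 2" by linarith
      then show "F i = lin ?B G i"
        using F F0 F1 by cases (auto simp: lin_def G_def grade_def)
    qed
    ultimately show "F \<in> lin ?B ` grade [6] t" by blast
  qed
  moreover have "lin ?B ` grade [6] t \<subseteq> grade [3, 3] t" using lin_grade[OF B] by blast
  ultimately have "mf.dim {F \<in> grade [3, 3] t. lin ?A F = 0} \<le> mf.dim (lin ?B ` grade [6] t)"
    by (intro mf.dim_subset_finite[of _ _ "unit_monomial ` grade_index [3, 3] t"])
      (use grade_span finite_grade_index in blast)+
  also have "\<dots> \<le> mf.dim (grade [6] t :: (nat \<Rightarrow> ('v, 'k) mpoly) set)"
    using dim_lin_image[OF subset_refl subspace_grade, of "[6]" t ?B] by simp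
  also have "\<dots> = cb (CARD('v) - 1) (t - 6)" by (simp add: dim_grade)
  finally have "mf.dim {F \<in> grade [3, 3] t. lin ?A F = 0} \<le> cb (CARD('v) - 1) (t - 6)" .
  moreover have "mp.dim {p \<in> ?I. homogeneous t p} + mf.dim {F \<in> grade [3, 3] t. lin ?A F = 0} = mf.dim (grade [3, 3] t :: (nat \<Rightarrow> ('v, 'k) mpoly) set)"
    by (rule dim_row_image(2)[OF A refl])
  moreover have "mf.dim (grade [3, 3] t :: (nat \<Rightarrow> ('v, 'k) mpoly) set) = 2 * cb (CARD('v) - 1) (t - 3)"
    by (simp add: dim_grade lessThan_Suc)
  moreover have "mp.dim {p \<in> ?I. homogeneous t p} \<le> mp.dim {p \<in> J. homogeneous t p}"
    by (rule dim_homogeneous_le) (use IJ in auto)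
  ultimately show ?thesis by linarith
qed

text \<open>The left side is at most the second difference of \<open>cb (Suc (Suc m))\<close> with
  step 3, a sum of nine values of \<open>cb m\<close> at arguments up to \<open>t\<close>. Nine is
  the degree of a complete intersection of two cubics.\<close>

lemma coprime_pair_growth:
  fixes J :: "('v::finite, 'k::field) mpoly set"
  assumes fg: "coprime_set {f, g}" "f \<noteq> 0" "homogeneous 3 f" "homogeneous 3 g"
    and J: "is_ideal J" "f \<in> J" "g \<in> J" and n: "CARD('v) = m + 3"
  shows "int (cb (Suc (Suc m)) t) - int (mp.dim {p \<in> J. homogeneous t p}) \<le> 9 * int (cb m t)"
proof -
  have c1: "cb (Suc m) s \<le> cb (Suc m) (s - 3) + 3 * cb m s" for s
    using cb_diff_bounds[of m s 3] by simp
  have e: "cb (Suc (Suc m)) s = cb (Suc (Suc m)) (s - 1) + cb (Suc m) s" for s by (rule cb_Suc)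
  have e0: "cb (Suc (Suc m)) t = cb (Suc (Suc m)) (t - 3) + cb (Suc m) t + cb (Suc m) (t - 1) + cb (Suc m) (t - 2)"
    using e[of t] e[of "t - 1"] e[of "t - 2"] by simp
  have e3: "cb (Suc (Suc m)) (t - 3) = cb (Suc (Suc m)) (t - 6) + cb (Suc m) (t - 3) + cb (Suc m) (t - 4) + cb (Suc m) (t - 5)"
    using e[of "t - 3"] e[of "t - 4"] e[of "t - 5"] by simp
  have "2 * cb (Suc (Suc m)) (t - 3) \<le> mp.dim {p \<in> J. homogeneous t p} + cb (Suc (Suc m)) (t - 6)"
    using coprime_pair_dim[OF fg J, of t] n by simp
  moreover have "cb m (t - 1) \<le> cb m t" "cb m (t - 2) \<le> cb m t" by (simp_all add: cb_mono)
  ultimately show ?thesis using e0 e3 c1[of t] c1[of "t - 1"] c1[of "t - 2"] by simp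
qed

section \<open>The shifts of the resolution\<close>

text \<open>A prime factor of \<open>f1\<close> that divides the combination for two values of
  \<open>c\<close> divides \<open>f3\<close> and \<open>f2\<close> as well. So each of the finitely
  many prime factors excludes at most one \<open>c\<close>.\<close>

lemma ex_coprime_combination:
  fixes f1 f2 f3 :: "('v::finite, 'k::field) mpoly"
  assumes "infinite (UNIV :: 'k set)" "coprime_set {f1, f2, f3}" "f1 \<noteq> 0"
  obtains c where "coprime_set {f1, f2 + cst c * f3}"
proof -
  define bad where "bad d = {c. \<exists>p. prime_elem p \<and> p dvd d \<and> p dvd f2 + cst c * f3}" for d
  have "finite (bad d)" if "d dvd f1" for d
  proof -
    have "d \<noteq> 0" using that assms(3) by auto
    then show ?thesis using that
    proof (induct rule: prime_induct)
      case (unit u)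
      have "bad u = {}" unfolding bad_def using unit(1) by (auto dest: prime_elem_not_unit dvd_trans)
      then show ?case by simp
    next
      case (mult p g)
      have fg: "finite (bad g)" using mult(3,4) by (blast dest: dvd_mult_right)
      have pf: "p dvd f1" using mult(4) by (rule dvd_mult_left)
      define B where "B = {c. p dvd f2 + cst c * f3}"
      have "B \<subseteq> {c}" if c: "c \<in> B" for c
      proof
        fix c' assume c': "c' \<in> B"
        show "c' \<in> {c}"
        proof (rule ccontr)
          assume "c' \<notin> {c}"
          have "p dvd (f2 + cst c * f3) - (f2 + cst c' * f3)" using c c' by (intro dvd_diff) (auto simp: B_def)
          also have "(f2 + cst c * f3) - (f2 + cst c' * f3) = cst (c - c') * f3"
            by (simp add: cst.hom_minus algebra_simps)
          finally have "p dvd cst (inverse (c - c')) * (cst (c - c') * f3)" by (rule dvd_mult)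
          also have "cst (inverse (c - c')) * (cst (c - c') * f3) = f3"
            using \<open>c' \<notin> {c}\<close> by (simp add: mult.assoc[symmetric] cst.hom_mult[symmetric])
          finally have p3: "p dvd f3" .
          have "p dvd f2 + cst c * f3" using c by (simp add: B_def)
          then have "p dvd f2" using p3 by (simp add: dvd_add_left_iff)
          then show False using assms(2) mult(1) pf p3 by (auto simp: coprime_set_def)
        qed
      qed
      then have "finite B" by (metis finite.emptyI finite.insertI finite_subset subsetI)
      moreover have "bad (p * g) \<subseteq> B \<union> bad g"
      proof
        fix c assume "c \<in> bad (p * g)"
        then obtain q where q: "prime_elem q" "q dvd p * g" "q dvd f2 + cst c * f3" by (auto simp: bad_def)
        have "q dvd p \<or> q dvd g" using q(1,2) by (simp add: prime_elem_dvd_mult_iff)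
        then show "c \<in> B \<union> bad g"
        proof
          assume "q dvd p"
          then obtain w where w: "p = q * w" by (elim dvdE)
          have "p dvd q \<or> p dvd w" using mult(1) w by (metis dvd_refl prime_elem_dvd_mult_iff)
          moreover have "\<not> p dvd w"
          proof
            assume "p dvd w"
            then obtain x where "w = p * x" by (elim dvdE)
            then have "p * 1 = p * (q * x)" using w by (simp add: ac_simps)
            then have "1 = q * x" using mult(1) mpoly_mult_left_cancel[of p 1 "q * x"] by (simp add: prime_elem_def)
            then show False using q(1) by (metis dvd_triv_left prime_elem_not_unit)
          qed
          ultimately have "p dvd q" by blast
          then have "p dvd f2 + cst c * f3" using q(3) by (rule dvd_trans)
          then show ?thesis by (simp add: B_def)
        next
          assume "q dvd g"
          then have "c \<in> bad g" using q by (auto simp: bad_def)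
          then show ?thesis by simp
        qed
      qed
      ultimately show ?case using fg by (meson finite_Un finite_subset)
    qed
  qed
  from this[OF dvd_refl] obtain c where "c \<notin> bad f1" using assms(1) by (metis ex_new_if_finite)
  then have "coprime_set {f1, f2 + cst c * f3}" by (auto simp: bad_def coprime_set_def)
  then show ?thesis using that by blast
qed

section \<open>An ideal with a resolution of the given form, and its Koszul relations\<close>

locale cubic_resolution =
  fixes J :: "('v::finite, 'k::field_char_0) mpoly set" and \<delta> \<epsilon> :: "nat list" and A0 A1 A2
  assumes conv: "shift_conventions \<delta> \<epsilon>" and ht: "height J = 2" and n: "CARD('v) \<ge> 3"
    and res: "minimal_graded_free_resolution J (resolution_shifts \<delta> \<epsilon>) [A0, A1, A2]"
begin

text \<open>So \<open>cb (Suc (Suc m))\<close> is the Hilbert function of the ring, and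
  \<open>cb m\<close> that of a ring with two variables fewer, the growth of a quotient of
  codimension two.\<close>

definition "m = CARD('v) - 3"

lemma card_m: "CARD('v) = m + 3" "CARD('v) - 1 = Suc (Suc m)"
  using n by (auto simp: m_def)

definition "a1 = map (\<lambda>i. 3 + int (\<delta> ! i)) [0..<5]"
definition "a2 = map (\<lambda>i. 3 + int (\<delta> ! (i + 2)) + int (\<epsilon> ! i)) [0..<3]"

lemma a_simps: "length a1 = 5" "length a2 = 3" "i < 5 \<Longrightarrow> a1 ! i = 3 + int (\<delta> ! i)"
  "i < 3 \<Longrightarrow> a2 ! i = 3 + int (\<delta> ! (i + 2)) + int (\<epsilon> ! i)"
  by (simp_all add: a1_def a2_def)

lemma shifts: "resolution_shifts \<delta> \<epsilon> = [[3, 3, 3], a1, a2]"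
  by (simp add: resolution_shifts_def a1_def a2_def)

lemma grf: "graded_free_resolution J [[3, 3, 3], a1, a2] [A0, A1, A2]"
  using res by (simp add: minimal_graded_free_resolution_def shifts)

lemma gA: "graded_matrix [3, 3, 3] [0] A0" "graded_matrix a1 [3, 3, 3] A1" "graded_matrix a2 a1 A2"
proof -
  have all: "\<forall>i<3. graded_matrix ([[3, 3, 3], a1, a2] ! i) (([0] # [[3, 3, 3], a1, a2]) ! i) ([A0, A1, A2] ! i)"
    using grf by (auto simp: graded_free_resolution_def)
  show "graded_matrix [3, 3, 3] [0] A0" "graded_matrix a1 [3, 3, 3] A1" "graded_matrix a2 a1 A2"
    using all[rule_format, of 0] all[rule_format, of 1] all[rule_format, of 2] by simp_all
qed

lemma dA: "dim_row A0 = 1" "dim_col A0 = 3" "dim_row A1 = 3" "dim_col A1 = 5" "dim_row A2 = 5" "dim_col A2 = 3"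
  using gA by (auto simp: graded_matrix_def a_simps)

lemma exA: "mat_kernel A0 = mat_image A1" "mat_kernel A1 = mat_image A2" "mat_kernel A2 = {0\<^sub>v 3}"
  "J = (\<lambda>v. v $ 0) ` mat_image A0"
proof -
  have all: "\<forall>i. Suc i < 3 \<longrightarrow> mat_kernel ([A0, A1, A2] ! i) = mat_image ([A0, A1, A2] ! Suc i)"
    using grf by (auto simp: graded_free_resolution_def)
  show "mat_kernel A0 = mat_image A1" "mat_kernel A1 = mat_image A2"
    using all[rule_format, of 0] all[rule_format, of 1] by simp_all
  show "mat_kernel A2 = {0\<^sub>v 3}" "J = (\<lambda>v. v $ 0) ` mat_image A0"
    using grf by (auto simp: graded_free_resolution_def a_simps)
qed

definition "f i = A0 $$ (0, i)"
definition "\<nu> j = (\<lambda>i. if i < 3 then A1 $$ (i, j) else 0)"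

lemma sum3: "(\<Sum>j<(3::nat). g j) = g 0 + g 1 + g 2" for g :: "nat \<Rightarrow> 'b::comm_monoid_add"
  by (simp add: eval_nat_numeral)

lemma lin_A0: "lin A0 F 0 = f 0 * F 0 + f 1 * F 1 + f 2 * F 2"
  by (simp add: lin_def dA f_def sum3)

lemma lin_A0_eq_0: "lin A0 F = 0 \<longleftrightarrow> f 0 * F 0 + f 1 * F 1 + f 2 * F 2 = 0"
  using lin_eq_0_iff_single_row[OF dA(1), of F] by (simp add: lin_A0)

lemma J_iff: "x \<in> J \<longleftrightarrow> (\<exists>u0 u1 u2. x = f 0 * u0 + f 1 * u1 + f 2 * u2)"
proof -
  have "J = {lin A0 F 0 | F. True}" using exA(4) mat_image_first[OF dA(1)] by simp
  then have J: "x \<in> J \<longleftrightarrow> (\<exists>F :: nat \<Rightarrow> ('v, 'k) mpoly. x = f 0 * F 0 + f 1 * F 1 + f 2 * F 2)" by (simp add: lin_A0)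
  show ?thesis
  proof
    assume "\<exists>u0 u1 u2. x = f 0 * u0 + f 1 * u1 + f 2 * u2"
    then obtain u0 u1 u2 where "x = f 0 * u0 + f 1 * u1 + f 2 * u2" by blast
    then show "x \<in> J" unfolding J by (intro exI[of _ "\<lambda>i. if i = 0 then u0 else if i = 1 then u1 else u2"]) simp
  qed (use J in blast)
qed

lemma f_hom: "i < 3 \<Longrightarrow> homogeneous 3 (f i)"
proof -
  assume "i < 3"
  then have "homogeneous ([3, 3, 3] ! i - [0] ! 0) (A0 $$ (0, i))" using gA(1) unfolding graded_matrix_def by auto
  moreover have "[3, 3, 3] ! i = (3 :: int)" using \<open>i < 3\<close> by (auto simp: less_Suc_eq numeral_3_eq_3)
  ultimately show ?thesis by (simp add: f_def)
qed

lemma J_memI: "x = f 0 * u0 + f 1 * u1 + f 2 * u2 \<Longrightarrow> x \<in> J"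
  unfolding J_iff by blast

lemma f_mem: "f 0 \<in> J" "f 1 \<in> J" "f 2 \<in> J"
  by (rule J_memI[of _ 1 0 0], simp, rule J_memI[of _ 0 1 0], simp, rule J_memI[of _ 0 0 1], simp)

lemma J_ideal: "is_ideal J"
  unfolding is_ideal_iff
proof (intro conjI ballI allI)
  show "0 \<in> J" by (rule J_memI[of _ 0 0 0]) simp
  fix x assume "x \<in> J"
  then obtain u0 u1 u2 where x: "x = f 0 * u0 + f 1 * u1 + f 2 * u2" unfolding J_iff by blast
  show "c * x \<in> J" for c
    by (rule J_memI[of _ "c * u0" "c * u1" "c * u2"]) (simp add: x algebra_simps)
  fix y assume "y \<in> J"
  then obtain v0 v1 v2 where y: "y = f 0 * v0 + f 1 * v1 + f 2 * v2" unfolding J_iff by blast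
  show "x + y \<in> J"
    by (rule J_memI[of _ "u0 + v0" "u1 + v1" "u2 + v2"]) (simp add: x y algebra_simps)
qed

lemma J_coprime: "coprime_set J"
  by (rule coprime_set_of_height) (simp add: ht)

lemma f_coprime: "coprime_set {f 0, f 1, f 2}"
  unfolding coprime_set_def
proof (intro allI impI, rule ccontr)
  fix p assume p: "prime_elem p" "\<not> (\<exists>g\<in>{f 0, f 1, f 2}. \<not> p dvd g)"
  then have "p dvd f 0" "p dvd f 1" "p dvd f 2" by blast+
  then have "p dvd x" if "x \<in> J" for x
    using that unfolding J_iff by (elim exE) simp
  then show False using J_coprime p(1) by (auto simp: coprime_set_def)
qed

lemma conv': "length \<delta> = 5" "length \<epsilon> = 3" "1 \<le> \<delta> ! 0" "\<delta> ! 0 \<le> \<delta> ! 1" "\<delta> ! 1 \<le> \<delta> ! 2"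
  "\<delta> ! 2 \<le> \<delta> ! 3" "\<delta> ! 3 \<le> \<delta> ! 4" "\<And>i. i < 3 \<Longrightarrow> 1 \<le> \<epsilon> ! i"
  using conv by (auto simp: shift_conventions_def sorted_iff_nth_mono)

lemma delta_ge: "j < 5 \<Longrightarrow> 1 \<le> \<delta> ! j"
  using conv' by (auto simp: sorted_iff_nth_mono less_Suc_eq eval_nat_numeral)

lemma a1_sum: "lin A1 G = (\<Sum>j<5. (\<lambda>i. G j * \<nu> j i))"
proof
  fix i
  show "lin A1 G i = (\<Sum>j<5. (\<lambda>i. G j * \<nu> j i)) i"
    unfolding sum_fun_apply by (simp add: lin_def dA \<nu>_def mult.commute)
qed

lemma syzygy_lift:
  assumes "F \<in> grade [3, 3, 3] t" "f 0 * F 0 + f 1 * F 1 + f 2 * F 2 = 0"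
  obtains G where "G \<in> grade a1 t" "F = lin A1 G"
proof -
  have "F \<in> {F \<in> grade [3, 3, 3] t. lin A0 F = 0}" using assms by (simp add: lin_A0_eq_0)
  then show ?thesis unfolding kernel_image_grade[OF gA(1,2) exA(1)] using that by blast
qed

text \<open>A constant relation would be a syzygy in degree 3, but the generators of the syzygies
  sit in degrees \<open>3 + \<delta> ! j \<ge> 4\<close>.\<close>

lemma f_indep:
  assumes "cst c0 * f 0 + cst c1 * f 1 + cst c2 * f 2 = 0" shows "c0 = 0 \<and> c1 = 0 \<and> c2 = 0"
proof -
  define F :: "nat \<Rightarrow> ('v, 'k) mpoly" where "F = (\<lambda>i. if i = 0 then cst c0 else if i = 1 then cst c1 else if i = 2 then cst c2 else 0)"
  have "F \<in> grade [3, 3, 3] 3" by (auto simp: grade_def F_def less_Suc_eq eval_nat_numeral)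
  moreover have "f 0 * F 0 + f 1 * F 1 + f 2 * F 2 = 0" using assms by (simp add: F_def mult.commute)
  ultimately obtain G where G: "G \<in> grade a1 3" "F = lin A1 G" by (rule syzygy_lift)
  have "G j = 0" if "j < 5" for j
  proof (rule homogeneous_neg)
    show "homogeneous (3 - a1 ! j) (G j)" using G(1) that by (simp add: grade_def a_simps)
    show "3 - a1 ! j < 0" using delta_ge[OF that] that by (simp add: a_simps)
  qed
  then have "F = 0" unfolding G(2) a1_sum by (auto simp: fun_eq_iff sum_fun_apply zero_fun_def)
  then have "F 0 = 0" "F 1 = 0" "F 2 = 0" by (simp_all add: zero_fun_def)
  then show ?thesis by (simp add: F_def)
qed

lemma f_nonzero: "i < 3 \<Longrightarrow> f i \<noteq> 0"
  using f_indep[of 1 0 0] f_indep[of 0 1 0] f_indep[of 0 0 1] by (auto simp: less_Suc_eq eval_nat_numeral)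

text \<open>\<open>K i\<close> is the Koszul relation not involving \<open>f i\<close>. With these
  signs the sum of the products of \<open>f i\<close> and \<open>K i\<close> is zero.\<close>

definition "K i = (\<lambda>j::nat. if i = (0::nat) then (if j = 1 then f 2 else if j = 2 then - f 1 else 0)
   else if i = 1 then (if j = 0 then - f 2 else if j = 2 then f 0 else 0)
   else (if j = 0 then f 1 else if j = 1 then - f 0 else 0))"

lemma K_lift:
  obtains G where "G \<in> grade a1 6" "K i = lin A1 G"
proof (rule syzygy_lift)
  show "K i \<in> grade [3, 3, 3] 6"
    using f_hom by (auto simp: grade_def K_def less_Suc_eq eval_nat_numeral intro: homogeneous_uminus)
  show "f 0 * K i 0 + f 1 * K i 1 + f 2 * K i 2 = 0" by (simp add: K_def)
qed

definition "GK i = (SOME G. G \<in> grade a1 6 \<and> K i = lin A1 G)"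

lemma GK: "GK i \<in> grade a1 6" "K i = lin A1 (GK i)"
proof -
  have "\<exists>G. G \<in> grade a1 6 \<and> K i = lin A1 G" by (rule K_lift) blast
  then have "GK i \<in> grade a1 6 \<and> K i = lin A1 (GK i)" unfolding GK_def by (rule someI_ex)
  then show "GK i \<in> grade a1 6" "K i = lin A1 (GK i)" by simp_all
qed

text \<open>The degree is \<open>6 - (3 + \<delta> ! j)\<close>. So a Koszul relation has constant
  coefficients at generators with \<open>\<delta> ! j = 3\<close> and does not involve those with
  larger \<open>\<delta> ! j\<close>; this makes the shifts accessible to linear algebra.\<close>

lemma GK_hom: "j < 5 \<Longrightarrow> homogeneous (3 - int (\<delta> ! j)) (GK i j)"
  using GK(1)[of i] by (auto simp: grade_def a_simps)

lemma GK_zero: "j < 5 \<Longrightarrow> 3 < \<delta> ! j \<Longrightarrow> GK i j = 0"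
  using homogeneous_neg[OF GK_hom] by simp

definition "W i j = coef (GK i j) 0"

lemma GK_const: "j < 5 \<Longrightarrow> \<delta> ! j = 3 \<Longrightarrow> GK i j = cst (W i j)"
  using homogeneous_degree_0[of "GK i j"] GK_hom[of j i] by (simp add: W_def)

lemma sum5: "(\<Sum>j<(5::nat). g j) = g 0 + g 1 + g 2 + g 3 + g 4" for g :: "nat \<Rightarrow> 'b::comm_monoid_add"
  by (simp add: eval_nat_numeral)

lemma K_expand: "K i l = GK i 0 * \<nu> 0 l + GK i 1 * \<nu> 1 l + GK i 2 * \<nu> 2 l + GK i 3 * \<nu> 3 l + GK i 4 * \<nu> 4 l"
proof -
  have "K i l = (\<Sum>j<5. GK i j * \<nu> j l)" unfolding GK(2) a1_sum sum_fun_apply ..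
  then show ?thesis unfolding sum5 .
qed

text \<open>Otherwise all Koszul relations are multiples of the one syzygy \<open>\<nu> 0\<close>.
  The first entry of \<open>K 0\<close> is zero, so its coefficient or \<open>\<nu> 0 0\<close>
  vanishes, and either forces \<open>f 2 = 0\<close>.\<close>

lemma delta1_le: "\<delta> ! 1 \<le> 3"
proof (rule ccontr)
  assume "\<not> \<delta> ! 1 \<le> 3"
  then have "GK i 1 = 0" "GK i 2 = 0" "GK i 3 = 0" "GK i 4 = 0" for i using conv' by (auto intro!: GK_zero)
  then have e: "K i l = GK i 0 * \<nu> 0 l" for i l using K_expand[of i l] by simp
  have "GK 0 0 * \<nu> 0 0 = 0" using e[of 0 0] by (simp add: K_def)
  then have "GK 0 0 = 0 \<or> \<nu> 0 0 = 0" by (simp add: mpoly_mult_eq_0_iff)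
  then have "f 2 = 0" using e[of 0 1] e[of 1 0] by (auto simp: K_def)
  then show False using f_nonzero[of 2] by simp
qed

lemma ex_coprime_pair:
  obtains c where "coprime_set {f 0, f 1 + cst c * f 2}"
  using ex_coprime_combination[OF infinite_UNIV_char_0 f_coprime f_nonzero[of 0]] by auto

lemma dim_J:
  "int (mp.dim {p \<in> J. homogeneous t p}) = 3 * int (cb (Suc (Suc m)) (t - 3))
    - (\<Sum>i<5. int (cb (Suc (Suc m)) (t - a1 ! i))) + (\<Sum>i<3. int (cb (Suc (Suc m)) (t - a2 ! i)))"
  and dim_syz: "int (mf.dim {F \<in> grade [3, 3, 3] t. lin A0 F = 0}) =
     (\<Sum>i<5. int (cb (Suc (Suc m)) (t - a1 ! i))) - (\<Sum>i<3. int (cb (Suc (Suc m)) (t - a2 ! i)))"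
proof -
  have d0: "mf.dim (grade [3, 3, 3] t :: (nat \<Rightarrow> ('v, 'k) mpoly) set) = 3 * cb (Suc (Suc m)) (t - 3)"
    by (simp add: dim_grade card_m lessThan_Suc)
  show "int (mf.dim {F \<in> grade [3, 3, 3] t. lin A0 F = 0}) =
     (\<Sum>i<5. int (cb (Suc (Suc m)) (t - a1 ! i))) - (\<Sum>i<3. int (cb (Suc (Suc m)) (t - a2 ! i)))"
    using dim_resolved_ideal(1)[OF grf, of t] by (simp add: dim_grade card_m a_simps(1,2) flip: of_nat_sum)
  then show "int (mp.dim {p \<in> J. homogeneous t p}) = 3 * int (cb (Suc (Suc m)) (t - 3))
    - (\<Sum>i<5. int (cb (Suc (Suc m)) (t - a1 ! i))) + (\<Sum>i<3. int (cb (Suc (Suc m)) (t - a2 ! i)))"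
    using dim_resolved_ideal(2)[OF grf, of t] by (simp add: d0)
qed

text \<open>The exponents in the numerator of the Hilbert series balance to first order; the last
  three entries of \<open>\<delta>\<close> occur on both sides and cancel.\<close>

lemma sum_epsilon: "\<epsilon> ! 0 + \<epsilon> ! 1 + \<epsilon> ! 2 + 3 = \<delta> ! 0 + \<delta> ! 1"
proof -
  obtain c where c: "coprime_set {f 0, f 1 + cst c * f 2}" by (rule ex_coprime_pair)
  \<comment> \<open>\<open>?as\<close> lists the shifts in even homological degree of the resolution
    of R/J, with 0 for the ring itself, and \<open>?bs\<close> those in odd degree. The alternating
    sum of ranks is zero, so each list has six entries.\<close>
  let ?as = "0 # map (\<lambda>i. 3 + \<delta> ! i) [0..<5]" and ?bs = "[3, 3, 3] @ map (\<lambda>i. 3 + \<delta> ! (i + 2) + \<epsilon> ! i) [0..<3]"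
  have "sum_list ?as = sum_list ?bs"
  proof (rule cb_combination_first_order[where m = m and K = 9])
    show "length ?as = length ?bs" by simp
    fix t :: nat
    have "int (cb (Suc (Suc m)) (int t)) - int (mp.dim {p \<in> J. homogeneous (int t) p}) \<le> 9 * int (cb m (int t))"
    proof (rule coprime_pair_growth[OF c f_nonzero[of 0] _ _ J_ideal])
      show "homogeneous 3 (f 0)" "homogeneous 3 (f 1 + cst c * f 2)"
        by (simp_all add: f_hom homogeneous_add homogeneous_cst_mult)
      show "f 0 \<in> J" "f 1 + cst c * f 2 \<in> J" using f_mem J_ideal[unfolded is_ideal_iff] unfolding mult.commute[of "cst c"] by (auto simp: mult.commute[of "f 2"])
      show "CARD('v) = m + 3" by (rule card_m)
    qed simp
    moreover have "int (mp.dim {p \<in> J. homogeneous (int t) p}) \<le> int (cb (Suc (Suc m)) (int t))"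
      using hilbert_function_add[of J t] by (simp add: card_m)
    moreover have "int (cb (Suc (Suc m)) (int t)) - int (mp.dim {p \<in> J. homogeneous (int t) p}) =
       (\<Sum>a\<leftarrow>?as. int (cb (Suc (Suc m)) (int t - int a))) - (\<Sum>b\<leftarrow>?bs. int (cb (Suc (Suc m)) (int t - int b)))"
      unfolding dim_J by (simp add: sum5 sum3 a_simps upt_rec numeral_eq_Suc add.assoc)
    ultimately show "\<bar>(\<Sum>a\<leftarrow>?as. int (cb (Suc (Suc m)) (int t - int a)))
        - (\<Sum>b\<leftarrow>?bs. int (cb (Suc (Suc m)) (int t - int b)))\<bar> \<le> 9 * int (cb m (int t))" by linarith
  qed
  then show ?thesis by (simp add: upt_rec eval_nat_numeral)
qed

lemma delta_01_epsilon: "\<delta> ! 0 = 3" "\<delta> ! 1 = 3" "\<epsilon> ! 0 = 1" "\<epsilon> ! 1 = 1" "\<epsilon> ! 2 = 1"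
  using sum_epsilon delta1_le conv'(4) conv'(8)[of 0] conv'(8)[of 1] conv'(8)[of 2] by simp_all

text \<open>Otherwise the Koszul relations are constant combinations of \<open>\<nu> 0\<close> and
  \<open>\<nu> 1\<close>. The first entry of \<open>K 0\<close> is zero, so the first entries of
  \<open>\<nu> 0\<close> and \<open>\<nu> 1\<close> are linearly dependent, and the first entries
  \<open>- f 2\<close> and \<open>f 1\<close> of \<open>K 1\<close> and \<open>K 2\<close> become
  proportional.\<close>

lemma delta2: "\<delta> ! 2 = 3"
proof (rule ccontr)
  assume "\<delta> ! 2 \<noteq> 3"
  then have "3 < \<delta> ! 2" using conv'(5) delta_01_epsilon by simp
  then have z: "GK i 2 = 0" "GK i 3 = 0" "GK i 4 = 0" for i using conv' by (auto intro!: GK_zero)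
  have e: "K i l = cst (W i 0) * \<nu> 0 l + cst (W i 1) * \<nu> 1 l" for i l
    using K_expand[of i l] z GK_const delta_01_epsilon by simp
  let ?a = "\<nu> 0 0" and ?b = "\<nu> 1 0"
  have r: "cst (W 0 0) * ?a + cst (W 0 1) * ?b = 0" "cst (W 1 0) * ?a + cst (W 1 1) * ?b = - f 2"
    "cst (W 2 0) * ?a + cst (W 2 1) * ?b = f 1"
    using e[of 0 0] e[of 1 0] e[of 2 0] by (simp_all add: K_def)
  have nz: "W 0 0 \<noteq> 0 \<or> W 0 1 \<noteq> 0"
    using e[of 0 1] f_nonzero[of 2] by (auto simp: K_def)
  define w0 w1 where "w0 = W 0 0" and "w1 = W 0 1"
  \<comment> \<open>Given the relation between \<open>?a\<close> and \<open>?b\<close>, this turns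
    all their combinations into constant multiples of a single element.\<close>
  have *: "cst (w0 * x0 + w1 * x1) * (cst x * ?a + cst y * ?b) = cst (w0 * y - w1 * x) * (cst x0 * ?b - cst x1 * ?a)" for x y x0 x1
  proof -
    have "cst (w0 * x0 + w1 * x1) * (cst x * ?a + cst y * ?b) - cst (w0 * y - w1 * x) * (cst x0 * ?b - cst x1 * ?a)
      = (cst (x * x0) + cst (y * x1)) * (cst w0 * ?a + cst w1 * ?b)"
      by (simp add: cst.hom_add cst.hom_mult cst.hom_minus algebra_simps)
    then show ?thesis using r(1) by (simp add: w0_def w1_def)
  qed
  \<comment> \<open>A solution of \<open>w0 * x0 + w1 * x1 = 1\<close>, using whichever of
    \<open>w0\<close>, \<open>w1\<close> is nonzero.\<close>
  define x0 x1 where "x0 = (if w0 \<noteq> 0 then 1 / w0 else 0)" and "x1 = (if w0 \<noteq> 0 then 0 else 1 / w1)"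
  have one: "w0 * x0 + w1 * x1 = 1" using nz by (auto simp: x0_def x1_def w0_def w1_def)
  define b' where "b' = cst x0 * ?b - cst x1 * ?a"
  have "f 1 = cst (w0 * W 2 1 - w1 * W 2 0) * b'" "- f 2 = cst (w0 * W 1 1 - w1 * W 1 0) * b'"
    using *[of x0 x1 "W 2 0" "W 2 1"] *[of x0 x1 "W 1 0" "W 1 1"] r(2,3) by (simp_all add: one b'_def)
  then obtain u v where uv: "f 1 = cst u * b'" "- f 2 = cst v * b'" by blast
  have "cst 0 * f 0 + cst v * f 1 + cst u * f 2 = cst v * f 1 - cst u * (- f 2)" by simp
  also have "\<dots> = 0" unfolding uv by (simp add: ac_simps)
  finally have "u = 0" using f_indep by blast
  then show False using uv(1) f_nonzero[of 1] by simp
qed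

text \<open>The coordinates of the relation are the 2 by 2 minors of the coefficient vector and the
  coprime vector of cubics, so these two are parallel.\<close>

lemma K_annihilator:
  assumes "\<And>l. l < 3 \<Longrightarrow> x0 * K 0 l + x1 * K 1 l + x2 * K 2 l = 0"
  shows "\<exists>c. x0 = c * f 0 \<and> x1 = c * f 1 \<and> x2 = c * f 2"
proof (rule coprime_triple_parallel[OF f_coprime])
  show "\<not> (f 0 = 0 \<and> f 1 = 0 \<and> f 2 = 0)" using f_nonzero[of 0] by simp
  show "x0 * f 1 = x1 * f 0" "x0 * f 2 = x2 * f 0" "x1 * f 2 = x2 * f 1"
    using assms[of 0] assms[of 1] assms[of 2] by (simp_all add: K_def algebra_simps)
qed

text \<open>Multiples of a cubic have no component in degree below 3. It is applied to linear and
  quadratic coefficients.\<close>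

lemma K_annihilator_small:
  assumes e: "\<And>l. l < 3 \<Longrightarrow> x0 * K 0 l + x1 * K 1 l + x2 * K 2 l = 0"
    and h: "homogeneous t x0" "homogeneous t x1" "homogeneous t x2" "t < 3"
  shows "x0 = 0 \<and> x1 = 0 \<and> x2 = 0"
proof -
  obtain c where c: "x0 = c * f 0" "x1 = c * f 1" "x2 = c * f 2" using K_annihilator[OF e] by blast
  have z: "c * f i = 0" if "homogeneous t (c * f i)" "i < 3" for i
  proof -
    have "c * f i = hc t (f i * c)" using that(1) by (simp add: homogeneous_iff_hc mult.commute)
    also have "\<dots> = f i * hc (t - 3) c" by (rule hc_mult[OF f_hom[OF that(2)]])
    also have "hc (t - 3) c = 0" using h(4) by (simp add: hc_def)
    finally show ?thesis by simp
  qed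
  show ?thesis using z[of 0] z[of 1] z[of 2] h c by simp
qed

text \<open>A relation between the generators lifts through \<open>A2\<close>, whose columns have
  degree at least \<open>3 + 3 + 1 = 7\<close>.\<close>

lemma \<nu>_syz: "G j = 0" if "lin A1 G = 0" "G \<in> grade a1 t" "t < 7" "\<delta> ! 3 \<ge> 3" "\<delta> ! 4 \<ge> 3"
proof -
  have "G \<in> {F \<in> grade a1 t. lin A1 F = 0}" using that by simp
  then obtain H where H: "H \<in> grade a2 t" "G = lin A2 H" unfolding kernel_image_grade[OF gA(2,3) exA(2)] by blast
  have "H l = 0" for l
  proof (cases "l < 3")
    case True
    then have "homogeneous (t - a2 ! l) (H l)" using H(1) by (simp add: grade_def a_simps)
    moreover have "t - a2 ! l < 0"
      using True that delta2 delta_01_epsilon by (auto simp: a_simps less_Suc_eq eval_nat_numeral)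
    ultimately show ?thesis by (rule homogeneous_neg)
  qed (use H(1) in \<open>simp add: grade_def a_simps\<close>)
  then show "G j = 0" by (simp add: H(2) lin_def)
qed

text \<open>Such a column has degree \<open>3 + 3 + 1\<close>, so its entries at generators with
  \<open>\<delta> ! j = 3\<close> are linear. At \<open>\<delta> ! j = 4\<close> the entry is a
  constant, which minimality makes zero, and beyond that the degree is negative.\<close>

lemma linear_relation:
  assumes "l < 3" "\<delta> ! (l + 2) = 3"
  shows "(\<Sum>j<5. A2 $$ (j, l) * \<nu> j i) = 0"
    and "j < 5 \<Longrightarrow> \<delta> ! j = 3 \<Longrightarrow> homogeneous 1 (A2 $$ (j, l))"
    and "j < 5 \<Longrightarrow> \<delta> ! j > 3 \<Longrightarrow> A2 $$ (j, l) = 0"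
proof -
  have eps: "\<epsilon> ! l = 1" using assms(1) delta_01_epsilon by (auto simp: less_Suc_eq eval_nat_numeral)
  have h: "homogeneous (4 - int (\<delta> ! j)) (A2 $$ (j, l))" if "j < 5" for j
  proof -
    have "homogeneous (a2 ! l - a1 ! j) (A2 $$ (j, l))" using gA(3) assms(1) that by (simp add: graded_matrix_def a_simps(1,2))
    then show ?thesis using that assms eps by (simp add: a_simps)
  qed
  show "homogeneous 1 (A2 $$ (j, l))" if "j < 5" "\<delta> ! j = 3" using h[OF that(1)] that by simp
  show "A2 $$ (j, l) = 0" if "j < 5" "\<delta> ! j > 3"
  proof (cases "\<delta> ! j = 4")
    case True
    then have "A2 $$ (j, l) = cst (coef (A2 $$ (j, l)) 0)" using h[OF that(1)] by (intro homogeneous_degree_0) simp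
    moreover have "coef (A2 $$ (j, l)) 0 = 0"
      using res that(1) assms(1) by (simp add: minimal_graded_free_resolution_def dA)
    ultimately show ?thesis by simp
  next
    case False
    then show ?thesis using homogeneous_neg[OF h[OF that(1)]] that by simp
  qed
  define E :: "nat \<Rightarrow> ('v, 'k) mpoly" where "E = (\<lambda>i. if i = l then 1 else 0)"
  have E: "E \<in> grade a2 (a2 ! l)" using assms(1) homogeneous_cst[of 1] by (auto simp: grade_def E_def a_simps(2))
  have "lin A2 E = (\<lambda>j. if j < 5 then A2 $$ (j, l) else 0)"
  proof
    fix j
    have "(\<Sum>i<3. A2 $$ (j, i) * E i) = (\<Sum>i<3. if i = l then A2 $$ (j, l) else 0)"
      by (rule sum.cong) (auto simp: E_def)
    then show "lin A2 E j = (if j < 5 then A2 $$ (j, l) else 0)" using assms(1) by (simp add: lin_def dA)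
  qed
  moreover have "lin A1 (lin A2 E) = 0"
    using E kernel_image_grade[OF gA(2,3) exA(2), of "a2 ! l"] by blast
  ultimately have "lin A1 (\<lambda>j. if j < 5 then A2 $$ (j, l) else 0) i = 0" by (simp add: zero_fun_def)
  then show "(\<Sum>j<5. A2 $$ (j, l) * \<nu> j i) = 0" unfolding a1_sum sum_fun_apply by simp
qed

lemma A2_injective:
  assumes "\<And>j. j < 5 \<Longrightarrow> A2 $$ (j, 0) * x0 + A2 $$ (j, 1) * x1 + A2 $$ (j, 2) * x2 = 0"
  shows "x0 = 0 \<and> x1 = 0 \<and> x2 = 0"
proof -
  define v where "v = vec 3 (\<lambda>i :: nat. if i = 0 then x0 else if i = 1 then x1 else x2)"
  have "A2 *\<^sub>v v = 0\<^sub>v 5"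
  proof (rule eq_vecI)
    fix j assume j: "j < dim_vec (0\<^sub>v 5 :: ('v, 'k) mpoly vec)"
    then have "(A2 *\<^sub>v v) $ j = (\<Sum>i<3. A2 $$ (j, i) * v $ i)"
      by (simp add: dA scalar_prod_def atLeast0LessThan v_def)
    then show "(A2 *\<^sub>v v) $ j = 0\<^sub>v 5 $ j" using assms[of j] j by (simp add: sum3 v_def)
  qed (simp add: dA)
  then have "v \<in> mat_kernel A2" by (simp add: mat_kernel_def dA v_def)
  then have "v = 0\<^sub>v 3" using exA(3) by simp
  then have "v $ i = 0" if "i < 3" for i using that by simp
  from this[of 0] this[of 1] this[of 2] show ?thesis by (simp add: v_def)
qed

text \<open>
  If the first \<open>N\<close> generators are those of degree 3, any \<open>N\<close> independent elements of their span
  can replace them, which transforms a linear relation between them by an invertible matrix.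
\<close>

lemma change_generators:
  assumes N: "N \<le> 5" "\<And>j. j < N \<Longrightarrow> \<delta> ! j = 3" "\<delta> ! 3 \<ge> 3" "\<delta> ! 4 \<ge> 3"
    and e: "\<And>i. i < N \<Longrightarrow> \<exists>w. e i = (\<Sum>j<N. scalef (w j) (\<nu> j))"
    and ind: "mf.independent (e ` {..<N})" "inj_on e {..<N}"
  shows "\<exists>V W. (\<forall>\<mu> l. (\<Sum>j<N. \<mu> j * \<nu> j l) = (\<Sum>i<N. (\<Sum>j<N. \<mu> j * cst (V j i)) * e i l)) \<and>
    (\<forall>\<mu> :: nat \<Rightarrow> ('v, 'k) mpoly. \<forall>j<N. \<mu> j = (\<Sum>i<N. (\<Sum>j<N. \<mu> j * cst (V j i)) * cst (W i j)))"
proof -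
  obtain W where W: "\<And>i. i < N \<Longrightarrow> e i = (\<Sum>j<N. scalef (W i j) (\<nu> j))" using e by metis
  let ?S = "mf.span (\<nu> ` {..<N})"
  have sub: "mf.span (e ` {..<N}) \<subseteq> ?S"
  proof (rule mf.span_minimal)
    show "e ` {..<N} \<subseteq> ?S"
    proof clarify
      fix i assume "i < N"
      then show "e i \<in> ?S" unfolding W[OF \<open>i < N\<close>]
        by (intro mf.span_sum mf.span_scale mf.span_base imageI)
    qed
  qed simp
  \<comment> \<open>The \<open>\<nu> j\<close> span a space of dimension at most \<open>N\<close>
    that contains \<open>N\<close> independent vectors, so both spans agree and the
    \<open>\<nu> j\<close> can be expressed through the \<open>e i\<close>.\<close>
  have "mf.dim ?S \<le> card (\<nu> ` {..<N})" using mf.dim_le_card[OF mf.span_superset finite_imageI[OF finite_lessThan], of \<nu> N] by simp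
  also have "\<dots> \<le> N" using card_image_le[of "{..<N}" \<nu>] by simp
  also have "N = mf.dim (mf.span (e ` {..<N}))"
    using mf.dim_eq_card_independent[OF ind(1)] card_image[OF ind(2)] by simp
  finally have "?S \<subseteq> mf.span (e ` {..<N})"
    by (intro mf.subspace_eq_of_dim[OF _ sub subset_refl]) auto
  then have "\<nu> j \<in> mf.span (e ` {..<N})" if "j < N" for j
    using that mf.span_base[of "\<nu> j" "\<nu> ` {..<N}"] by blast
  moreover have "finite (e ` {..<N})" by simp
  ultimately have "\<exists>u. \<nu> j = (\<Sum>x\<in>e ` {..<N}. scalef (u x) x)" if "j < N" for j
    using that unfolding mf.span_finite[OF \<open>finite (e ` {..<N})\<close>] by blast
  then have Ve: "\<exists>V. \<nu> j = (\<Sum>i<N. scalef (V i) (e i))" if "j < N" for j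
  proof -
    from that obtain u where "\<nu> j = (\<Sum>x\<in>e ` {..<N}. scalef (u x) x)"
      using \<open>\<And>j. j < N \<Longrightarrow> \<exists>u. \<nu> j = (\<Sum>x\<in>e ` {..<N}. scalef (u x) x)\<close> by blast
    then have "\<nu> j = (\<Sum>i<N. scalef (u (e i)) (e i))" unfolding sum.reindex[OF ind(2)] o_def .
    then show ?thesis by (intro exI[of _ "\<lambda>i. u (e i)"])
  qed
  then obtain V where V: "\<And>j. j < N \<Longrightarrow> \<nu> j = (\<Sum>i<N. scalef (V j i) (e i))"
    using choice[of "\<lambda>j V. j < N \<longrightarrow> \<nu> j = (\<Sum>i<N. scalef (V i) (e i))"] by blast
  have Vl: "\<nu> j l = (\<Sum>i<N. cst (V j i) * e i l)" if "j < N" for j l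
    using V[OF that] by (simp add: sum_fun_apply scalef_def scale_cst)
  have Wl: "e i l = (\<Sum>j<N. cst (W i j) * \<nu> j l)" if "i < N" for i l
    using W[OF that] by (simp add: sum_fun_apply scalef_def scale_cst)
  have 1: "(\<Sum>j<N. \<mu> j * \<nu> j l) = (\<Sum>i<N. (\<Sum>j<N. \<mu> j * cst (V j i)) * e i l)" for \<mu> l
  proof -
    have "(\<Sum>j<N. \<mu> j * \<nu> j l) = (\<Sum>j<N. \<Sum>i<N. \<mu> j * cst (V j i) * e i l)"
      by (simp add: Vl sum_distrib_left mult.assoc)
    also have "\<dots> = (\<Sum>i<N. \<Sum>j<N. \<mu> j * cst (V j i) * e i l)" by (rule sum.swap)
    finally show ?thesis by (simp add: sum_distrib_right)
  qed
  \<comment> \<open>Expanding \<open>\<nu> j\<close> through the \<open>e i\<close> and back yields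
    a constant relation between the generators. It has degree 6 and is trivial by
    \<open>\<nu>_syz\<close>.\<close>
  have VW: "(\<Sum>i<N. V j i * W i j') = (if j = j' then 1 else 0)" if "j < N" "j' < N" for j j'
  proof -
    define G :: "nat \<Rightarrow> ('v, 'k) mpoly" where
      "G k = (if k < N then cst ((\<Sum>i<N. V j i * W i k) - (if j = k then 1 else 0)) else 0)" for k
    have "G k' = 0" for k'
    proof (rule \<nu>_syz[where t = 6])
      show "G \<in> grade a1 6" using N by (auto simp: grade_def G_def a_simps)
      have "(\<Sum>k<5. G k * \<nu> k l) = 0" for l
      proof -
        have "(\<Sum>k<5. G k * \<nu> k l) = (\<Sum>k<N. G k * \<nu> k l)"
          by (rule sum.mono_neutral_right) (use N in \<open>auto simp: G_def\<close>)
        also have "\<dots> = (\<Sum>k<N. (\<Sum>i<N. cst (V j i) * (cst (W i k) * \<nu> k l)) - (if j = k then \<nu> k l else 0))"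
          by (rule sum.cong) (auto simp: G_def cst.hom_minus cst.hom_sum cst.hom_mult left_diff_distrib sum_distrib_right mult.assoc)
        also have "\<dots> = (\<Sum>k<N. \<Sum>i<N. cst (V j i) * (cst (W i k) * \<nu> k l)) - \<nu> j l"
          using that by (simp add: sum_subtractf)
        also have "(\<Sum>k<N. \<Sum>i<N. cst (V j i) * (cst (W i k) * \<nu> k l)) = (\<Sum>i<N. \<Sum>k<N. cst (V j i) * (cst (W i k) * \<nu> k l))"
          by (rule sum.swap)
        also have "\<dots> = (\<Sum>i<N. cst (V j i) * e i l)" by (rule sum.cong) (auto simp: Wl sum_distrib_left)
        also have "\<dots> = \<nu> j l" by (rule Vl[OF that(1), symmetric])
        finally show ?thesis by simp
      qed
      then show "lin A1 G = 0" unfolding a1_sum by (auto simp: fun_eq_iff sum_fun_apply zero_fun_def)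
    qed (use N in simp_all)
    from this[of j'] show ?thesis using that by (simp add: G_def split: if_splits)
  qed
  have inv: "(\<Sum>i<N. (\<Sum>k<N. \<mu> k * cst (V k i)) * cst (W i j)) = \<mu> j" if "j < N" for \<mu> :: "nat \<Rightarrow> ('v, 'k) mpoly" and j
  proof -
    have "(\<Sum>i<N. (\<Sum>k<N. \<mu> k * cst (V k i)) * cst (W i j)) = (\<Sum>i<N. \<Sum>k<N. \<mu> k * (cst (V k i) * cst (W i j)))"
      by (simp add: sum_distrib_right mult.assoc)
    also have "\<dots> = (\<Sum>k<N. \<Sum>i<N. \<mu> k * (cst (V k i) * cst (W i j)))" by (rule sum.swap)
    also have "\<dots> = (\<Sum>k<N. \<mu> k * cst (\<Sum>i<N. V k i * W i j))"
      by (simp add: sum_distrib_left cst.hom_sum cst.hom_mult)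
    also have "\<dots> = (\<Sum>k<N. if k = j then \<mu> j else 0)"
      by (rule sum.cong) (use that in \<open>auto simp: VW\<close>)
    finally show ?thesis using that by simp
  qed
  then have 2: "\<forall>\<mu> :: nat \<Rightarrow> ('v, 'k) mpoly. \<forall>j<N. \<mu> j = (\<Sum>i<N. (\<Sum>j<N. \<mu> j * cst (V j i)) * cst (W i j))"
    by (intro allI impI inv[symmetric])
  show ?thesis by (intro exI[of _ V] exI[of _ W] conjI 2 allI 1)
qed

section \<open>The last two shifts\<close>

lemma K_independent: "mf.independent (K ` {..<3}) \<and> inj_on K {..<3}"
proof -
  have "\<forall>i\<in>{..<3}. c i = 0" if c: "(\<Sum>i\<in>{..<3}. scalef (c i) (K i)) = 0" for c
  proof -
    have "cst (c 0) * K 0 l + cst (c 1) * K 1 l + cst (c 2) * K 2 l = 0" for l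
      using fun_cong[OF c, of l] by (simp add: sum_fun_apply scalef_def scale_cst sum3 zero_fun_def)
    from this[of 0] this[of 1] have "cst 0 * f 0 + cst (c 2) * f 1 + cst (- c 1) * f 2 = 0"
      "cst (- c 2) * f 0 + cst 0 * f 1 + cst (c 0) * f 2 = 0"
      by (simp_all add: K_def cst.hom_uminus)
    then have "c 2 = 0" "c 1 = 0" "c 0 = 0" using f_indep by fastforce+
    then show ?thesis by (auto simp: less_Suc_eq eval_nat_numeral)
  qed
  then show ?thesis using mf.dim_family[of "{..<3}" K] by blast
qed

lemma K_in_span:
  assumes "N \<le> 5" "\<And>j. j < N \<Longrightarrow> \<delta> ! j = 3" "\<And>j. N \<le> j \<Longrightarrow> j < 5 \<Longrightarrow> \<delta> ! j > 3"
  shows "\<exists>w. K i = (\<Sum>j<N. scalef (w j) (\<nu> j))"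
proof -
  have "K i = (\<Sum>j<N. scalef (W i j) (\<nu> j))"
  proof
    fix l
    have "K i l = (\<Sum>j<5. GK i j * \<nu> j l)" unfolding GK(2) a1_sum sum_fun_apply ..
    also have "\<dots> = (\<Sum>j<N. GK i j * \<nu> j l)"
      by (rule sum.mono_neutral_right) (use assms GK_zero in auto)
    also have "\<dots> = (\<Sum>j<N. scalef (W i j) (\<nu> j)) l"
      unfolding sum_fun_apply by (rule sum.cong) (use assms GK_const in \<open>auto simp: scalef_def scale_cst\<close>)
    finally show "K i l = (\<Sum>j<N. scalef (W i j) (\<nu> j)) l" .
  qed
  then show ?thesis by blast
qed

lemma column_nonzero:
  assumes "l < 3" shows "\<not> (\<forall>j<5. A2 $$ (j, l) = 0)"
proof
  assume z: "\<forall>j<5. A2 $$ (j, l) = 0"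
  consider "l = 0" | "l = 1" | "l = 2" using assms by linarith
  then show False using z A2_injective[of 1 0 0] A2_injective[of 0 1 0] A2_injective[of 0 0 1] by cases auto
qed

text \<open>Otherwise only three generators have degree 3, and the Koszul relations can replace
  them. Column 0 of \<open>A2\<close> becomes a linear relation between \<open>K 0\<close>,
  \<open>K 1\<close> and \<open>K 2\<close>, so it vanishes, against injectivity.\<close>

lemma delta3: "\<delta> ! 3 = 3"
proof (rule ccontr)
  assume "\<delta> ! 3 \<noteq> 3"
  then have d: "\<delta> ! 3 > 3" "\<delta> ! 4 > 3" using conv' delta2 by simp_all
  have lt3: "\<delta> ! j = 3" if "j < 3" for j using that delta_01_epsilon delta2 by (auto simp: less_Suc_eq eval_nat_numeral)
  have ge3: "\<delta> ! j > 3" if "3 \<le> j" "j < 5" for j using that d by (auto simp: less_Suc_eq eval_nat_numeral)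
  have le: "(3::nat) \<le> 5" by simp
  have "\<exists>V W. (\<forall>\<mu> l. (\<Sum>j<3. \<mu> j * \<nu> j l) = (\<Sum>i<3. (\<Sum>j<3. \<mu> j * cst (V j i)) * K i l)) \<and>
    (\<forall>\<mu> :: nat \<Rightarrow> ('v, 'k) mpoly. \<forall>j<3. \<mu> j = (\<Sum>i<3. (\<Sum>j<3. \<mu> j * cst (V j i)) * cst (W i j)))"
    by (rule change_generators[of 3 K, OF le lt3 d[THEN less_imp_le] K_in_span[of 3, OF le lt3 ge3]
          K_independent[THEN conjunct1] K_independent[THEN conjunct2]]) simp_all
  then obtain V W where VW0: "\<forall>\<mu> l. (\<Sum>j<3. \<mu> j * \<nu> j l) = (\<Sum>i<3. (\<Sum>j<3. \<mu> j * cst (V j i)) * K i l)"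
    "\<forall>\<mu> :: nat \<Rightarrow> ('v, 'k) mpoly. \<forall>j<3. \<mu> j = (\<Sum>i<3. (\<Sum>j<3. \<mu> j * cst (V j i)) * cst (W i j))"
    by (elim exE conjE)
  note VW = VW0[rule_format]
  define \<mu> where "\<mu> j = A2 $$ (j, 0)" for j
  define x where "x i = (\<Sum>j<3. \<mu> j * cst (V j i))" for i
  have d02: "\<delta> ! (0 + 2) = 3" using delta2 by (simp only: add_0)
  have \<mu>0: "\<mu> j = 0" if "3 \<le> j" "j < 5" for j
    using linear_relation(3)[OF _ d02 that(2) ge3[OF that]] by (simp add: \<mu>_def)
  have r: "(\<Sum>j<3. \<mu> j * \<nu> j l) = 0" for l
  proof -
    have "(\<Sum>j<3. \<mu> j * \<nu> j l) = (\<Sum>j<5. \<mu> j * \<nu> j l)"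
      by (rule sum.mono_neutral_left) (use \<mu>0 in auto)
    then show ?thesis using linear_relation(1)[OF _ d02] by (simp add: \<mu>_def)
  qed
  have hx: "homogeneous 1 (x i)" for i unfolding x_def
  proof (rule homogeneous_sum)
    fix j :: nat assume "j \<in> {..<3}"
    then have "homogeneous 1 (\<mu> j)" using linear_relation(2)[OF _ d02] lt3[of j] by (simp add: \<mu>_def)
    then show "homogeneous 1 (\<mu> j * cst (V j i))" using homogeneous_cst_mult[of 1 "\<mu> j" "V j i"] by (simp add: mult.commute)
  qed
  have "x 0 = 0 \<and> x 1 = 0 \<and> x 2 = 0"
  proof (rule K_annihilator_small[OF _ hx hx hx])
    show "x 0 * K 0 l + x 1 * K 1 l + x 2 * K 2 l = 0" for l
      using VW(1)[of \<mu> l] r[of l] by (simp add: x_def[symmetric] sum3)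
  qed simp
  then have "\<mu> j = 0" if "j < 3" for j using VW(2)[OF that, of \<mu>] by (simp add: x_def[symmetric] sum3)
  then have "\<mu> j = 0" if "j < 5" for j using \<mu>0 that by (cases "j < 3") auto
  then have "\<forall>j<5. A2 $$ (j, 0) = 0" by (simp add: \<mu>_def)
  then show False using column_nonzero[of 0] by simp
qed

lemma sum4: "(\<Sum>j<(4::nat). g j) = g 0 + g 1 + g 2 + g 3" for g :: "nat \<Rightarrow> 'b::comm_monoid_add"
  by (simp add: eval_nat_numeral)

text \<open>Otherwise columns 0 and 1 of \<open>A2\<close> are linear relations between the Koszul
  relations and one more generator \<open>\<nu> k\<close>, with coefficients
  \<open>?\<alpha>\<close> and \<open>?\<beta>\<close> at \<open>\<nu> k\<close>. Eliminating
  \<open>\<nu> k\<close> leaves quadratic coefficients, which must vanish, so the columns are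
  proportional. Injectivity of \<open>A2\<close> then makes \<open>?\<alpha>\<close> and
  \<open>?\<beta>\<close> zero, and column 0 is a linear relation between Koszul relations
  alone.\<close>

lemma delta4: "\<delta> ! 4 = 3"
proof (rule ccontr)
  assume "\<delta> ! 4 \<noteq> 3"
  then have d: "\<delta> ! 4 > 3" using conv' delta3 by simp
  have lt4: "\<delta> ! j = 3" if "j < 4" for j using that delta_01_epsilon delta2 delta3 by (auto simp: less_Suc_eq eval_nat_numeral)
  have ge4: "\<delta> ! j > 3" if "4 \<le> j" "j < 5" for j
  proof -
    have "j = 4" using that by simp
    then show ?thesis using d by simp
  qed
  have \<nu>_ind: "mf.independent (\<nu> ` {..<4}) \<and> inj_on \<nu> {..<4}"
  proof -
    have "\<forall>i\<in>{..<4}. c i = 0" if c: "(\<Sum>i\<in>{..<4}. scalef (c i) (\<nu> i)) = 0" for c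
    proof -
      define G :: "nat \<Rightarrow> ('v, 'k) mpoly" where "G k = (if k < 4 then cst (c k) else 0)" for k
      have "G k = 0" for k
      proof (rule \<nu>_syz[where t = 6])
        show "G \<in> grade a1 6" using lt4 by (auto simp: grade_def G_def a_simps)
        have "lin A1 G l = 0" for l
          using fun_cong[OF c, of l] by (simp add: a1_sum sum_fun_apply sum5 sum4 G_def scalef_def scale_cst zero_fun_def)
        then show "lin A1 G = 0" by (auto simp: zero_fun_def)
      qed (use d delta3 in simp_all)
      then show ?thesis by (auto simp: G_def) (metis cst_eq_0_iff)
    qed
    then show ?thesis using mf.dim_family[of "{..<4}" \<nu>] by blast
  qed
  \<comment> \<open>Four independent generators do not fit into the span of three vectors, so one of
    them completes the Koszul relations to a basis.\<close>
  have "\<exists>j<4. \<nu> j \<notin> mf.span (K ` {..<3})"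
  proof (rule ccontr)
    assume "\<not> ?thesis"
    then have "\<nu> ` {..<4} \<subseteq> mf.span (K ` {..<3})" by auto
    then have "card (\<nu> ` {..<4}) \<le> card (K ` {..<3})"
      using mf.independent_span_bound[of "K ` {..<3}" "\<nu> ` {..<4}"] \<nu>_ind by auto
    then show False using \<nu>_ind K_independent by (simp add: card_image)
  qed
  then obtain k where k: "k < 4" "\<nu> k \<notin> mf.span (K ` {..<3})" by blast
  define e where "e i = (if i < 3 then K i else \<nu> k)" for i :: nat
  have img: "e ` {..<4} = insert (\<nu> k) (K ` {..<3})" by (auto simp: e_def less_Suc_eq eval_nat_numeral)
  have e_ind: "mf.independent (e ` {..<4})" unfolding img
    using k(2) K_independent by (simp add: mf.independent_insert)
  have nK: "K i \<noteq> \<nu> k" if "i < 3" for i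
  proof
    assume "K i = \<nu> k"
    then have "\<nu> k \<in> K ` {..<3}" using that by (metis imageI lessThan_iff)
    then show False using k(2) mf.span_base by metis
  qed
  have e_inj: "inj_on e {..<4}"
  proof (rule inj_onI)
    fix i j :: nat assume ij: "i \<in> {..<4}" "j \<in> {..<4}" "e i = e j"
    have "i < 3 \<or> i = 3" "j < 3 \<or> j = 3" using ij(1,2) by auto
    then consider "i < 3" "j < 3" | "i < 3" "j = 3" | "i = 3" "j < 3" | "i = 3" "j = 3" by blast
    then show "i = j"
    proof cases
      case 1
      then show ?thesis using ij(3) K_independent by (simp add: e_def inj_on_def)
    qed (use ij(3) nK[of i] nK[of j] in \<open>auto simp: e_def\<close>)
  qed
  have e_span: "\<exists>w. e i = (\<Sum>j<4. scalef (w j) (\<nu> j))" if "i < 4" for i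
  proof (cases "i < 3")
    case True
    then show ?thesis using K_in_span[of 4 i] lt4 ge4 by (simp add: e_def)
  next
    case False
    have "(\<Sum>j<4. scalef (if j = k then 1 else 0) (\<nu> j)) = (\<Sum>j<4. if j = k then \<nu> k else 0)"
      by (rule sum.cong) auto
    also have "\<dots> = \<nu> k" using k(1) by simp
    finally show ?thesis using False by (intro exI[of _ "\<lambda>j. if j = k then 1 else 0"]) (simp add: e_def)
  qed
  have le: "(4::nat) \<le> 5" by simp
  have "\<exists>V W. (\<forall>\<mu> l. (\<Sum>j<4. \<mu> j * \<nu> j l) = (\<Sum>i<4. (\<Sum>j<4. \<mu> j * cst (V j i)) * e i l)) \<and>
    (\<forall>\<mu> :: nat \<Rightarrow> ('v, 'k) mpoly. \<forall>j<4. \<mu> j = (\<Sum>i<4. (\<Sum>j<4. \<mu> j * cst (V j i)) * cst (W i j)))"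
    by (rule change_generators[of 4 e, OF le lt4 eq_refl[OF delta3[symmetric]] less_imp_le[OF d] e_span e_ind e_inj]) simp_all
  then obtain V W where VW0: "\<forall>\<mu> l. (\<Sum>j<4. \<mu> j * \<nu> j l) = (\<Sum>i<4. (\<Sum>j<4. \<mu> j * cst (V j i)) * e i l)"
    "\<forall>\<mu> :: nat \<Rightarrow> ('v, 'k) mpoly. \<forall>j<4. \<mu> j = (\<Sum>i<4. (\<Sum>j<4. \<mu> j * cst (V j i)) * cst (W i j))"
    by (elim exE conjE)
  note VW = VW0[rule_format]
  define x where "x l i = (\<Sum>j<4. A2 $$ (j, l) * cst (V j i))" for l i
  have dl: "\<delta> ! (l + 2) = 3" if "l < 2" for l using that delta2 delta3 by (auto simp: less_Suc_eq eval_nat_numeral)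
  have r: "x l 0 * K 0 i + x l 1 * K 1 i + x l 2 * K 2 i + x l 3 * \<nu> k i = 0" if "l < 2" for l i
  proof -
    have "(\<Sum>j<4. A2 $$ (j, l) * \<nu> j i) = (\<Sum>j<5. A2 $$ (j, l) * \<nu> j i)"
      by (rule sum.mono_neutral_left) (use linear_relation(3)[of l] dl[OF that] that ge4 in auto)
    also have "\<dots> = 0" using linear_relation(1)[of l i] dl[OF that] that by simp
    finally show ?thesis using VW(1)[of "\<lambda>j. A2 $$ (j, l)" i] by (simp add: x_def[symmetric] sum4 e_def)
  qed
  have hx: "homogeneous 1 (x l i)" if "l < 2" for l i unfolding x_def
  proof (rule homogeneous_sum)
    fix j :: nat assume "j \<in> {..<4}"
    then have "homogeneous 1 (A2 $$ (j, l))" using linear_relation(2)[of l j] lt4[of j] dl[OF that] that by simp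
    then show "homogeneous 1 (A2 $$ (j, l) * cst (V j i))"
      using homogeneous_cst_mult[of 1 "A2 $$ (j, l)" "V j i"] by (simp add: mult.commute)
  qed
  have lt2: "(0::nat) < 2" "(1::nat) < 2" by simp_all
  let ?\<alpha> = "x 0 3" and ?\<beta> = "x 1 3"
  have "?\<beta> * x 0 0 - ?\<alpha> * x 1 0 = 0 \<and> ?\<beta> * x 0 1 - ?\<alpha> * x 1 1 = 0 \<and> ?\<beta> * x 0 2 - ?\<alpha> * x 1 2 = 0"
  proof (rule K_annihilator_small[where t = 2])
    fix i :: nat
    have "(?\<beta> * x 0 0 - ?\<alpha> * x 1 0) * K 0 i + (?\<beta> * x 0 1 - ?\<alpha> * x 1 1) * K 1 i + (?\<beta> * x 0 2 - ?\<alpha> * x 1 2) * K 2 i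
      = ?\<beta> * (x 0 0 * K 0 i + x 0 1 * K 1 i + x 0 2 * K 2 i + x 0 3 * \<nu> k i)
      - ?\<alpha> * (x 1 0 * K 0 i + x 1 1 * K 1 i + x 1 2 * K 2 i + x 1 3 * \<nu> k i)" by (simp add: algebra_simps)
    also have "\<dots> = ?\<beta> * 0 - ?\<alpha> * 0" using r[of 0, OF lt2(1), of i] r[of 1, OF lt2(2), of i] by (simp only:)
    also have "\<dots> = 0" by simp
    finally show "(?\<beta> * x 0 0 - ?\<alpha> * x 1 0) * K 0 i + (?\<beta> * x 0 1 - ?\<alpha> * x 1 1) * K 1 i + (?\<beta> * x 0 2 - ?\<alpha> * x 1 2) * K 2 i = 0" .
  next
    have "homogeneous 2 (?\<beta> * x 0 i - ?\<alpha> * x 1 i)" for i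
      using homogeneous_mult[OF hx[of 1 3] hx[of 0 i]] homogeneous_mult[OF hx[of 0 3] hx[of 1 i]]
      by (intro homogeneous_diff) auto
    then show "homogeneous 2 (?\<beta> * x 0 0 - ?\<alpha> * x 1 0)" "homogeneous 2 (?\<beta> * x 0 1 - ?\<alpha> * x 1 1)"
      "homogeneous 2 (?\<beta> * x 0 2 - ?\<alpha> * x 1 2)" by blast+
  qed simp
  then have px: "?\<beta> * x 0 i = ?\<alpha> * x 1 i" if "i < 4" for i
    using that by (auto simp: less_Suc_eq eval_nat_numeral mult.commute)
  have col: "A2 $$ (j, l) = (\<Sum>i<4. x l i * cst (W i j))" if "j < 4" for j l
    using VW(2)[OF that, of "\<lambda>j. A2 $$ (j, l)"] by (simp add: x_def)
  have col4: "A2 $$ (4, l) = 0" if "l < 2" for l using linear_relation(3)[of l 4] dl[OF that] that d by simp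
  have "?\<beta> = 0 \<and> - ?\<alpha> = 0 \<and> (0 :: ('v, 'k) mpoly) = 0"
  proof (rule A2_injective)
    fix j :: nat assume "j < 5"
    then consider "j < 4" | "j = 4" by linarith
    then show "A2 $$ (j, 0) * ?\<beta> + A2 $$ (j, 1) * - ?\<alpha> + A2 $$ (j, 2) * 0 = 0"
    proof cases
      case 1
      have "A2 $$ (j, 0) * ?\<beta> = (\<Sum>i<4. (?\<beta> * x 0 i) * cst (W i j))" unfolding col[OF 1] sum_distrib_right by (simp add: ac_simps)
      also have "\<dots> = (\<Sum>i<4. (?\<alpha> * x 1 i) * cst (W i j))" by (rule sum.cong) (simp_all only: px lessThan_iff)
      also have "\<dots> = A2 $$ (j, 1) * ?\<alpha>" unfolding col[OF 1] sum_distrib_right by (simp add: ac_simps)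
      finally show ?thesis by simp
    qed (simp add: col4)
  qed
  then have \<alpha>: "?\<alpha> = 0" by simp
  have "x 0 0 = 0 \<and> x 0 1 = 0 \<and> x 0 2 = 0"
    by (rule K_annihilator_small[where t = 1]) (use r[of 0] \<alpha> hx in auto)
  then have "A2 $$ (j, 0) = 0" if "j < 4" for j using col[OF that, of 0] \<alpha> by (simp add: sum4)
  moreover have "A2 $$ (4, 0) = 0" by (simp add: col4)
  ultimately have "\<forall>j<5. A2 $$ (j, 0) = 0" by (auto simp: less_Suc_eq eval_nat_numeral)
  then show False using column_nonzero[of 0] by simp
qed

theorem shifts_unique: "\<delta> = [3, 3, 3, 3, 3]" "\<epsilon> = [1, 1, 1]"
proof -
  show "\<delta> = [3, 3, 3, 3, 3]"
    by (rule nth_equalityI)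
      (use conv'(1) delta_01_epsilon delta2 delta3 delta4 in \<open>auto simp: less_Suc_eq eval_nat_numeral\<close>)
  show "\<epsilon> = [1, 1, 1]"
    by (rule nth_equalityI) (use conv'(2) delta_01_epsilon in \<open>auto simp: less_Suc_eq eval_nat_numeral\<close>)
qed

end

section \<open>No resolution of length two\<close>

text \<open>Projectivity of free modules, column by column.\<close>

lemma lift_columns:
  fixes A :: "'a::comm_ring_1 mat"
  assumes A: "A \<in> carrier_mat r n" and M: "M \<in> carrier_mat r p"
    and col: "\<And>j. j < p \<Longrightarrow> col M j \<in> mat_image A"
  obtains Y where "Y \<in> carrier_mat n p" "M = A * Y"
proof -
  have "\<forall>j\<in>{..<p}. \<exists>w\<in>carrier_vec n. col M j = A *\<^sub>v w"
    using col A by (fastforce simp: mat_image_def)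
  then obtain w where w: "\<And>j. j < p \<Longrightarrow> w j \<in> carrier_vec n \<and> col M j = A *\<^sub>v w j"
    using bchoice[of "{..<p}" "\<lambda>j v. v \<in> carrier_vec n \<and> col M j = A *\<^sub>v v"] by blast
  define Y where "Y = mat n p (\<lambda>(i, j). w j $ i)"
  have Y: "Y \<in> carrier_mat n p" by (simp add: Y_def)
  have cY: "col Y j = w j" if "j < p" for j
    using w[OF that] that by (intro eq_vecI) (auto simp: Y_def)
  have "M = A * Y"
  proof (rule mat_col_eqI)
    fix j assume "j < dim_col (A * Y)"
    then have "j < p" using Y by simp
    then show "col M j = col (A * Y) j" using w[OF \<open>j < p\<close>] cY[OF \<open>j < p\<close>] col_mult2[OF A Y \<open>j < p\<close>] by simp
  qed (use A M Y in auto)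
  then show ?thesis using that Y by blast
qed

lemma lift_kernel:
  fixes A B :: "'a::comm_ring_1 mat"
  assumes "A \<in> carrier_mat r n" "B \<in> carrier_mat n q" "mat_kernel A = mat_image B"
    and M: "M \<in> carrier_mat n p" "A * M = 0\<^sub>m r p"
  obtains Y where "Y \<in> carrier_mat q p" "M = B * Y"
proof (rule lift_columns[OF assms(2) M(1)])
  fix j assume j: "j < p"
  have "A *\<^sub>v col M j = col (A * M) j" by (rule col_mult2[symmetric, OF assms(1) M(1) j])
  also have "\<dots> = 0\<^sub>v r" using M(2) j by simp
  finally have "col M j \<in> mat_kernel A" using assms(1) M(1) j by (auto simp: mat_kernel_def)
  then show "col M j \<in> mat_image B" using assms(3) by simp
qed (use that in blast)

lemma kernel_zero_cancel:
  fixes A :: "'a::comm_ring_1 mat"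
  assumes "A \<in> carrier_mat r n" "mat_kernel A = {0\<^sub>v n}" "M \<in> carrier_mat n p" "A * M = 0\<^sub>m r p"
  shows "M = 0\<^sub>m n p"
proof (rule mat_col_eqI)
  fix j assume "j < dim_col (0\<^sub>m n p :: 'a mat)"
  then have j: "j < p" by simp
  have "A *\<^sub>v col M j = col (A * M) j" by (rule col_mult2[symmetric, OF assms(1,3) j])
  also have "\<dots> = 0\<^sub>v r" using assms(4) j by simp
  finally have "col M j \<in> mat_kernel A" using assms(1,3) j by (auto simp: mat_kernel_def)
  then show "col M j = col (0\<^sub>m n p) j" using assms(2) j by simp
qed (use assms in auto)

lemma col_mult_unit_vec:
  fixes M :: "'a::comm_ring_1 mat"
  assumes "M \<in> carrier_mat a b" "j < b" shows "col M j = M *\<^sub>v unit_vec b j"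
  by (rule eq_vecI) (use assms in auto)

lemma product_zero_of_image:
  fixes A B :: "'a::comm_ring_1 mat"
  assumes A: "A \<in> carrier_mat r n" and B: "B \<in> carrier_mat n q" and "mat_kernel A = mat_image B"
  shows "A * B = 0\<^sub>m r q"
proof (rule mat_col_eqI)
  fix j assume "j < dim_col (0\<^sub>m r q :: 'a mat)"
  then have j: "j < q" by simp
  have "col B j = B *\<^sub>v unit_vec q j" by (rule col_mult_unit_vec[OF B j])
  then have "col B j \<in> mat_kernel A" unfolding assms(3) mat_image_def using B j by auto
  then show "col (A * B) j = col (0\<^sub>m r q) j" using A col_mult2[OF A B j] j by (simp add: mat_kernel_def)
qed (use A B in auto)

text \<open>
  Comparing an exact complex \<open>A\<close> of length three with one of length two, the composite chain map is
  homotopic to the identity; in the top degree it vanishes, so the last map of \<open>A\<close> splits.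
\<close>

lemma last_map_splits:
  fixes A0 A1 A2 B0 B1 :: "'a::comm_ring_1 mat"
  assumes A: "A0 \<in> carrier_mat r n0" "A1 \<in> carrier_mat n0 n1" "A2 \<in> carrier_mat n1 n2"
    and B: "B0 \<in> carrier_mat r p0" "B1 \<in> carrier_mat p0 p1"
    and exA: "mat_kernel A0 = mat_image A1" "mat_kernel A1 = mat_image A2" "mat_kernel A2 = {0\<^sub>v n2}"
    and exB: "mat_kernel B0 = mat_image B1" "mat_kernel B1 = {0\<^sub>v p1}"
    and im: "mat_image A0 = mat_image B0"
  obtains h where "h \<in> carrier_mat n2 n1" "1\<^sub>m n2 + h * A2 = 0\<^sub>m n2 n2"
proof -
  have im_col: "col M j \<in> mat_image M" if "M \<in> carrier_mat a b" "j < b" for M :: "'a mat" and a b j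
  proof -
    have "col M j = M *\<^sub>v unit_vec b j" by (rule col_mult_unit_vec[OF that])
    then show ?thesis using that by (auto simp: mat_image_def)
  qed
  have AA: "A0 * A1 = 0\<^sub>m r n1" "A1 * A2 = 0\<^sub>m n0 n2"
    using product_zero_of_image[OF A(1,2) exA(1)] product_zero_of_image[OF A(2,3) exA(2)] by auto
  have BB: "B0 * B1 = 0\<^sub>m r p1" by (rule product_zero_of_image[OF B(1,2) exB(1)])
  \<comment> \<open>\<open>\<alpha>\<close> and \<open>\<beta>\<close> become chain maps in both
    directions over the identity of the common image; \<open>h0\<close> and \<open>h1\<close> form
    the homotopy between their composite and the identity.\<close>
  obtain \<alpha>0 where \<alpha>0: "\<alpha>0 \<in> carrier_mat p0 n0" "A0 = B0 * \<alpha>0"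
    by (rule lift_columns[OF B(1) A(1)]) (use im_col[OF A(1)] im in auto)
  obtain \<beta>0 where \<beta>0: "\<beta>0 \<in> carrier_mat n0 p0" "B0 = A0 * \<beta>0"
    by (rule lift_columns[OF A(1) B(1)]) (use im_col[OF B(1)] im in auto)
  have "B0 * (\<alpha>0 * A1) = A0 * A1"
    unfolding \<alpha>0(2) by (rule assoc_mult_mat[symmetric, OF B(1) \<alpha>0(1) A(2)])
  then obtain \<alpha>1 where \<alpha>1: "\<alpha>1 \<in> carrier_mat p1 n1" "\<alpha>0 * A1 = B1 * \<alpha>1"
    using lift_kernel[OF B exB(1) mult_carrier_mat[OF \<alpha>0(1) A(2)]] AA(1) by metis
  \<comment> \<open>Here the difference of lengths enters: as \<open>B1\<close> is injective,
    \<open>\<alpha>1\<close> kills the image of \<open>A2\<close>.\<close>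
  have "B1 * (\<alpha>1 * A2) = \<alpha>0 * (A1 * A2)"
    using assoc_mult_mat[OF B(2) \<alpha>1(1) A(3)] assoc_mult_mat[OF \<alpha>0(1) A(2,3)] \<alpha>1(2) by simp
  also have "\<dots> = 0\<^sub>m p0 n2" unfolding AA(2) by (rule right_mult_zero_mat[OF \<alpha>0(1)])
  finally have \<alpha>1A2: "\<alpha>1 * A2 = 0\<^sub>m p1 n2"
    by (rule kernel_zero_cancel[OF B(2) exB(2) mult_carrier_mat[OF \<alpha>1(1) A(3)]])
  have "A0 * (\<beta>0 * B1) = B0 * B1"
    unfolding \<beta>0(2) by (rule assoc_mult_mat[symmetric, OF A(1) \<beta>0(1) B(2)])
  then obtain \<beta>1 where \<beta>1: "\<beta>1 \<in> carrier_mat n1 p1" "\<beta>0 * B1 = A1 * \<beta>1"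
    using lift_kernel[OF A(1,2) exA(1) mult_carrier_mat[OF \<beta>0(1) B(2)]] BB by metis
  let ?I0 = "1\<^sub>m n0 :: 'a mat" and ?I1 = "1\<^sub>m n1 :: 'a mat" and ?I2 = "1\<^sub>m n2 :: 'a mat"
  have c0: "\<beta>0 * \<alpha>0 \<in> carrier_mat n0 n0" by (rule mult_carrier_mat[OF \<beta>0(1) \<alpha>0(1)])
  have "A0 * (\<beta>0 * \<alpha>0 - ?I0) = A0 * (\<beta>0 * \<alpha>0) - A0 * ?I0"
    by (rule mult_minus_distrib_mat[OF A(1) c0 one_carrier_mat])
  also have "A0 * (\<beta>0 * \<alpha>0) = A0"
    using assoc_mult_mat[OF A(1) \<beta>0(1) \<alpha>0(1)] \<beta>0(2) \<alpha>0(2) by metis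
  also have "A0 * ?I0 = A0" by (rule right_mult_one_mat[OF A(1)])
  also have "A0 - A0 = 0\<^sub>m r n0" by (rule minus_r_inv_mat[OF A(1)])
  finally obtain h0 where h0: "h0 \<in> carrier_mat n1 n0" "\<beta>0 * \<alpha>0 - ?I0 = A1 * h0"
    using lift_kernel[OF A(1,2) exA(1), of "\<beta>0 * \<alpha>0 - ?I0" n0] c0 by (metis minus_carrier_mat one_carrier_mat)
  have c1: "\<beta>1 * \<alpha>1 \<in> carrier_mat n1 n1" "h0 * A1 \<in> carrier_mat n1 n1" "\<beta>1 * \<alpha>1 - ?I1 \<in> carrier_mat n1 n1"
    using mult_carrier_mat[OF \<beta>1(1) \<alpha>1(1)] mult_carrier_mat[OF h0(1) A(2)] by (auto intro: minus_carrier_mat)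
  let ?D = "\<beta>1 * \<alpha>1 - ?I1 - h0 * A1"
  have D: "?D \<in> carrier_mat n1 n1" using c1 by (intro minus_carrier_mat) auto
  have "A1 * ?D = A1 * (\<beta>1 * \<alpha>1 - ?I1) - A1 * (h0 * A1)" by (rule mult_minus_distrib_mat[OF A(2) c1(3,2)])
  also have "A1 * (\<beta>1 * \<alpha>1 - ?I1) = A1 * (\<beta>1 * \<alpha>1) - A1 * ?I1"
    by (rule mult_minus_distrib_mat[OF A(2) c1(1) one_carrier_mat])
  also have "A1 * (\<beta>1 * \<alpha>1) = \<beta>0 * \<alpha>0 * A1"
    using assoc_mult_mat[OF A(2) \<beta>1(1) \<alpha>1(1)] assoc_mult_mat[OF \<beta>0(1) B(2) \<alpha>1(1)]
      assoc_mult_mat[OF \<beta>0(1) \<alpha>0(1) A(2)] \<beta>1(2) \<alpha>1(2) by simp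
  also have "A1 * ?I1 = ?I0 * A1" using left_mult_one_mat[OF A(2)] right_mult_one_mat[OF A(2)] by simp
  also have "A1 * (h0 * A1) = (\<beta>0 * \<alpha>0 - ?I0) * A1"
    unfolding h0(2) by (rule assoc_mult_mat[symmetric, OF A(2) h0(1) A(2)])
  also have "\<beta>0 * \<alpha>0 * A1 - ?I0 * A1 = (\<beta>0 * \<alpha>0 - ?I0) * A1"
    by (rule minus_mult_distrib_mat[symmetric, OF c0 one_carrier_mat A(2)])
  also have "(\<beta>0 * \<alpha>0 - ?I0) * A1 - (\<beta>0 * \<alpha>0 - ?I0) * A1 = 0\<^sub>m n0 n1"
    by (rule minus_r_inv_mat[of _ n0 n1]) (use c0 A(2) in \<open>auto intro!: mult_carrier_mat[of _ n0 n0] minus_carrier_mat\<close>)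
  finally obtain h1 where h1: "h1 \<in> carrier_mat n2 n1" "?D = A2 * h1"
    using lift_kernel[OF A(2,3) exA(2) D] by metis
  have c2: "\<beta>1 * \<alpha>1 * A2 = 0\<^sub>m n1 n2"
    using assoc_mult_mat[OF \<beta>1(1) \<alpha>1(1) A(3)] \<alpha>1A2 right_mult_zero_mat[OF \<beta>1(1)] by simp
  have c3: "h0 * A1 * A2 = 0\<^sub>m n1 n2"
    using assoc_mult_mat[OF h0(1) A(2,3)] AA(2) right_mult_zero_mat[OF h0(1)] by simp
  have "?D * A2 = (\<beta>1 * \<alpha>1 - ?I1) * A2 - h0 * A1 * A2" by (rule minus_mult_distrib_mat[OF c1(3,2) A(3)])
  also have "(\<beta>1 * \<alpha>1 - ?I1) * A2 = \<beta>1 * \<alpha>1 * A2 - ?I1 * A2"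
    by (rule minus_mult_distrib_mat[OF c1(1) one_carrier_mat A(3)])
  finally have DA2: "A2 * h1 * A2 = 0\<^sub>m n1 n2 - A2 - 0\<^sub>m n1 n2"
    unfolding h1(2) c2 c3 left_mult_one_mat[OF A(3)] .
  have hA: "h1 * A2 \<in> carrier_mat n2 n2" by (rule mult_carrier_mat[OF h1(1) A(3)])
  have "A2 * (?I2 + h1 * A2) = A2 * ?I2 + A2 * (h1 * A2)"
    by (rule mult_add_distrib_mat[OF A(3) one_carrier_mat hA])
  also have "A2 * (h1 * A2) = 0\<^sub>m n1 n2 - A2 - 0\<^sub>m n1 n2"
    using assoc_mult_mat[OF A(3) h1(1) A(3)] DA2 by simp
  also have "A2 * ?I2 = A2" by (rule right_mult_one_mat[OF A(3)])
  also have "A2 + (0\<^sub>m n1 n2 - A2 - 0\<^sub>m n1 n2) = 0\<^sub>m n1 n2" using A(3) by (intro eq_matI) auto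
  finally have "?I2 + h1 * A2 = 0\<^sub>m n2 n2"
    by (intro kernel_zero_cancel[OF A(3) exA(3)]) (use hA in auto)
  then show ?thesis using that h1(1) by blast
qed

lemma lookup_mult_0: "coef (p * q) 0 = coef p 0 * coef (q :: ('v::finite, 'k::field) mpoly) 0"
proof -
  have c: "coeff (gr r) 0 = cst (coef r 0)" for r :: "('v, 'k) mpoly"
    by (rule poly_mapping_eqI) (simp add: lookup_coeff_gr cst_def lookup_single when_def mon_degree_eq_0)
  have "coeff (gr (p * q)) 0 = coeff (gr p) 0 * coeff (gr q) 0" by (simp add: gr.hom_mult coeff_mult)
  then have "cst (coef (p * q) 0) = (cst (coef p 0 * coef q 0) :: ('v, 'k) mpoly)" unfolding c by (simp add: cst.hom_mult)
  then show ?thesis by (metis cst_def lookup_single_eq)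
qed

lemma ideal_image_eq:
  assumes "A \<in> carrier_mat 1 n" "B \<in> carrier_mat 1 p" "(\<lambda>v. v $ 0) ` mat_image A = (\<lambda>v. v $ 0) ` mat_image B"
  shows "mat_image A = mat_image B"
proof -
  have *: "mat_image M = {v \<in> carrier_vec 1. v $ 0 \<in> (\<lambda>v. v $ 0) ` mat_image M}" if "M \<in> carrier_mat 1 a" for M :: "'a mat" and a
  proof (intro equalityI subsetI)
    fix v assume "v \<in> {v \<in> carrier_vec 1. v $ 0 \<in> (\<lambda>v. v $ 0) ` mat_image M}"
    then obtain w where w: "w \<in> mat_image M" "v $ 0 = w $ 0" "v \<in> carrier_vec 1" by blast
    have "w \<in> carrier_vec 1" using w(1) that by (auto simp: mat_image_def)
    then have "v = w" using w by (intro eq_vecI) auto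
    then show "v \<in> mat_image M" using w by simp
  qed (use that in \<open>auto simp: mat_image_def\<close>)
  show ?thesis using *[OF assms(1)] *[OF assms(2)] assms(3) by simp
qed

section \<open>Multiplicity and Bourbaki degree\<close>

lemma ideal_gen_hc_low:
  assumes "\<And>g. g \<in> set fs \<Longrightarrow> homogeneous d g" "x \<in> ideal_gen (set fs)" "t < d"
  shows "hc t x = 0"
proof -
  obtain F where x: "x = (\<Sum>j<length fs. fs ! j * F j)" using assms(2) unfolding ideal_gen_set by blast
  have "hc t (fs ! j * F j) = 0" if "j < length fs" for j
  proof -
    have "hc t (fs ! j * F j) = fs ! j * hc (t - d) (F j)" by (rule hc_mult) (use assms(1) that in simp)
    then show ?thesis using assms(3) by (simp add: hc_def)
  qed
  then show ?thesis by (simp add: x hc_sum)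
qed

text \<open>Comparing the components of degree 3 makes the coefficients constant.\<close>

lemma form_not_in_ideal_of_others:
  assumes h: "homogeneous 3 g0" "homogeneous 3 g1" "homogeneous 3 g2"
    and ind: "\<And>c0 c1 c2. cst c0 * g0 + cst c1 * g1 + cst c2 * g2 = 0 \<Longrightarrow> c0 = 0 \<and> c1 = 0 \<and> c2 = 0"
  shows "g0 \<noteq> u * g1 + v * (g2 :: ('v::finite, 'k::field) mpoly)"
proof
  assume e: "g0 = u * g1 + v * g2"
  have "g0 = hc 3 (g1 * u + g2 * v)" using h(1) e by (simp add: homogeneous_iff_hc mult.commute)
  also have "\<dots> = g1 * hc 0 u + g2 * hc 0 v" by (simp add: hc_add hc_mult[OF h(2)] hc_mult[OF h(3)])
  also have "\<dots> = g1 * cst (coef u 0) + g2 * cst (coef v 0)"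
    using homogeneous_degree_0[OF homogeneous_hc[of 0 u]] homogeneous_degree_0[OF homogeneous_hc[of 0 v]]
    by (simp_all add: lookup_hc mon_degree_def)
  finally have "cst (- 1) * g0 + cst (coef u 0) * g1 + cst (coef v 0) * g2 = 0"
    by (simp add: cst.hom_uminus mult.commute)
  then have "(- 1 :: 'k) = 0" using ind by blast
  then show False by simp
qed

lemma ideal_gen_pair: "ideal_gen {g1, g2} = ideal_pair g1 (g2 :: 'a::comm_ring_1)"
proof -
  have "ideal_gen {g1, g2} = {\<Sum>j<2. [g1, g2] ! j * F j | F. True}" using ideal_gen_set[of "[g1, g2]"] by (simp add: numeral_2_eq_2)
  also have "\<dots> = ideal_pair g1 g2"
  proof (intro equalityI subsetI)
    fix x assume "x \<in> ideal_pair g1 g2"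
    then obtain u v where "x = u * g1 + v * g2" by (auto simp: ideal_pair_def)
    then show "x \<in> {\<Sum>j<2. [g1, g2] ! j * F j | F. True}"
      by (intro CollectI exI[of _ "\<lambda>j. if j = 0 then u else v"]) (simp add: numeral_2_eq_2 mult.commute)
  next
    fix x assume "x \<in> {\<Sum>j<2. [g1, g2] ! j * F j | F. True}"
    then obtain F where "x = (\<Sum>j<2. [g1, g2] ! j * F j)" by blast
    then have "x = F 0 * g1 + F 1 * g2" by (simp add: numeral_2_eq_2 mult.commute)
    then show "x \<in> ideal_pair g1 g2" by (rule ideal_pairI)
  qed
  finally show ?thesis .
qed

lemma ideal_gen_triple: "x \<in> ideal_gen {g0, g1, g2} \<longleftrightarrow> (\<exists>u0 u1 u2. x = g0 * u0 + g1 * u1 + g2 * (u2 :: 'a::comm_ring_1))"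
proof -
  have "ideal_gen {g0, g1, g2} = {\<Sum>j<3. [g0, g1, g2] ! j * F j | F. True}" using ideal_gen_set[of "[g0, g1, g2]"] by (simp add: eval_nat_numeral)
  then have "x \<in> ideal_gen {g0, g1, g2} \<longleftrightarrow> (\<exists>F :: nat \<Rightarrow> 'a. x = g0 * F 0 + g1 * F 1 + g2 * F 2)"
    by (auto simp: eval_nat_numeral)
  also have "\<dots> \<longleftrightarrow> (\<exists>u0 u1 u2. x = g0 * u0 + g1 * u1 + g2 * u2)"
  proof
    assume "\<exists>u0 u1 u2. x = g0 * u0 + g1 * u1 + g2 * u2"
    then obtain u0 u1 u2 where "x = g0 * u0 + g1 * u1 + g2 * u2" by blast
    then show "\<exists>F :: nat \<Rightarrow> 'a. x = g0 * F 0 + g1 * F 1 + g2 * F 2"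
      by (intro exI[of _ "\<lambda>i. if i = 0 then u0 else if i = 1 then u1 else u2"]) simp
  qed blast
  finally show ?thesis .
qed

lemma independent_cubics_minimal:
  assumes h: "homogeneous 3 g0" "homogeneous 3 g1" "homogeneous 3 g2"
    and ind: "\<And>c0 c1 c2. cst c0 * g0 + cst c1 * g1 + cst c2 * g2 = 0 \<Longrightarrow> c0 = 0 \<and> c1 = 0 \<and> c2 = 0"
  shows "minimally_generated_by_forms 3 [g0, g1, g2 :: ('v::finite, 'k::field) mpoly] (ideal_gen {g0, g1, g2})"
proof -
  have n0: "g0 \<noteq> u * g1 + v * g2" for u v by (rule form_not_in_ideal_of_others[OF h ind])
  have n1: "g1 \<noteq> u * g0 + v * g2" for u v
  proof (rule form_not_in_ideal_of_others[OF h(2,1,3)])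
    fix c0 c1 c2 assume "cst c0 * g1 + cst c1 * g0 + cst c2 * g2 = 0"
    then have "cst c1 * g0 + cst c0 * g1 + cst c2 * g2 = 0" by (simp only: add.commute)
    then show "c0 = 0 \<and> c1 = 0 \<and> c2 = 0" using ind by blast
  qed
  have n2: "g2 \<noteq> u * g0 + v * g1" for u v
  proof (rule form_not_in_ideal_of_others[OF h(3,1,2)])
    fix c0 c1 c2 assume "cst c0 * g2 + cst c1 * g0 + cst c2 * g1 = 0"
    then have "cst c1 * g0 + cst c2 * g1 + cst c0 * g2 = 0" by (simp only: ac_simps)
    then show "c0 = 0 \<and> c1 = 0 \<and> c2 = 0" using ind by blast
  qed
  have d: "g0 \<noteq> g1" "g0 \<noteq> g2" "g1 \<noteq> g2" using n0[of 1 0] n0[of 0 1] n1[of 0 1] by auto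
  have s: "{g0, g1, g2} - {g0} = {g1, g2}" "{g0, g1, g2} - {g1} = {g0, g2}" "{g0, g1, g2} - {g2} = {g0, g1}"
    using d by auto
  have "g0 \<notin> ideal_gen {g1, g2}" "g1 \<notin> ideal_gen {g0, g2}" "g2 \<notin> ideal_gen {g0, g1}"
    unfolding ideal_gen_pair using n0 n1 n2 by (auto simp: ideal_pair_def)
  then show ?thesis using h d by (simp add: minimally_generated_by_forms_def s)
qed

section \<open>Multiplicity of the ideal, and why it is not perfect\<close>

context cubic_resolution
begin

lemma a_values: "i < 5 \<Longrightarrow> a1 ! i = 6" "i < 3 \<Longrightarrow> a2 ! i = 7"
proof -
  have d: "\<delta> ! i = 3" if "i < 5" for i
    by (subst shifts_unique(1)) (use that in \<open>auto simp: less_Suc_eq eval_nat_numeral\<close>)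
  have e: "\<epsilon> ! i = 1" if "i < 3" for i
    by (subst shifts_unique(2)) (use that in \<open>auto simp: less_Suc_eq eval_nat_numeral\<close>)
  show "i < 5 \<Longrightarrow> a1 ! i = 6" "i < 3 \<Longrightarrow> a2 ! i = 7" using d[of i] d[of "i + 2"] e[of i] by (simp_all add: a_simps)
qed

lemma dim_J_value: "int (mp.dim {p \<in> J. homogeneous t p}) = 3 * int (cb (Suc (Suc m)) (t - 3))
    - 5 * int (cb (Suc (Suc m)) (t - 6)) + 3 * int (cb (Suc (Suc m)) (t - 7))"
  using dim_J[of t] by (simp add: a_values)

lemma second_difference:
  "int (cb (Suc (Suc m)) s) = int (cb (Suc (Suc m)) (s - 1)) + int (cb (Suc m) s)"
  "int (cb (Suc m) s) = int (cb (Suc m) (s - 1)) + int (cb m s)"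
  using cb_Suc[of "Suc m" s] cb_Suc[of m s] by simp_all

theorem multiplicity_J: "multiplicity_quotient J = 3"
proof -
  \<comment> \<open>The coefficients of
    \<open>(1 - 3 z^3 + 5 z^6 - 3 z^7) / (1 - z)^2\<close>.\<close>
  define q :: "nat \<Rightarrow> int" where "q j = [1, 2, 3, 1, - 1, - 3] ! j" for j
  have "int (hilbert_function J t) = (\<Sum>j<6. q j * int (cb m (int t - int j)))" for t
  proof -
    define T where "T = int t"
    have "int (hilbert_function J t) = int (cb (Suc (Suc m)) T) - int (mp.dim {p \<in> J. homogeneous T p})"
      using hilbert_function_add[of J t] by (simp add: card_m T_def flip: of_nat_add)
    also have "\<dots> = int (cb (Suc (Suc m)) T) - 3 * int (cb (Suc (Suc m)) (T - 3))
      + 5 * int (cb (Suc (Suc m)) (T - 6)) - 3 * int (cb (Suc (Suc m)) (T - 7))"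
      unfolding dim_J_value by simp
    also have "\<dots> = int (cb m T) + 2 * int (cb m (T - 1)) + 3 * int (cb m (T - 2)) + int (cb m (T - 3))
      - int (cb m (T - 4)) - 3 * int (cb m (T - 5))"
      using second_difference[of T] second_difference[of "T - 1"] second_difference[of "T - 2"]
        second_difference[of "T - 3"] second_difference[of "T - 4"] second_difference[of "T - 5"] second_difference[of "T - 6"]
      by simp
    also have "\<dots> = (\<Sum>j<6. q j * int (cb m (int t - int j)))"
      by (simp add: q_def T_def eval_nat_numeral)
    finally show ?thesis .
  qed
  moreover have "(\<Sum>j<6. q j) = 3" by (simp add: q_def eval_nat_numeral)
  ultimately show ?thesis using multiplicity_from_hilbert_function[where I = J and l = 6 and q = q and m = m] by simp
qed

text \<open>A perfect \<open>J\<close> would have a resolution of length two, and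
  \<open>last_map_splits\<close> would make 1 plus an entry of \<open>h * A2\<close> zero. By
  minimality that entry has constant term 0.\<close>

lemma not_perfect: "\<not> perfect_ideal J"
proof
  assume "perfect_ideal J"
  then have "proj_dim_quotient J = 2" using ht by (simp add: perfect_ideal_def numeral_eq_enat)
  moreover have "\<exists>F A. graded_free_resolution J F A \<and> length F = 3"
    by (intro exI[of _ "[[3, 3, 3], a1, a2]"] exI[of _ "[A0, A1, A2]"] conjI grf) simp
  then have "\<exists>F A. graded_free_resolution J F A \<and> length F = proj_dim_quotient J"
    unfolding proj_dim_quotient_def by (rule LeastI)
  ultimately obtain F A where F: "graded_free_resolution J F A" "length F = 2" by auto
  obtain b0 b1 where Fe: "F = [b0, b1]" using F(2) by (auto simp: length_Suc_conv numeral_2_eq_2)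
  have "length A = 2" using F by (auto simp: graded_free_resolution_def)
  then obtain B0 B1 where Ae: "A = [B0, B1]" by (auto simp: length_Suc_conv numeral_2_eq_2)
  have all: "\<forall>i<2. graded_matrix ([b0, b1] ! i) (([0] # [b0, b1]) ! i) ([B0, B1] ! i)"
    "\<forall>i. Suc i < 2 \<longrightarrow> mat_kernel ([B0, B1] ! i) = mat_image ([B0, B1] ! Suc i)"
    "mat_kernel B1 = {0\<^sub>v (length b1)}" "J = (\<lambda>v. v $ 0) ` mat_image B0"
    using F(1) unfolding Fe Ae graded_free_resolution_def by auto
  have B: "B0 \<in> carrier_mat 1 (length b0)" "B1 \<in> carrier_mat (length b0) (length b1)"
    using all(1)[rule_format, of 0] all(1)[rule_format, of 1] by (simp_all add: graded_matrix_def)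
  have A: "A0 \<in> carrier_mat 1 3" "A1 \<in> carrier_mat 3 5" "A2 \<in> carrier_mat 5 3"
    using dA by (auto intro: carrier_matI)
  have im: "mat_image A0 = mat_image B0"
    by (rule ideal_image_eq[OF A(1) B(1)]) (use exA(4) all(4) in simp)
  have exB: "mat_kernel B0 = mat_image B1" using all(2)[rule_format, of 0] by simp
  obtain h where h: "h \<in> carrier_mat 3 5" "1\<^sub>m 3 + h * A2 = 0\<^sub>m 3 3"
    by (rule last_map_splits[OF A B exA(1-3) exB all(3) im])
  have "(1\<^sub>m 3 + h * A2) $$ (0, 0) = 1 + (\<Sum>i<5. h $$ (0, i) * A2 $$ (i, 0))"
    using h(1) A(3) by (simp add: scalar_prod_def atLeast0LessThan)
  then have "1 + (\<Sum>i<5. h $$ (0, i) * A2 $$ (i, 0)) = 0" unfolding h(2) by simp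
  then have "coef (1 + (\<Sum>i<5. h $$ (0, i) * A2 $$ (i, 0))) 0 = 0" by simp
  moreover have "coef (A2 $$ (i, 0)) 0 = 0" if "i < 5" for i
    using res that by (simp add: minimal_graded_free_resolution_def dA)
  ultimately show False by (simp add: lookup_add lookup_sum lookup_mult_0)
qed

end

section \<open>Arbitrary generating triples, and uniqueness of the multiplicity of Bourbaki
  ideals\<close>

context cubic_resolution
begin

lemma cubic_multiple_homogeneous:
  assumes "homogeneous d p" "p \<noteq> 0" "homogeneous t (p * r)" shows "homogeneous (t - d) r"
proof -
  have "p * r = p * hc (t - d) r" using assms(3) hc_mult[OF assms(1), of t r] by (simp add: homogeneous_iff_hc)
  then have "r = hc (t - d) r" using mpoly_mult_left_cancel[OF assms(2)] by blast
  then show ?thesis by (simp add: homogeneous_iff_hc)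
qed

text \<open>\<open>bourbaki_degree\<close> leaves \<open>d\<close> open. For \<open>d > 3\<close>
  the cubic \<open>f 0\<close> could not lie in the ideal; for \<open>d < 3\<close> a generator
  would be zero and hence redundant.\<close>

lemma generators_degree:
  assumes "length fs = 3" "minimally_generated_by_forms d fs J" shows "d = 3"
proof -
  have fs: "\<And>g. g \<in> set fs \<Longrightarrow> homogeneous (int d) g" "J = ideal_gen (set fs)"
    "\<And>g. g \<in> set fs \<Longrightarrow> g \<notin> ideal_gen (set fs - {g})"
    using assms(2) by (auto simp: minimally_generated_by_forms_def)
  have "hc 3 (f 0) = f 0" using f_hom[of 0] by (simp add: homogeneous_iff_hc)
  then have "\<not> 3 < int d" using ideal_gen_hc_low[where fs = fs and d = "int d" and x = "f 0" and t = 3, OF fs(1)] f_mem(1) fs(2) f_nonzero[of 0] by auto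
  moreover have "\<not> int d < 3"
  proof
    assume d: "int d < 3"
    have g: "fs ! 0 \<in> set fs" using assms(1) by simp
    then have "fs ! 0 \<in> J" unfolding fs(2) by (intro Modules.module.span_base[OF module_mult])
    then obtain u0 u1 u2 where u: "fs ! 0 = f 0 * u0 + f 1 * u1 + f 2 * u2" unfolding J_iff by blast
    have z: "hc (int d) (f i * u) = 0" if "i < 3" for i u
      using hc_mult[OF f_hom[OF that], of "int d" u] d by (simp add: hc_def)
    have "fs ! 0 = hc (int d) (fs ! 0)" using fs(1)[OF g] by (simp add: homogeneous_iff_hc)
    then have "fs ! 0 = 0" unfolding u hc_add using z[of 0 u0] z[of 1 u1] z[of 2 u2] by simp
    moreover have "0 \<in> ideal_gen (set fs - {fs ! 0})" by (rule Modules.module.span_zero[OF module_mult])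
    ultimately show False using fs(3)[OF g] by simp
  qed
  ultimately show ?thesis by simp
qed

end

text \<open>The resolution fixes one generating triple, but the Bourbaki degree refers to all of
  them. The dimensions of the graded pieces of \<open>J\<close>, computed from the resolution, serve
  for every triple.\<close>

locale cubic_generators = cubic_resolution J \<delta> \<epsilon> A0 A1 A2
  for J :: "('v::finite, 'k::field_char_0) mpoly set" and \<delta> \<epsilon> A0 A1 A2 +
  fixes g0 g1 g2 :: "('v, 'k) mpoly"
  assumes g_hom: "homogeneous 3 g0" "homogeneous 3 g1" "homogeneous 3 g2"
    and J_gen: "J = ideal_gen {g0, g1, g2}"
begin

abbreviation "gs \<equiv> [g0, g1, g2]"

lemma J_iff_g: "x \<in> J \<longleftrightarrow> (\<exists>u0 u1 u2. x = g0 * u0 + g1 * u1 + g2 * u2)"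
  unfolding J_gen by (rule ideal_gen_triple)

lemma g_coprime: "coprime_set {g0, g1, g2}"
  unfolding coprime_set_def
proof (intro allI impI, rule ccontr)
  fix p assume p: "prime_elem p" "\<not> (\<exists>g\<in>{g0, g1, g2}. \<not> p dvd g)"
  then have "p dvd g0" "p dvd g1" "p dvd g2" by blast+
  then have "p dvd x" if "x \<in> J" for x using that unfolding J_iff_g by (elim exE) simp
  then show False using J_coprime p(1) by (auto simp: coprime_set_def)
qed

lemma g_nonzero: "\<not> (g0 = 0 \<and> g1 = 0 \<and> g2 = 0)"
proof
  assume "g0 = 0 \<and> g1 = 0 \<and> g2 = 0"
  moreover have "f 0 \<in> J" by (rule f_mem)
  ultimately have "f 0 = 0" unfolding J_iff_g by simp
  then show False using f_nonzero[of 0] by simp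
qed

definition "syz = {F :: nat \<Rightarrow> ('v, 'k) mpoly. (\<forall>i\<ge>3. F i = 0) \<and> g0 * F 0 + g1 * F 1 + g2 * F 2 = 0}"

lemma row_eq_0: "lin (row_matrix gs) F = 0 \<longleftrightarrow> g0 * F 0 + g1 * F 1 + g2 * F 2 = 0"
proof -
  have "dim_row (row_matrix gs) = 1" by (simp add: row_matrix_def)
  then show ?thesis
    using lin_eq_0_iff_single_row[of "row_matrix gs" F] by (simp add: lin_row_matrix eval_nat_numeral add.assoc)
qed

lemma graded_row: "graded_matrix [3, 3, 3] [0] (row_matrix gs)"
proof -
  have "homogeneous 3 h" if "h \<in> set gs" for h using that g_hom by auto
  then have "graded_matrix (replicate (length gs) 3) [0] (row_matrix gs)" by (rule graded_row_matrix)
  then show ?thesis by (simp add: eval_nat_numeral)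
qed

lemma syz_grade: "{F \<in> grade [3, 3, 3] t. lin (row_matrix gs) F = 0} = {F \<in> syz. F \<in> grade [3, 3, 3] t}"
  by (auto simp: row_eq_0 syz_def grade_def)

text \<open>Rank and nullity for the row \<open>gs\<close> gives this from the dimensions of
  \<open>J\<close> alone, so all generating triples have syzygies with the same Hilbert
  function.\<close>

lemma dim_syz_g: "int (mf.dim {F \<in> syz. F \<in> grade [3, 3, 3] t}) = 5 * int (cb (Suc (Suc m)) (t - 6)) - 3 * int (cb (Suc (Suc m)) (t - 7))"
proof -
  have J: "J = {lin (row_matrix gs) F 0 | F. True}"
    using ideal_gen_set[of gs] unfolding J_gen lin_row_matrix by simp
  have "mf.dim (grade [3, 3, 3] t :: (nat \<Rightarrow> ('v, 'k) mpoly) set) = 3 * cb (Suc (Suc m)) (t - 3)"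
    by (simp add: dim_grade card_m lessThan_Suc)
  then show ?thesis
    using dim_row_image(2)[OF graded_row J, of t] dim_J_value[of t] by (simp add: syz_grade)
qed

lemma syz_low: "F \<in> syz \<Longrightarrow> F \<in> grade [3, 3, 3] t \<Longrightarrow> t < 6 \<Longrightarrow> F = 0"
proof -
  assume F: "F \<in> syz" "F \<in> grade [3, 3, 3] t" and t: "t < 6"
  have "mf.dim {F \<in> syz. F \<in> grade [3, 3, 3] t} = 0" using dim_syz_g[of t] t by (simp add: cb_def)
  moreover obtain C where "mf.independent C" "{F \<in> syz. F \<in> grade [3, 3, 3] t} \<subseteq> mf.span C"
    "card C = mf.dim {F \<in> syz. F \<in> grade [3, 3, 3] t}" "C \<subseteq> {F \<in> syz. F \<in> grade [3, 3, 3] t}" by (rule mf.basis_exists)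
  moreover have "finite C"
  proof -
    have "C \<subseteq> mf.span (unit_monomial ` grade_index [3, 3, 3] t)" using calculation(5) grade_span by blast
    then show ?thesis using mf.independent_span_bound[OF finite_imageI[OF finite_grade_index] calculation(2)] by blast
  qed
  ultimately have "C = {}" "{F \<in> syz. F \<in> grade [3, 3, 3] t} \<subseteq> mf.span C" by auto
  then show "F = 0" using F by auto
qed

lemma syzygies_vec: "v \<in> syzygies gs \<longleftrightarrow> v \<in> carrier_vec 3 \<and> vfun v \<in> syz"
proof -
  have 1: "v \<in> syzygies gs \<longleftrightarrow> v \<in> carrier_vec 3 \<and> (\<Sum>i<3. v $ i * gs ! i) = 0"
    by (simp add: syzygies_def numeral_3_eq_3)
  have 2: "(\<Sum>i<3. v $ i * gs ! i) = g0 * v $ 0 + g1 * v $ 1 + g2 * v $ 2" by (simp add: eval_nat_numeral ac_simps)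
  have 3: "vfun v \<in> syz \<longleftrightarrow> g0 * v $ 0 + g1 * v $ 1 + g2 * v $ 2 = 0" if "v \<in> carrier_vec 3"
    using that by (simp add: syz_def vfun_def)
  show ?thesis unfolding 1 2 using 3 by blast
qed

lemma syz_mult: "F \<in> syz \<Longrightarrow> (\<lambda>i. c * F i) \<in> syz"
proof -
  assume F: "F \<in> syz"
  have "g0 * (c * F 0) + g1 * (c * F 1) + g2 * (c * F 2) = c * (g0 * F 0 + g1 * F 1 + g2 * F 2)"
    by (simp add: algebra_simps)
  then show ?thesis using F by (simp add: syz_def)
qed

lemma vec_syz: "F \<in> syz \<Longrightarrow> vec 3 F \<in> syzygies gs \<and> vfun (vec 3 F) = F"
proof -
  assume F: "F \<in> syz"
  then have "vfun (vec 3 F) = F" by (intro vfun_vec) (simp add: syz_def)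
  then show ?thesis using F by (simp add: syzygies_vec)
qed

lemma homogeneous_vec_grade:
  assumes "v \<in> carrier_vec 3" shows "homogeneous_vec t v \<longleftrightarrow> vfun v \<in> grade [3, 3, 3] (t + 3)"
proof -
  have "\<forall>i<3. [3, 3, 3] ! i = (3 :: int)" by (auto simp: less_Suc_eq eval_nat_numeral)
  then show ?thesis using assms by (auto simp: homogeneous_vec_def grade_def vfun_def)
qed

text \<open>The general combination of the three Koszul syzygies of the triple.\<close>

definition "ko a b c = (\<lambda>i::nat. if i = 0 then a * g1 - b * g2 else if i = 1 then c * g2 - a * g0 else if i = 2 then b * g0 - c * g1 else (0 :: ('v, 'k) mpoly))"

lemma ko_syz: "ko a b c \<in> syz"
  by (simp add: ko_def syz_def algebra_simps)

lemma ko_grade: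
  assumes "homogeneous t a" "homogeneous t b" "homogeneous t c"
  shows "ko a b c \<in> grade [3, 3, 3] (t + 6)"
proof -
  have m: "homogeneous (t + 3) (a * g1 - b * g2)" "homogeneous (t + 3) (c * g2 - a * g0)" "homogeneous (t + 3) (b * g0 - c * g1)"
    by (rule homogeneous_diff; rule homogeneous_mult[OF assms(1) g_hom(1)] homogeneous_mult[OF assms(1) g_hom(2)]
      homogeneous_mult[OF assms(2) g_hom(1)] homogeneous_mult[OF assms(2) g_hom(3)]
      homogeneous_mult[OF assms(3) g_hom(2)] homogeneous_mult[OF assms(3) g_hom(3)])+
  have "homogeneous (t + 6 - [3, 3, 3] ! i) (ko a b c i)" if "i < 3" for i
  proof -
    have "i = 0 \<or> i = 1 \<or> i = 2" using that by linarith
    then show ?thesis using m by (elim disjE) (simp_all add: ko_def add.commute)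
  qed
  moreover have "ko a b c i = 0" if "i \<ge> 3" for i using that by (simp add: ko_def)
  ultimately show ?thesis unfolding grade_def by (simp add: numeral_3_eq_3)
qed

text \<open>There are no nonzero syzygies with entries of degree below 3 by dimension, and the
  Koszul syzygies, which are not all zero, have entries of degree 3.\<close>

lemma syz_indeg_value: "syz_indeg gs = 3"
proof -
  obtain a b c where ko: "ko a b c \<noteq> 0" "homogeneous 0 a" "homogeneous 0 b" "homogeneous 0 c"
  proof -
    have e: "ko 1 0 0 0 = g1" "ko 1 0 0 1 = - g0" "ko 0 1 0 2 = g0" "ko 0 0 1 1 = g2" by (simp_all add: ko_def)
    have "ko 1 0 0 \<noteq> 0 \<or> ko 0 0 1 \<noteq> 0"
    proof (rule ccontr)
      assume "\<not> ?thesis"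
      then have z: "ko 1 0 0 = 0" "ko 0 0 1 = 0" by blast+
      have "g1 = 0" "- g0 = 0" "g2 = 0"
        using fun_cong[OF z(1), of 0] fun_cong[OF z(1), of 1] fun_cong[OF z(2), of 1]
        unfolding e zero_fun_apply by blast+
      then show False using g_nonzero by simp
    qed
    moreover have "homogeneous 0 (1 :: ('v, 'k) mpoly)" using homogeneous_cst[of 1] by simp
    ultimately show ?thesis using that[of 1 0 0] that[of 0 0 1] homogeneous_0 by blast
  qed
  have "(LEAST t. \<exists>v\<in>syzygies gs. v \<noteq> 0\<^sub>v (length gs) \<and> homogeneous_vec (int t) v) = 3"
  proof (rule Least_equality)
    have "vec 3 (ko a b c) \<in> syzygies gs" "vfun (vec 3 (ko a b c)) = ko a b c" using vec_syz[OF ko_syz] by auto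
    moreover have "vec 3 (ko a b c) \<noteq> 0\<^sub>v 3"
    proof
      assume "vec 3 (ko a b c) = 0\<^sub>v 3"
      then have "ko a b c = vfun (0\<^sub>v 3)" using calculation(2) by simp
      then show False using ko(1) by (auto simp: vfun_def zero_fun_def)
    qed
    moreover have "homogeneous_vec (int 3) (vec 3 (ko a b c))"
      using ko_grade[OF ko(2-4)] calculation(2) by (subst homogeneous_vec_grade) simp_all
    ultimately show "\<exists>v\<in>syzygies gs. v \<noteq> 0\<^sub>v (length gs) \<and> homogeneous_vec (int 3) v" by (auto simp: eval_nat_numeral)
  next
    fix t assume "\<exists>v\<in>syzygies gs. v \<noteq> 0\<^sub>v (length gs) \<and> homogeneous_vec (int t) v"
    then obtain v where v: "v \<in> syzygies gs" "v \<noteq> 0\<^sub>v 3" "homogeneous_vec (int t) v" by (auto simp: eval_nat_numeral)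
    show "3 \<le> t"
    proof (rule ccontr)
      assume "\<not> 3 \<le> t"
      then have "vfun v = 0" using v syz_low[of "vfun v" "int t + 3"] by (simp add: syzygies_vec homogeneous_vec_grade)
      then have "v = 0\<^sub>v 3" using v(1) by (auto simp: syzygies_vec vfun_def zero_fun_def fun_eq_iff intro!: eq_vecI) metis
      then show False using v(2) by simp
    qed
  qed
  then show ?thesis by (simp add: syz_indeg_def)
qed

context
  fixes \<nu>' B \<phi> s
  assumes \<nu>': "\<nu>' \<in> syzygies gs" "\<nu>' \<noteq> 0\<^sub>v 3" "homogeneous_vec 3 \<nu>'"
    and B: "height B = 2"
    and \<phi>_add: "\<And>v w. v \<in> syzygies gs \<Longrightarrow> w \<in> syzygies gs \<Longrightarrow> \<phi> (v + w) = \<phi> v + \<phi> w"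
    and \<phi>_mult: "\<And>r v. v \<in> syzygies gs \<Longrightarrow> \<phi> (r \<cdot>\<^sub>v v) = r * \<phi> v"
    and \<phi>_hom: "\<And>t v. v \<in> syzygies gs \<Longrightarrow> homogeneous_vec t v \<Longrightarrow> homogeneous (t + s) (\<phi> v)"
    and \<phi>_im: "\<phi> ` syzygies gs = B"
    and \<phi>_ker: "{v \<in> syzygies gs. \<phi> v = 0} = range (\<lambda>r. r \<cdot>\<^sub>v \<nu>')"
begin

definition "\<psi> F = \<phi> (vec 3 F)"
definition "N = vfun \<nu>'"

lemma N: "N \<in> syz" "N \<noteq> 0" "N \<in> grade [3, 3, 3] 6"
proof -
  show "N \<in> syz" "N \<in> grade [3, 3, 3] 6"
    using \<nu>' by (simp_all add: N_def syzygies_vec homogeneous_vec_grade)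
  have "\<nu>' = vec 3 N" using \<nu>'(1) by (auto simp: N_def syzygies_vec vfun_def)
  then show "N \<noteq> 0" using \<nu>'(2) by (auto simp: zero_fun_def)
qed

lemma \<psi>_add: "F \<in> syz \<Longrightarrow> G \<in> syz \<Longrightarrow> \<psi> (F + G) = \<psi> F + \<psi> G"
proof -
  assume "F \<in> syz" "G \<in> syz"
  moreover have "vec 3 (F + G) = vec 3 F + vec 3 G" by (auto simp: plus_fun_def)
  ultimately show ?thesis using vec_syz \<phi>_add by (simp add: \<psi>_def)
qed

lemma \<psi>_mult: "F \<in> syz \<Longrightarrow> \<psi> (\<lambda>i. r * F i) = r * \<psi> F"
proof -
  assume "F \<in> syz"
  moreover have "vec 3 (\<lambda>i. r * F i) = r \<cdot>\<^sub>v vec 3 F" by auto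
  ultimately show ?thesis using vec_syz \<phi>_mult by (simp add: \<psi>_def)
qed

lemma \<psi>_hom: "F \<in> syz \<Longrightarrow> F \<in> grade [3, 3, 3] (t + 3) \<Longrightarrow> homogeneous (t + s) (\<psi> F)"
  using vec_syz[of F] \<phi>_hom[of "vec 3 F" t] by (simp add: \<psi>_def homogeneous_vec_grade)

lemma \<psi>_image: "\<psi> ` syz = B"
proof -
  have "\<psi> (vfun v) = \<phi> v" if "v \<in> syzygies gs" for v
  proof -
    have "vec 3 (vfun v) = v" using that by (auto simp: syzygies_vec vfun_def)
    then show ?thesis by (simp add: \<psi>_def)
  qed
  moreover have "\<psi> F = \<phi> (vec 3 F)" for F by (simp add: \<psi>_def)
  ultimately show ?thesis using \<phi>_im vec_syz syzygies_vec by (smt (verit) image_iff subsetI subset_antisym)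
qed

lemma \<psi>_ker: "F \<in> syz \<Longrightarrow> \<psi> F = 0 \<longleftrightarrow> (\<exists>r. F = (\<lambda>i. r * N i))"
proof -
  assume F: "F \<in> syz"
  have v: "vec 3 F \<in> syzygies gs" "vfun (vec 3 F) = F" using vec_syz[OF F] by auto
  have "\<psi> F = 0 \<longleftrightarrow> vec 3 F \<in> range (\<lambda>r. r \<cdot>\<^sub>v \<nu>')" using v(1) \<phi>_ker by (auto simp: \<psi>_def)
  also have "\<dots> \<longleftrightarrow> (\<exists>r. F = (\<lambda>i. r * N i))"
  proof
    assume "vec 3 F \<in> range (\<lambda>r. r \<cdot>\<^sub>v \<nu>')"
    then obtain r where "vec 3 F = r \<cdot>\<^sub>v \<nu>'" by blast
    then have "F = vfun (r \<cdot>\<^sub>v \<nu>')" using v(2) by simp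
    then have "F = (\<lambda>i. r * N i)" by (auto simp: N_def vfun_def)
    then show "\<exists>r. F = (\<lambda>i. r * N i)" by blast
  next
    assume "\<exists>r. F = (\<lambda>i. r * N i)"
    then obtain r where r: "F = (\<lambda>i. r * N i)" by blast
    have "dim_vec \<nu>' = 3" using \<nu>'(1) by (simp add: syzygies_vec)
    then have "vec 3 F = r \<cdot>\<^sub>v \<nu>'" by (auto simp: r N_def vfun_def)
    then show "vec 3 F \<in> range (\<lambda>r. r \<cdot>\<^sub>v \<nu>')" by blast
  qed
  finally show ?thesis .
qed

text \<open>A common factor of the entries of \<open>\<nu>'\<close> would give a syzygy of smaller degree.\<close>

lemma N_coprime: "coprime_set {N 0, N 1, N 2}"
  unfolding coprime_set_def
proof (intro allI impI, rule ccontr)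
  fix p assume p: "prime_elem p" "\<not> (\<exists>f\<in>{N 0, N 1, N 2}. \<not> p dvd f)"
  then obtain a0 a1 a2 where a: "N 0 = p * a0" "N 1 = p * a1" "N 2 = p * a2" by (auto simp: dvd_def)
  have Nz: "N i = 0" if "i \<ge> 3" for i using N(1) that by (simp add: syz_def)
  have allz: "N = 0" if "N 0 = 0" "N 1 = 0" "N 2 = 0"
  proof
    fix i :: nat
    have "i = 0 \<or> i = 1 \<or> i = 2 \<or> i \<ge> 3" by linarith
    then show "N i = 0 i" using that Nz[of i] by (elim disjE) (simp_all add: zero_fun_def)
  qed
  have hN: "homogeneous 3 (N 0)" "homogeneous 3 (N 1)" "homogeneous 3 (N 2)"
    using N(3) by (auto simp: grade_def less_Suc_eq eval_nat_numeral)
  have p0: "p \<noteq> 0" using p(1) by auto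
  have "\<exists>e\<ge>0. homogeneous e p"
  proof -
    have "N 0 \<noteq> 0 \<or> N 1 \<noteq> 0 \<or> N 2 \<noteq> 0" using allz N(2) by blast
    then show ?thesis using homogeneous_factor[of 3 p a0] homogeneous_factor[of 3 p a1] homogeneous_factor[of 3 p a2] hN a by auto
  qed
  then obtain e where e: "e \<ge> 0" "homogeneous e p" by blast
  \<comment> \<open>A prime element is not a unit, so its degree is positive and dividing by it
    lowers the degree of the syzygy.\<close>
  have "e \<noteq> 0"
  proof
    assume "e = 0"
    then have "p = cst (coef p 0)" using e(2) homogeneous_degree_0 by blast
    then have "p dvd 1" using p0 cst_dvd_1[of "coef p 0"] by (metis cst_eq_0_iff)
    then show False using p(1) by (simp add: prime_elem_not_unit)
  qed
  define F where "F = (\<lambda>i::nat. if i = 0 then a0 else if i = 1 then a1 else if i = 2 then a2 else 0)"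
  have "g0 * N 0 + g1 * N 1 + g2 * N 2 = 0" using N(1) by (simp add: syz_def)
  then have "p * (g0 * a0 + g1 * a1 + g2 * a2) = 0" unfolding a by (simp add: algebra_simps)
  then have "F \<in> syz" using p0 by (simp add: syz_def F_def mpoly_mult_eq_0_iff)
  moreover have "F \<in> grade [3, 3, 3] (6 - e)"
    using cubic_multiple_homogeneous[OF e(2) p0] hN a by (auto simp: grade_def F_def less_Suc_eq eval_nat_numeral)
  ultimately have "F = 0" using e \<open>e \<noteq> 0\<close> by (intro syz_low) auto
  then have "F 0 = 0" "F 1 = 0" "F 2 = 0" by (simp_all add: zero_fun_def)
  then have "a0 = 0" "a1 = 0" "a2 = 0" by (simp_all add: F_def)
  then show False using allz a N(2) by simp
qed

text \<open>
  The values of \<open>\<phi>\<close> on the Koszul syzygies form a multiple \<open>c \<nu>'\<close>; then \<open>c\<close> divides the ideal \<open>B\<close>,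
  so it is a constant, which determines the degree of \<open>\<phi>\<close>.
\<close>

lemma shift_zero: "s = 0"
proof -
  define k0 k1 k2 where "k0 = \<psi> (ko 0 0 1)" and "k1 = \<psi> (ko 0 1 0)" and "k2 = \<psi> (ko 1 0 0)"
  \<comment> \<open>Each generator times \<open>F\<close> is a combination of two Koszul syzygies
    with entries of \<open>F\<close> as coefficients, so the three values \<open>k0\<close>,
    \<open>k1\<close>, \<open>k2\<close> determine \<open>\<psi>\<close>.\<close>
  have e: "g2 * \<psi> F = F 1 * k0 - F 0 * k1" "g0 * \<psi> F = F 2 * k1 - F 1 * k2" "g1 * \<psi> F = F 0 * k2 - F 2 * k0"
    if F: "F \<in> syz" for F
  proof -
    have Fs: "g0 * F 0 + g1 * F 1 + g2 * F 2 = 0" "\<And>i. i \<ge> 3 \<Longrightarrow> F i = 0" using F by (simp_all add: syz_def)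
    have lin: "\<psi> ((\<lambda>i. a * ko x y z i) + (\<lambda>i. b * ko x' y' z' i)) = a * \<psi> (ko x y z) + b * \<psi> (ko x' y' z')" for a b x y z x' y' z'
    proof -
      show ?thesis by (simp add: \<psi>_add \<psi>_mult ko_syz syz_mult)
    qed
    have t2: "g2 * F 2 = F 1 * - g1 + - F 0 * g0" using minus_unique[OF Fs(1)] by (simp add: algebra_simps)
    have "g1 * F 1 + g2 * F 2 + g0 * F 0 = 0" using Fs(1) by (simp add: ac_simps)
    from minus_unique[OF this] have t0: "g0 * F 0 = F 2 * - g2 + - F 1 * g1" by (simp add: algebra_simps)
    have "g0 * F 0 + g2 * F 2 + g1 * F 1 = 0" using Fs(1) by (simp add: ac_simps)
    from minus_unique[OF this] have t1: "g1 * F 1 = F 0 * - g0 + - F 2 * g2" by (simp add: algebra_simps)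
    have c: "i = 0 \<or> i = 1 \<or> i = 2 \<or> i \<ge> 3" for i :: nat by linarith
    have "(\<lambda>i. g2 * F i) = (\<lambda>i. F 1 * ko 0 0 1 i) + (\<lambda>i. (- F 0) * ko 0 1 0 i)"
    proof
      fix i show "g2 * F i = ((\<lambda>i. F 1 * ko 0 0 1 i) + (\<lambda>i. (- F 0) * ko 0 1 0 i)) i"
        using c[of i] Fs(2)[of i] t2 by (elim disjE) (simp_all add: plus_fun_def ko_def mult.commute)
    qed
    then show "g2 * \<psi> F = F 1 * k0 - F 0 * k1" using \<psi>_mult[OF F, of g2] lin[of "F 1" 0 0 1 "- F 0" 0 1 0] by (simp add: k0_def k1_def)
    have "(\<lambda>i. g0 * F i) = (\<lambda>i. F 2 * ko 0 1 0 i) + (\<lambda>i. (- F 1) * ko 1 0 0 i)"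
    proof
      fix i show "g0 * F i = ((\<lambda>i. F 2 * ko 0 1 0 i) + (\<lambda>i. (- F 1) * ko 1 0 0 i)) i"
        using c[of i] Fs(2)[of i] t0 by (elim disjE) (simp_all add: plus_fun_def ko_def mult.commute)
    qed
    then show "g0 * \<psi> F = F 2 * k1 - F 1 * k2" using \<psi>_mult[OF F, of g0] lin[of "F 2" 0 1 0 "- F 1" 1 0 0] by (simp add: k1_def k2_def)
    have "(\<lambda>i. g1 * F i) = (\<lambda>i. F 0 * ko 1 0 0 i) + (\<lambda>i. (- F 2) * ko 0 0 1 i)"
    proof
      fix i show "g1 * F i = ((\<lambda>i. F 0 * ko 1 0 0 i) + (\<lambda>i. (- F 2) * ko 0 0 1 i)) i"
        using c[of i] Fs(2)[of i] t1 by (elim disjE) (simp_all add: plus_fun_def ko_def mult.commute)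
    qed
    then show "g1 * \<psi> F = F 0 * k2 - F 2 * k0" using \<psi>_mult[OF F, of g1] lin[of "F 0" 1 0 0 "- F 2" 0 0 1] by (simp add: k2_def k0_def)
  qed
  have "\<psi> N = 0" using \<psi>_ker[OF N(1)] by (auto intro!: exI[of _ 1])
  \<comment> \<open>Applied to \<open>N\<close>, on which \<open>\<psi>\<close> vanishes, the
    formulas say that the vector of the \<open>k\<close> is parallel to \<open>N\<close>.\<close>
  then have "N 1 * k0 = N 0 * k1" "N 2 * k1 = N 1 * k2" "N 0 * k2 = N 2 * k0" using e[OF N(1)] by simp_all
  moreover have "\<not> (N 0 = 0 \<and> N 1 = 0 \<and> N 2 = 0)"
  proof
    assume z: "N 0 = 0 \<and> N 1 = 0 \<and> N 2 = 0"
    obtain p :: "('v, 'k) mpoly" where "prime_elem p"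
      using irreducible_factor[OF f_nonzero[of 0]] irreducible_prime_elem unit_iff_tdeg[of "f 0"] f_nonzero[of 0]
        homogeneous_gr[of 3 "f 0"] f_hom[of 0] by (auto simp: degree_monom_eq)
    then show False using N_coprime z by (auto simp: coprime_set_def)
  qed
  ultimately obtain c where c: "k0 = c * N 0" "k1 = c * N 1" "k2 = c * N 2"
    using coprime_triple_parallel[OF N_coprime, of k0 k1 k2] by (metis mult.commute)
  have cB: "c dvd b" if b: "b \<in> B" for b
  proof -
    obtain F where F: "F \<in> syz" "b = \<psi> F" using b \<psi>_image by blast
    have d: "c dvd g0 * b" "c dvd g1 * b" "c dvd g2 * b"
      unfolding F(2) e[OF F(1)] c by (auto intro!: dvd_diff)
    show ?thesis
    proof (cases "c = 0")
      case True
      then have "g0 * b = 0" "g1 * b = 0" "g2 * b = 0" using d by auto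
      then show ?thesis using g_nonzero by (auto simp: mpoly_mult_eq_0_iff)
    next
      case False
      show ?thesis by (rule coprime_set_dvd[OF g_coprime False]) (use d in \<open>auto simp: mult.commute\<close>)
    qed
  qed
  have Bc: "coprime_set B" by (rule coprime_set_of_height) (simp add: B)
  have c0: "c \<noteq> 0"
  proof
    assume "c = 0"
    then have "B \<subseteq> {0}" using cB by auto
    moreover obtain p :: "('v, 'k) mpoly" where "prime_elem p"
      using irreducible_factor[OF f_nonzero[of 0]] irreducible_prime_elem unit_iff_tdeg[of "f 0"] f_nonzero[of 0]
        homogeneous_gr[of 3 "f 0"] f_hom[of 0] by (auto simp: degree_monom_eq)
    ultimately show False using Bc unfolding coprime_set_def by blast
  qed
  have "c dvd 1"
  proof (rule ccontr)
    assume "\<not> c dvd 1"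
    then obtain p g where "irreducible p" "c = p * g" using irreducible_factor[OF c0] by metis
    then have "prime_elem p" "p dvd c" using irreducible_prime_elem by auto
    then show False using Bc cB unfolding coprime_set_def by (meson dvd_trans)
  qed
  then obtain c' where c': "c = cst c'" using unit_iff_tdeg tdeg_eq_0 by blast
  have k_hom: "homogeneous (3 + s) k0" "homogeneous (3 + s) k1" "homogeneous (3 + s) k2"
  proof -
    have 1: "homogeneous 0 (1 :: ('v, 'k) mpoly)" using homogeneous_cst[of 1] by simp
    have k: "homogeneous (3 + s) (\<psi> (ko a b c))" if "homogeneous 0 a" "homogeneous 0 b" "homogeneous 0 c" for a b c
      by (rule \<psi>_hom[OF ko_syz]) (use ko_grade[OF that] in simp)
    show "homogeneous (3 + s) k0" unfolding k0_def by (rule k[OF homogeneous_0 homogeneous_0 1])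
    show "homogeneous (3 + s) k1" unfolding k1_def by (rule k[OF homogeneous_0 1 homogeneous_0])
    show "homogeneous (3 + s) k2" unfolding k2_def by (rule k[OF 1 homogeneous_0 homogeneous_0])
  qed
  have hN: "homogeneous 3 (N 0)" "homogeneous 3 (N 1)" "homogeneous 3 (N 2)"
    using N(3) by (auto simp: grade_def less_Suc_eq eval_nat_numeral)
  \<comment> \<open>The values on Koszul syzygies have degree \<open>3 + s\<close>, the entries of
    \<open>N\<close> have degree 3, and they differ by a nonzero constant.\<close>
  have "3 + s = 3" if "homogeneous (3 + s) (c * x)" "homogeneous 3 x" "x \<noteq> 0" for x
  proof (rule homogeneous_unique[OF that(1)])
    show "homogeneous 3 (c * x)" unfolding c' by (rule homogeneous_cst_mult[OF that(2)])
    show "c * x \<noteq> 0" using c0 that(3) by (simp add: mpoly_mult_eq_0_iff)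
  qed
  then have "3 + s = 3" using k_hom hN c \<open>\<not> (N 0 = 0 \<and> N 1 = 0 \<and> N 2 = 0)\<close> by metis
  then show ?thesis by simp
qed

text \<open>Rank and nullity in degree \<open>t + 3\<close> of the syzygies: the kernel is free on
  \<open>\<nu>'\<close>, with generator in degree 6, and by \<open>shift_zero\<close> the image is
  the part of \<open>B\<close> of degree exactly \<open>t\<close>.\<close>

lemma dim_B: "int (mp.dim {p \<in> B. homogeneous t p}) = 4 * int (cb (Suc (Suc m)) (t - 3)) - 3 * int (cb (Suc (Suc m)) (t - 4))"
proof -
  let ?V = "{F \<in> syz. F \<in> grade [3, 3, 3] (t + 3)}"
  have syz_sub: "mf.subspace syz"
    unfolding mf.subspace_def
  proof (intro conjI ballI allI)
    show "0 \<in> syz" by (simp add: syz_def zero_fun_def)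
    fix F assume F: "F \<in> syz"
    show "scalef c F \<in> syz" for c using syz_mult[OF F, of "cst c"] by (simp add: scalef_def scale_cst)
    fix G assume G: "G \<in> syz"
    have "g0 * (F 0 + G 0) + g1 * (F 1 + G 1) + g2 * (F 2 + G 2) = (g0 * F 0 + g1 * F 1 + g2 * F 2) + (g0 * G 0 + g1 * G 1 + g2 * G 2)"
      by (simp add: algebra_simps)
    then show "F + G \<in> syz" using F G by (simp add: syz_def plus_fun_def)
  qed
  have V: "mf.subspace ?V" using mf.subspace_inter[OF syz_sub subspace_grade, of "[3, 3, 3]" "t + 3"] by (simp add: Int_def)
  have "mf.dim ?V = mp.dim (\<psi> ` ?V) + mf.dim {F \<in> ?V. \<psi> F = 0}"
  proof (rule mfp.rank_nullity_on[OF V])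
    show "?V \<subseteq> mf.span (unit_monomial ` grade_index [3, 3, 3] (t + 3))" using grade_span by blast
    show "finite (unit_monomial ` grade_index [3, 3, 3] (t + 3) :: (nat \<Rightarrow> ('v, 'k) mpoly) set)" by (intro finite_imageI finite_grade_index)
    show "\<psi> (x + y) = \<psi> x + \<psi> y" if "x \<in> ?V" "y \<in> ?V" for x y using that by (simp add: \<psi>_add)
    show "\<psi> (scalef c x) = scale c (\<psi> x)" if "x \<in> ?V" for c x
      using that \<psi>_mult[of x "cst c"] by (simp add: scalef_def scale_cst)
  qed
  moreover have "mf.dim {F \<in> ?V. \<psi> F = 0} = cb (Suc (Suc m)) (t - 3)"
  proof -
    let ?A = "mat 3 1 (\<lambda>(i, j). N i)"
    have lA: "lin ?A G = (\<lambda>i. G 0 * N i)" for G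
      using N(1) by (auto simp: lin_def syz_def fun_eq_iff mult.commute)
    have gA: "graded_matrix [6] [3, 3, 3] ?A"
      using N(3) by (auto simp: graded_matrix_def grade_def)
    obtain i where i: "N i \<noteq> 0" using N(2) by (auto simp: fun_eq_iff zero_fun_def)
    have "{F \<in> ?V. \<psi> F = 0} = lin ?A ` grade [6] (t + 3)"
    proof (intro equalityI subsetI)
      fix F assume F: "F \<in> {F \<in> ?V. \<psi> F = 0}"
      then obtain r where r: "F = (\<lambda>i. r * N i)" using \<psi>_ker by blast
      have i3: "i < 3" using i N(1) by (auto simp: syz_def not_less[symmetric])
      have l3: "[3, 3, 3] ! i = (3 :: int)" using i3 by (auto simp: less_Suc_eq eval_nat_numeral)
      have il: "i < length [3, 3, 3 :: int]" using i3 by simp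
      have "homogeneous (t + 3 - [3, 3, 3] ! i) (F i)" using F il unfolding grade_def by blast
      then have "homogeneous (t + 3 - 3) (F i)" unfolding l3 .
      then have "homogeneous t (N i * r)" by (simp add: r mult.commute)
      moreover have "homogeneous (6 - [3, 3, 3] ! i) (N i)" using N(3) il unfolding grade_def by blast
      then have "homogeneous (6 - 3) (N i)" unfolding l3 .
      ultimately have "homogeneous (t - 3) r" using cubic_multiple_homogeneous[OF _ i, of 3 t r] by simp
      then have "(\<lambda>i. if i = 0 then r else 0) \<in> grade [6] (t + 3)" by (simp add: grade_def)
      then show "F \<in> lin ?A ` grade [6] (t + 3)" unfolding r
        by (rule rev_image_eqI) (simp only: lA refl if_True)
    next
      fix F assume "F \<in> lin ?A ` grade [6] (t + 3)"
      then obtain G where G: "G \<in> grade [6] (t + 3)" "F = lin ?A G" by blast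
      have FN: "F = (\<lambda>i. G 0 * N i)" by (simp only: G(2) lA)
      have "F \<in> syz" unfolding FN by (rule syz_mult[OF N(1)])
      moreover have "F \<in> grade [3, 3, 3] (t + 3)" unfolding G(2) by (rule lin_grade[OF gA G(1)])
      moreover have "\<psi> F = 0" using \<psi>_ker[OF \<open>F \<in> syz\<close>] FN by blast
      ultimately show "F \<in> {F \<in> ?V. \<psi> F = 0}" by simp
    qed
    moreover have "{G \<in> grade [6] (t + 3). lin ?A G = 0} \<subseteq> {0}"
    proof
      fix G assume G: "G \<in> {G \<in> grade [6] (t + 3). lin ?A G = 0}"
      then have "lin ?A G = 0" by blast
      then have "G 0 * N i = 0" unfolding lA by (simp only: zero_fun_apply fun_eq_iff)
      then have "G 0 = 0" using i by (simp add: mpoly_mult_eq_0_iff)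
      moreover have "G j = 0" if "j \<ge> 1" for j using G that by (simp add: grade_def)
      ultimately have "G j = 0" for j by (cases "j = 0") simp_all
      then show "G \<in> {0}" by (auto simp: fun_eq_iff)
    qed
    then have "mf.dim {G \<in> grade [6] (t + 3). lin ?A G = 0} = 0"
      using mf.dim_le_card[of "{G \<in> grade [6] (t + 3). lin ?A G = 0}" "{}"] by simp
    moreover have "mf.dim (grade [6] (t + 3) :: (nat \<Rightarrow> ('v, 'k) mpoly) set) = mf.dim (lin ?A ` grade [6] (t + 3)) + mf.dim {G \<in> grade [6] (t + 3). lin ?A G = 0}"
      by (rule dim_lin_image[OF subset_refl subspace_grade])
    ultimately show ?thesis by (simp add: dim_grade card_m)
  qed
  moreover have "\<psi> ` ?V = {p \<in> B. homogeneous t p}"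
  proof (intro equalityI subsetI)
    fix p assume "p \<in> \<psi> ` ?V"
    then obtain F where F: "F \<in> syz" "F \<in> grade [3, 3, 3] (t + 3)" "p = \<psi> F" by blast
    then show "p \<in> {p \<in> B. homogeneous t p}" using \<psi>_image \<psi>_hom[of F t] shift_zero by auto
  next
    fix p assume p: "p \<in> {p \<in> B. homogeneous t p}"
    then obtain F where F: "F \<in> syz" "p = \<psi> F" using \<psi>_image by blast
    \<comment> \<open>The preimage \<open>F\<close> need not be homogeneous. It is cut into
      components, of which only \<open>C t\<close> contributes to degree \<open>t\<close>.\<close>
    define C where "C d = component [3, 3, 3] (d + 3) F" for d
    have C: "C d \<in> syz" "C d \<in> grade [3, 3, 3] (d + 3)" for d
    proof -
      have "lin (row_matrix gs) (C d) = component [0] (d + 3) (lin (row_matrix gs) F)"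
        unfolding C_def by (rule lin_component[OF graded_row])
      also have "lin (row_matrix gs) F = 0" using F(1) by (simp add: row_eq_0 syz_def)
      also have "component [0] (d + 3) (0 :: nat \<Rightarrow> ('v, 'k) mpoly) = 0" by (auto simp: component_def zero_fun_def)
      finally show "C d \<in> syz" by (auto simp: row_eq_0 syz_def C_def component_def)
      show "C d \<in> grade [3, 3, 3] (d + 3)" unfolding C_def by (rule component_grade)
    qed
    define D where "D = Max (tdeg ` {F 0, F 1, F 2})"
    have "F = (\<Sum>d\<le>D. C (int d))"
    proof
      fix i
      show "F i = (\<Sum>d\<le>D. C (int d)) i"
      proof (cases "i < 3")
        case True
        then have "i = 0 \<or> i = 1 \<or> i = 2" by linarith
        then have D: "tdeg (F i) \<le> D" unfolding D_def by (intro Max_ge) auto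
        have l3: "[3, 3, 3] ! i = (3 :: int)" using True by (auto simp: less_Suc_eq eval_nat_numeral)
        have "F i = (\<Sum>d\<le>tdeg (F i). hc (int d) (F i))" by (rule sum_hc)
        also have "\<dots> = (\<Sum>d\<le>D. hc (int d) (F i))"
          by (rule sum.mono_neutral_left) (use D in \<open>auto simp: hc_def coeff_eq_0\<close>)
        also have "\<dots> = (\<Sum>d\<le>D. C (int d)) i" unfolding sum_fun_apply
          by (rule sum.cong) (use True l3 in \<open>auto simp: C_def component_def\<close>)
        finally show ?thesis .
      next
        case False
        then show ?thesis using F(1) by (simp add: syz_def sum_fun_apply C_def component_def)
      qed
    qed
    moreover have "\<psi> (\<Sum>d\<in>S. C (int d)) = (\<Sum>d\<in>S. \<psi> (C (int d))) \<and> (\<Sum>d\<in>S. C (int d)) \<in> syz" if "finite S" for S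
      using that
    proof induct
      case empty
      have "(0 :: nat \<Rightarrow> ('v, 'k) mpoly) \<in> syz" by (rule mf.subspace_0[OF syz_sub])
      moreover have "\<psi> 0 = 0" using \<psi>_ker[OF calculation] by (auto simp: zero_fun_def intro!: exI[of _ 0])
      ultimately show ?case unfolding sum.empty by blast
    next
      case (insert x S)
      then have i: "\<psi> (\<Sum>d\<in>S. C (int d)) = (\<Sum>d\<in>S. \<psi> (C (int d)))" "(\<Sum>d\<in>S. C (int d)) \<in> syz" by blast+
      have "\<psi> (C (int x) + (\<Sum>d\<in>S. C (int d))) = \<psi> (C (int x)) + (\<Sum>d\<in>S. \<psi> (C (int d)))"
        unfolding \<psi>_add[OF C(1) i(2)] i(1) ..
      moreover have "C (int x) + (\<Sum>d\<in>S. C (int d)) \<in> syz" by (rule mf.subspace_add[OF syz_sub C(1) i(2)])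
      ultimately show ?case unfolding sum.insert[OF insert(1,2)] by blast
    qed
    ultimately have pe: "p = (\<Sum>d\<le>D. \<psi> (C (int d)))" using F(2) by simp
    have hC: "homogeneous d (\<psi> (C d))" for d using \<psi>_hom[OF C(1) C(2), of d] shift_zero by simp
    have "p = hc t p" using p by (simp add: homogeneous_iff_hc)
    also have "\<dots> = (\<Sum>d\<le>D. if int d = t then \<psi> (C t) else 0)"
      unfolding pe hc_sum by (rule sum.cong) (use hC hc_other[OF hC] in \<open>auto simp: homogeneous_iff_hc\<close>)
    finally have pt: "p = (if t \<ge> 0 \<and> t \<le> int D then \<psi> (C t) else 0)"
    proof -
      assume e: "p = (\<Sum>d\<le>D. if int d = t then \<psi> (C t) else 0)"
      show ?thesis
      proof (cases "t \<ge> 0")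
        case True
        then have "(\<Sum>d\<le>D. if int d = t then \<psi> (C t) else 0) = (\<Sum>d\<le>D. if d = nat t then \<psi> (C t) else 0)"
          by (intro sum.cong) auto
        then show ?thesis using e True by auto
      next
        case False
        then have "(\<Sum>d\<le>D. if int d = t then \<psi> (C t) else 0) = 0" by (intro sum.neutral) auto
        then show ?thesis using e False by simp
      qed
    qed
    have \<psi>0: "\<psi> 0 = 0" using \<psi>_ker[OF mf.subspace_0[OF syz_sub]] by (auto simp: zero_fun_def intro!: exI[of _ 0])
    have "0 \<in> \<psi> ` ?V" by (rule rev_image_eqI[OF mf.subspace_0[OF V]]) (simp only: \<psi>0)
    moreover have "\<psi> (C t) \<in> \<psi> ` ?V" by (rule imageI) (use C in blast)
    ultimately show "p \<in> \<psi> ` ?V" by (subst pt, cases "0 \<le> t \<and> t \<le> int D") (simp_all only: if_True if_False simp_thms)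
  qed
  ultimately show ?thesis using dim_syz_g[of "t + 3"] by simp
qed

lemma multiplicity_B: "multiplicity_quotient B = 6"
proof -
  \<comment> \<open>The coefficients of \<open>(1 - 4 z^3 + 3 z^4) / (1 - z)^2\<close>.\<close>
  define q :: "nat \<Rightarrow> int" where "q j = [1, 2, 3] ! j" for j
  have "int (hilbert_function B t) = (\<Sum>j<3. q j * int (cb m (int t - int j)))" for t
  proof -
    define T where "T = int t"
    have "int (hilbert_function B t) = int (cb (Suc (Suc m)) T) - int (mp.dim {p \<in> B. homogeneous T p})"
      using hilbert_function_add[of B t] by (simp add: card_m T_def flip: of_nat_add)
    also have "\<dots> = int (cb (Suc (Suc m)) T) - 4 * int (cb (Suc (Suc m)) (T - 3)) + 3 * int (cb (Suc (Suc m)) (T - 4))"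
      unfolding dim_B by simp
    also have "\<dots> = int (cb m T) + 2 * int (cb m (T - 1)) + 3 * int (cb m (T - 2))"
      using second_difference[of T] second_difference[of "T - 1"] second_difference[of "T - 2"]
        second_difference[of "T - 3"] by simp
    also have "\<dots> = (\<Sum>j<3. q j * int (cb m (int t - int j)))"
      by (simp add: q_def T_def eval_nat_numeral)
    finally show ?thesis .
  qed
  moreover have "(\<Sum>j<3. q j) = 6" by (simp add: q_def eval_nat_numeral)
  ultimately show ?thesis using multiplicity_from_hilbert_function[where I = B and l = 3 and q = q and m = m] by simp
qed

end

lemma bourbaki_ideal_multiplicity:
  assumes "\<nu>' \<in> syzygies gs" "\<nu>' \<noteq> 0\<^sub>v 3" "homogeneous_vec (int (syz_indeg gs)) \<nu>'" "bourbaki_ideal gs \<nu>' B"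
  shows "multiplicity_quotient B = 6"
proof -
  obtain \<phi> s where "\<forall>v\<in>syzygies gs. \<forall>w\<in>syzygies gs. \<phi> (v + w) = \<phi> v + \<phi> w"
    "\<forall>r. \<forall>v\<in>syzygies gs. \<phi> (r \<cdot>\<^sub>v v) = r * \<phi> v"
    "\<forall>t. \<forall>v\<in>syzygies gs. homogeneous_vec t v \<longrightarrow> homogeneous (t + s) (\<phi> v)"
    "\<phi> ` syzygies gs = B" "{v \<in> syzygies gs. \<phi> v = 0} = range (\<lambda>r. r \<cdot>\<^sub>v \<nu>')" "height B = 2"
    using assms(4) by (auto simp: bourbaki_ideal_def)
  then show ?thesis
    using assms(1-3) by (intro multiplicity_B[of \<nu>' B \<phi> s]) (auto simp: syz_indeg_value)
qed

end

section \<open>Existence of a Bourbaki ideal\<close>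

lemma colon_pair_homogeneous:
  assumes "homogeneous a f" "homogeneous b g" "homogeneous c (h :: ('v::finite, 'k::field) mpoly)"
  shows "homogeneous_ideal (colon_pair f g h)"
  unfolding homogeneous_ideal_def
proof (intro equalityI subsetI)
  let ?H = "{p \<in> colon_pair f g h. \<exists>t. homogeneous t p}"
  fix q assume "q \<in> colon_pair f g h"
  then obtain u v where "q * h = u * f + v * g" by (auto simp: colon_pair_def ideal_pair_def)
  then have e: "h * q = f * u + g * v" by (simp add: mult.commute)
  have "hc t q \<in> ?H" for t
  proof -
    have "h * hc t q = f * hc (t + c - a) u + g * hc (t + c - b) v"
      using hc_mult[OF assms(3), of "t + c" q] hc_mult[OF assms(1), of "t + c" u] hc_mult[OF assms(2), of "t + c" v]
      by (simp add: e hc_add)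
    then have "hc t q \<in> colon_pair f g h"
      unfolding colon_pair_def ideal_pair_def by (intro CollectI exI[of _ "hc (t + c - a) u"] exI[of _ "hc (t + c - b) v"]) (simp add: mult.commute)
    moreover have "\<exists>s. homogeneous s (hc t q)" using homogeneous_hc by blast
    ultimately show ?thesis by blast
  qed
  then have "(\<Sum>d\<le>tdeg q. hc (int d) q) \<in> ideal_gen ?H"
    by (intro Modules.module.span_sum[OF module_mult] Modules.module.span_base[OF module_mult])
  then show "q \<in> ideal_gen ?H" using sum_hc[of q] by simp
next
  fix q assume "q \<in> ideal_gen {p \<in> colon_pair f g h. \<exists>t. homogeneous t p}"
  moreover have "ideal_gen {p \<in> colon_pair f g h. \<exists>t. homogeneous t p} \<subseteq> colon_pair f g h"
    by (intro Modules.module.span_minimal[OF module_mult] colon_pair_ideal) blast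
  ultimately show "q \<in> colon_pair f g h" by blast
qed

lemma syzygies_triple: "v \<in> syzygies [f, g, h] \<longleftrightarrow> v \<in> carrier_vec 3 \<and> v $ 0 * f + v $ 1 * g + v $ 2 * h = 0"
proof -
  have "(\<Sum>i<3. v $ i * [f, g, h] ! i) = v $ 0 * f + v $ 1 * g + v $ 2 * h" by (simp add: eval_nat_numeral)
  then show ?thesis by (simp add: syzygies_def numeral_3_eq_3)
qed

lemma vec_of_3: "v \<in> carrier_vec 3 \<Longrightarrow> w \<in> carrier_vec 3 \<Longrightarrow> v $ 0 = w $ 0 \<Longrightarrow> v $ 1 = w $ 1 \<Longrightarrow> v $ 2 = w $ 2 \<Longrightarrow> v = w"
  by (intro eq_vecI) (auto simp: less_Suc_eq eval_nat_numeral)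

text \<open>
  For \<open>f, g\<close> coprime the Koszul syzygy on \<open>f, g\<close> is a Bourbaki syzygy, and projection to the third
  coordinate identifies the quotient with \<open>(f, g) : h\<close>.
\<close>

lemma bourbaki_ideal_colon_pair:
  fixes f g h :: "('v::finite, 'k::field) mpoly"
  assumes n: "CARD('v) \<ge> 2" and fg: "coprime_set {f, g}" "f \<noteq> 0"
    and h: "homogeneous a f" "homogeneous b g" "homogeneous c h" and nm: "h \<notin> ideal_pair f g"
  shows "bourbaki_ideal [f, g, h] (vec_of_list [g, - f, 0]) (colon_pair f g h)"
  unfolding bourbaki_ideal_def
proof (intro conjI colon_pair_ideal colon_pair_homogeneous[OF h] height_colon_pair[OF fg n nm] unmixed_colon_pair[OF fg n nm]
    exI[of _ "\<lambda>v. v $ 2"] exI[of _ "0 :: int"] ballI allI impI)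
  let ?S = "syzygies [f, g, h]" and ?v = "vec_of_list [g, - f, 0]"
  have d: "dim_vec v = 3" if "v \<in> ?S" for v using that by (simp add: syzygies_triple)
  have v: "?v \<in> carrier_vec 3" "?v $ 0 = g" "?v $ 1 = - f" "?v $ 2 = 0" by (auto simp: eval_nat_numeral)
  show "(v + w) $ 2 = v $ 2 + w $ 2" if "v \<in> ?S" "w \<in> ?S" for v w using d[OF that(1)] d[OF that(2)] by simp
  show "(r \<cdot>\<^sub>v v) $ 2 = r * v $ 2" if "v \<in> ?S" for r v using d[OF that] by simp
  show "homogeneous (t + 0) (v $ 2)" if "v \<in> ?S" "homogeneous_vec t v" for t v
    using that(2) d[OF that(1)] by (simp add: homogeneous_vec_def)
  show "(\<lambda>v. v $ 2) ` ?S = colon_pair f g h"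
  proof (intro equalityI subsetI)
    fix q assume "q \<in> (\<lambda>v. v $ 2) ` ?S"
    then obtain v where v: "v \<in> ?S" "q = v $ 2" by blast
    then have "q * h = (- v $ 0) * f + (- v $ 1) * g" by (simp add: syzygies_triple algebra_simps eq_neg_iff_add_eq_0)
    then show "q \<in> colon_pair f g h" unfolding colon_pair_def by (intro CollectI ideal_pairI)
  next
    fix q assume "q \<in> colon_pair f g h"
    then obtain u v where "q * h = u * f + v * g" by (auto simp: colon_pair_def ideal_pair_def)
    then have "vec_of_list [- u, - v, q] \<in> ?S" by (auto simp: syzygies_triple eval_nat_numeral)
    moreover have "q = vec_of_list [- u, - v, q] $ 2" by (simp add: eval_nat_numeral)
    ultimately show "q \<in> (\<lambda>v. v $ 2) ` ?S" by (rule rev_image_eqI)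
  qed
  show "{v \<in> ?S. v $ 2 = 0} = range (\<lambda>r. r \<cdot>\<^sub>v ?v)"
  proof (intro equalityI subsetI)
    fix w assume "w \<in> {v \<in> ?S. v $ 2 = 0}"
    then have w: "w \<in> carrier_vec 3" "w $ 0 * f + w $ 1 * g = 0" "w $ 2 = 0" by (auto simp: syzygies_triple)
    have "f * (- w $ 0) = g * w $ 1" using w(2) by (simp add: algebra_simps neg_eq_iff_add_eq_0)
    then have "f dvd w $ 1" using coprime_pair_dvd[OF fg] dvd_triv_left by metis
    then obtain r where r: "w $ 1 = f * r" by (elim dvdE)
    have "f * (w $ 0 + g * r) = w $ 0 * f + (f * r) * g" by (simp add: algebra_simps)
    also have "\<dots> = 0" using w(2) unfolding r .
    finally have "f * (w $ 0 + g * r) = 0" .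
    then have "w $ 0 + g * r = 0" using fg(2) by (simp add: mpoly_mult_eq_0_iff)
    then have "w = (- r) \<cdot>\<^sub>v ?v"
      using w(1,3) r v by (intro vec_of_3) (simp_all add: mult.commute eq_neg_iff_add_eq_0)
    then show "w \<in> range (\<lambda>r. r \<cdot>\<^sub>v ?v)" by (rule range_eqI)
  next
    fix w assume "w \<in> range (\<lambda>r. r \<cdot>\<^sub>v ?v)"
    then obtain r where w: "w = r \<cdot>\<^sub>v ?v" by blast
    have "w \<in> carrier_vec 3" "w $ 0 = r * g" "w $ 1 = - (r * f)" "w $ 2 = 0" using v by (simp_all add: w)
    then show "w \<in> {v \<in> ?S. v $ 2 = 0}" by (simp add: syzygies_triple algebra_simps)
  qed
qed

context cubic_resolution
begin

lemma bourbaki_multiplicity: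
  assumes "length fs = 3" "minimally_generated_by_forms d fs J"
    "\<nu>' \<in> syzygies fs" "\<nu>' \<noteq> 0\<^sub>v 3" "homogeneous_vec (int (syz_indeg fs)) \<nu>'" "bourbaki_ideal fs \<nu>' B"
  shows "multiplicity_quotient B = 6"
proof -
  obtain g0 g1 g2 where fs: "fs = [g0, g1, g2]"
    using assms(1) by (metis (no_types) length_0_conv length_Suc_conv numeral_3_eq_3)
  have "d = 3" by (rule generators_degree[OF assms(1,2)])
  then have "cubic_generators J \<delta> \<epsilon> A0 A1 A2 g0 g1 g2"
    using assms(2) by unfold_locales (auto simp: minimally_generated_by_forms_def fs)
  then show ?thesis
    using assms(3-6) unfolding fs by (rule cubic_generators.bourbaki_ideal_multiplicity)
qed

text \<open>Adding a multiple of \<open>f 2\<close> to \<open>f 1\<close> makes the first two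
  generators coprime. Their Koszul syzygy has the least degree 3, so the colon ideal it yields is
  admissible in the definition.\<close>

lemma ex_bourbaki_ideal:
  "\<exists>fs \<nu>' B. length fs = 3 \<and> minimally_generated_by_forms 3 fs J \<and> \<nu>' \<in> syzygies fs \<and> \<nu>' \<noteq> 0\<^sub>v 3 \<and>
    homogeneous_vec (int (syz_indeg fs)) \<nu>' \<and> bourbaki_ideal fs \<nu>' B"
proof -
  obtain c where c: "coprime_set {f 0, f 1 + cst c * f 2}" by (rule ex_coprime_pair)
  let ?g = "f 1 + cst c * f 2" and ?\<nu> = "vec_of_list [f 1 + cst c * f 2, - f 0, 0]"
  have h: "homogeneous 3 (f 0)" "homogeneous 3 ?g" "homogeneous 3 (f 2)"
    using f_hom[of 0] f_hom[of 1] f_hom[of 2] homogeneous_mult[OF homogeneous_cst f_hom[of 2], of c]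
    by (auto intro!: homogeneous_add)
  have ind: "c0 = 0 \<and> c1 = 0 \<and> c2 = 0" if "cst c0 * f 0 + cst c1 * ?g + cst c2 * f 2 = 0" for c0 c1 c2
  proof -
    have "cst c0 * f 0 + cst c1 * f 1 + cst (c1 * c + c2) * f 2 = 0" using that by (simp add: cst.hom_add cst.hom_mult algebra_simps)
    then have "c0 = 0 \<and> c1 = 0 \<and> c1 * c + c2 = 0" by (rule f_indep)
    then show ?thesis by auto
  qed
  have J: "J = ideal_gen {f 0, ?g, f 2}"
  proof (intro equalityI subsetI)
    fix x assume "x \<in> J"
    then obtain u0 u1 u2 where "x = f 0 * u0 + f 1 * u1 + f 2 * u2" unfolding J_iff by blast
    then have "x = f 0 * u0 + ?g * u1 + f 2 * (u2 - cst c * u1)" by (simp add: algebra_simps)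
    then show "x \<in> ideal_gen {f 0, ?g, f 2}" unfolding ideal_gen_triple by blast
  next
    fix x assume "x \<in> ideal_gen {f 0, ?g, f 2}"
    then obtain u0 u1 u2 where "x = f 0 * u0 + ?g * u1 + f 2 * u2" unfolding ideal_gen_triple by blast
    then have "x = f 0 * u0 + f 1 * u1 + f 2 * (cst c * u1 + u2)" by (simp add: algebra_simps)
    then show "x \<in> J" unfolding J_iff by blast
  qed
  interpret cg: cubic_generators J \<delta> \<epsilon> A0 A1 A2 "f 0" ?g "f 2"
    by unfold_locales (fact h J)+
  have "minimally_generated_by_forms 3 [f 0, ?g, f 2] J"
    unfolding J by (rule independent_cubics_minimal[OF h ind])
  moreover have "f 2 \<notin> ideal_pair (f 0) ?g"
  proof
    assume "f 2 \<in> ideal_pair (f 0) ?g"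
    then obtain u v where "f 2 = u * f 0 + v * ?g" by (auto simp: ideal_pair_def)
    moreover have "f 2 \<noteq> u * f 0 + v * ?g"
    proof (rule form_not_in_ideal_of_others[OF h(3,1,2)])
      fix c0 c1 c2 assume "cst c0 * f 2 + cst c1 * f 0 + cst c2 * ?g = 0"
      then have "cst c1 * f 0 + cst c2 * ?g + cst c0 * f 2 = 0" by (simp add: ac_simps)
      then show "c0 = 0 \<and> c1 = 0 \<and> c2 = 0" using ind by blast
    qed
    ultimately show False by blast
  qed
  then have "bourbaki_ideal [f 0, ?g, f 2] ?\<nu> (colon_pair (f 0) ?g (f 2))"
    using n f_nonzero[of 0] by (intro bourbaki_ideal_colon_pair[OF _ c _ h]) simp_all
  moreover have v: "?\<nu> \<in> carrier_vec 3" "?\<nu> $ 0 = ?g" "?\<nu> $ 1 = - f 0" "?\<nu> $ 2 = 0" by (auto simp: eval_nat_numeral)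
  then have "?\<nu> \<in> syzygies [f 0, ?g, f 2]" by (simp add: syzygies_triple)
  moreover have "?\<nu> \<noteq> 0\<^sub>v 3"
  proof
    assume "?\<nu> = 0\<^sub>v 3"
    then have "?\<nu> $ 1 = 0" by simp
    then show False using v(3) f_nonzero[of 0] by simp
  qed
  moreover have "homogeneous_vec 3 ?\<nu>"
    unfolding homogeneous_vec_def
  proof (intro allI impI)
    fix i assume "i < dim_vec ?\<nu>"
    then have "i = 0 \<or> i = 1 \<or> i = 2" using v(1) by auto
    then show "homogeneous 3 (?\<nu> $ i)" using v h by (elim disjE) (simp_all add: homogeneous_uminus)
  qed
  then have "homogeneous_vec (int (syz_indeg [f 0, ?g, f 2])) ?\<nu>" by (simp only: cg.syz_indeg_value of_nat_numeral)
  moreover have "length [f 0, ?g, f 2] = 3" by simp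
  ultimately show ?thesis by blast
qed

lemma bourbaki_degree_J: "bourbaki_degree J = 6"
proof -
  obtain fs \<nu>' B where ex: "length fs = 3" "minimally_generated_by_forms 3 fs J" "\<nu>' \<in> syzygies fs" "\<nu>' \<noteq> 0\<^sub>v 3"
    "homogeneous_vec (int (syz_indeg fs)) \<nu>'" "bourbaki_ideal fs \<nu>' B"
    using ex_bourbaki_ideal by blast
  have "(THE b. \<exists>d fs \<nu>' B. length fs = 3 \<and> minimally_generated_by_forms d fs J \<and> \<nu>' \<in> syzygies fs \<and> \<nu>' \<noteq> 0\<^sub>v 3 \<and>
    homogeneous_vec (int (syz_indeg fs)) \<nu>' \<and> bourbaki_ideal fs \<nu>' B \<and> b = multiplicity_quotient B) = 6"
  proof (rule the_equality)
    show "\<exists>d fs \<nu>' B. length fs = 3 \<and> minimally_generated_by_forms d fs J \<and> \<nu>' \<in> syzygies fs \<and> \<nu>' \<noteq> 0\<^sub>v 3 \<and>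
      homogeneous_vec (int (syz_indeg fs)) \<nu>' \<and> bourbaki_ideal fs \<nu>' B \<and> 6 = multiplicity_quotient B"
      by (intro exI conjI) (rule ex bourbaki_multiplicity[OF ex, symmetric])+
  next
    fix b assume "\<exists>d fs \<nu>' B. length fs = 3 \<and> minimally_generated_by_forms d fs J \<and> \<nu>' \<in> syzygies fs \<and> \<nu>' \<noteq> 0\<^sub>v 3 \<and>
      homogeneous_vec (int (syz_indeg fs)) \<nu>' \<and> bourbaki_ideal fs \<nu>' B \<and> b = multiplicity_quotient B"
    then show "b = 6" by (elim exE conjE) (metis bourbaki_multiplicity)
  qed
  then show ?thesis using not_perfect unfolding bourbaki_degree_def by simp
qed

end

section \<open>An ideal with the given resolution\<close>

definition vanish :: "'v set \<Rightarrow> ('v::finite, 'k::field) mpoly \<Rightarrow> ('v, 'k) mpoly" where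
  "vanish V = msubst cst (\<lambda>v. if v \<in> V then 0 else X v)"

lemma comm_ring_hom_vanish: "comm_ring_hom (vanish V)"
  unfolding vanish_def by (rule comm_ring_hom_msubst[OF comm_ring_hom_cst])

interpretation vanish: comm_ring_hom "vanish V"
  by (rule comm_ring_hom_vanish)

lemma vanish_cst [simp]: "vanish V (cst c) = cst c"
  by (simp add: vanish_def msubst_cst[OF comm_ring_hom_cst])

lemma vanish_X: "vanish V (X v) = (if v \<in> V then 0 else X v)"
  by (simp add: vanish_def msubst_X[OF comm_ring_hom_cst])

lemma vanish_svars: "p \<in> svars (- V) \<Longrightarrow> vanish V p = p"
  by (induct p rule: svars_induct) (simp_all add: vanish_X vanish.hom_add vanish.hom_mult)

lemma X_dvd_diff_vanish: "X v dvd p - vanish {v} p"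
proof -
  have "p \<in> svars UNIV" by simp
  then show ?thesis
  proof (induct p rule: svars_induct)
    case (X w)
    then show ?case by (simp add: vanish_X)
  next
    case (add p q)
    then have "X v dvd (p - vanish {v} p) + (q - vanish {v} q)" by (rule dvd_add)
    also have "\<dots> = p + q - vanish {v} (p + q)" by (simp add: vanish.hom_add)
    finally show ?case .
  next
    case (mult p q)
    then have "X v dvd (p - vanish {v} p) * q + vanish {v} p * (q - vanish {v} q)" by (intro dvd_add dvd_mult dvd_mult2)
    also have "\<dots> = p * q - vanish {v} (p * q)" by (simp add: vanish.hom_mult algebra_simps)
    finally show ?case .
  qed simp
qed

lemma X_dvd_iff: "X v dvd p \<longleftrightarrow> vanish {v} p = 0"
proof
  assume "X v dvd p"
  then show "vanish {v} p = 0" by (elim dvdE) (simp add: vanish.hom_mult vanish_X)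
next
  assume "vanish {v} p = 0"
  then show "X v dvd p" using X_dvd_diff_vanish[of v p] by simp
qed

lemma X_nonzero [simp]: "X v \<noteq> (0 :: ('v::finite, 'k::field) mpoly)"
proof
  assume "X v = (0 :: ('v, 'k) mpoly)"
  then have "coef (X v :: ('v, 'k) mpoly) (Poly_Mapping.single v 1) = 0" by simp
  then show False by (simp add: X_def)
qed

lemma ex_vanish: "\<exists>q. p = vanish {v} p + X v * q"
proof -
  obtain q where "p - vanish {v} p = X v * q" using X_dvd_diff_vanish[of v p] by (elim dvdE)
  then have "p = vanish {v} p + X v * q" by (simp add: algebra_simps)
  then show ?thesis by blast
qed

lemma X_dvd_X_mult:
  fixes p :: "('v::finite, 'k::field) mpoly"
  shows "v \<noteq> w \<Longrightarrow> X v dvd X w * p \<Longrightarrow> X v dvd p"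
  by (simp add: X_dvd_iff vanish.hom_mult vanish_X mpoly_mult_eq_0_iff)

text \<open>Setting \<open>X u\<close> to zero leaves a relation between two variables, whose
  solutions are Koszul; multiples of \<open>X u\<close> are then restored.\<close>

lemma ex_koszul:
  fixes a b :: "('v::finite, 'k::field) mpoly"
  assumes "u \<noteq> v" "u \<noteq> w" "v \<noteq> w" "X u dvd X v * a + X w * b"
  shows "\<exists>c a' b'. a = X w * c + X u * a' \<and> b = - (X v * c) + X u * b'"
proof -
  let ?a = "vanish {u} a" and ?b = "vanish {u} b"
  have e: "X v * ?a + X w * ?b = 0"
    using assms by (simp add: X_dvd_iff vanish.hom_mult vanish.hom_add vanish_X)
  then have "X w * ?b = X v * (- ?a)" by (simp add: algebra_simps eq_neg_iff_add_eq_0)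
  then have "X v dvd X w * ?b" by (rule dvdI)
  then have "X v dvd ?b" by (rule X_dvd_X_mult[OF assms(3)])
  then obtain c where c: "?b = X v * c" by (elim dvdE)
  have "X v * (?a + X w * c) = 0" using e unfolding c by (simp add: algebra_simps)
  then have a: "?a = - (X w * c)" by (simp add: mpoly_mult_eq_0_iff eq_neg_iff_add_eq_0)
  obtain a' where a': "a = ?a + X u * a'" using ex_vanish by blast
  obtain b' where b': "b = ?b + X u * b'" using ex_vanish by blast
  have "a = X w * (- c) + X u * a'" using a' unfolding a by simp
  moreover have "b = - (X v * (- c)) + X u * b'" using b' unfolding c by simp
  ultimately show ?thesis by blast
qed

lemma graded_matrix_rows:
  assumes "length L = nr" "\<And>l. l \<in> set L \<Longrightarrow> length l = nc" "\<And>l p. l \<in> set L \<Longrightarrow> p \<in> set l \<Longrightarrow> homogeneous (d - d') p"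
  shows "graded_matrix (replicate nc d) (replicate nr d') (mat nr nc (\<lambda>(i, j). L ! i ! j))"
  unfolding graded_matrix_def
proof (intro conjI allI impI)
  fix i j assume "i < length (replicate nr d')" "j < length (replicate nc d)"
  then have ij: "i < nr" "j < nc" by simp_all
  then have l: "L ! i \<in> set L" using assms(1) by simp
  have "L ! i ! j \<in> set (L ! i)" using assms(2)[OF l] ij by simp
  then show "homogeneous (replicate nc d ! j - replicate nr d' ! i) (mat nr nc (\<lambda>(i, j). L ! i ! j) $$ (i, j))"
    using assms(3)[OF l] ij by simp
qed simp

lemma vec_of_5: "v \<in> carrier_vec 5 \<Longrightarrow> w \<in> carrier_vec 5 \<Longrightarrow> v $ 0 = w $ 0 \<Longrightarrow> v $ 1 = w $ 1 \<Longrightarrow> v $ 2 = w $ 2 \<Longrightarrow>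
    v $ 3 = w $ 3 \<Longrightarrow> v $ 4 = w $ 4 \<Longrightarrow> v = w"
  by (intro eq_vecI) (auto simp: less_Suc_eq eval_nat_numeral)

section \<open>The example: exactness, height and minimality\<close>

locale three_variables =
  fixes x y z :: "('v::finite, 'k::field_char_0) mpoly" and u v w :: 'v
  assumes xyz: "x = X u" "y = X v" "z = X w" and ne: "u \<noteq> v" "u \<noteq> w" "v \<noteq> w"
begin

abbreviation "f4 \<equiv> y * y * y - x * y * z - x * y * z"
abbreviation "f5 \<equiv> y * y * z - x * z * z"
abbreviation "J \<equiv> ideal_gen {x * x * x, f4, f5}"

lemma x0: "x \<noteq> 0" by (simp add: xyz)

lemma x_cancel: "x * p = 0 \<Longrightarrow> p = 0"
  using x0 by (simp add: mpoly_mult_eq_0_iff)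

lemma x_dvd_y: "x dvd y * p \<Longrightarrow> x dvd p"
  using X_dvd_X_mult[OF ne(1)] by (simp add: xyz)

lemma x_dvd_of_sum: "p + x * q = 0 \<Longrightarrow> x dvd p"
  by (rule dvdI[of _ _ "- q"]) (simp add: eq_neg_iff_add_eq_0)

lemma koszul: "x dvd y * a + z * b \<Longrightarrow> \<exists>c a' b'. a = z * c + x * a' \<and> b = - (y * c) + x * b'"
  using ex_koszul[OF ne] by (simp add: xyz)

text \<open>Cancels \<open>z\<close> modulo the ideal of \<open>x\<close> and \<open>y\<close>; with
  \<open>reduce\<close>, \<open>b\<close> is then written as an element of this ideal.\<close>

lemma strip_z:
  assumes "x dvd y * a + z * b" shows "\<exists>a'. x dvd y * a' + b"
proof -
  obtain c b' where "b = - (y * c) + x * b'" using koszul[OF assms] by blast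
  then have "y * c + b = x * b'" by simp
  then have "x dvd y * c + b" by (rule dvdI)
  then show ?thesis by blast
qed

lemma reduce:
  assumes "x dvd y * a + b" shows "\<exists>c b'. b = y * c + x * b'"
proof -
  obtain d where "y * a + b = x * d" using assms by (elim dvdE)
  then have "b = y * (- a) + x * d" by (simp add: algebra_simps)
  then show ?thesis by blast
qed

text \<open>
  Modulo \<open>x\<close> only the powers of \<open>y\<close> and \<open>z\<close> survive; reducing modulo \<open>x\<close>, solving there and
  dividing by \<open>x\<close> determines the coefficients one order in \<open>x\<close> at a time.
\<close>

lemma kernel_A0:
  assumes E: "x * x * x * a3 + f4 * a4 + f5 * a5 = 0"
  shows "\<exists>v1 v2 v3 v4 v5. a3 = - z * z * z * v2 + y * z * z * v3 - f5 * v4 + f4 * v5 \<and>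
    a4 = f5 * v1 - x * y * z * v2 + x * x * z * v3 - x * x * x * v5 \<and>
    a5 = - f4 * v1 + (x * y * y - x * x * z) * v2 - x * x * y * v3 + x * x * x * v4"
proof -
  have "y * (y * (y * a4 + z * a5)) + x * (x * x * a3 - y * z * a4 - y * z * a4 - z * z * a5) = 0"
    unfolding E[symmetric] by (simp add: algebra_simps)
  then have "x dvd y * a4 + z * a5" by (rule x_dvd_of_sum[THEN x_dvd_y, THEN x_dvd_y])
  then obtain c a4' a5' where a4: "a4 = z * c + x * a4'" and a5: "a5 = - (y * c) + x * a5'"
    using koszul by blast
  have "x * (x * x * a3 - y * z * z * c + f4 * a4' + f5 * a5') = 0"
    unfolding E[symmetric] a4 a5 by (simp add: algebra_simps)
  \<comment> \<open>Dividing by \<open>x\<close> gives the equation of the next order, to which the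
    same reduction applies; \<open>E3\<close> is the following one.\<close>
  then have E2: "x * x * a3 - y * z * z * c + f4 * a4' + f5 * a5' = 0" by (rule x_cancel)
  have "y * (y * (y * a4' + z * a5') - z * (z * c)) + x * (x * a3 - y * z * a4' - y * z * a4' - z * z * a5') = 0"
    unfolding E2[symmetric] by (simp add: algebra_simps)
  then have "x dvd - (y * (y * a4' + z * a5') - z * (z * c))" unfolding dvd_minus_iff by (rule x_dvd_of_sum[THEN x_dvd_y])
  then have "x dvd y * (- (y * a4' + z * a5')) + z * (z * c)" by (simp add: algebra_simps)
  then obtain c' c'' where c: "c = y * c' + x * c''" using strip_z reduce by metis
  have "y * (y * (y * a4' + z * (a5' - z * c'))) + x * (x * a3 - y * z * a4' - y * z * a4' - z * z * a5' - y * z * z * c'') = 0"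
    unfolding E2[symmetric] c by (simp add: algebra_simps)
  then have "x dvd y * a4' + z * (a5' - z * c')" by (rule x_dvd_of_sum[THEN x_dvd_y, THEN x_dvd_y])
  then obtain e a4'' a5'' where a4': "a4' = z * e + x * a4''" and "a5' - z * c' = - (y * e) + x * a5''"
    using koszul by blast
  then have a5': "a5' = z * c' - y * e + x * a5''" by (simp add: algebra_simps)
  have "x * (x * a3 - y * z * z * c'' - y * z * z * e - z * z * z * c' + f4 * a4'' + f5 * a5'') = 0"
    unfolding E2[symmetric] c a4' a5' by (simp add: algebra_simps)
  then have E3: "x * a3 - y * z * z * c'' - y * z * z * e - z * z * z * c' + f4 * a4'' + f5 * a5'' = 0" by (rule x_cancel)
  let ?Q = "y * (y * a4'' + z * a5'') - z * z * (c'' + e)" and ?r = "a3 - y * z * a4'' - y * z * a4'' - z * z * a5''"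
  have "(y * ?Q - z * (z * (z * c'))) + x * ?r = 0"
    unfolding E3[symmetric] by (simp add: algebra_simps)
  then have "x dvd - (y * ?Q - z * (z * (z * c')))" unfolding dvd_minus_iff by (rule x_dvd_of_sum)
  then have "x dvd y * (- ?Q) + z * (z * (z * c'))" by (simp add: algebra_simps)
  then obtain g g' where c': "c' = y * g + x * g'" using strip_z reduce by metis
  have "y * (?Q - z * (z * (z * g))) + x * (?r - z * z * z * g') = 0"
    unfolding E3[symmetric] c' by (simp add: algebra_simps)
  then have "x dvd - (?Q - z * (z * (z * g)))" unfolding dvd_minus_iff by (rule x_dvd_of_sum[THEN x_dvd_y])
  then have "x dvd y * (- (y * a4'' + z * a5'')) + z * (z * (c'' + e + z * g))" by (simp add: algebra_simps)
  then obtain h h' where "c'' + e + z * g = y * h + x * h'" using strip_z reduce by metis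
  then have c'': "c'' = y * h + x * h' - e - z * g" by (simp add: algebra_simps)
  have "y * (y * (y * a4'' + z * (a5'' - z * h))) + x * (?r - z * z * z * g' - y * z * z * h') = 0"
    unfolding E3[symmetric] c' c'' by (simp add: algebra_simps)
  then have "x dvd y * a4'' + z * (a5'' - z * h)" by (rule x_dvd_of_sum[THEN x_dvd_y, THEN x_dvd_y])
  then obtain k l l' where a4'': "a4'' = z * k + x * l" and "a5'' - z * h = - (y * k) + x * l'"
    using koszul by blast
  then have a5'': "a5'' = z * h - y * k + x * l'" by (simp add: algebra_simps)
  \<comment> \<open>The parameters left free by the three rounds are collected into the coordinates
    \<open>g\<close>, \<open>?v2\<close>, \<open>?v3\<close>, \<open>l'\<close> and
    \<open>- l\<close> of a preimage.\<close>
  let ?v2 = "- (g' + h)" and ?v3 = "h' + k"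
  have A4: "a4 = f5 * g - x * y * z * ?v2 + x * x * z * ?v3 - x * x * x * (- l)"
    unfolding a4 c c' c'' a4' a4'' by (simp add: algebra_simps)
  have A5: "a5 = - f4 * g + (x * y * y - x * x * z) * ?v2 - x * x * y * ?v3 + x * x * x * l'"
    unfolding a5 c c' c'' a5' a5'' by (simp add: algebra_simps)
  \<comment> \<open>With \<open>a4\<close> and \<open>a5\<close> known, \<open>E\<close> determines
    \<open>a3\<close> after cancelling \<open>x\<close> three times.\<close>
  have "x * (x * (x * (a3 - (- z * z * z * ?v2 + y * z * z * ?v3 - f5 * l' + f4 * (- l))))) = 0"
    unfolding E[symmetric] A4 A5 by (simp add: algebra_simps)
  then have "a3 - (- z * z * z * ?v2 + y * z * z * ?v3 - f5 * l' + f4 * (- l)) = 0" by (rule x_cancel[THEN x_cancel, THEN x_cancel])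
  then have "a3 = - z * z * z * ?v2 + y * z * z * ?v3 - f5 * l' + f4 * (- l)" by (rule eq_iff_diff_eq_0[THEN iffD2])
  then show ?thesis using A4 A5 by (intro exI[of _ g] exI[of _ ?v2] exI[of _ ?v3] exI[of _ l'] exI[of _ "- l"] conjI)
qed

text \<open>By \<open>A0 * A1 = 0\<close>, the first row of \<open>A1\<close> times
  \<open>x * x * x\<close> is a combination of the other two rows, so the kernel is read off from
  those.\<close>

lemma kernel_A1:
  assumes 1: "f5 * v1 - x * y * z * v2 + x * x * z * v3 - x * x * x * v5 = 0"
    and 2: "- f4 * v1 + (x * y * y - x * x * z) * v2 - x * x * y * v3 + x * x * x * v4 = 0"
  shows "\<exists>w1 w2 w3. v1 = x * w1 \<and> v2 = y * w1 + x * w2 \<and> v3 = z * w1 + y * w2 + x * w3 \<and>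
    v4 = z * w2 + y * w3 \<and> v5 = z * w3"
proof -
  have "y * (y * (y * (- v1))) + x * (y * z * v1 + y * z * v1 + (y * y - x * z) * v2 - x * y * v3 + x * x * v4) = 0"
    unfolding 2[symmetric] by (simp add: algebra_simps)
  then have "x dvd - v1" by (rule x_dvd_of_sum[THEN x_dvd_y, THEN x_dvd_y, THEN x_dvd_y])
  then obtain w1 where v1: "v1 = x * w1" unfolding dvd_minus_iff by (elim dvdE)
  have "x * (- f4 * w1 + (y * y - x * z) * v2 - x * y * v3 + x * x * v4) = 0"
    unfolding 2[symmetric] v1 by (simp add: algebra_simps)
  then have E2: "- f4 * w1 + (y * y - x * z) * v2 - x * y * v3 + x * x * v4 = 0" by (rule x_cancel)
  have "y * (y * (v2 - y * w1)) + x * (y * z * w1 + y * z * w1 - z * v2 - y * v3 + x * v4) = 0"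
    unfolding E2[symmetric] by (simp add: algebra_simps)
  then have "x dvd v2 - y * w1" by (rule x_dvd_of_sum[THEN x_dvd_y, THEN x_dvd_y])
  then obtain w2 where "v2 - y * w1 = x * w2" by (elim dvdE)
  then have v2: "v2 = y * w1 + x * w2" by (simp add: algebra_simps)
  have "x * (y * z * w1 + y * y * w2 - x * z * w2 - y * v3 + x * v4) = 0"
    unfolding E2[symmetric] v2 by (simp add: algebra_simps)
  then have E3: "y * z * w1 + y * y * w2 - x * z * w2 - y * v3 + x * v4 = 0" by (rule x_cancel)
  have "y * (z * w1 + y * w2 - v3) + x * (v4 - z * w2) = 0"
    unfolding E3[symmetric] by (simp add: algebra_simps)
  then have "x dvd - (z * w1 + y * w2 - v3)" unfolding dvd_minus_iff by (rule x_dvd_of_sum[THEN x_dvd_y])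
  then obtain w3 where "- (z * w1 + y * w2 - v3) = x * w3" by (elim dvdE)
  then have v3: "v3 = z * w1 + y * w2 + x * w3" by (simp add: algebra_simps)
  have "x * (v4 - (z * w2 + y * w3)) = 0" unfolding E3[symmetric] v3 by (simp add: algebra_simps)
  then have "v4 - (z * w2 + y * w3) = 0" by (rule x_cancel)
  then have v4: "v4 = z * w2 + y * w3" by (rule eq_iff_diff_eq_0[THEN iffD2])
  have "x * (x * (x * (z * w3 - v5))) = 0" unfolding 1[symmetric] v1 v2 v3 by (simp add: algebra_simps)
  then have "z * w3 - v5 = 0" by (rule x_cancel[THEN x_cancel, THEN x_cancel])
  then have "v5 = z * w3" by simp
  then show ?thesis using v1 v2 v3 v4 by blast
qed

lemma prime_dvd_xy:
  assumes "prime_elem p" "p dvd x" "p dvd y" shows False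
proof -
  obtain a b where ab: "x = p * a" "y = p * b" using assms by (elim dvdE)
  have "y * a = x * b" by (simp add: ab)
  then have "x dvd y * a" by (rule dvdI)
  then have "x dvd a" by (rule x_dvd_y)
  then obtain c where c: "a = x * c" by (elim dvdE)
  have "x * (1 - p * c) = x - p * (x * c)" by (simp add: algebra_simps)
  also have "\<dots> = 0" using ab(1) unfolding c by simp
  finally have "1 - p * c = 0" by (rule x_cancel)
  then have "1 = p * c" by simp
  then have "p dvd 1" by (rule dvdI)
  then show False using assms(1) by (simp add: prime_elem_def)
qed

lemma coprime_generators: "coprime_set {x * x * x, f4}"
  unfolding coprime_set_def
proof (intro allI impI, rule ccontr)
  fix p assume p: "prime_elem p" and "\<not> (\<exists>f\<in>{x * x * x, f4}. \<not> p dvd f)"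
  then have d: "p dvd x * x * x" "p dvd f4" by blast+
  have x: "p dvd x" using d(1) p by (simp add: prime_elem_dvd_mult_iff)
  have "p dvd f4 + x * (y * z + y * z)" using d(2) x by (intro dvd_add dvd_mult2)
  also have "f4 + x * (y * z + y * z) = y * y * y" by (simp add: algebra_simps)
  finally have "p dvd y" using p by (simp add: prime_elem_dvd_mult_iff)
  then show False using prime_dvd_xy p x by blast
qed

lemma generators_in_J: "x * x * x \<in> J" "f4 \<in> J" "f5 \<in> J"
  by (intro Modules.module.span_base[OF module_mult]; simp)+

text \<open>For the upper bound, the generators lie in the ideal of \<open>x\<close> and
  \<open>y\<close>, here the kernel of \<open>vanish {u, v}\<close>, which meets the ring in the
  other variables only in zero. For the lower bound, the first two generators are coprime.\<close>

lemma height_J: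
  assumes n: "CARD('v) \<ge> 3" shows "height J = 2"
proof (rule antisym)
  let ?P = "{p. vanish {u, v} p = (0 :: ('v, 'k) mpoly)}"
  have P: "is_prime_ideal ?P"
    by (auto simp: is_prime_ideal_def is_ideal_iff vanish.hom_add vanish.hom_mult mpoly_mult_eq_0_iff)
  have "{x * x * x, f4, f5} \<subseteq> ?P"
    by (auto simp: xyz vanish.hom_mult vanish.hom_minus vanish_X)
  then have "J \<subseteq> ?P" using P by (intro Modules.module.span_minimal[OF module_mult]) (auto simp: is_prime_ideal_def)
  then have "height J \<le> prime_height ?P" unfolding height_def using P by (intro INF_lower) blast
  also have "growth ?P (card (- {u, v}))"
  proof (rule growth_of_subring[where \<kappa> = "\<lambda>p. p"])
    show "comm_ring_hom (\<lambda>p :: ('v, 'k) mpoly. p)" by unfold_locales simp_all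
    fix s :: "('v, 'k) mpoly" assume "s \<in> svars (- {u, v})" "s \<noteq> 0"
    then show "s \<notin> ?P" using vanish_svars[of s "{u, v}"] by simp
  qed simp
  then have "prime_height ?P \<le> enat (CARD('v) - card (- {u, v}))" by (rule prime_height_le_of_growth)
  also have "CARD('v) - card (- {u, v}) = 2" using n ne by (simp add: Compl_eq_Diff_UNIV card_Diff_subset)
  finally show "height J \<le> 2" by (simp add: numeral_eq_enat)
next
  show "2 \<le> height J" unfolding height_def
  proof (rule INF_greatest)
    fix P assume "P \<in> {P. is_prime_ideal P \<and> J \<subseteq> P}"
    then have P: "is_prime_ideal P" "J \<subseteq> P" by simp_all
    have "coprime_set P" by (rule coprime_set_mono[OF coprime_generators]) (use generators_in_J P(2) in blast)
    moreover have "x * x * x \<in> P" using generators_in_J P(2) by blast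
    moreover have "x * x * x \<noteq> 0" using x0 by (simp add: mpoly_mult_eq_0_iff)
    ultimately show "2 \<le> prime_height P" using prime_height_ge_2[OF P(1)] by blast
  qed
qed

lemma generators_independent:
  assumes "cst c0 * (x * x * x) + cst c1 * f4 + cst c2 * f5 = 0" shows "c0 = 0 \<and> c1 = 0 \<and> c2 = 0"
proof -
  have id: "comm_ring_hom (\<lambda>c :: 'k. c)" by unfold_locales simp_all
  have e: "c0 * (a * a * a) + c1 * (b * b * b - a * b * c - a * b * c) + c2 * (b * b * c - a * c * c) = 0" for a b c :: 'k
  proof -
    let ?s = "\<lambda>t. if t = u then a else if t = v then b else c"
    interpret h: comm_ring_hom "msubst (\<lambda>c. c) ?s" by (rule comm_ring_hom_msubst[OF id])
    have s: "msubst (\<lambda>c. c) ?s x = a" "msubst (\<lambda>c. c) ?s y = b" "msubst (\<lambda>c. c) ?s z = c"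
      using ne by (simp_all add: xyz msubst_X[OF id])
    have "msubst (\<lambda>c. c) ?s (cst c0 * (x * x * x) + cst c1 * f4 + cst c2 * f5) =
        c0 * (a * a * a) + c1 * (b * b * b - a * b * c - a * b * c) + c2 * (b * b * c - a * c * c)"
      by (simp only: h.hom_add h.hom_mult h.hom_minus msubst_cst[OF id] s)
    then show ?thesis unfolding assms by simp
  qed
  \<comment> \<open>Evaluation at \<open>(1, 0, 0)\<close>, \<open>(0, 1, 0)\<close> and
    \<open>(0, 1, 1)\<close> isolates the coefficients one after another.\<close>
  show ?thesis using e[of 1 0 0] e[of 0 1 0] e[of 0 1 1] by simp
qed

lemma hx: "homogeneous 1 x" "homogeneous 1 y" "homogeneous 1 z"
  by (simp_all add: xyz)

lemma h3: "homogeneous 1 p \<Longrightarrow> homogeneous 1 q \<Longrightarrow> homogeneous 1 r \<Longrightarrow> homogeneous 3 (p * q * (r :: ('v, 'k) mpoly))"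
  using homogeneous_mult[OF homogeneous_mult, of 1 p 1 q 1 r] by simp

lemma generators_homogeneous: "homogeneous 3 (x * x * x)" "homogeneous 3 f4" "homogeneous 3 f5"
  by (intro homogeneous_diff h3 hx)+

text \<open>Each row is a sequence \<open>r\<close> with
  \<open>x * r i + y * r (i + 1) + z * r (i + 2) = 0\<close>, which expresses that it annihilates
  the columns of \<open>M2\<close>.\<close>

definition "M1 = [[0, - (z * z * z), y * z * z, - f5, f4],
  [f5, - (x * y * z), x * x * z, 0, - (x * x * x)],
  [- f4, x * y * y - x * x * z, - (x * x * y), x * x * x, 0]]"
text \<open>Multiplication by \<open>x + y s + z s^2\<close> from polynomials of degree at most 2 in
  an auxiliary \<open>s\<close> to those of degree at most 4, in the bases of powers of
  \<open>s\<close>.\<close>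

definition "M2 = [[x, 0, 0], [y, x, 0], [z, y, x], [0, z, y], [0, 0, z]]"
definition "A0 = row_matrix [x * x * x, f4, f5]"
definition "A1 = mat 3 5 (\<lambda>(i, j). M1 ! i ! j)"
definition "A2 = mat 5 3 (\<lambda>(i, j). M2 ! i ! j)"

lemma A0_mult:
  assumes "a \<in> carrier_vec 3" shows "(A0 *\<^sub>v a) $ 0 = x * x * x * a $ 0 + f4 * a $ 1 + f5 * a $ 2"
  using assms by (simp add: A0_def row_matrix_def scalar_prod_def eval_nat_numeral ac_simps)

lemma A1_mult:
  assumes "a \<in> carrier_vec 5"
  shows "(A1 *\<^sub>v a) $ 0 = - (z * z * z) * a $ 1 + y * z * z * a $ 2 - f5 * a $ 3 + f4 * a $ 4"
    "(A1 *\<^sub>v a) $ 1 = f5 * a $ 0 - x * y * z * a $ 1 + x * x * z * a $ 2 - x * x * x * a $ 4"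
    "(A1 *\<^sub>v a) $ 2 = - f4 * a $ 0 + (x * y * y - x * x * z) * a $ 1 - x * x * y * a $ 2 + x * x * x * a $ 3"
  using assms by (simp_all add: A1_def M1_def scalar_prod_def eval_nat_numeral algebra_simps)

lemma A2_mult:
  assumes "a \<in> carrier_vec 3"
  shows "(A2 *\<^sub>v a) $ 0 = x * a $ 0" "(A2 *\<^sub>v a) $ 1 = y * a $ 0 + x * a $ 1"
    "(A2 *\<^sub>v a) $ 2 = z * a $ 0 + y * a $ 1 + x * a $ 2"
    "(A2 *\<^sub>v a) $ 3 = z * a $ 1 + y * a $ 2" "(A2 *\<^sub>v a) $ 4 = z * a $ 2"
  using assms by (simp_all add: A2_def M2_def scalar_prod_def eval_nat_numeral)

lemma dims: "A0 \<in> carrier_mat 1 3" "A1 \<in> carrier_mat 3 5" "A2 \<in> carrier_mat 5 3"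
  by (simp_all add: A0_def A1_def A2_def row_matrix_def numeral_3_eq_3)

lemma exact_A0: "mat_kernel A0 = mat_image A1"
proof (intro equalityI subsetI)
  fix a assume "a \<in> mat_kernel A0"
  then have a: "a \<in> carrier_vec 3" "A0 *\<^sub>v a = 0\<^sub>v 1" using mat_kernel[OF dims(1)] by auto
  have "x * x * x * a $ 0 + f4 * a $ 1 + f5 * a $ 2 = 0" unfolding A0_mult[OF a(1), symmetric] a(2) by simp
  then obtain v1 v2 v3 v4 v5 where v: "a $ 0 = - z * z * z * v2 + y * z * z * v3 - f5 * v4 + f4 * v5"
    "a $ 1 = f5 * v1 - x * y * z * v2 + x * x * z * v3 - x * x * x * v5"
    "a $ 2 = - f4 * v1 + (x * y * y - x * x * z) * v2 - x * x * y * v3 + x * x * x * v4"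
    using kernel_A0 by blast
  let ?b = "vec_of_list [v1, v2, v3, v4, v5]"
  have b: "?b \<in> carrier_vec 5" "?b $ 0 = v1" "?b $ 1 = v2" "?b $ 2 = v3" "?b $ 3 = v4" "?b $ 4 = v5"
    by (auto simp: eval_nat_numeral)
  have "a = A1 *\<^sub>v ?b"
  proof (rule vec_of_3[OF a(1)])
    show "A1 *\<^sub>v ?b \<in> carrier_vec 3" by (rule mult_mat_vec_carrier[OF dims(2) b(1)])
  qed (simp_all only: A1_mult[OF b(1)] b v, simp)
  then show "a \<in> mat_image A1" using b(1) dims(2) unfolding mat_image_def by (intro image_eqI[of _ _ ?b]) auto
next
  fix a assume "a \<in> mat_image A1"
  then obtain b where b: "b \<in> carrier_vec 5" "a = A1 *\<^sub>v b" using dims(2) by (auto simp: mat_image_def)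
  have a: "a \<in> carrier_vec 3" unfolding b(2) by (rule mult_mat_vec_carrier[OF dims(2) b(1)])
  have "(A0 *\<^sub>v a) $ 0 = 0"
    unfolding A0_mult[OF a] unfolding b(2) A1_mult[OF b(1)] by (simp add: algebra_simps)
  then have "A0 *\<^sub>v a = 0\<^sub>v 1" using mult_mat_vec_carrier[OF dims(1) a] dims(1) by (intro eq_vecI) auto
  then show "a \<in> mat_kernel A0" using a mat_kernel[OF dims(1)] by simp
qed

lemma exact_A1: "mat_kernel A1 = mat_image A2"
proof (intro equalityI subsetI)
  fix a assume "a \<in> mat_kernel A1"
  then have a: "a \<in> carrier_vec 5" "A1 *\<^sub>v a = 0\<^sub>v 3" using mat_kernel[OF dims(2)] by auto
  have "f5 * a $ 0 - x * y * z * a $ 1 + x * x * z * a $ 2 - x * x * x * a $ 4 = 0"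
    "- f4 * a $ 0 + (x * y * y - x * x * z) * a $ 1 - x * x * y * a $ 2 + x * x * x * a $ 3 = 0"
    unfolding A1_mult[OF a(1), symmetric] a(2) by simp_all
  then obtain w1 w2 w3 where w: "a $ 0 = x * w1" "a $ 1 = y * w1 + x * w2" "a $ 2 = z * w1 + y * w2 + x * w3"
    "a $ 3 = z * w2 + y * w3" "a $ 4 = z * w3"
    using kernel_A1 by blast
  let ?b = "vec_of_list [w1, w2, w3]"
  have b: "?b \<in> carrier_vec 3" "?b $ 0 = w1" "?b $ 1 = w2" "?b $ 2 = w3" by (auto simp: eval_nat_numeral)
  have "a = A2 *\<^sub>v ?b"
  proof (rule vec_of_5[OF a(1)])
    show "A2 *\<^sub>v ?b \<in> carrier_vec 5" by (rule mult_mat_vec_carrier[OF dims(3) b(1)])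
  qed (simp_all only: A2_mult[OF b(1)] b w)
  then show "a \<in> mat_image A2" using b(1) dims(3) unfolding mat_image_def by (intro image_eqI[of _ _ ?b]) auto
next
  fix a assume "a \<in> mat_image A2"
  then obtain b where b: "b \<in> carrier_vec 3" "a = A2 *\<^sub>v b" using dims(3) by (auto simp: mat_image_def)
  have a: "a \<in> carrier_vec 5" unfolding b(2) by (rule mult_mat_vec_carrier[OF dims(3) b(1)])
  have "A1 *\<^sub>v a = 0\<^sub>v 3"
  proof (rule vec_of_3[OF mult_mat_vec_carrier[OF dims(2) a]])
    show "(A1 *\<^sub>v a) $ 0 = 0\<^sub>v 3 $ 0" "(A1 *\<^sub>v a) $ 1 = 0\<^sub>v 3 $ 1" "(A1 *\<^sub>v a) $ 2 = 0\<^sub>v 3 $ 2"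
      unfolding A1_mult[OF a] unfolding b(2) A2_mult[OF b(1)] by (simp_all add: algebra_simps)
  qed simp
  then show "a \<in> mat_kernel A1" using a mat_kernel[OF dims(2)] by simp
qed

lemma kernel_A2: "mat_kernel A2 = {0\<^sub>v 3}"
proof (intro equalityI subsetI)
  fix a assume "a \<in> mat_kernel A2"
  then have a: "a \<in> carrier_vec 3" "A2 *\<^sub>v a = 0\<^sub>v 5" using mat_kernel[OF dims(3)] by auto
  have e: "x * a $ 0 = 0" "y * a $ 0 + x * a $ 1 = 0" "z * a $ 0 + y * a $ 1 + x * a $ 2 = 0"
    unfolding A2_mult[OF a(1), symmetric] a(2) by simp_all
  have 0: "a $ 0 = 0" by (rule x_cancel[OF e(1)])
  have 1: "a $ 1 = 0" using x_cancel e(2) unfolding 0 by simp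
  have 2: "a $ 2 = 0" using x_cancel e(3) unfolding 0 1 by simp
  have "a = 0\<^sub>v 3" by (rule vec_of_3[OF a(1)]) (simp_all only: 0 1 2, simp_all)
  then show "a \<in> {0\<^sub>v 3}" by simp
next
  fix a assume "a \<in> {0\<^sub>v 3 :: ('v, 'k) mpoly vec}"
  then have a: "a = 0\<^sub>v 3" by simp
  have "A2 *\<^sub>v 0\<^sub>v 3 = 0\<^sub>v 5"
    by (rule vec_of_5[OF mult_mat_vec_carrier[OF dims(3) zero_carrier_vec] zero_carrier_vec]; subst A2_mult[OF zero_carrier_vec]; simp)
  then show "a \<in> mat_kernel A2" using mat_kernel[OF dims(3)] by (simp add: a)
qed

lemma J_image: "J = (\<lambda>v. v $ 0) ` mat_image A0"
proof -
  have "J = {lin A0 F 0 | F. True}" using ideal_gen_set[of "[x * x * x, f4, f5]"] unfolding A0_def lin_row_matrix by simp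
  then show ?thesis using mat_image_first[of A0] dims(1) by simp
qed

lemma graded_matrices: "graded_matrix [3, 3, 3] [0] A0" "graded_matrix [6, 6, 6, 6, 6] [3, 3, 3] A1"
  "graded_matrix [7, 7, 7] [6, 6, 6, 6, 6] A2"
proof -
  have r: "replicate 3 d = [d, d, d]" "replicate 5 d = [d, d, d, d, d]" for d :: int by (simp_all add: eval_nat_numeral)
  have "homogeneous 3 p" if "p \<in> set [x * x * x, f4, f5]" for p using that generators_homogeneous by auto
  then have "graded_matrix (replicate (length [x * x * x, f4, f5]) 3) [0] (row_matrix [x * x * x, f4, f5])" by (rule graded_row_matrix)
  then show "graded_matrix [3, 3, 3] [0] A0" by (simp add: A0_def eval_nat_numeral)
  have "homogeneous (6 - 3) p" if "l \<in> set M1" "p \<in> set l" for l p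
  proof -
    have h: "homogeneous 3 f4" "homogeneous 3 f5" "homogeneous 3 (- f4)" "homogeneous 3 (- f5)"
      "homogeneous 3 (x * x * x)" "homogeneous 3 (- (x * x * x))" "homogeneous 3 (- (z * z * z))" "homogeneous 3 (y * z * z)"
      "homogeneous 3 (- (x * y * z))" "homogeneous 3 (x * x * z)" "homogeneous 3 (x * y * y - x * x * z)" "homogeneous 3 (- (x * x * y))"
      by (intro homogeneous_uminus homogeneous_diff h3 hx)+
    have "\<forall>l\<in>set M1. \<forall>p\<in>set l. homogeneous 3 p"
      unfolding M1_def by (simp only: list.set ball_simps h homogeneous_0 simp_thms)
    then have "homogeneous 3 p" using that by blast
    then show ?thesis by simp
  qed
  then have "graded_matrix (replicate 5 6) (replicate 3 3) A1"
    unfolding A1_def by (intro graded_matrix_rows) (auto simp: M1_def)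
  then show "graded_matrix [6, 6, 6, 6, 6] [3, 3, 3] A1" unfolding r .
  have "homogeneous (7 - 6) p" if "l \<in> set M2" "p \<in> set l" for l p using that hx by (auto simp: M2_def)
  then have "graded_matrix (replicate 3 7) (replicate 5 6) A2"
    unfolding A2_def by (intro graded_matrix_rows) (auto simp: M2_def)
  then show "graded_matrix [7, 7, 7] [6, 6, 6, 6, 6] A2" unfolding r .
qed

lemma resolution: "minimal_graded_free_resolution J (resolution_shifts [3, 3, 3, 3, 3] [1, 1, 1]) [A0, A1, A2]"
proof -
  have F: "resolution_shifts [3, 3, 3, 3, 3] [1, 1, 1] = [[3, 3, 3], [6, 6, 6, 6, 6], [7, 7, 7]]"
    by (simp add: resolution_shifts_def upt_rec numeral_3_eq_3 eval_nat_numeral)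
  have c: "i = 0 \<or> i = 1 \<or> i = 2" if "i < 3" for i :: nat using that by linarith
  have "graded_free_resolution J [[3, 3, 3], [6, 6, 6, 6, 6], [7, 7, 7]] [A0, A1, A2]"
    unfolding graded_free_resolution_def
  proof (intro conjI allI impI)
    fix i assume "i < length [[3, 3, 3], [6, 6, 6, 6, 6], [7, 7, 7 :: int]]"
    then have "i = 0 \<or> i = 1 \<or> i = 2" using c by simp
    then show "graded_matrix ([[3, 3, 3], [6, 6, 6, 6, 6], [7, 7, 7]] ! i) (([0] # [[3, 3, 3], [6, 6, 6, 6, 6], [7, 7, 7]]) ! i) ([A0, A1, A2] ! i)"
      using graded_matrices by (elim disjE) simp_all
  next
    fix i assume "Suc i < length [[3, 3, 3], [6, 6, 6, 6, 6], [7, 7, 7 :: int]]"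
    then have "i = 0 \<or> i = 1" by auto
    then show "mat_kernel ([A0, A1, A2] ! i) = mat_image ([A0, A1, A2] ! Suc i)"
      using exact_A0 exact_A1 by (elim disjE) simp_all
  qed (use J_image kernel_A2 in \<open>simp_all add: eval_nat_numeral\<close>)
  moreover have "coef (B $$ (i, j)) 0 = 0" if "B \<in> set [A0, A1, A2]" "i < dim_row B" "j < dim_col B" for B i j
  proof -
    \<comment> \<open>In each matrix all entries are forms of one nonzero degree, so they have no
      constant term.\<close>
    have z: "coef (B $$ (i, j)) 0 = 0" if "graded_matrix (replicate nc d) (replicate nr d') B" "i < dim_row B" "j < dim_col B" "d \<noteq> d'"
      for B :: "('v, 'k) mpoly mat" and nc nr d d'
    proof (rule homogeneous_const_coef)
      show "homogeneous (d - d') (B $$ (i, j))" using that by (auto simp: graded_matrix_def)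
    qed (use that in simp)
    show ?thesis using that z[of 3 3 1 0 A0] z[of 5 6 3 3 A1] z[of 3 7 5 6 A2] graded_matrices by (auto simp: eval_nat_numeral)
  qed
  ultimately show ?thesis unfolding F minimal_graded_free_resolution_def by blast
qed

end

theorem proposition3p16:
  assumes "CARD('v::finite) \<ge> 3"
  shows "{(\<delta>, \<epsilon>, multiplicity_quotient J, bourbaki_degree J) | \<delta> \<epsilon>
             (J :: ('v, 'k::{alg_closed_field, field_char_0}) mpoly set).
           shift_conventions \<delta> \<epsilon> \<and>
           (\<exists>fs. length fs = 3 \<and> minimally_generated_by_forms 3 fs J) \<and>
           height J = 2 \<and>
           (\<exists>A. minimal_graded_free_resolution J (resolution_shifts \<delta> \<epsilon>) A)}
         = {([3, 3, 3, 3, 3], [1, 1, 1], 3, 6)}"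
proof (intro equalityI subsetI)
  have main: "\<delta> = [3, 3, 3, 3, 3] \<and> \<epsilon> = [1, 1, 1] \<and> multiplicity_quotient J = 3 \<and> bourbaki_degree J = 6"
    if "shift_conventions \<delta> \<epsilon>" "height J = 2" "minimal_graded_free_resolution J (resolution_shifts \<delta> \<epsilon>) A"
    for \<delta> \<epsilon> A and J :: "('v, 'k) mpoly set"
  proof -
    have "length A = 3" using that(3)
      by (simp add: minimal_graded_free_resolution_def graded_free_resolution_def resolution_shifts_def)
    then obtain A0 A1 A2 where A: "A = [A0, A1, A2]"
      by (metis (no_types) length_0_conv length_Suc_conv numeral_3_eq_3)
    interpret cubic_resolution J \<delta> \<epsilon> A0 A1 A2
      by unfold_locales (use that assms in \<open>simp_all only: A\<close>)
    show ?thesis using shifts_unique multiplicity_J bourbaki_degree_J by simp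
  qed
  {
    fix t assume "t \<in> {(\<delta>, \<epsilon>, multiplicity_quotient J, bourbaki_degree J) | \<delta> \<epsilon> (J :: ('v, 'k) mpoly set).
           shift_conventions \<delta> \<epsilon> \<and> (\<exists>fs. length fs = 3 \<and> minimally_generated_by_forms 3 fs J) \<and>
           height J = 2 \<and> (\<exists>A. minimal_graded_free_resolution J (resolution_shifts \<delta> \<epsilon>) A)}"
    then obtain \<delta> \<epsilon> A and J :: "('v, 'k) mpoly set" where t: "t = (\<delta>, \<epsilon>, multiplicity_quotient J, bourbaki_degree J)"
      and J: "shift_conventions \<delta> \<epsilon>" "height J = 2" "minimal_graded_free_resolution J (resolution_shifts \<delta> \<epsilon>) A"
      by blast
    then show "t \<in> {([3, 3, 3, 3, 3], [1, 1, 1], 3, 6)}" using main[OF J] by simp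
  }
  fix t :: "nat list \<times> nat list \<times> rat \<times> rat" assume t: "t \<in> {([3, 3, 3, 3, 3], [1, 1, 1], 3, 6)}"
  have "3 \<le> card (UNIV :: 'v set)" using assms .
  then obtain T :: "'v set" where "card T = 3" using obtain_subset_with_card_n by blast
  then obtain u v w :: 'v where ne: "u \<noteq> v" "u \<noteq> w" "v \<noteq> w"
    unfolding card_3_iff by blast
  \<comment> \<open>The example uses only three of the variables, so it serves for every admissible
    number of them.\<close>
  interpret three_variables "X u :: ('v, 'k) mpoly" "X v" "X w" u v w
    by unfold_locales (use ne in simp_all)
  have c: "shift_conventions [3, 3, 3, 3, 3] [1, 1, 1]" by (auto simp: shift_conventions_def less_Suc_eq eval_nat_numeral)
  have h: "height J = 2" by (rule height_J[OF assms])
  have "minimally_generated_by_forms 3 [X u * X u * X u, f4, f5] J"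
    by (rule independent_cubics_minimal[OF generators_homogeneous generators_independent])
  moreover have "length [X u * X u * X u, f4, f5] = 3" by simp
  ultimately have m: "\<exists>fs. length fs = 3 \<and> minimally_generated_by_forms 3 fs J" by blast
  have "t = ([3, 3, 3, 3, 3], [1, 1, 1], multiplicity_quotient J, bourbaki_degree J)"
    using main[OF c h resolution] t by simp
  then show "t \<in> {(\<delta>, \<epsilon>, multiplicity_quotient J, bourbaki_degree J) | \<delta> \<epsilon> (J :: ('v, 'k) mpoly set).
           shift_conventions \<delta> \<epsilon> \<and> (\<exists>fs. length fs = 3 \<and> minimally_generated_by_forms 3 fs J) \<and>
           height J = 2 \<and> (\<exists>A. minimal_graded_free_resolution J (resolution_shifts \<delta> \<epsilon>) A)}"
    using c h m resolution by blast
qed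

end
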